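(* Let $N\ge 3$, let $\ell$ be a positive integer, $1<p<\frac{N}{N-2}$, $\varepsilon>0$, $y_i\in\mathbb{R}^N$, $\mu_i>0$ for $i=1,\ldots,\ell$, and $\lambda_{ij}=\lambda_{ji}<0$ for $i\ne j$. Then the system $$\begin{cases}-\Delta v_i+v_i=\mu_iQ_\varepsilon(x-y_i)|v_i|^{2p-2}v_i+\sum_{j\ne i}\lambda_{ij}|v_j|^p|v_i|^{p-2}v_i,\\ v_i\in H^1(\mathbb{R}^N),\quad v_i\neq 0,\quad i=1,\ldots,\ell,\end{cases}$$ has a sequence of solutions $(v_1,\ldots,v_\ell)$ which is unbounded in $(H^1(\mathbb{R}^N))^\ell$, and at least one of these solutions is a nonnegative least energy solution.
   Context: $Q_\varepsilon(x):=1$ if $|x|<\varepsilon$ and $Q_\varepsilon(x):=-1$ if $|x|\ge\varepsilon$. For $1<p<2$ the expression $|t|^{p-2}t$ is taken to be $0$ at $t=0$. Solutions are weak solutions, i.e. critical points with all components nontrivial of the $\mathcal{C}^1$ functional on $(H^1(\mathbb{R}^N))^\ell$ $$I_\varepsilon(\mathbf v):=\frac12\sum_{i=1}^\ell\int_{\mathbb{R}^N}(|\nabla v_i|^2+v_i^2)-\frac1{2p}\sum_{i=1}^\ell\int_{\mathbb{R}^N}\mu_iQ_\varepsilon(x-y_i)|v_i|^{2p}-\frac1{2p}\sum_{i\ne j}\int_{\mathbb{R}^N}\lambda_{ij}|v_j|^p|v_i|^p$$ (the last sum is over ordered pairs $(i,j)$ with $i\neq j$). A solution $\mathbf v=(v_1,\ldots,v_\ell)$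 is nonnegative if $v_i\ge0$ for all $i$. Every solution lies in the Nehari-type set $$\Big\{\mathbf v\in (H^1(\mathbb{R}^N))^\ell: v_i\ne0,\ \int_{\mathbb{R}^N}(|\nabla v_i|^2+v_i^2)=\int_{\mathbb{R}^N}\mu_iQ_\varepsilon(x-y_i)|v_i|^{2p}+\sum_{j\ne i}\int_{\mathbb{R}^N}\lambda_{ij}|v_j|^p|v_i|^p\ \text{ for all } i\Big\},$$ and a least energy solution is a solution at which $I_\varepsilon$ attains its infimum over this set. *)

theory Defs
  imports "HOL-Analysis.Analysis"
begin

section \<open>The Sobolev space $H^1(\mathbb{R}^N)$\<close>

primrec continuously_differentiable :: "nat \<Rightarrow> ('a::euclidean_space \<Rightarrow> real) \<Rightarrow> bool" where
  "continuously_differentiable 0 f \<longleftrightarrow> continuous_on UNIV f"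
| "continuously_differentiable (Suc k) f \<longleftrightarrow>
     (\<forall>x. f differentiable (at x)) \<and>
     (\<forall>b\<in>Basis. continuously_differentiable k (\<lambda>x. frechet_derivative f (at x) b))"

definition test_functions :: "('a::euclidean_space \<Rightarrow> real) set" where
  "test_functions =
     {\<phi>. (\<forall>k. continuously_differentiable k \<phi>) \<and> compact (closure {x. \<phi> x \<noteq> 0})}"

text \<open>
  Elements of the Lebesgue and Sobolev spaces are represented by Borel measurable functions
  (every class has such a representative). They are never quotiented; instead, equalities and
  inequalities between them are stated almost everywhere.
\<close>

definition square_integrable :: "('a::euclidean_space \<Rightarrow> 'b::euclidean_space) set" where
  "square_integrable =
     {f \<in> borel_measurable lborel. integrable lborel (\<lambda>x. (norm (f x))\<^sup>2)}"

definition is_weak_gradient ::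
    "('a::euclidean_space \<Rightarrow> real) \<Rightarrow> ('a \<Rightarrow> 'a) \<Rightarrow> bool" where
  "is_weak_gradient u g \<longleftrightarrow>
     (\<forall>\<phi>\<in>test_functions. \<forall>b\<in>Basis.
        (\<integral>x. u x * frechet_derivative \<phi> (at x) b \<partial>lborel) = - (\<integral>x. (g x \<bullet> b) * \<phi> x \<partial>lborel))"

definition H1 :: "('a::euclidean_space \<Rightarrow> real) set" where
  "H1 = {u \<in> square_integrable. \<exists>g\<in>square_integrable. is_weak_gradient u g}"

text \<open>The choice is immaterial, since weak gradients are unique almost everywhere.\<close>

definition weak_gradient :: "('a::euclidean_space \<Rightarrow> real) \<Rightarrow> 'a \<Rightarrow> 'a" where
  "weak_gradient u = (SOME g. g \<in> square_integrable \<and> is_weak_gradient u g)"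

definition H1_inner :: "('a::euclidean_space \<Rightarrow> real) \<Rightarrow> ('a \<Rightarrow> real) \<Rightarrow> real" where
  "H1_inner u w = (\<integral>x. weak_gradient u x \<bullet> weak_gradient w x + u x * w x \<partial>lborel)"

text \<open>
  The number $\ell$ of components is the cardinality of a finite index type: an element of
  $(H^1(\mathbb{R}^N))^\ell$ is a family indexed by that type.
\<close>

definition H1_tuples :: "('l::finite \<Rightarrow> 'a::euclidean_space \<Rightarrow> real) set" where
  "H1_tuples = {v. \<forall>i. v i \<in> H1}"

definition H1_norm :: "('l::finite \<Rightarrow> 'a::euclidean_space \<Rightarrow> real) \<Rightarrow> real" where
  "H1_norm v = sqrt (\<Sum>i\<in>UNIV. H1_inner (v i) (v i))"

definition nontrivial :: "('l::finite \<Rightarrow> 'a::euclidean_space \<Rightarrow> real) \<Rightarrow> bool" where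
  "nontrivial v \<longleftrightarrow> (\<forall>i. \<not> (AE x in lborel. v i x = 0))"

definition nonnegative :: "('l::finite \<Rightarrow> 'a::euclidean_space \<Rightarrow> real) \<Rightarrow> bool" where
  "nonnegative v \<longleftrightarrow> (\<forall>i. AE x in lborel. 0 \<le> v i x)"


section \<open>The system and its functional\<close>

definition Q :: "real \<Rightarrow> 'a::euclidean_space \<Rightarrow> real" where
  "Q \<epsilon> x = (if norm x < \<epsilon> then 1 else - 1)"

definition energy ::
    "real \<Rightarrow> real \<Rightarrow> ('l::finite \<Rightarrow> 'a::euclidean_space) \<Rightarrow> ('l \<Rightarrow> real) \<Rightarrow> ('l \<Rightarrow> 'l \<Rightarrow> real) \<Rightarrow>
     ('l \<Rightarrow> 'a \<Rightarrow> real) \<Rightarrow> real" where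
  "energy p \<epsilon> y \<mu> lam v =
     1 / 2 * (\<Sum>i\<in>UNIV. \<integral>x. (norm (weak_gradient (v i) x))\<^sup>2 + (v i x)\<^sup>2 \<partial>lborel)
     - 1 / (2 * p) * (\<Sum>i\<in>UNIV. \<integral>x. \<mu> i * Q \<epsilon> (x - y i) * \<bar>v i x\<bar> powr (2 * p) \<partial>lborel)
     - 1 / (2 * p) * (\<Sum>(i, j)\<in>{(i, j). i \<noteq> j}.
         \<integral>x. lam i j * \<bar>v j x\<bar> powr p * \<bar>v i x\<bar> powr p \<partial>lborel)"

text \<open>The Frechet derivative of \<open>J\<close> at \<open>v\<close>, with respect to the norm of
  $(H^1(\mathbb{R}^N))^\ell$, is zero.\<close>

definition critical_point ::
    "(('l::finite \<Rightarrow> 'a::euclidean_space \<Rightarrow> real) \<Rightarrow> real) \<Rightarrow> ('l \<Rightarrow> 'a \<Rightarrow> real) \<Rightarrow> bool" where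
  "critical_point J v \<longleftrightarrow> v \<in> H1_tuples \<and>
     (\<forall>e>0. \<exists>d>0. \<forall>h\<in>H1_tuples. H1_norm h < d \<longrightarrow>
        \<bar>J (\<lambda>i x. v i x + h i x) - J v\<bar> \<le> e * H1_norm h)"

text \<open>
  The weak form of the system. As \<open>0 powr a = 0\<close>, the expressions of the form
  \<open>\<bar>t\<bar> powr a * t\<close> vanish at \<open>t = 0\<close>, also for negative \<open>a\<close>.
\<close>

definition satisfies_system ::
    "real \<Rightarrow> real \<Rightarrow> ('l::finite \<Rightarrow> 'a::euclidean_space) \<Rightarrow> ('l \<Rightarrow> real) \<Rightarrow> ('l \<Rightarrow> 'l \<Rightarrow> real) \<Rightarrow>
     ('l \<Rightarrow> 'a \<Rightarrow> real) \<Rightarrow> bool" where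
  "satisfies_system p \<epsilon> y \<mu> lam v \<longleftrightarrow> v \<in> H1_tuples \<and>
     (\<forall>i. \<forall>\<phi>\<in>H1.
        (\<integral>x. weak_gradient (v i) x \<bullet> weak_gradient \<phi> x + v i x * \<phi> x \<partial>lborel) =
        (\<integral>x. (\<mu> i * Q \<epsilon> (x - y i) * (\<bar>v i x\<bar> powr (2 * p - 2) * v i x)
              + (\<Sum>j\<in>UNIV - {i}. lam i j * \<bar>v j x\<bar> powr p * (\<bar>v i x\<bar> powr (p - 2) * v i x)))
             * \<phi> x \<partial>lborel))"

text \<open>
  In the subcritical range of \<open>p\<close> critical points of the energy are exactly the weak solutions of
  the system. Both descriptions are required, so that no appeal to this equivalence is needed to
  read the definition.
\<close>

definition is_solution ::
    "real \<Rightarrow> real \<Rightarrow> ('l::finite \<Rightarrow> 'a::euclidean_space) \<Rightarrow> ('l \<Rightarrow> real) \<Rightarrow> ('l \<Rightarrow> 'l \<Rightarrow> real) \<Rightarrow>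
     ('l \<Rightarrow> 'a \<Rightarrow> real) \<Rightarrow> bool" where
  "is_solution p \<epsilon> y \<mu> lam v \<longleftrightarrow>
     nontrivial v \<and> critical_point (energy p \<epsilon> y \<mu> lam) v \<and> satisfies_system p \<epsilon> y \<mu> lam v"

definition nehari_set ::
    "real \<Rightarrow> real \<Rightarrow> ('l::finite \<Rightarrow> 'a::euclidean_space) \<Rightarrow> ('l \<Rightarrow> real) \<Rightarrow> ('l \<Rightarrow> 'l \<Rightarrow> real) \<Rightarrow>
     ('l \<Rightarrow> 'a \<Rightarrow> real) set" where
  "nehari_set p \<epsilon> y \<mu> lam = {v \<in> H1_tuples. nontrivial v \<and>
     (\<forall>i. (\<integral>x. (norm (weak_gradient (v i) x))\<^sup>2 + (v i x)\<^sup>2 \<partial>lborel) =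
        (\<integral>x. \<mu> i * Q \<epsilon> (x - y i) * \<bar>v i x\<bar> powr (2 * p) \<partial>lborel)
        + (\<Sum>j\<in>UNIV - {i}. \<integral>x. lam i j * \<bar>v j x\<bar> powr p * \<bar>v i x\<bar> powr p \<partial>lborel))}"

definition is_least_energy_solution ::
    "real \<Rightarrow> real \<Rightarrow> ('l::finite \<Rightarrow> 'a::euclidean_space) \<Rightarrow> ('l \<Rightarrow> real) \<Rightarrow> ('l \<Rightarrow> 'l \<Rightarrow> real) \<Rightarrow>
     ('l \<Rightarrow> 'a \<Rightarrow> real) \<Rightarrow> bool" where
  "is_least_energy_solution p \<epsilon> y \<mu> lam v \<longleftrightarrow>
     is_solution p \<epsilon> y \<mu> lam v \<and> v \<in> nehari_set p \<epsilon> y \<mu> lam \<and>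
     (\<forall>w\<in>nehari_set p \<epsilon> y \<mu> lam. energy p \<epsilon> y \<mu> lam v \<le> energy p \<epsilon> y \<mu> lam w)"

end

theory Submission
  imports Defs "HOL-Homology.Homology" "HOL-Library.Diagonal_Subsequence"
begin

text \<open>
  On the Nehari set the functional is a positive multiple of the squared norm, and, as the couplings
  are nonpositive, every element $v$ of this set has the largest energy among its rescalings
  $(t_1v_1,\ldots,t_\ell v_\ell)$ with $t_i>0$. Hence every $w$ near the Nehari set has exactly one rescaling $m(w)$
  in it, $m$ is continuous and odd, and $v\mapsto m(v-\sigma\nabla I(v))$ lowers the energy at a definite
  rate as long as the gradient is bounded away from zero. Outside a ball all coefficients of the
  nonlinearity are negative, so local compactness suffices for the Palais-Smale condition. This
  gives a minimiser. It is a critical point, and so is the tuple of the absolute values of its components.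

  If the energies of the critical points were bounded, the descent step could be iterated to push
  odd images of spheres of every dimension, spanned by disjointly supported functions in the regions
  where \<open>Q\<close> is positive, below a fixed energy level. But on the part of the Nehari set below that level
  finitely many linear functionals have no common zero, by compactness, which contradicts the
  Borsuk-Ulam theorem. The Sobolev embedding and the local compactness come from averages over dyadic
  cubes.
\<close>

text \<open>The exponent p may lie below 2, and always does when N is at least 4. The coupling terms
  are then merely Hoelder continuous in a component, so the Nehari set need not be a C^1 manifold
  and the gradient need not be Lipschitz. The proof therefore compares energies instead of
  differentiating along the set: the rescaling onto it is an interior maximum over a small box of
  factors, and a gradient step followed by \<open>proj\<close> is compared with the step from a
  rescaled point, whose energy is bounded by maximality.

  The second obstacle is the unbounded domain. The sign of the coefficients outside a ball enters
  twice. It gives \<open>G (x n) \<bullet> (x n - v)\<close> an upper bound tending to 0, and this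
  is the side that norm convergence requires. It also bounds \<open>\<beta> i i\<close> by an
  integral over one ball. On the Nehari set \<open>\<beta> i i\<close> has a positive lower bound,
  so finitely many averages over small cubes cannot all vanish there below a given energy
  level.\<close>

section \<open>The Borsuk-Ulam theorem\<close>

text \<open>Labels are pairs of an index and a sign. \<open>alternating s S js\<close> says that, for the labels in \<open>S\<close>
 in the order of their indices in \<open>js\<close>, the signs alternate and the first sign is \<open>s\<close>. As in Fan's lemma,
 simplices with alternating labels are counted modulo 2.\<close>

primrec alternating :: "bool \<Rightarrow> (nat \<times> bool) set \<Rightarrow> nat list \<Rightarrow> bool" where
 "alternating s S [] \<longleftrightarrow> True"
| "alternating s S (j # js) \<longleftrightarrow>
   (if (j, s) \<in> S then alternating (\<not> s) S js
   else (j, \<not> s) \<notin> S \<and> alternating s S js)"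

lemma alternating_cong:
 assumes "\<And>j t. j \<in> set js \<Longrightarrow> (j, t) \<in> S \<longleftrightarrow> (j, t) \<in> S'"
 shows "alternating s S js = alternating s S' js"
 using assms by (induction js arbitrary: s) simp_all

lemma alternating_flip:
 assumes "\<And>j. (j, True) \<notin> S \<or> (j, False) \<notin> S"
 shows "alternating s ((\<lambda>(j, t). (j, \<not> t)) ` S) js = alternating (\<not> s) S js"
proof -
 have *: "(j, t) \<in> (\<lambda>(j, t). (j, \<not> t)) ` S \<longleftrightarrow> (j, \<not> t) \<in> S" for j t
  by force
 have **: "(j, s) \<in> S \<Longrightarrow> (j, \<not> s) \<notin> S" for j s using assms[of j] by (cases s) auto
 show ?thesis
  by (induction js arbitrary: s) (use * ** in auto)
qed

text \<open>This is the local count behind Fan's lemma. A nonempty set alternating from either sign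
  has exactly one facet alternating from \<open>s\<close>, obtained by removing the last or the
  first label. A set alternating from neither sign has no such facet, or two of them, obtained by
  removing one of two neighbouring labels of equal sign.\<close>

lemma alternating_faces:
 assumes "finite S" "S \<subseteq> set js \<times> UNIV" "distinct js"
  and nc: "\<And>j. (j, True) \<notin> S \<or> (j, False) \<notin> S"
 shows "even ((\<Sum>x\<in>S. of_bool (alternating s (S - {x}) js) :: int)
      + of_bool (alternating s S js) + of_bool (alternating (\<not> s) S js))"
 using assms
proof (induction js arbitrary: s S)
 case Nil
 then show ?case by simp
next
 case (Cons j js)
 have nc: "(j, t) \<in> S \<Longrightarrow> (j, \<not> t) \<notin> S" for j t using Cons.prems(4)[of j] by (cases t) auto
 show ?case
 proof (cases "\<exists>t. (j, t) \<in> S")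
  case False
  have "S \<subseteq> set js \<times> UNIV" using Cons.prems(2) False by auto
  from Cons.IH[OF Cons.prems(1) this _ Cons.prems(4)] Cons.prems(3) False
  show ?thesis by simp
 next
  case True
  then obtain t where t: "(j, t) \<in> S" by blast
  define S0 where "S0 = S - {(j, t)}"
  have S: "S = insert (j, t) S0" "(j, t) \<notin> S0" using t by (auto simp: S0_def)
  have nj: "(j, u) \<notin> S0" for u using nc[OF t] by (cases "u = t") (auto simp: S0_def)
  have sub: "S0 \<subseteq> set js \<times> UNIV" using Cons.prems(2) nj unfolding S0_def by auto
  have fin: "finite S0" using Cons.prems(1) by (simp add: S0_def)
  have ih: "even ((\<Sum>x\<in>S0. of_bool (alternating r (S0 - {x}) js) :: int)
      + of_bool (alternating r S0 js) + of_bool (alternating (\<not> r) S0 js))" for r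
   by (rule Cons.IH[OF fin sub]) (use Cons.prems S0_def in auto)
  have jn: "j \<notin> set js" using Cons.prems(3) by simp
  have c1: "alternating r (insert (j, t) A) js = alternating r A js" for r A
   by (rule alternating_cong) (use jn in auto)
  have e1: "S - {(j, t)} = S0" using S by auto
  have e2: "S - {x} = insert (j, t) (S0 - {x})" if "x \<in> S0" for x using that S by auto
  have "(\<Sum>x\<in>S. of_bool (alternating s (S - {x}) (j # js)) :: int)
    = of_bool (alternating s S0 (j # js)) + (\<Sum>x\<in>S0. of_bool (alternating s (S - {x}) (j # js)))"
   using S fin e1 by (metis (no_types, lifting) sum.insert)
  also have "(\<Sum>x\<in>S0. of_bool (alternating s (S - {x}) (j # js)) :: int)
    = (\<Sum>x\<in>S0. of_bool (s = t \<and> alternating (\<not> s) (S0 - {x}) js))"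
   by (rule sum.cong) (use nj in \<open>auto simp: e2 c1\<close>)
  finally have e3: "(\<Sum>x\<in>S. of_bool (alternating s (S - {x}) (j # js)) :: int)
    = of_bool (alternating s S0 js) + (\<Sum>x\<in>S0. of_bool (s = t \<and> alternating (\<not> s) (S0 - {x}) js))"
   using nj by simp
  have e4: "alternating r S (j # js) \<longleftrightarrow> r = t \<and> alternating (\<not> r) S0 js" for r
   using nj S by (auto simp: c1)
  show ?thesis
  proof (cases "s = t")
   case True
   have "(\<Sum>x\<in>S0. of_bool (s = t \<and> alternating (\<not> s) (S0 - {x}) js) :: int)
     = (\<Sum>x\<in>S0. of_bool (alternating (\<not> s) (S0 - {x}) js))"
    using True by simp
   moreover have "of_bool (alternating s S (j # js)) = (of_bool (alternating (\<not> s) S0 js) :: int)"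
    "of_bool (alternating (\<not> s) S (j # js)) = (0 :: int)"
    unfolding e4 using True by simp_all
   ultimately show ?thesis unfolding e3 using ih[of "\<not> s"] by (simp only: not_not add_0_right) (simp only: ac_simps)
  next
   case False
   have "(\<Sum>x\<in>S0. of_bool (s = t \<and> alternating (\<not> s) (S0 - {x}) js) :: int) = 0"
    using False by simp
   moreover have "of_bool (alternating s S (j # js)) = (0 :: int)"
    "of_bool (alternating (\<not> s) S (j # js)) = (of_bool (alternating s S0 js) :: int)"
    unfolding e4 using False by auto
   ultimately show ?thesis unfolding e3 by simp
  qed
 qed
qed

text \<open>When two vertices share a label, only the faces opposite to one of them can carry
  distinct labels. These two faces have the same label set, so their contributions are equal and
  cancel modulo 2.\<close>

lemma alternating_faces_family:
 fixes L :: "'i \<Rightarrow> nat \<times> bool"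
 assumes "finite T" "L ` T \<subseteq> set js \<times> UNIV" "distinct js"
  and nc: "\<And>j. (j, True) \<notin> L ` T \<or> (j, False) \<notin> L ` T"
 shows "even ((\<Sum>k\<in>T. of_bool (inj_on L (T - {k}) \<and> alternating s (L ` (T - {k})) js) :: int)
      + of_bool (inj_on L T \<and> alternating s (L ` T) js)
      + of_bool (inj_on L T \<and> alternating (\<not> s) (L ` T) js))"
proof (cases "inj_on L T")
 case True
 have im: "L ` (T - {k}) = L ` T - {L k}" if "k \<in> T" for k
  using True that by (auto simp: inj_on_def)
 have "(\<Sum>k\<in>T. of_bool (inj_on L (T - {k}) \<and> alternating s (L ` (T - {k})) js) :: int)
   = (\<Sum>k\<in>T. of_bool (alternating s (L ` T - {L k}) js))"
  by (intro sum.cong) (auto simp: im inj_on_diff[OF True])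
 also have "\<dots> = (\<Sum>x\<in>L ` T. of_bool (alternating s (L ` T - {x}) js))"
  by (simp add: sum.reindex[OF True])
 finally show ?thesis
  using alternating_faces[OF _ assms(2-4), of s] assms(1) True by simp
next
 case False
 then obtain i j where ij: "i \<in> T" "j \<in> T" "i \<noteq> j" "L i = L j" by (auto simp: inj_on_def)
 let ?P = "\<lambda>k. inj_on L (T - {k}) \<and> alternating s (L ` (T - {k})) js"
 have no: "\<not> ?P k" if "k \<in> T - {i, j}" for k
  using ij that by (auto simp: inj_on_def)
 have T: "T - {i} = insert j (T - {i, j})" "T - {j} = insert i (T - {i, j})" using ij by auto
 have "L ` (T - {i}) = L ` (T - {j})" unfolding T using ij(4) by simp
 moreover have "inj_on L (T - {i}) \<longleftrightarrow> inj_on L (T - {j})"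
  unfolding T using ij(3,4) by simp
 ultimately have eq: "?P i = ?P j" by simp
 have "(\<Sum>k\<in>T. of_bool (?P k) :: int) = (\<Sum>k\<in>{i, j}. of_bool (?P k))"
  by (rule sum.mono_neutral_right) (use assms(1) ij no in auto)
 also have "\<dots> = of_bool (?P i) + of_bool (?P j)" using ij(3) by (subst sum.insert) simp_all
 also have "\<dots> = 2 * of_bool (?P i)" unfolding eq by (rule mult_2[symmetric])
 finally have E: "(\<Sum>k\<in>T. of_bool (?P k) :: int) = 2 * of_bool (?P i)" .
 show ?thesis unfolding E using False by simp
qed

section \<open>Alternating simplices of singular chains\<close>

definition simplex_vertex :: "nat \<Rightarrow> nat \<Rightarrow> real" where
 "simplex_vertex i = (\<lambda>j. if j = i then 1 else 0)"

definition alternating_simplex ::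
  "('a \<Rightarrow> nat \<times> bool) \<Rightarrow> nat \<Rightarrow> nat \<Rightarrow> bool \<Rightarrow> ((nat \<Rightarrow> real) \<Rightarrow> 'a) \<Rightarrow> bool" where
 "alternating_simplex lab m p s f \<longleftrightarrow>
   inj_on (\<lambda>i. lab (f (simplex_vertex i))) {..p} \<and>
   alternating s ((\<lambda>i. lab (f (simplex_vertex i))) ` {..p}) [0..<m]"

text \<open>\<open>frag_extend\<close> takes values in free abelian groups. The integer count is
  therefore realised in the group on the single generator \<open>()\<close> and read off as its
  coefficient, which makes it additive on chains.\<close>

definition alternating_count ::
  "('a \<Rightarrow> nat \<times> bool) \<Rightarrow> nat \<Rightarrow> nat \<Rightarrow> bool \<Rightarrow> 'a chain \<Rightarrow> int" where
 "alternating_count lab m p s c =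
   Poly_Mapping.lookup (frag_extend (\<lambda>f. frag_cmul (of_bool (alternating_simplex lab m p s f)) (frag_of ())) c) ()"

lemma alternating_count_of [simp]:
 "alternating_count lab m p s (frag_of f) = of_bool (alternating_simplex lab m p s f)"
 by (simp add: alternating_count_def)

lemma alternating_count_0 [simp]: "alternating_count lab m p s 0 = 0"
 by (simp add: alternating_count_def)

lemma alternating_count_diff:
 "alternating_count lab m p s (a - b) = alternating_count lab m p s a - alternating_count lab m p s b"
 by (simp add: alternating_count_def frag_extend_diff lookup_minus)

lemma alternating_count_add:
 "alternating_count lab m p s (a + b) = alternating_count lab m p s a + alternating_count lab m p s b"
 by (simp add: alternating_count_def frag_extend_add lookup_add)

lemma alternating_count_cmul:
 "alternating_count lab m p s (frag_cmul k a) = k * alternating_count lab m p s a"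
 by (simp add: alternating_count_def frag_extend_cmul)

lemma alternating_count_sum:
 "finite I \<Longrightarrow> alternating_count lab m p s (\<Sum>i\<in>I. g i) = (\<Sum>i\<in>I. alternating_count lab m p s (g i))"
 by (induction I rule: finite_induct) (simp_all add: alternating_count_add)

lemma singular_face_vertex:
 assumes "k \<le> Suc p" "i \<le> p"
 shows "singular_face (Suc p) k f (simplex_vertex i) = f (simplex_vertex (if i < k then i else Suc i))"
proof -
 have "simplical_face k (simplex_vertex i) = simplex_vertex (if i < k then i else Suc i)"
  by (rule ext) (auto simp: simplical_face_def simplex_vertex_def)
 moreover have "simplex_vertex i \<in> standard_simplex p"
  using assms by (simp add: simplex_vertex_def)
 ultimately show ?thesis by (simp add: singular_face_def)
qed

lemma alternating_singular_face:
 assumes "k \<le> Suc p"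
 shows "alternating_simplex lab m p s (singular_face (Suc p) k f) \<longleftrightarrow>
   inj_on (\<lambda>i. lab (f (simplex_vertex i))) ({..Suc p} - {k}) \<and>
   alternating s ((\<lambda>i. lab (f (simplex_vertex i))) ` ({..Suc p} - {k})) [0..<m]"
proof -
 let ?L = "\<lambda>i. lab (f (simplex_vertex i))"
 let ?d = "\<lambda>i. if i < k then i else Suc i"
 have d: "inj_on ?d {..p}" by (auto simp: inj_on_def)
 have im: "?d ` {..p} = {..Suc p} - {k}"
 proof (intro equalityI subsetI)
  fix x assume x: "x \<in> {..Suc p} - {k}"
  show "x \<in> ?d ` {..p}"
  proof (cases "x < k")
   case True then show ?thesis using x assms by (intro image_eqI[of _ _ x]) auto
  next
   case False then show ?thesis using x by (intro image_eqI[of _ _ "x - 1"]) auto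
  qed
 qed (use assms in auto)
 have L: "lab (singular_face (Suc p) k f (simplex_vertex i)) = (?L \<circ> ?d) i" if "i \<in> {..p}" for i
  using that assms singular_face_vertex[of k p i f] by simp
 have 1: "inj_on (\<lambda>i. lab (singular_face (Suc p) k f (simplex_vertex i))) {..p} \<longleftrightarrow> inj_on (?L \<circ> ?d) {..p}"
  by (rule inj_on_cong) (rule L)
 have 2: "(\<lambda>i. lab (singular_face (Suc p) k f (simplex_vertex i))) ` {..p} = (?L \<circ> ?d) ` {..p}"
  by (rule image_cong) (use L in auto)
 have 3: "inj_on (?L \<circ> ?d) {..p} \<longleftrightarrow> inj_on ?L (?d ` {..p})" by (rule comp_inj_on_iff[OF d, symmetric])
 show ?thesis unfolding alternating_simplex_def 1 2 3 image_comp[symmetric] im ..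
qed

text \<open>The second condition excludes complementary edges, as in Fan's lemma; iterated
  subdivision produces it from continuity.\<close>

definition small_simplex :: "('a \<Rightarrow> nat \<times> bool) \<Rightarrow> nat \<Rightarrow> nat \<Rightarrow> ((nat \<Rightarrow> real) \<Rightarrow> 'a) \<Rightarrow> bool" where
 "small_simplex lab m p f \<longleftrightarrow>
   (\<forall>i\<le>p. fst (lab (f (simplex_vertex i))) < m) \<and>
   (\<forall>i\<le>p. \<forall>k\<le>p. \<forall>j. lab (f (simplex_vertex i)) = (j, True) \<longrightarrow> lab (f (simplex_vertex k)) \<noteq> (j, False))"

lemma small_simplex_labels:
 assumes "small_simplex lab m p f"
 shows "(\<lambda>i. lab (f (simplex_vertex i))) ` {..p} \<subseteq> {..<m} \<times> UNIV"
  and "(j, True) \<notin> (\<lambda>i. lab (f (simplex_vertex i))) ` {..p} \<or>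
     (j, False) \<notin> (\<lambda>i. lab (f (simplex_vertex i))) ` {..p}"
proof -
 show "(\<lambda>i. lab (f (simplex_vertex i))) ` {..p} \<subseteq> {..<m} \<times> UNIV"
  using assms unfolding small_simplex_def mem_Times_iff by (auto simp: mem_Times_iff image_subset_iff)
 show "(j, True) \<notin> (\<lambda>i. lab (f (simplex_vertex i))) ` {..p} \<or>
     (j, False) \<notin> (\<lambda>i. lab (f (simplex_vertex i))) ` {..p}"
 proof (rule ccontr)
  assume "\<not> ?thesis"
  then obtain i k where "i \<le> p" "k \<le> p" "lab (f (simplex_vertex i)) = (j, True)" "lab (f (simplex_vertex k)) = (j, False)"
   unfolding image_iff by (metis atMost_iff)
  then show False using assms unfolding small_simplex_def by blast
 qed
qed

text \<open>Every single simplex satisfies the parity statement of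
  \<open>alternating_faces_family\<close>, the signs in the boundary being invisible modulo 2, and
  all three counts are additive.\<close>

lemma alternating_count_boundary:
 assumes "\<And>f. f \<in> Poly_Mapping.keys c \<Longrightarrow> small_simplex lab m (Suc p) f"
 shows "even (alternating_count lab m p s (chain_boundary (Suc p) c)
  + alternating_count lab m (Suc p) s c + alternating_count lab m (Suc p) (\<not> s) c)"
proof -
 have "Poly_Mapping.keys c \<subseteq> Collect (small_simplex lab m (Suc p))" using assms by auto
 then show ?thesis
 proof (induction c rule: frag_induction)
  case zero
  then show ?case by simp
 next
  case (one f)
  let ?L = "\<lambda>i. lab (f (simplex_vertex i))"
  let ?A = "\<lambda>k. of_bool (alternating_simplex lab m p s (singular_face (Suc p) k f)) :: int"
  from one have small: "small_simplex lab m (Suc p) f" by simp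
  have par: "even ((\<Sum>k\<in>{..Suc p}. (-1) ^ k * ?A k) + (\<Sum>k\<in>{..Suc p}. ?A k))"
   unfolding sum.distrib[symmetric]
   by (rule dvd_sum) (simp add: uminus_power_if)
  have "alternating_count lab m p s (chain_boundary (Suc p) (frag_of f)) = (\<Sum>k\<in>{..Suc p}. (-1) ^ k * ?A k)"
   by (simp add: chain_boundary_of alternating_count_sum alternating_count_cmul alternating_count_add)
  moreover have "even ((\<Sum>k\<in>{..Suc p}. ?A k)
    + of_bool (alternating_simplex lab m (Suc p) s f) + of_bool (alternating_simplex lab m (Suc p) (\<not> s) f))"
  proof -
   have "(\<Sum>k\<in>{..Suc p}. ?A k) =
    (\<Sum>k\<in>{..Suc p}. of_bool (inj_on ?L ({..Suc p} - {k}) \<and> alternating s (?L ` ({..Suc p} - {k})) [0..<m]))"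
    by (rule sum.cong) (simp_all add: alternating_singular_face)
   moreover have "even ((\<Sum>k\<in>{..Suc p}. of_bool (inj_on ?L ({..Suc p} - {k}) \<and> alternating s (?L ` ({..Suc p} - {k})) [0..<m]) :: int)
     + of_bool (inj_on ?L {..Suc p} \<and> alternating s (?L ` {..Suc p}) [0..<m])
      + of_bool (inj_on ?L {..Suc p} \<and> alternating (\<not> s) (?L ` {..Suc p}) [0..<m]))"
   proof (rule alternating_faces_family)
    show "?L ` {..Suc p} \<subseteq> set [0..<m] \<times> UNIV"
     using small_simplex_labels(1)[OF small] by (simp add: lessThan_atLeast0)
    show "(j, True) \<notin> ?L ` {..Suc p} \<or> (j, False) \<notin> ?L ` {..Suc p}" for j
     by (rule small_simplex_labels(2)[OF small])
   qed auto
   ultimately show ?thesis by (simp add: alternating_simplex_def)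
  qed
  moreover have "even (x + y) \<Longrightarrow> even (y + a + b) \<Longrightarrow> even (x + a + b)" for x y a b :: int by presburger
  ultimately show ?case using par unfolding alternating_count_of by metis
 next
  case (diff a b)
  have "alternating_count lab m p s (chain_boundary (Suc p) (a - b))
   + alternating_count lab m (Suc p) s (a - b) + alternating_count lab m (Suc p) (\<not> s) (a - b)
   = (alternating_count lab m p s (chain_boundary (Suc p) a)
   + alternating_count lab m (Suc p) s a + alternating_count lab m (Suc p) (\<not> s) a)
   - (alternating_count lab m p s (chain_boundary (Suc p) b)
   + alternating_count lab m (Suc p) s b + alternating_count lab m (Suc p) (\<not> s) b)"
   by (simp only: chain_boundary_diff alternating_count_diff)
  then show ?case using diff by (metis dvd_diff)
 qed
qed

text \<open>Antipodes have labels with the same index and opposite signs, so an alternating simplex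
  is carried to one with the other leading sign.\<close>

lemma alternating_count_flip:
 assumes c: "singular_chain p X c"
  and small: "\<And>f. f \<in> Poly_Mapping.keys c \<Longrightarrow> small_simplex lab m p f"
  and odd: "\<And>x. x \<in> topspace X \<Longrightarrow> lab (\<nu> x) = (fst (lab x), \<not> snd (lab x))"
 shows "alternating_count lab m p s (chain_map p \<nu> c) = alternating_count lab m p (\<not> s) c"
proof -
 have "Poly_Mapping.keys c \<subseteq> {f. small_simplex lab m p f \<and> singular_simplex p X f}"
  using assms by (auto simp: singular_chain_def)
 then show ?thesis
 proof (induction c rule: frag_induction)
  case zero
  then show ?case by simp
 next
  case (diff a b)
  then show ?case by (simp add: chain_map_diff alternating_count_diff)
 next
  case (one f)
  let ?L = "\<lambda>i. lab (f (simplex_vertex i))"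
  let ?fl = "\<lambda>(j::nat, t). (j, \<not> t)"
  from one have small: "small_simplex lab m p f" and f: "singular_simplex p X f" by auto
  have v: "simplex_vertex i \<in> standard_simplex p" if "i \<le> p" for i
   using that by (simp add: simplex_vertex_def)
  have fx: "f (simplex_vertex i) \<in> topspace X" if "i \<le> p" for i
   using f v[OF that] unfolding singular_simplex_def continuous_map_def by auto
  have L: "lab (simplex_map p \<nu> f (simplex_vertex i)) = (?fl \<circ> ?L) i" if "i \<in> {..p}" for i
   using that v[of i] odd[OF fx, of i] by (simp add: simplex_map_def split: prod.split)
  have 1: "inj_on (\<lambda>i. lab (simplex_map p \<nu> f (simplex_vertex i))) {..p} \<longleftrightarrow> inj_on (?fl \<circ> ?L) {..p}"
   by (rule inj_on_cong) (rule L)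
  have inj: "inj_on ?fl A" for A by (auto simp: inj_on_def)
  have 2: "(\<lambda>i. lab (simplex_map p \<nu> f (simplex_vertex i))) ` {..p} = ?fl ` ?L ` {..p}"
   unfolding image_comp by (rule image_cong) (use L in auto)
  have 3: "inj_on (?fl \<circ> ?L) {..p} \<longleftrightarrow> inj_on ?L {..p}"
   using comp_inj_on[OF _ inj] inj_on_imageI2 by blast
  have "(j, True) \<notin> ?L ` {..p} \<or> (j, False) \<notin> ?L ` {..p}" for j
   by (rule small_simplex_labels(2)[OF small])
  then show ?case
   unfolding chain_map_of alternating_count_of alternating_simplex_def 1 2 3
   by (subst alternating_flip) auto
 qed
qed

text \<open>Distinct labels without a complementary pair have distinct indices, and
  \<open>p + 1\<close> vertices do not fit into \<open>m\<close> indices.\<close>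

lemma alternating_simplex_dim:
 assumes "small_simplex lab m p f" "m \<le> p"
 shows "\<not> alternating_simplex lab m p s f"
proof
 assume "alternating_simplex lab m p s f"
 then have inj: "inj_on (\<lambda>i. lab (f (simplex_vertex i))) {..p}" by (simp add: alternating_simplex_def)
 have "inj_on (\<lambda>i. fst (lab (f (simplex_vertex i)))) {..p}"
 proof (rule inj_onI)
  fix i k assume ik: "i \<in> {..p}" "k \<in> {..p}" "fst (lab (f (simplex_vertex i))) = fst (lab (f (simplex_vertex k)))"
  obtain a u b t where ab: "lab (f (simplex_vertex i)) = (a, u)" "lab (f (simplex_vertex k)) = (b, t)"
   by (meson surj_pair)
  have r: "\<And>i k j. i \<le> p \<Longrightarrow> k \<le> p \<Longrightarrow> lab (f (simplex_vertex i)) = (j, True) \<Longrightarrow> lab (f (simplex_vertex k)) \<noteq> (j, False)"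
   using assms(1) unfolding small_simplex_def by blast
  have "u = t"
   using r[of i k a] r[of k i a] ab ik by (cases u; cases t) auto
  then have "lab (f (simplex_vertex i)) = lab (f (simplex_vertex k))"
   using ab ik by auto
  then show "i = k" using inj ik by (auto simp: inj_on_def)
 qed
 moreover have "(\<lambda>i. fst (lab (f (simplex_vertex i)))) ` {..p} \<subseteq> {..<m}"
  using assms(1) by (auto simp: small_simplex_def)
 ultimately have "card {..p} \<le> card {..<m}" by (metis card_inj_on_le finite_lessThan)
 then show False using assms(2) by simp
qed

lemma alternating_count_dim:
 assumes small: "\<And>f. f \<in> Poly_Mapping.keys c \<Longrightarrow> small_simplex lab m p f" and "m \<le> p"
 shows "alternating_count lab m p s c = 0"
proof -
 have "Poly_Mapping.keys c \<subseteq> {f. small_simplex lab m p f}" using small by auto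
 then show ?thesis
  by (induction c rule: frag_induction)
    (simp_all add: alternating_count_diff alternating_simplex_dim[OF _ assms(2)])
qed

section \<open>Iterated subdivision and antipodal hemispheres\<close>

lemma singular_subdivision_power:
 assumes "singular_chain p X c"
 shows singular_chain_subdivision_power: "singular_chain p X ((singular_subdivision p ^^ n) c)"
  and chain_boundary_subdivision_power:
   "chain_boundary p ((singular_subdivision p ^^ n) c) = (singular_subdivision (p - Suc 0) ^^ n) (chain_boundary p c)"
  and chain_map_subdivision_power:
   "(singular_subdivision p ^^ n) (chain_map p g c) = chain_map p g ((singular_subdivision p ^^ n) c)"
proof -
 have 1: "singular_chain p X ((singular_subdivision p ^^ n) c)" for n
  by (induction n) (simp_all add: assms singular_chain_singular_subdivision)
 show "singular_chain p X ((singular_subdivision p ^^ n) c)" by (rule 1)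
 show "chain_boundary p ((singular_subdivision p ^^ n) c) = (singular_subdivision (p - Suc 0) ^^ n) (chain_boundary p c)"
  by (induction n) (simp_all add: chain_boundary_singular_subdivision[OF 1])
 show "(singular_subdivision p ^^ n) (chain_map p g c) = chain_map p g ((singular_subdivision p ^^ n) c)"
  by (induction n) (simp_all add: naturality_singular_subdivision[OF 1])
qed

lemma singular_subdivision_power_add:
 "(singular_subdivision p ^^ n) (a + b) = (singular_subdivision p ^^ n) a + (singular_subdivision p ^^ n) b"
 by (induction n) (auto simp: singular_subdivision_add)

lemma singular_subdivision_power_cmul_sign:
 "(singular_subdivision p ^^ n) (frag_cmul ((-1) ^ k) a) = frag_cmul ((-1) ^ k) ((singular_subdivision p ^^ n) a)"
proof -
 have "(singular_subdivision p ^^ n) (- a) = - ((singular_subdivision p ^^ n) a)"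
  using singular_subdivision_power_diff[of n p 0 a] by simp
 then show ?thesis by (cases "even k") auto
qed

text \<open>In dimension 0 the hypothesis on \<open>aug\<close> says that the cycle has degree 0.\<close>

lemma homology_nsphere_boundary:
 assumes c: "singular_chain p (nsphere n) c" "chain_boundary p c = 0" and "p < n"
  and aug: "p = 0 \<Longrightarrow> chain_map 0 (\<lambda>x. ()) c = 0"
 shows "\<exists>d. singular_chain (Suc p) (nsphere n) d \<and> chain_boundary (Suc p) d = c"
proof -
 let ?X = "nsphere n"
 have rc: "singular_relcycle p ?X {} c" using c by (simp add: singular_cycle)
 have cl: "homologous_rel_set p ?X {} c \<in> carrier (homology_group (int p) ?X)"
  using rc by (auto simp: carrier_relative_homology_group)
 have triv: "trivial_group (reduced_homology_group (int p) ?X)"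
  using assms(3) by (intro reduced_homology_group_nsphere(2)) simp
 have "homologous_rel_set p ?X {} c \<in> carrier (reduced_homology_group (int p) ?X)"
 proof (cases "p = 0")
  case False
  then show ?thesis using cl by (simp add: un_reduced_homology_group)
 next
  case True
  have "hom_induced (int p) ?X {} (discrete_topology {()}) {} (\<lambda>x. ()) (homologous_rel_set p ?X {} c)
    = homologous_rel_set p (discrete_topology {()}) {} (chain_map p (\<lambda>x. ()) c)"
   using rc by (intro hom_induced_chain_map) auto
  also have "\<dots> = \<one>\<^bsub>homology_group (int p) (discrete_topology {()})\<^esub>"
   using aug True by (simp only: one_relative_homology_group homologous_rel_set_eq_relboundary) simp
  finally show ?thesis using cl by (simp add: carrier_reduced_homology_group kernel_def)
 qed
 then have "homologous_rel_set p ?X {} c = \<one>\<^bsub>homology_group (int p) ?X\<^esub>"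
  using triv by (auto simp: trivial_group_def one_reduced_homology_group)
 then have "singular_relboundary p ?X {} c"
  by (simp add: homologous_rel_set_eq_relboundary)
 then show ?thesis by (simp add: singular_boundary)
qed

lemma continuous_map_nsphere_minus:
 "continuous_map (nsphere n) (nsphere n) (\<lambda>x i. - x i)"
 unfolding nsphere
 by (auto simp: continuous_map_in_subtopology continuous_map_componentwise_UNIV
   intro!: continuous_intros continuous_map_from_subtopology)

text \<open>\<open>c k\<close> plays the role of a hemisphere of dimension \<open>k\<close>, whose boundary is a sphere made of
 \<open>c (k - 1)\<close> and its antipodal image.\<close>

lemma antipodal_chains:
 assumes "k \<le> n"
 shows "\<exists>c. (\<forall>j\<le>k. singular_chain j (nsphere n) (c j)) \<and>
   c 0 = frag_of (restrict (\<lambda>_. simplex_vertex 0) (standard_simplex 0)) \<and>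
   (\<forall>j<k. chain_boundary (Suc j) (c (Suc j)) =
    c j + frag_cmul ((-1) ^ Suc j) (chain_map j (\<lambda>x i. - x i) (c j)))"
 using assms
proof (induction k)
 case 0
 have "singular_chain 0 (nsphere n) (frag_of (restrict (\<lambda>_. simplex_vertex 0) (standard_simplex 0)))"
  using in_topspace_nsphere[of n]
  by (auto simp: singular_chain_of singular_simplex_def simplex_vertex_def continuous_map_const)
 then show ?case
  by (intro exI[of _ "\<lambda>_. frag_of (restrict (\<lambda>_. simplex_vertex 0) (standard_simplex 0))"])
   (simp del: restrict_apply)
next
 case (Suc k)
 let ?nu = "\<lambda>(x::nat \<Rightarrow> real) i. - x i"
 have "k \<le> n" using Suc.prems by simp
 from Suc.IH[OF this] obtain c where c: "\<And>j. j \<le> k \<Longrightarrow> singular_chain j (nsphere n) (c j)"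
   "c 0 = frag_of (restrict (\<lambda>_. simplex_vertex 0) (standard_simplex 0))"
   "\<And>j. j < k \<Longrightarrow> chain_boundary (Suc j) (c (Suc j)) = c j + frag_cmul ((-1) ^ Suc j) (chain_map j ?nu (c j))"
  by blast
 have invol: "chain_map j ?nu (chain_map j ?nu d) = d" if "singular_chain j (nsphere n) d" for j d
  using chain_map_id_gen[OF that, of "?nu \<circ> ?nu"] by (simp add: chain_map_compose)
 let ?e = "c k + frag_cmul ((-1) ^ Suc k) (chain_map k ?nu (c k))"
 have e: "singular_chain k (nsphere n) ?e"
  using c(1)[of k] by (intro singular_chain_add singular_chain_cmul singular_chain_chain_map[OF _ continuous_map_nsphere_minus]) auto
 \<comment> \<open>The antipodal map is an involution, so applying it to the boundary formula of
   \<open>c k\<close> interchanges the two summands. The sign changes from one dimension to the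
   next, and the four terms cancel.\<close>
 have bd: "chain_boundary k ?e = 0"
 proof (cases k)
  case 0
  then show ?thesis by (simp add: chain_boundary_def)
 next
  case (Suc j)
  have cj: "singular_chain j (nsphere n) (c j)" using c(1)[of j] Suc by simp
  have "chain_boundary k (c k) = c j + frag_cmul ((-1) ^ Suc j) (chain_map j ?nu (c j))"
   using c(3)[of j] Suc by simp
  moreover have "chain_boundary k (chain_map k ?nu (c k)) = chain_map j ?nu (c j) + frag_cmul ((-1) ^ Suc j) (c j)"
   using chain_boundary_chain_map[OF c(1)[of k], of ?nu] calculation Suc invol[OF cj]
   by (simp add: chain_map_add chain_map_minus)
  ultimately show ?thesis
   using Suc by (cases "even j") (simp_all add: chain_boundary_add chain_boundary_cmul chain_boundary_minus chain_boundary_diff)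
 qed
 \<comment> \<open>In dimension 0 the chain is a point minus its antipode, and both have the same
   image in the one-point space.\<close>
 have aug: "chain_map 0 (\<lambda>x. ()) ?e = 0" if "k = 0"
  using that c(2) by (simp add: chain_map_add chain_map_minus chain_map_diff simplex_map_def restrict_def cong: if_cong)
 from homology_nsphere_boundary[OF e bd _ aug] Suc.prems
 obtain d where d: "singular_chain (Suc k) (nsphere n) d" "chain_boundary (Suc k) d = ?e" by auto
 show ?case
  by (intro exI[of _ "c(Suc k := d)"]) (use c d in \<open>auto simp: le_Suc_eq less_Suc_eq simp del: restrict_apply power_Suc\<close>)
qed

text \<open>Without a common zero, the index and sign of a coordinate of largest modulus label the
  sphere antipodally. On finely subdivided hemispheres the number of alternating simplices of both
  signs together stays odd from one dimension to the next, but in dimension \<open>m\<close>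
  alternation would require more than \<open>m\<close> indices.\<close>

theorem Borsuk_Ulam_nsphere:
 fixes f :: "nat \<Rightarrow> (nat \<Rightarrow> real) \<Rightarrow> real"
 assumes "m \<le> n"
  and cont: "\<And>j. j < m \<Longrightarrow> continuous_map (nsphere n) euclideanreal (f j)"
  and odd: "\<And>j x. j < m \<Longrightarrow> x \<in> topspace (nsphere n) \<Longrightarrow> f j (\<lambda>i. - x i) = - f j x"
 shows "\<exists>x\<in>topspace (nsphere n). \<forall>j<m. f j x = 0"
proof (rule ccontr)
 assume no: "\<not> ?thesis"
 let ?X = "nsphere n"
 let ?nu = "\<lambda>(x::nat \<Rightarrow> real) i. - x i"
 have m: "0 < m" using no in_topspace_nsphere[of n] by (cases m) auto
 define M where "M x = Max ((\<lambda>j. \<bar>f j x\<bar>) ` {..<m})" for x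
 have fin: "finite ((\<lambda>j. \<bar>f j x\<bar>) ` {..<m})" "(\<lambda>j. \<bar>f j x\<bar>) ` {..<m} \<noteq> {}" for x
  using m by auto
 have M_ge: "\<bar>f j x\<bar> \<le> M x" if "j < m" for j x
  unfolding M_def using that by (intro Max_ge) auto
 have M_ex: "\<exists>j<m. \<bar>f j x\<bar> = M x" for x
  using Max_in[OF fin[of x]] unfolding M_def by (auto simp: image_iff)
 have M_pos: "0 < M x" if "x \<in> topspace ?X" for x
 proof -
  have "\<not> (\<forall>j<m. f j x = 0)" using no that by simp
  then obtain j where "j < m" "f j x \<noteq> 0" by auto
  then show ?thesis using M_ge[of j x] by linarith
 qed
 \<comment> \<open>Taking the least index makes the choice depend on the moduli alone, so a point
   and its antipode receive the same index.\<close>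
 define J where "J x = (LEAST j. j < m \<and> \<bar>f j x\<bar> = M x)" for x
 have J: "J x < m" "\<bar>f (J x) x\<bar> = M x" for x
  using LeastI_ex[OF M_ex[of x]] unfolding J_def by auto
 define lab where "lab x = (J x, 0 < f (J x) x)" for x
 have nuX: "?nu x \<in> topspace ?X" if "x \<in> topspace ?X" for x
  using that continuous_map_nsphere_minus[of n] by (auto simp: continuous_map_def)
 have lab_odd: "lab (?nu x) = (fst (lab x), \<not> snd (lab x))" if x: "x \<in> topspace ?X" for x
 proof -
  have a: "\<bar>f j (?nu x)\<bar> = \<bar>f j x\<bar>" if "j < m" for j using odd[OF that x] by simp
  have MM: "M (?nu x) = M x" unfolding M_def by (intro arg_cong[of _ _ Max] image_cong) (use a in auto)
  have JJ: "J (?nu x) = J x" unfolding J_def MM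
   by (rule arg_cong[of _ _ Least]) (use a in auto)
  have "f (J x) x \<noteq> 0" using J(2)[of x] M_pos[OF x] by auto
  then show ?thesis using odd[OF J(1) x, of x] by (auto simp: lab_def JJ)
 qed
 \<comment> \<open>The radius \<open>M x / 4\<close> excludes complementary labels: at two such
   points the chosen coordinate would have modulus above 3/4 of \<open>M x\<close> and opposite
   signs, while its values differ by less than \<open>M x / 2\<close>.\<close>
 define V where "V x = {z \<in> topspace ?X. \<forall>i<m. \<bar>f i z - f i x\<bar> < M x / 4}" for x
 have V_open: "openin ?X (V x)" for x
 proof -
  have "openin ?X {z \<in> topspace ?X. f i z \<in> ball (f i x) (M x / 4)}" if "i < m" for i
   using openin_continuous_map_preimage[OF cont[OF that], of "ball (f i x) (M x / 4)"] by (simp del: mem_ball)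
  then have "openin ?X (topspace ?X \<inter> (\<Inter>i\<in>{..<m}. {z \<in> topspace ?X. f i z \<in> ball (f i x) (M x / 4)}))"
   by (intro openin_Int_Inter) auto
  moreover have "topspace ?X \<inter> (\<Inter>i\<in>{..<m}. {z \<in> topspace ?X. f i z \<in> ball (f i x) (M x / 4)}) = V x"
   by (auto simp: V_def dist_real_def abs_minus_commute)
  ultimately show ?thesis by simp
 qed
 have V_lab: "lab a = (j, True) \<Longrightarrow> lab b \<noteq> (j, False)" if "x \<in> topspace ?X" "a \<in> V x" "b \<in> V x" for x a b j
 proof
  assume a: "lab a = (j, True)" and b: "lab b = (j, False)"
  have j: "j < m" using a J(1)[of a] by (auto simp: lab_def)
  obtain i where i: "i < m" "\<bar>f i x\<bar> = M x" using M_ex by blast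
  have "\<bar>f i a - f i x\<bar> < M x / 4" "\<bar>f i b - f i x\<bar> < M x / 4" using that i by (auto simp: V_def)
  then have "\<bar>f i a\<bar> > 3 / 4 * M x" "\<bar>f i b\<bar> > 3 / 4 * M x" using i by linarith+
  then have "M a > 3 / 4 * M x" "M b > 3 / 4 * M x"
   using M_ge[OF i(1), of a] M_ge[OF i(1), of b] by linarith+
  moreover have "f j a = M a" "f j b \<le> 0"
   using a b J(2)[of a] by (auto simp: lab_def)
  moreover have "\<bar>f j b\<bar> = M b" using b J(2)[of b] by (auto simp: lab_def)
  moreover have "\<bar>f j a - f j x\<bar> < M x / 4" "\<bar>f j b - f j x\<bar> < M x / 4" using that j by (auto simp: V_def)
  ultimately show False using M_pos[OF that(1)] by linarith
 qed
 obtain c where c: "\<And>j. j \<le> m \<Longrightarrow> singular_chain j ?X (c j)"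
   "c 0 = frag_of (restrict (\<lambda>_. simplex_vertex 0) (standard_simplex 0))"
   "\<And>j. j < m \<Longrightarrow> chain_boundary (Suc j) (c (Suc j)) = c j + frag_cmul ((-1) ^ Suc j) (chain_map j ?nu (c j))"
  using antipodal_chains[OF assms(1)] by blast
 have "\<exists>N. \<forall>M f. N \<le> M \<and> f \<in> Poly_Mapping.keys ((singular_subdivision j ^^ M) (c j)) \<longrightarrow>
     (\<exists>U\<in>V ` topspace ?X. f \<in> standard_simplex j \<rightarrow> U)" if "j \<le> m" for j
 proof -
  have cj: "singular_chain j ?X (c j)" by (rule c(1)[OF that])
  have sub: "topspace ?X \<subseteq> \<Union>(V ` topspace ?X)"
  proof
   fix x assume "x \<in> topspace ?X"
   then show "x \<in> \<Union>(V ` topspace ?X)" using M_pos[of x] by (intro UN_I[of x]) (auto simp: V_def)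
  qed
  obtain N where "\<And>M f. N \<le> M \<Longrightarrow> f \<in> Poly_Mapping.keys ((singular_subdivision j ^^ M) (c j)) \<Longrightarrow>
     \<exists>U\<in>V ` topspace ?X. f \<in> standard_simplex j \<rightarrow> U"
   by (rule sufficient_iterated_singular_subdivision_exists[OF _ sub cj]) (use V_open in auto)
  then show ?thesis by blast
 qed
 then obtain N where N: "\<And>j M f. j \<le> m \<Longrightarrow> N j \<le> M \<Longrightarrow> f \<in> Poly_Mapping.keys ((singular_subdivision j ^^ M) (c j)) \<Longrightarrow>
     \<exists>U\<in>V ` topspace ?X. f \<in> standard_simplex j \<rightarrow> U"
  by metis
 \<comment> \<open>One number of subdivisions serves all dimensions at once, so that the boundary
   relations between the hemispheres persist.\<close>
 define R where "R = Max (N ` {..m})"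
 have R: "N j \<le> R" if "j \<le> m" for j unfolding R_def using that by simp
 define d where "d j = (singular_subdivision j ^^ R) (c j)" for j
 have d: "singular_chain j ?X (d j)" if "j \<le> m" for j
  unfolding d_def by (rule singular_chain_subdivision_power[OF c(1)[OF that]])
 have small: "small_simplex lab m j g" if jm: "j \<le> m" and g: "g \<in> Poly_Mapping.keys (d j)" for j g
 proof -
  obtain x where x: "x \<in> topspace ?X" "g \<in> standard_simplex j \<rightarrow> V x"
   using N[OF jm R[OF jm] g[unfolded d_def]] by auto
  have "g (simplex_vertex i) \<in> V x" if "i \<le> j" for i
   using that x(2) by (auto simp: simplex_vertex_def Pi_iff)
  then show ?thesis
   unfolding small_simplex_def using V_lab[OF x(1)] J(1) by (auto simp: lab_def)
 qed
 have step: "chain_boundary (Suc j) (d (Suc j)) = d j + frag_cmul ((-1) ^ Suc j) (chain_map j ?nu (d j))" if "j < m" for j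
  using that c(3)[OF that] chain_boundary_subdivision_power[OF c(1)[of "Suc j"], of R]
   chain_map_subdivision_power[OF c(1)[of j], of R ?nu]
  by (simp add: d_def singular_subdivision_power_add singular_subdivision_power_cmul_sign del: power_Suc)
 \<comment> \<open>Modulo 2, the boundary of \<open>d (Suc j)\<close> counts the alternating
   simplices of \<open>d j\<close> of both signs, because the antipodal half contributes those of
   the other sign.\<close>
 have "odd (alternating_count lab m j True (d j) + alternating_count lab m j False (d j))" if "j \<le> m" for j
  using that
 proof (induction j)
  case 0
  have "(singular_subdivision 0 ^^ n) (c 0) = c 0" for n
   by (induction n) (use singular_subdivision_zero[OF c(1)[of 0]] in simp_all)
  then have "d 0 = c 0" by (simp add: d_def)
  then have d0: "d 0 = frag_of (restrict (\<lambda>_. simplex_vertex 0) (standard_simplex 0))" using c(2) by simp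
  define q where "q = lab (restrict (\<lambda>_. simplex_vertex 0) (standard_simplex 0) (simplex_vertex 0))"
  have q: "fst q < m" unfolding q_def lab_def using J(1) by simp
  have key: "alternating s {(a, t)} js \<longleftrightarrow> (a \<in> set js \<longrightarrow> t = s)" if "distinct js" for s t a and js :: "nat list"
   using that by (induction js arbitrary: s) auto
  have key: "alternating s {q} [0..<m] \<longleftrightarrow> (fst q \<in> set [0..<m] \<longrightarrow> snd q = s)" for s
   using key[of "[0..<m]" s "fst q" "snd q"] by simp
  have "alternating_count lab m 0 s (d 0) = of_bool (snd q = s)" for s
   using q unfolding d0 alternating_count_of alternating_simplex_def by (simp add: q_def[symmetric] key del: restrict_apply)
  then show ?case by simp
 next
  case (Suc j)
  let ?a = "alternating_count lab m"
  have jm: "j \<le> m" "j < m" using Suc by auto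
  have f: "?a j True (chain_map j ?nu (d j)) = ?a j False (d j)"
   using alternating_count_flip[OF d[OF jm(1)] small[OF jm(1)], of ?nu True] lab_odd by simp
  have "even (?a j True (chain_boundary (Suc j) (d (Suc j))) + ?a (Suc j) True (d (Suc j)) + ?a (Suc j) False (d (Suc j)))"
   using alternating_count_boundary[of "d (Suc j)" lab m j True] small[of "Suc j"] Suc.prems by simp
  moreover have "?a j True (chain_boundary (Suc j) (d (Suc j))) = ?a j True (d j) + (-1) ^ Suc j * ?a j False (d j)"
   unfolding step[OF jm(2)] by (simp add: alternating_count_add alternating_count_cmul f del: power_Suc)
  moreover have "odd (?a j True (d j) + ?a j False (d j))" using Suc by simp
  moreover have "even (x + (-1) ^ Suc j * y + a + b) \<Longrightarrow> odd (x + y) \<Longrightarrow> odd (a + b)" for x y a b :: int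
   by (cases "even j") (simp_all, presburger+)
  ultimately show ?case by metis
 qed
 from this[of m] show False
  using alternating_count_dim[of "d m" lab m m] small[of m] by simp
qed

section \<open>The sphere as a compact subset of a product space\<close>

lemma nsphere_eq: "nsphere n = top_of_set (topspace (nsphere n))"
 by (simp add: nsphere euclidean_product_topology)

lemma continuous_map_nsphere:
 "continuous_map (nsphere n) euclidean f \<longleftrightarrow> continuous_on (topspace (nsphere n)) f"
 by (subst nsphere_eq) simp

lemma compact_nsphere: "compact (topspace (nsphere n))"
proof -
 have S: "topspace (nsphere n) = {x. (\<Sum>i\<le>n. (x i)\<^sup>2) = 1 \<and> (\<forall>i>n. x i = 0)}"
  by (simp add: nsphere)
 have cl: "closed {x :: nat \<Rightarrow> real. (\<Sum>i\<le>n. (x i)\<^sup>2) = 1 \<and> (\<forall>i. i > n \<longrightarrow> x i = 0)}"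
  by (intro closed_Collect_conj closed_Collect_all closed_Collect_imp closed_Collect_eq open_Collect_const
    continuous_on_sum continuous_on_power continuous_on_product_coordinates continuous_on_const)
 have cp: "compact (Pi\<^sub>E UNIV (\<lambda>_::nat. {-1..1::real}))"
  unfolding compactin_euclidean_iff[symmetric] euclidean_product_topology[symmetric] compactin_PiE by simp
 have sub: "topspace (nsphere n) \<subseteq> Pi\<^sub>E UNIV (\<lambda>_::nat. {-1..1})"
 proof
  fix x assume x: "x \<in> topspace (nsphere n)"
  have "\<bar>x i\<bar> \<le> 1" for i
  proof (cases "i \<le> n")
   case True
   then have "(x i)\<^sup>2 \<le> (\<Sum>i\<le>n. (x i)\<^sup>2)" by (intro member_le_sum) auto
   then show ?thesis using x by (simp add: S abs_square_le_1)
  qed (use x in \<open>simp add: S\<close>)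
  then show "x \<in> Pi\<^sub>E UNIV (\<lambda>_::nat. {-1..1})" by (simp add: abs_le_iff PiE_def minus_le_iff)
 qed
 show ?thesis using closed_Int_compact[OF cl cp] sub unfolding S by (simp only: Int_absorb2)
qed

section \<open>Test functions\<close>

abbreviation deriv_at :: "('a::real_normed_vector \<Rightarrow> real) \<Rightarrow> 'a \<Rightarrow> 'a \<Rightarrow> real" where
 "deriv_at f x \<equiv> frechet_derivative f (at x)"

lemma continuously_differentiable_Suc_imp:
 "continuously_differentiable (Suc k) f \<Longrightarrow> continuously_differentiable k f"
proof (induction k arbitrary: f)
 case 0
 then show ?case
  by (auto intro!: continuous_at_imp_continuous_on differentiable_imp_continuous_within)
next
 case (Suc k)
 then show ?case by (metis continuously_differentiable.simps(2))
qed

lemma continuously_differentiable_const: "continuously_differentiable k (\<lambda>x. c)"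
proof (induction k arbitrary: c)
 case (Suc k)
 have "frechet_derivative (\<lambda>x. c) (at x) = (\<lambda>h. 0)" for x :: 'a
  by (rule frechet_derivative_const)
 then show ?case using Suc[of 0] by simp
qed simp

lemma continuously_differentiable_add:
 "continuously_differentiable k f \<Longrightarrow> continuously_differentiable k g \<Longrightarrow>
  continuously_differentiable k (\<lambda>x. f x + g x)"
proof (induction k arbitrary: f g)
 case 0 then show ?case by (auto intro: continuous_intros)
next
 case (Suc k)
 then have d: "f differentiable (at x)" "g differentiable (at x)" for x by auto
 have hd: "((\<lambda>x. f x + g x) has_derivative
   (\<lambda>h. deriv_at f x h + deriv_at g x h)) (at x)" for x
  using d[of x] by (intro has_derivative_add) (simp_all add: frechet_derivative_works)
 have fd: "frechet_derivative (\<lambda>x. f x + g x) (at x) b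
   = deriv_at f x b + deriv_at g x b" for x b
  unfolding frechet_derivative_at[OF hd[of x], symmetric] ..
 show ?case unfolding continuously_differentiable.simps fd
  using Suc d by (auto intro: derivative_intros)
qed

lemma continuously_differentiable_mult:
 fixes f g :: "'a::euclidean_space \<Rightarrow> real"
 assumes "continuously_differentiable k f" "continuously_differentiable k g"
 shows "continuously_differentiable k (\<lambda>x. f x * g x)"
 using assms
proof (induction k arbitrary: f g)
 case 0 then show ?case by (auto intro: continuous_intros)
next
 case (Suc k)
 then have d: "f differentiable (at x)" "g differentiable (at x)" for x by auto
 have hd: "((\<lambda>x. f x * g x) has_derivative
   (\<lambda>h. f x * deriv_at g x h + deriv_at f x h * g x)) (at x)" for x
  using d[of x] by (intro has_derivative_mult) (simp_all add: frechet_derivative_works)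
 have fd: "frechet_derivative (\<lambda>x. f x * g x) (at x) b
   = f x * deriv_at g x b + deriv_at f x b * g x" for x b
  unfolding frechet_derivative_at[OF hd[of x], symmetric] ..
 have c: "continuously_differentiable k f" "continuously_differentiable k g"
  using Suc.prems continuously_differentiable_Suc_imp by blast+
 show ?case unfolding continuously_differentiable.simps fd
  using Suc c d by (auto intro!: continuously_differentiable_add intro: derivative_intros)
qed

lemma continuously_differentiable_prod:
 fixes f :: "'i \<Rightarrow> 'a::euclidean_space \<Rightarrow> real"
 assumes "finite I" "\<And>i. i \<in> I \<Longrightarrow> continuously_differentiable k (f i)"
 shows "continuously_differentiable k (\<lambda>x. \<Prod>i\<in>I. f i x)"
 using assms by (induction I rule: finite_induct)
  (auto intro!: continuously_differentiable_const continuously_differentiable_mult)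

text \<open>\<open>F\<close> lists a function together with all its derivatives. Generalising over
  the index \<open>j\<close> lets the induction on \<open>k\<close> pass to the derivative, which
  has the same form up to a constant factor.\<close>

lemma continuously_differentiable_affine_compose:
 fixes F :: "nat \<Rightarrow> real \<Rightarrow> real" and c :: "'a::euclidean_space"
 assumes F: "\<And>j t. (F j has_real_derivative F (Suc j) t) (at t)"
 shows "continuously_differentiable k (\<lambda>x. F j (x \<bullet> c + d))"
proof (induction k arbitrary: j)
 case 0
 have "continuous_on UNIV (F j)"
  by (intro continuous_at_imp_continuous_on ballI DERIV_isCont[OF F])
 then have "continuous_on UNIV (F j \<circ> (\<lambda>x. x \<bullet> c + d))"
  by (intro continuous_on_compose) (auto intro!: continuous_intros intro: continuous_on_subset)
 then show ?case by (simp add: o_def)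
next
 case (Suc k)
 have hd: "((\<lambda>x. F j (x \<bullet> c + d)) has_derivative (\<lambda>h. F (Suc j) (x \<bullet> c + d) * (h \<bullet> c))) (at x)" for x
 proof -
  have "(F j has_derivative (\<lambda>h. F (Suc j) (x \<bullet> c + d) * h)) (at (x \<bullet> c + d))"
   using F[of j "x \<bullet> c + d"] by (simp add: has_field_derivative_def)
  moreover have "((\<lambda>x. x \<bullet> c + d) has_derivative (\<lambda>h. h \<bullet> c)) (at x)"
   by (auto intro!: derivative_eq_intros)
  ultimately show ?thesis by (rule has_derivative_compose[rotated])
 qed
 have fd: "frechet_derivative (\<lambda>x. F j (x \<bullet> c + d)) (at x) b = F (Suc j) (x \<bullet> c + d) * (b \<bullet> c)" for x b
  by (subst frechet_derivative_at[OF hd[of x], symmetric]) simp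
 show ?case unfolding continuously_differentiable.simps fd
  using hd by (auto intro!: continuously_differentiable_mult Suc.IH continuously_differentiable_const
    simp: differentiable_def)
qed

section \<open>Smooth bump functions on boxes\<close>

definition flat_exp :: "real \<Rightarrow> real" where
 "flat_exp t = (if 0 < t then exp (- (1 / t)) else 0)"

lemma poly_div_exp_tendsto_0: "((\<lambda>s. poly p s / exp s) \<longlongrightarrow> (0::real)) at_top"
proof -
 have "((\<lambda>s. \<Sum>i\<le>Polynomial.degree p. Polynomial.coeff p i * (s ^ i / exp s)) \<longlongrightarrow> (\<Sum>i\<le>Polynomial.degree p. Polynomial.coeff p i * 0)) at_top"
  by (intro tendsto_sum tendsto_mult tendsto_const tendsto_power_div_exp_0)
 then show ?thesis by (simp add: poly_altdef sum_divide_distrib)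
qed

text \<open>With s = 1/t, the derivative in t of P(s) exp(-s) is s^2 (P(s) - P'(s)) exp(-s); this is
  the recursion.\<close>

primrec flat_exp_poly :: "nat \<Rightarrow> real poly" where
 "flat_exp_poly 0 = 1"
| "flat_exp_poly (Suc k) = [:0, 0, 1:] * (flat_exp_poly k - pderiv (flat_exp_poly k))"

definition flat_exp_deriv :: "nat \<Rightarrow> real \<Rightarrow> real" where
 "flat_exp_deriv k t = (if 0 < t then poly (flat_exp_poly k) (1 / t) * exp (- (1 / t)) else 0)"

lemma flat_exp_deriv_0: "flat_exp_deriv 0 = flat_exp"
 by (auto simp: flat_exp_deriv_def flat_exp_def)

lemma flat_exp_has_deriv: "(flat_exp_deriv k has_real_derivative flat_exp_deriv (Suc k) t) (at t)"
proof -
 consider "t < 0" | "t = 0" | "t > 0" by linarith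
 then show ?thesis
 proof cases
  case 1
  have "((\<lambda>t. 0) has_real_derivative 0) (at t)" by simp
  moreover have "eventually (\<lambda>s. s < 0) (nhds t)" using 1 using eventually_nhds_in_open[of "{..<0::real}" t] by (auto elim: eventually_mono)
  ultimately show ?thesis using 1
   by (subst DERIV_cong_ev[OF refl, where g = "\<lambda>t. 0" and v = 0]) (auto simp: flat_exp_deriv_def elim: eventually_mono)
 next
  case 3
  let ?f = "\<lambda>t. poly (flat_exp_poly k) (1 / t) * exp (- (1 / t))"
  have "(?f has_real_derivative flat_exp_deriv (Suc k) t) (at t)"
   unfolding flat_exp_deriv_def using 3
   by (auto intro!: derivative_eq_intros DERIV_chain'[OF _ poly_DERIV]
     simp: power2_eq_square field_simps)
  moreover have "eventually (\<lambda>s. s > 0) (nhds t)" using 3 using eventually_nhds_in_open[of "{0<..}" t] by (auto elim: eventually_mono)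
  ultimately show ?thesis
   by (subst DERIV_cong_ev[OF refl _ refl, of _ ?f]) (auto simp: flat_exp_deriv_def elim: eventually_mono)
 next
  case 2
  \<comment> \<open>The substitution s = 1/h turns flatness at 0 into the decay of a polynomial
    against the exponential at infinity.\<close>
  have "((\<lambda>h. flat_exp_deriv k h / h) \<longlongrightarrow> 0) (at_right 0)"
  proof -
   have "((\<lambda>s. poly ([:0, 1:] * flat_exp_poly k) s / exp s) \<longlongrightarrow> 0) at_top"
    by (rule poly_div_exp_tendsto_0)
   then have "((\<lambda>h. poly ([:0, 1:] * flat_exp_poly k) (inverse h) / exp (inverse h)) \<longlongrightarrow> 0) (at_right 0)"
    using filterlim_compose[OF _ filterlim_inverse_at_top_right] by blast
   moreover have "eventually (\<lambda>h. poly ([:0, 1:] * flat_exp_poly k) (inverse h) / exp (inverse h) = flat_exp_deriv k h / h) (at_right 0)"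
    by (rule eventually_at_rightI[of 0 1]) (auto simp: flat_exp_deriv_def exp_minus field_simps)
   ultimately show ?thesis by (rule Lim_transform_eventually)
  qed
  moreover have "((\<lambda>h. flat_exp_deriv k h / h) \<longlongrightarrow> 0) (at_left 0)"
   by (rule tendsto_eventually) (auto simp: flat_exp_deriv_def eventually_at_filter)
  ultimately have "((\<lambda>h. flat_exp_deriv k h / h) \<longlongrightarrow> 0) (at 0)"
   by (simp add: filterlim_split_at)
  then show ?thesis using 2 by (simp add: DERIV_def flat_exp_deriv_def)
 qed
qed

lemma flat_exp_bounds: "0 \<le> flat_exp t" "flat_exp t \<le> 1" "flat_exp t = 0 \<longleftrightarrow> t \<le> 0"
 by (auto simp: flat_exp_def)

lemma flat_exp_tendsto:
 assumes "0 < t"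
 shows "(\<lambda>n. flat_exp (real n * t)) \<longlonglongrightarrow> 1"
proof -
 have "(\<lambda>n. exp (- (inverse (real n) * (1 / t)))) \<longlonglongrightarrow> exp (- (0 * (1 / t)))"
  by (intro tendsto_intros lim_inverse_n)
 moreover have "eventually (\<lambda>n. exp (- (inverse (real n) * (1 / t))) = flat_exp (real n * t)) sequentially"
  by (rule eventually_sequentiallyI[of 1]) (use assms in \<open>auto simp: flat_exp_def field_simps\<close>)
 ultimately show ?thesis using Lim_transform_eventually by fastforce
qed

text \<open>The factor \<open>n\<close> steepens the edges, so that these functions converge to the
  indicator of the open box while vanishing outside it.\<close>

definition box_bump :: "'a::euclidean_space \<Rightarrow> 'a \<Rightarrow> nat \<Rightarrow> 'a \<Rightarrow> real" where
 "box_bump l u n x =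
   (\<Prod>b\<in>Basis. flat_exp (real n * (x \<bullet> b - l \<bullet> b)) * flat_exp (real n * (u \<bullet> b - x \<bullet> b)))"

lemma box_bump_bounds: "0 \<le> box_bump l u n x" "box_bump l u n x \<le> 1"
 unfolding box_bump_def
 by (auto intro!: prod_nonneg prod_le_1 mult_le_one simp: flat_exp_bounds)

lemma box_bump_eq_0: "x \<notin> box l u \<Longrightarrow> box_bump l u n x = 0"
proof -
 assume "x \<notin> box l u"
 then obtain b where b: "b \<in> Basis" "x \<bullet> b - l \<bullet> b \<le> 0 \<or> u \<bullet> b - x \<bullet> b \<le> 0"
  by (auto simp: mem_box not_less)
 then have "flat_exp (real n * (x \<bullet> b - l \<bullet> b)) * flat_exp (real n * (u \<bullet> b - x \<bullet> b)) = 0"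
  by (auto simp: flat_exp_bounds mult_nonneg_nonpos)
 then show "box_bump l u n x = 0"
  unfolding box_bump_def using b(1) by (intro prod_zero) auto
qed

lemma box_bump_pos: "x \<in> box l u \<Longrightarrow> 0 < n \<Longrightarrow> 0 < box_bump l u n x"
 unfolding box_bump_def mem_box
 by (intro prod_pos) (auto simp: flat_exp_def)

lemma box_bump_tendsto: "(\<lambda>n. box_bump l u n x) \<longlonglongrightarrow> indicator (box l u) x"
proof (cases "x \<in> box l u")
 case True
 have "(\<lambda>n. box_bump l u n x) \<longlonglongrightarrow> (\<Prod>b\<in>(Basis :: 'a set). 1 * 1)"
  unfolding box_bump_def
  by (intro tendsto_prod tendsto_mult flat_exp_tendsto) (use True in \<open>auto simp: mem_box\<close>)
 then show ?thesis using True by simp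
qed (simp add: box_bump_eq_0)

lemma box_bump_test: "box_bump l u n \<in> test_functions"
proof -
 have "continuously_differentiable k (box_bump l u n)" for k
 proof -
  have eq: "box_bump l u n = (\<lambda>x. \<Prod>b\<in>Basis. flat_exp_deriv 0 (x \<bullet> (real n *\<^sub>R b) + - real n * (l \<bullet> b)) *
    flat_exp_deriv 0 (x \<bullet> (- real n *\<^sub>R b) + real n * (u \<bullet> b)))"
   by (rule ext) (simp add: box_bump_def flat_exp_deriv_0 algebra_simps)
  show ?thesis unfolding eq
   by (intro continuously_differentiable_prod continuously_differentiable_mult
     continuously_differentiable_affine_compose flat_exp_has_deriv) auto
 qed
 moreover have "compact (closure {x. box_bump l u n x \<noteq> 0})"
 proof -
  have "{x. box_bump l u n x \<noteq> 0} \<subseteq> cbox l u"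
   using box_bump_eq_0 box_subset_cbox by blast
  then show ?thesis by (metis bounded_cbox bounded_subset compact_closure)
 qed
 ultimately show ?thesis by (simp add: test_functions_def)
qed

lemma test_differentiable:
 assumes "\<phi> \<in> test_functions"
 shows "\<phi> differentiable (at x)" "continuous_on UNIV \<phi>"
  "continuous_on UNIV (\<lambda>x. deriv_at \<phi> x b)"
proof -
 have c: "continuously_differentiable k \<phi>" for k using assms by (simp add: test_functions_def)
 show "\<phi> differentiable (at x)" using c[of 1] by simp
 show "continuous_on UNIV \<phi>" using c[of 0] by simp
 have d: "(\<phi> has_derivative deriv_at \<phi> x) (at x)" for x
  using c[of 1] by (simp add: frechet_derivative_works)
 \<comment> \<open>\<open>continuously_differentiable\<close> speaks of basis directions; the other
   directions follow by linearity of the derivative.\<close>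
 have "deriv_at \<phi> x b = (\<Sum>i\<in>Basis. (b \<bullet> i) * deriv_at \<phi> x i)" for x
 proof -
  have l: "linear (deriv_at \<phi> x)" by (rule has_derivative_linear[OF d])
  have "deriv_at \<phi> x b = deriv_at \<phi> x (\<Sum>i\<in>Basis. (b \<bullet> i) *\<^sub>R i)"
   by (simp add: euclidean_representation)
  also have "\<dots> = (\<Sum>i\<in>Basis. (b \<bullet> i) * deriv_at \<phi> x i)"
   by (simp add: linear_sum[OF l] linear_cmul[OF l])
  finally show ?thesis .
 qed
 moreover have "continuous_on UNIV (\<lambda>x. deriv_at \<phi> x i)" if "i \<in> Basis" for i
  using c[of 1] that by simp
 ultimately show "continuous_on UNIV (\<lambda>x. deriv_at \<phi> x b)"
  by (simp add: continuous_on_sum continuous_on_mult_left)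
qed

lemma test_support:
 assumes "\<phi> \<in> test_functions"
 obtains R where "0 < R" "\<And>x. R \<le> norm x \<Longrightarrow> \<phi> x = 0"
  "\<And>x b. R \<le> norm x \<Longrightarrow> deriv_at \<phi> x b = 0"
proof -
 have "bounded (closure {x. \<phi> x \<noteq> 0})" using assms by (simp add: test_functions_def compact_imp_bounded)
 then obtain R where R: "0 < R" "\<And>x. x \<in> closure {x. \<phi> x \<noteq> 0} \<Longrightarrow> norm x \<le> R"
  by (auto simp: bounded_pos)
 have z: "\<phi> x = 0" if "R < norm x" for x
  using R(2)[of x] that closure_subset[of "{x. \<phi> x \<noteq> 0}"] by force
 have "deriv_at \<phi> x b = 0" if "R < norm x" for x b
 proof -
  have "open {x::'a. R < norm x}" by (intro open_Collect_less continuous_intros)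
  then have "(\<phi> has_derivative (\<lambda>h. 0)) (at x)"
   by (rule has_derivative_transform_within_open[OF has_derivative_const[of 0]]) (use that z in auto)
  from frechet_derivative_at[OF this] show ?thesis by metis
 qed
 then show ?thesis using z R(1) by (intro that[of "R + 1"]) auto
qed

lemma test_bounded:
 assumes "\<phi> \<in> test_functions"
 obtains C where "0 < C" "\<And>x. \<bar>\<phi> x\<bar> \<le> C" "\<And>x. \<bar>deriv_at \<phi> x b\<bar> \<le> C"
proof -
 obtain R where R: "0 < R" "\<And>x. R \<le> norm x \<Longrightarrow> \<phi> x = 0"
  "\<And>x b. R \<le> norm x \<Longrightarrow> deriv_at \<phi> x b = 0"
  by (rule test_support[OF assms]) blast
 have bd: "\<exists>C. \<forall>x. \<bar>f x\<bar> \<le> C" if "continuous_on UNIV f" "\<And>x. R \<le> norm x \<Longrightarrow> f x = 0" for f :: "'a \<Rightarrow> real"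
 proof -
  have "compact (f ` cball 0 R)"
   using that(1) by (intro compact_continuous_image) (auto intro: continuous_on_subset)
  then have "bounded (f ` cball 0 R)" by (rule compact_imp_bounded)
  then obtain C where "\<forall>z\<in>f ` cball 0 R. norm z \<le> C" unfolding bounded_iff by blast
  then have C: "\<bar>f x\<bar> \<le> C" if "x \<in> cball 0 R" for x using that by (simp del: mem_cball)
  have "\<bar>f x\<bar> \<le> max C 0" for x
   using C[of x] that(2)[of x] by (cases "norm x \<le> R") auto
  then show ?thesis by blast
 qed
 obtain C1 where C1: "\<And>x. \<bar>\<phi> x\<bar> \<le> C1" using bd[OF test_differentiable(2)[OF assms]] R by blast
 obtain C2 where C2: "\<And>x. \<bar>deriv_at \<phi> x b\<bar> \<le> C2"
  using bd[OF test_differentiable(3)[OF assms]] R by blast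
 have "\<bar>\<phi> x\<bar> \<le> max 1 (max C1 C2)" "\<bar>deriv_at \<phi> x b\<bar> \<le> max 1 (max C1 C2)" for x
  using C1[of x] C2[of x] by auto
 then show ?thesis by (intro that[of "max 1 (max C1 C2)"]) auto
qed

section \<open>Hilbert spaces\<close>

lemma minimizing_Cauchy:
 fixes x :: "nat \<Rightarrow> 'h::real_inner"
 assumes "\<And>n m. (norm (x n - x m))\<^sup>2 \<le> e n + e m" "e \<longlonglongrightarrow> 0"
 shows "Cauchy x"
proof (rule CauchyI)
 fix r :: real assume r: "0 < r"
 obtain N where N: "\<And>n. n \<ge> N \<Longrightarrow> norm (e n - 0) < r\<^sup>2 / 2"
  using LIMSEQ_D[OF assms(2), of "r\<^sup>2 / 2"] r by auto
 have "norm (x m - x n) < r" if "m \<ge> N" "n \<ge> N" for m n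
 proof -
  have "(norm (x m - x n))\<^sup>2 < r\<^sup>2"
   using assms(1)[of m n] N[OF that(1)] N[OF that(2)] by (auto simp: abs_if split: if_splits)
  then show ?thesis using r power_less_imp_less_base by fastforce
 qed
 then show "\<exists>N. \<forall>m\<ge>N. \<forall>n\<ge>N. norm (x m - x n) < r" by blast
qed

lemma parallelogram:
 fixes a b :: "'h::real_inner"
 shows "(norm (a - b))\<^sup>2 = 2 * (norm a)\<^sup>2 + 2 * (norm b)\<^sup>2 - 4 * (norm ((1/2) *\<^sub>R (a + b)))\<^sup>2"
 by (simp add: power2_norm_eq_inner inner_simps inner_commute field_simps)

text \<open>Elements of almost minimal norm in the convex hulls of the tails form a Cauchy sequence,
 by the parallelogram law.\<close>

lemma bounded_convex_hull_limit:
 fixes x :: "nat \<Rightarrow> 'h::{real_inner,complete_space}"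
 assumes C: "\<And>n. norm (x n) \<le> C"
 obtains u y where "\<And>n. y n \<in> convex hull (x ` {n..})" "y \<longlonglongrightarrow> u"
proof -
 let ?K = "\<lambda>n. convex hull (x ` {n..})"
 define d where "d n = (INF z\<in>?K n. (norm z)\<^sup>2)" for n
 have ne: "x n \<in> ?K n" for n by (intro hull_inc) auto
 have bdd: "bdd_below ((\<lambda>z. (norm z)\<^sup>2) ` A)" for A :: "'h set" by (intro bdd_belowI[of _ 0]) auto
 have sub: "?K m \<subseteq> ?K n" if "n \<le> m" for n m by (intro hull_mono) (use that in auto)
 have dle: "d n \<le> (norm z)\<^sup>2" if "z \<in> ?K n" for z n unfolding d_def by (rule cINF_lower[OF bdd that])
 have mono: "incseq d"
 proof (rule incseq_SucI)
  show "d n \<le> d (Suc n)" for n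
   unfolding d_def by (rule cINF_superset_mono[OF _ bdd sub]) (use ne in auto)
 qed
 have ub: "d n \<le> C\<^sup>2" for n
 proof -
  have "d n \<le> (norm (x n))\<^sup>2" by (rule dle[OF ne])
  also have "\<dots> \<le> C\<^sup>2" by (rule power_mono[OF C]) simp
  finally show ?thesis .
 qed
 obtain L where L: "d \<longlonglongrightarrow> L" "\<And>n. d n \<le> L"
  using incseq_convergent[OF mono, of "C\<^sup>2"] ub by blast
 have "\<exists>z\<in>?K n. (norm z)\<^sup>2 < d n + inverse (Suc n)" for n
  using cINF_less_iff[of "?K n" "\<lambda>z. (norm z)\<^sup>2" "d n + inverse (Suc n)"] ne[of n] bdd
  by (auto simp: d_def)
 then obtain y where y: "\<And>n. y n \<in> ?K n" "\<And>n. (norm (y n))\<^sup>2 < d n + inverse (Suc n)" by metis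
 define e where "e n = 4 * (L - d n) + 2 * inverse (Suc n)" for n
 have key: "(norm (y n - y m))\<^sup>2 \<le> e n + e m" if "n \<le> m" for n m
 proof -
  have "(1/2) *\<^sub>R (y n + y m) \<in> ?K n"
   using convexD[OF convex_convex_hull y(1)[of n], of "y m" "1/2" "1/2"] sub[OF that] y(1)[of m]
   by (auto simp: scaleR_add_right)
  from dle[OF this] have "d n \<le> (norm ((1/2) *\<^sub>R (y n + y m)))\<^sup>2" .
  moreover have "2 * a + 2 * b - 4 * c \<le> 4 * (l - p) + 2 * i + (4 * (l - q) + 2 * j)"
   if "p \<le> c" "a < p + i" "b < q + j" "q \<le> l" "p \<le> l" for a b c p q i j l :: real
   using that by argo
  ultimately show ?thesis
   unfolding parallelogram[of "y n"] e_def using y(2)[of n] y(2)[of m] L(2)[of m] L(2)[of n] by blast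
 qed
 have "Cauchy y"
 proof (rule minimizing_Cauchy)
  show "(norm (y n - y m))\<^sup>2 \<le> e n + e m" for n m
   using key[of n m] key[of m n] by (cases "n \<le> m") (simp_all add: norm_minus_commute add.commute)
  have "e \<longlonglongrightarrow> 4 * (L - L) + 2 * 0"
   unfolding e_def by (intro tendsto_intros L(1) LIMSEQ_inverse_real_of_nat)
  then show "e \<longlonglongrightarrow> 0" by simp
 qed
 then obtain u where "y \<longlonglongrightarrow> u" using Cauchy_convergent convergentD by blast
 with y(1) show ?thesis by (rule that)
qed

lemma convex_hull_le:
 fixes L :: "'h::real_vector \<Rightarrow> real"
 assumes "linear L" "\<And>z. z \<in> S \<Longrightarrow> L z \<le> c" "u \<in> convex hull S"
 shows "L u \<le> c"
proof -
 have "convex {z. L z \<le> c}"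
  using convex_linear_vimage[OF assms(1), of "{..c}"] by (simp add: vimage_def)
 then have "convex hull S \<subseteq> {z. L z \<le> c}" using assms(2) by (intro hull_minimal) auto
 then show ?thesis using assms(3) by auto
qed

text \<open>A bound for \<open>L\<close> on a tail of the sequence passes to the convex hull of that
  tail, so convex combinations of later and later tails keep the limit of a functional.\<close>

lemma hull_limit_bounded_linear:
 fixes L :: "'h::real_normed_vector \<Rightarrow> real"
 assumes L: "bounded_linear L" and y: "\<And>n. y n \<in> convex hull (x ` {n..})" "y \<longlonglongrightarrow> u"
  and lim: "(\<lambda>n. L (x n)) \<longlonglongrightarrow> l"
 shows "L u = l"
proof -
 have Ly: "(\<lambda>n. L (y n)) \<longlonglongrightarrow> L u" by (rule bounded_linear.tendsto[OF L y(2)])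
 have "(\<lambda>n. L (y n)) \<longlonglongrightarrow> l"
 proof (rule LIMSEQ_I)
  fix r :: real assume "0 < r"
  then obtain N where N: "\<And>n. n \<ge> N \<Longrightarrow> norm (L (x n) - l) < r / 2"
   using LIMSEQ_D[OF lim, of "r / 2"] by auto
  have "norm (L (y n) - l) < r" if "n \<ge> N" for n
  proof -
   have b: "L z \<le> l + r / 2" "- L z \<le> - l + r / 2" if "z \<in> x ` {n..}" for z
   proof -
    from that obtain m where "m \<ge> n" "z = x m" by auto
    with \<open>n \<ge> N\<close> have "\<bar>L z - l\<bar> < r / 2" using N[of m] by simp
    then show "L z \<le> l + r / 2" "- L z \<le> - l + r / 2" by linarith+
   qed
   have "L (y n) \<le> l + r / 2"
    by (rule convex_hull_le[OF bounded_linear.linear[OF L] _ y(1)[of n]]) (rule b)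
   moreover have "- L (y n) \<le> - l + r / 2"
    by (rule convex_hull_le[OF linear_compose_neg[OF bounded_linear.linear[OF L]] _ y(1)[of n]]) (rule b)
   ultimately show ?thesis using \<open>0 < r\<close> by (simp add: abs_le_iff abs_less_iff)
  qed
  then show "\<exists>no. \<forall>n\<ge>no. norm (L (y n) - l) < r" by blast
 qed
 then show ?thesis using Ly LIMSEQ_unique by blast
qed

lemma convex_hull_norm_le:
 fixes u :: "'h::real_normed_vector"
 assumes "\<And>z. z \<in> S \<Longrightarrow> norm z \<le> c" "u \<in> convex hull S"
 shows "norm u \<le> c"
proof -
 have "convex hull S \<subseteq> cball 0 c" using assms(1) by (intro hull_minimal) auto
 then show ?thesis using assms(2) by auto
qed

text \<open>A diagonal subsequence makes the inner products with all members of the sequence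
  converge, and convex combinations of its tails converge in norm to some \<open>u\<close>. If
  convergence against some \<open>w\<close> failed, a further subsequence would yield
  \<open>u'\<close> with the same products with every \<open>x j\<close>. Both limits are
  approximated by combinations of the \<open>x j\<close>, so \<open>u - u'\<close> is orthogonal to
  itself.\<close>

lemma bounded_weakly_convergent_subseq:
 fixes x :: "nat \<Rightarrow> 'h::{real_inner,complete_space}"
 assumes C: "\<And>n. norm (x n) \<le> C"
 obtains u r where "strict_mono r" "\<And>w. (\<lambda>n. x (r n) \<bullet> w) \<longlonglongrightarrow> u \<bullet> w"
proof -
 have "\<exists>r. strict_mono r \<and> (\<forall>j. convergent (\<lambda>n. x (r n) \<bullet> x j))"
 proof -
  interpret subseqs "\<lambda>j s. convergent (\<lambda>n. x (s n) \<bullet> x j)"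
  proof
   fix n :: nat and s :: "nat \<Rightarrow> nat" assume "strict_mono s"
   have "norm (x k \<bullet> x n) \<le> C * norm (x n)" for k
    using Cauchy_Schwarz_ineq2[of "x k" "x n"] mult_right_mono[OF C[of k] norm_ge_zero[of "x n"]] by simp
   then have "bounded (range (\<lambda>k. x (s k) \<bullet> x n))" by (intro boundedI) blast
   then obtain l r where "strict_mono r" "((\<lambda>k. x (s k) \<bullet> x n) \<circ> r) \<longlonglongrightarrow> l"
    using bounded_imp_convergent_subsequence by blast
   then show "\<exists>r'. strict_mono r' \<and> convergent (\<lambda>k. x ((s \<circ> r') k) \<bullet> x n)"
    by (intro exI[of _ r]) (auto simp: o_def convergent_def)
  qed
  have "convergent (\<lambda>n. x (diagseq n) \<bullet> x j)" for j
  proof -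
   have "convergent (\<lambda>n. x ((diagseq \<circ> (+) (Suc j)) n) \<bullet> x j)"
   proof (rule diagseq_holds)
    fix m s t and r :: "nat \<Rightarrow> nat"
    assume "strict_mono r" "convergent (\<lambda>n. x (s n) \<bullet> x m)"
    then show "convergent (\<lambda>n. x ((s \<circ> r) n) \<bullet> x m)"
     using convergent_subseq_convergent[of "\<lambda>n. x (s n) \<bullet> x m" r] by (simp add: o_def)
   qed
   then have "convergent (\<lambda>n. x (diagseq (n + Suc j)) \<bullet> x j)" by (simp add: o_def add.commute)
   then show ?thesis using convergent_ignore_initial_segment[of "\<lambda>n. x (diagseq n) \<bullet> x j" "Suc j"] by simp
  qed
  then show ?thesis using subseq_diagseq by blast
 qed
 then obtain r where r: "strict_mono r" "\<And>j. convergent (\<lambda>n. x (r n) \<bullet> x j)" by blast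
 then obtain l where l: "\<And>j. (\<lambda>n. x (r n) \<bullet> x j) \<longlonglongrightarrow> l j" unfolding convergent_def by metis
 have lim: "\<exists>u. (\<forall>j. u \<bullet> x j = l j) \<and> (\<forall>w c. (\<forall>n. x (r (s n)) \<bullet> w \<le> c) \<longrightarrow> u \<bullet> w \<le> c)"
  if s: "strict_mono s" for s :: "nat \<Rightarrow> nat"
 proof -
  obtain u and y :: "nat \<Rightarrow> 'h" where u: "\<And>n. y n \<in> convex hull ((\<lambda>n. x (r (s n))) ` {n..})" "y \<longlonglongrightarrow> u"
   by (rule bounded_convex_hull_limit[of "\<lambda>n. x (r (s n))" C, OF C]) blast
  have "u \<bullet> x j = l j" for j
   by (rule hull_limit_bounded_linear[OF bounded_linear_inner_left u])
     (use LIMSEQ_subseq_LIMSEQ[OF l[of j] s] in \<open>simp add: o_def\<close>)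
  moreover have "u \<bullet> w \<le> c" if "\<And>n. x (r (s n)) \<bullet> w \<le> c" for w c
  proof -
   have lin: "linear (\<lambda>z. z \<bullet> w)" by (rule bounded_linear.linear[OF bounded_linear_inner_left])
   have "y n \<bullet> w \<le> c" for n
    by (rule convex_hull_le[OF lin _ u(1)[of n]]) (use that in auto)
   moreover have "(\<lambda>n. y n \<bullet> w) \<longlonglongrightarrow> u \<bullet> w" using u(2) by (intro tendsto_intros)
   ultimately show ?thesis by (intro LIMSEQ_le_const2[of "\<lambda>n. y n \<bullet> w"]) auto
  qed
  ultimately show ?thesis by blast
 qed
 obtain u where u: "\<And>j. u \<bullet> x j = l j" "\<And>w c. (\<And>n. x (r n) \<bullet> w \<le> c) \<Longrightarrow> u \<bullet> w \<le> c"
  using lim[of id] by (auto simp: strict_mono_id)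
 \<comment> \<open>The bound is one-sided, and it is applied below to \<open>w\<close> and to
   \<open>- w\<close>.\<close>
 have one: "\<exists>N. \<forall>n\<ge>N. x (r n) \<bullet> w > u \<bullet> w - e" if "e > 0" for w e
 proof (rule ccontr)
  assume "\<not> ?thesis"
  then have "\<exists>\<^sub>\<infinity>n. x (r n) \<bullet> w \<le> u \<bullet> w - e"
   unfolding INFM_nat_le by (auto simp: not_less)
  then have inf: "infinite {n. x (r n) \<bullet> w \<le> u \<bullet> w - e}" by (simp add: INFM_iff_infinite)
  obtain s :: "nat \<Rightarrow> nat" where s: "strict_mono s" "\<And>n. x (r (s n)) \<bullet> w \<le> u \<bullet> w - e"
   using infinite_enumerate[OF inf] unfolding mem_Collect_eq by blast
  obtain u' where u': "\<And>j. u' \<bullet> x j = l j" "\<And>w c. (\<And>n. x (r (s n)) \<bullet> w \<le> c) \<Longrightarrow> u' \<bullet> w \<le> c"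
   using lim[OF s(1)] by auto
  have z: "x j \<bullet> (u' - u) = 0 \<and> x j \<bullet> (u - u') = 0" for j
   using u(1)[of j] u'(1)[of j] by (simp add: inner_diff_right inner_commute)
  have "u \<bullet> (u - u') \<le> 0" "u' \<bullet> (u' - u) \<le> 0"
   using u(2)[of "u - u'" 0] u'(2)[of "u' - u" 0] z by auto
  then have "(u' - u) \<bullet> (u' - u) \<le> 0" by (simp add: inner_diff_left inner_diff_right)
  then have "u' - u = 0" by (simp flip: power2_norm_eq_inner)
  then show False using u'(2)[of w "u \<bullet> w - e"] s(2) that by simp
 qed
 have "(\<lambda>n. x (r n) \<bullet> w) \<longlonglongrightarrow> u \<bullet> w" for w
 proof (rule LIMSEQ_I)
  fix e :: real assume e: "0 < e"
  obtain N1 where N1: "\<And>n. n \<ge> N1 \<Longrightarrow> x (r n) \<bullet> w > u \<bullet> w - e" using one[OF e] by blast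
  obtain N2 where N2: "\<And>n. n \<ge> N2 \<Longrightarrow> x (r n) \<bullet> (- w) > u \<bullet> (- w) - e" using one[OF e] by blast
  have "norm (x (r n) \<bullet> w - u \<bullet> w) < e" if "n \<ge> max N1 N2" for n
   using N1[of n] N2[of n] that by (auto simp: abs_less_iff)
  then show "\<exists>no. \<forall>n\<ge>no. norm (x (r n) \<bullet> w - u \<bullet> w) < e" by blast
 qed
 with r(1) show ?thesis by (rule that)
qed

text \<open>The representing vector is the minimiser of |z|^2 - 2 L z. A minimising sequence is
  Cauchy by the parallelogram law, and the first variation at the minimiser is the claim.\<close>

lemma Riesz_representation:
 fixes L :: "'h::{real_inner,complete_space} \<Rightarrow> real"
 assumes L: "bounded_linear L"
 shows "\<exists>u. \<forall>z. L z = u \<bullet> z"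
proof -
 obtain K where K: "K > 0" "\<And>z. \<bar>L z\<bar> \<le> norm z * K"
  using bounded_linear.pos_bounded[OF L] by auto
 define \<phi> where "\<phi> z = (norm z)\<^sup>2 - 2 * L z" for z
 have low: "- K\<^sup>2 \<le> \<phi> z" for z
 proof -
  have "0 \<le> (norm z - K)\<^sup>2" by simp
  then show ?thesis using K(2)[of z] by (simp add: \<phi>_def power2_eq_square algebra_simps abs_le_iff)
 qed
 define d where "d = (INF z. \<phi> z)"
 have bdd: "bdd_below (range \<phi>)" using low by (intro bdd_belowI[of _ "- K\<^sup>2"]) auto
 have dle: "d \<le> \<phi> z" for z unfolding d_def by (rule cINF_lower[OF bdd]) simp
 have "\<exists>z. \<phi> z < d + inverse (Suc n)" for n
  using cINF_less_iff[of UNIV \<phi> "d + inverse (Suc n)"] bdd by (auto simp: d_def)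
 then obtain y where y: "\<And>n. \<phi> (y n) < d + inverse (Suc n)" by metis
 have lin: "L (a + b) = L a + L b" "L (c *\<^sub>R a) = c * L a" for a b c
  using bounded_linear.linear[OF L] by (simp_all add: linear_add linear_cmul)
 have "Cauchy y"
 proof (rule minimizing_Cauchy[where e = "\<lambda>n. 2 * inverse (Suc n)"])
  fix n m
  have "(norm (y n - y m))\<^sup>2 = 2 * \<phi> (y n) + 2 * \<phi> (y m) - 4 * \<phi> ((1/2) *\<^sub>R (y n + y m))"
   unfolding parallelogram[of "y n"] \<phi>_def lin by (simp add: field_simps)
  also have "\<dots> \<le> 2 * (d + inverse (Suc n)) + 2 * (d + inverse (Suc m)) - 4 * d"
   using y[of n] y[of m] dle[of "(1/2) *\<^sub>R (y n + y m)"] by argo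
  finally show "(norm (y n - y m))\<^sup>2 \<le> 2 * inverse (Suc n) + 2 * inverse (Suc m)" by argo
 next
  have "(\<lambda>n. 2 * inverse (Suc n)) \<longlonglongrightarrow> 2 * (0::real)"
   by (intro tendsto_intros LIMSEQ_inverse_real_of_nat)
  then show "(\<lambda>n. 2 * inverse (real (Suc n))) \<longlonglongrightarrow> 0" by simp
 qed
 then obtain u where u: "y \<longlonglongrightarrow> u" using Cauchy_convergent convergentD by blast
 have "(\<lambda>n. \<phi> (y n)) \<longlonglongrightarrow> \<phi> u"
  unfolding \<phi>_def using u by (intro tendsto_intros bounded_linear.tendsto[OF L])
 moreover have "(\<lambda>n. \<phi> (y n)) \<longlonglongrightarrow> d"
 proof (rule tendsto_sandwich[of "\<lambda>_. d" _ _ "\<lambda>n. d + inverse (Suc n)"])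
  show "(\<lambda>n. d + inverse (real (Suc n))) \<longlonglongrightarrow> d"
   using tendsto_add[OF tendsto_const LIMSEQ_inverse_real_of_nat, of d] by simp
 qed (use dle y less_imp_le in \<open>auto intro!: always_eventually\<close>)
 ultimately have min: "\<phi> u \<le> \<phi> z" for z using dle LIMSEQ_unique by metis
 have "L z = u \<bullet> z" for z
 proof (rule ccontr)
  assume ne: "L z \<noteq> u \<bullet> z"
  define q where "q = L z - u \<bullet> z"
  have z: "z \<noteq> 0" using ne lin(2)[of 0 z] by auto
  \<comment> \<open>This value minimises the quadratic polynomial
    \<open>\<phi> (u + t *\<^sub>R z)\<close> in \<open>t\<close>.\<close>
  define t where "t = q / (norm z)\<^sup>2"
  have "\<phi> (u + t *\<^sub>R z) = \<phi> u - 2 * t * q + t\<^sup>2 * (norm z)\<^sup>2"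
   unfolding \<phi>_def lin q_def
   by (simp add: power2_norm_eq_inner inner_simps inner_commute[of z u]) (simp add: algebra_simps power2_eq_square)
  also have "\<dots> = \<phi> u - q\<^sup>2 / (norm z)\<^sup>2"
   using z by (simp add: t_def power2_eq_square field_simps)
  also have "\<dots> < \<phi> u" using z ne by (simp add: q_def)
  finally show False using min[of "u + t *\<^sub>R z"] by simp
 qed
 then show ?thesis by blast
qed

section \<open>The Hilbert space $L^2$\<close>

abbreviation nn_int :: "('a::euclidean_space \<Rightarrow> real) \<Rightarrow> ennreal" where
 "nn_int f \<equiv> \<integral>\<^sup>+x. ennreal (f x) \<partial>lborel"

lemma sq_intD:
 assumes "f \<in> square_integrable"
 shows "f \<in> borel_measurable lborel" "f \<in> borel_measurable borel"
  "integrable lborel (\<lambda>x. (norm (f x))\<^sup>2)"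
 using assms by (simp_all add: square_integrable_def)

lemma sq_int_bound:
 fixes f :: "'a::euclidean_space \<Rightarrow> 'b::euclidean_space"
 assumes "f \<in> borel_measurable lborel" "integrable lborel g" "AE x in lborel. (norm (f x))\<^sup>2 \<le> g x"
 shows "f \<in> square_integrable"
 unfolding square_integrable_def
proof (intro CollectI conjI assms(1))
 show "integrable lborel (\<lambda>x. (norm (f x))\<^sup>2)"
  by (rule Bochner_Integration.integrable_bound[OF assms(2)])
    (use assms(1,3) in \<open>auto elim!: eventually_mono\<close>)
qed

lemma sq_int_0: "(\<lambda>x. 0) \<in> square_integrable"
 by (simp add: square_integrable_def)

lemma sq_int_scaleR:
 "f \<in> square_integrable \<Longrightarrow> (\<lambda>x. c *\<^sub>R f x) \<in> square_integrable"
 by (auto simp: square_integrable_def power_mult_distrib)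

lemma sq_int_add:
 assumes "f \<in> square_integrable" "g \<in> square_integrable"
 shows "(\<lambda>x. f x + g x) \<in> square_integrable"
proof (rule sq_int_bound)
 show "integrable lborel (\<lambda>x. 2 * (norm (f x))\<^sup>2 + 2 * (norm (g x))\<^sup>2)"
  using assms by (simp add: square_integrable_def)
 have "(norm (a + b))\<^sup>2 \<le> 2 * (norm a)\<^sup>2 + 2 * (norm b)\<^sup>2" for a b :: 'b
 proof -
  have "0 \<le> (norm (a - b))\<^sup>2" by simp
  then show ?thesis by (simp add: power2_norm_eq_inner inner_simps inner_commute)
 qed
 then show "AE x in lborel. (norm (f x + g x))\<^sup>2 \<le> 2 * (norm (f x))\<^sup>2 + 2 * (norm (g x))\<^sup>2" by simp
 show "(\<lambda>x. f x + g x) \<in> borel_measurable lborel"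
  using assms sq_intD(1) by (intro borel_measurable_add) auto
qed

lemma sq_int_minus:
 "f \<in> square_integrable \<Longrightarrow> (\<lambda>x. - f x) \<in> square_integrable"
 using sq_int_scaleR[of f "-1"] by simp

lemma sq_int_diff:
 assumes "f \<in> square_integrable" "g \<in> square_integrable"
 shows "(\<lambda>x. f x - g x) \<in> square_integrable"
 using sq_int_add[OF assms(1) sq_int_minus[OF assms(2)]] by simp

lemma integrable_inner:
 fixes f g :: "'a::euclidean_space \<Rightarrow> 'b::euclidean_space"
 assumes "f \<in> square_integrable" "g \<in> square_integrable"
 shows "integrable lborel (\<lambda>x. f x \<bullet> g x)"
proof (rule Bochner_Integration.integrable_bound)
 show "integrable lborel (\<lambda>x. (norm (f x))\<^sup>2 + (norm (g x))\<^sup>2)"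
  using assms by (simp add: square_integrable_def)
 show "(\<lambda>x. f x \<bullet> g x) \<in> borel_measurable lborel"
  using assms sq_intD(1) by (intro borel_measurable_inner) auto
 have "\<bar>a \<bullet> b\<bar> \<le> (norm a)\<^sup>2 + (norm b)\<^sup>2" for a b :: 'b
  using Cauchy_Schwarz_ineq2[of a b] sum_squares_bound[of "norm a" "norm b"]
   mult_nonneg_nonneg[of "norm a" "norm b"] by simp
 then show "AE x in lborel. norm (f x \<bullet> g x) \<le> norm ((norm (f x))\<^sup>2 + (norm (g x))\<^sup>2)" by simp
qed

lemma integrable_mult_sq_int:
 fixes f g :: "'a::euclidean_space \<Rightarrow> real"
 assumes "f \<in> square_integrable" "g \<in> square_integrable"
 shows "integrable lborel (\<lambda>x. f x * g x)"
 using integrable_inner[OF assms] by simp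

text \<open>Restricting the relation to square integrable functions makes it partial, so that its
  quotient is L^2 itself.\<close>

definition l2_rel :: "('a::euclidean_space \<Rightarrow> 'b::euclidean_space) \<Rightarrow> ('a \<Rightarrow> 'b) \<Rightarrow> bool" where
 "l2_rel f g \<longleftrightarrow> f \<in> square_integrable \<and> g \<in> square_integrable \<and> (AE x in lborel. f x = g x)"

lemma l2_rel_refl: "f \<in> square_integrable \<Longrightarrow> l2_rel f f"
 by (simp add: l2_rel_def)

lemma part_equivp_l2_rel: "part_equivp l2_rel"
proof (rule part_equivpI)
 show "\<exists>f. l2_rel f f" using sq_int_0 l2_rel_refl by blast
 show "symp l2_rel" by (auto simp: symp_def l2_rel_def elim: eventually_mono)
 show "transp l2_rel" by (auto simp: transp_def l2_rel_def elim: eventually_elim2)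
qed

quotient_type (overloaded) ('a, 'b) l2 = "'a::euclidean_space \<Rightarrow> 'b::euclidean_space" / partial: l2_rel
 by (rule part_equivp_l2_rel)

lemma l2_rel_integral:
 assumes "l2_rel f f'" "l2_rel g g'"
 shows "(LBINT x. f x \<bullet> g x) = (LBINT x. f' x \<bullet> g' x)"
proof (rule integral_cong_AE)
 show "AE x in lborel. f x \<bullet> g x = f' x \<bullet> g' x" using assms by (auto simp: l2_rel_def)
qed (use assms in \<open>auto simp: l2_rel_def square_integrable_def\<close>)

lemma inner_self_eq_0_iff_AE:
 fixes f :: "'a::euclidean_space \<Rightarrow> 'b::euclidean_space"
 assumes "f \<in> square_integrable"
 shows "(LBINT x. f x \<bullet> f x) = 0 \<longleftrightarrow> (AE x in lborel. f x = 0)"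
 using integral_nonneg_eq_0_iff_AE[of lborel "\<lambda>x. f x \<bullet> f x"] integrable_inner[OF assms assms]
 by simp

instantiation l2 :: (euclidean_space, euclidean_space) real_inner
begin

lift_definition zero_l2 :: "('a, 'b) l2" is "\<lambda>x. 0"
 by (simp add: l2_rel_def sq_int_0)

lift_definition plus_l2 :: "('a, 'b) l2 \<Rightarrow> ('a, 'b) l2 \<Rightarrow> ('a, 'b) l2" is "\<lambda>f g x. f x + g x"
 by (auto simp: l2_rel_def sq_int_add)

lift_definition minus_l2 :: "('a, 'b) l2 \<Rightarrow> ('a, 'b) l2 \<Rightarrow> ('a, 'b) l2" is "\<lambda>f g x. f x - g x"
 by (auto simp: l2_rel_def sq_int_diff)

lift_definition uminus_l2 :: "('a, 'b) l2 \<Rightarrow> ('a, 'b) l2" is "\<lambda>f x. - f x"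
 by (auto simp: l2_rel_def sq_int_minus)

lift_definition scaleR_l2 :: "real \<Rightarrow> ('a, 'b) l2 \<Rightarrow> ('a, 'b) l2" is "\<lambda>c f x. c *\<^sub>R f x"
 by (auto simp: l2_rel_def sq_int_scaleR)

lift_definition inner_l2 :: "('a, 'b) l2 \<Rightarrow> ('a, 'b) l2 \<Rightarrow> real" is "\<lambda>f g. \<integral>x. f x \<bullet> g x \<partial>lborel"
 by (rule l2_rel_integral)

definition norm_l2 :: "('a, 'b) l2 \<Rightarrow> real" where "norm_l2 f = sqrt (f \<bullet> f)"
definition dist_l2 :: "('a, 'b) l2 \<Rightarrow> ('a, 'b) l2 \<Rightarrow> real" where "dist_l2 f g = norm (f - g)"
definition sgn_l2 :: "('a, 'b) l2 \<Rightarrow> ('a, 'b) l2" where "sgn_l2 f = inverse (norm f) *\<^sub>R f"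
definition uniformity_l2 :: "(('a, 'b) l2 \<times> ('a, 'b) l2) filter" where
 "uniformity_l2 = (INF e\<in>{0<..}. principal {(x, y). dist x y < e})"
definition open_l2 :: "('a, 'b) l2 set \<Rightarrow> bool" where
 "open_l2 U \<longleftrightarrow> (\<forall>x\<in>U. eventually (\<lambda>(x', y). x' = x \<longrightarrow> y \<in> U) uniformity)"

instance
proof
 fix f g h :: "('a, 'b) l2" and a b :: real
 show "f + g + h = f + (g + h)"
  by transfer (auto simp: l2_rel_def sq_int_add ac_simps)
 show "f + g = g + f" by transfer (auto simp: l2_rel_def sq_int_add ac_simps)
 show "0 + f = f" by transfer (auto simp: l2_rel_def sq_int_add)
 show "- f + f = 0" by transfer (auto simp: l2_rel_def sq_int_0)
 show "f - g = f + - g" by transfer (auto simp: l2_rel_def sq_int_diff)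
 show "a *\<^sub>R (f + g) = a *\<^sub>R f + a *\<^sub>R g"
  by transfer (auto simp: l2_rel_def sq_int_add sq_int_scaleR scaleR_add_right)
 show "(a + b) *\<^sub>R f = a *\<^sub>R f + b *\<^sub>R f"
  by transfer (auto simp: l2_rel_def sq_int_add sq_int_scaleR scaleR_add_left)
 show "a *\<^sub>R b *\<^sub>R f = (a * b) *\<^sub>R f"
  by transfer (auto simp: l2_rel_def sq_int_scaleR)
 show "1 *\<^sub>R f = f" by transfer (auto simp: l2_rel_def)
 show "f \<bullet> g = g \<bullet> f" by transfer (simp add: inner_commute)
 show "(f + g) \<bullet> h = f \<bullet> h + g \<bullet> h"
  by transfer (simp add: l2_rel_def inner_add_left integrable_inner)
 show "(a *\<^sub>R f) \<bullet> g = a * (f \<bullet> g)"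
  by transfer simp
 show "0 \<le> f \<bullet> f" by transfer simp
 show "f \<bullet> f = 0 \<longleftrightarrow> f = 0"
  by transfer (simp add: l2_rel_def inner_self_eq_0_iff_AE sq_int_0)
 show "norm f = sqrt (f \<bullet> f)" by (rule norm_l2_def)
 show "dist f g = norm (f - g)" by (rule dist_l2_def)
 show "sgn f = inverse (norm f) *\<^sub>R f" by (rule sgn_l2_def)
 show "(uniformity :: (('a, 'b) l2 \<times> ('a, 'b) l2) filter) = (INF e\<in>{0<..}. principal {(x, y). dist x y < e})"
  by (rule uniformity_l2_def)
 show "open U \<longleftrightarrow> (\<forall>x\<in>U. eventually (\<lambda>(x', y). x' = x \<longrightarrow> y \<in> U) uniformity)" for U :: "('a, 'b) l2 set"
  by (rule open_l2_def)
qed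

end

definition l2_of :: "('a::euclidean_space \<Rightarrow> 'b::euclidean_space) \<Rightarrow> ('a, 'b) l2" where
 "l2_of = abs_l2"

definition l2_fun :: "('a::euclidean_space, 'b::euclidean_space) l2 \<Rightarrow> 'a \<Rightarrow> 'b" where
 "l2_fun = rep_l2"

lemma l2_fun_sq_int: "l2_fun h \<in> square_integrable"
 using Quotient_rep_reflp[OF Quotient_l2, of h] by (simp add: l2_fun_def l2_rel_def)

lemma l2_fun_measurable [measurable]: "l2_fun h \<in> borel_measurable borel"
 using sq_intD[OF l2_fun_sq_int[of h]] by simp

lemma l2_of_fun [simp]: "l2_of (l2_fun h) = h"
 unfolding l2_of_def l2_fun_def by (rule Quotient_abs_rep[OF Quotient_l2])

lemma l2_of_eq_iff:
 assumes "f \<in> square_integrable" "g \<in> square_integrable"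
 shows "l2_of f = l2_of g \<longleftrightarrow> (AE x in lborel. f x = g x)"
 using Quotient_rel[OF Quotient_l2, of f g] assms by (auto simp: l2_of_def l2_rel_def)

lemma l2_fun_of_AE:
 assumes "f \<in> square_integrable"
 shows "AE x in lborel. l2_fun (l2_of f) x = f x"
 using l2_of_eq_iff[OF l2_fun_sq_int assms, of "l2_of f"] by simp

lemma l2_eqI: "AE x in lborel. l2_fun f x = l2_fun g x \<Longrightarrow> f = g"
 using l2_of_eq_iff[OF l2_fun_sq_int l2_fun_sq_int, of f g] by simp

lemma l2_of_arith:
 assumes "f \<in> square_integrable" "g \<in> square_integrable"
 shows "l2_of f + l2_of g = l2_of (\<lambda>x. f x + g x)" "l2_of f - l2_of g = l2_of (\<lambda>x. f x - g x)"
  "c *\<^sub>R l2_of f = l2_of (\<lambda>x. c *\<^sub>R f x)"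
  "l2_of f \<bullet> l2_of g = (LBINT x. f x \<bullet> g x)"
proof -
 note f = l2_rel_refl[OF assms(1)] and g = l2_rel_refl[OF assms(2)]
 show "l2_of f + l2_of g = l2_of (\<lambda>x. f x + g x)" "l2_of f - l2_of g = l2_of (\<lambda>x. f x - g x)"
  "c *\<^sub>R l2_of f = l2_of (\<lambda>x. c *\<^sub>R f x)"
  "l2_of f \<bullet> l2_of g = (LBINT x. f x \<bullet> g x)"
  unfolding l2_of_def
  by (rule plus_l2.abs_eq[OF f g] minus_l2.abs_eq[OF f g] scaleR_l2.abs_eq[OF f] inner_l2.abs_eq[OF f g])+
qed

lemma l2_of_0: "l2_of (\<lambda>x. 0) = 0"
 unfolding l2_of_def zero_l2_def ..

lemma l2_fun_arith_AE:
 shows "AE x in lborel. l2_fun (f + g) x = l2_fun f x + l2_fun g x"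
  "AE x in lborel. l2_fun (f - g) x = l2_fun f x - l2_fun g x"
  "AE x in lborel. l2_fun (c *\<^sub>R f) x = c *\<^sub>R l2_fun f x"
 using l2_fun_of_AE[OF sq_int_add[OF l2_fun_sq_int[of f] l2_fun_sq_int[of g]]]
  l2_fun_of_AE[OF sq_int_diff[OF l2_fun_sq_int[of f] l2_fun_sq_int[of g]]]
  l2_fun_of_AE[OF sq_int_scaleR[OF l2_fun_sq_int[of f]], of c]
  l2_of_arith[OF l2_fun_sq_int[of f] l2_fun_sq_int[of g]]
 by simp_all

lemma l2_fun_0_AE: "AE x in lborel. l2_fun 0 x = 0"
 using l2_fun_of_AE[OF sq_int_0] by (simp add: l2_of_0)

lemma inner_l2_eq: "f \<bullet> g = (LBINT x. l2_fun f x \<bullet> l2_fun g x)"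
 using l2_of_arith(4)[OF l2_fun_sq_int l2_fun_sq_int, of f g] by simp

lemma norm_l2_eq: "(norm f)\<^sup>2 = (LBINT x. (norm (l2_fun f x))\<^sup>2)"
 by (simp add: power2_norm_eq_inner inner_l2_eq)

lemma norm_l2_of: "f \<in> square_integrable \<Longrightarrow> (norm (l2_of f))\<^sup>2 = (LBINT x. (norm (f x))\<^sup>2)"
 by (simp add: power2_norm_eq_inner l2_of_arith)

lemma nn_norm_l2_of:
 assumes "f \<in> square_integrable"
 shows "nn_int (\<lambda>x. (norm (f x))\<^sup>2) = ennreal ((norm (l2_of f))\<^sup>2)"
 unfolding norm_l2_of[OF assms]
 by (rule nn_integral_eq_integral) (use assms sq_intD in auto)

lemma sq_int_iff_nn:
 fixes f :: "'a::euclidean_space \<Rightarrow> 'b::euclidean_space"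
 assumes "f \<in> borel_measurable borel"
 shows "f \<in> square_integrable \<longleftrightarrow> (nn_int (\<lambda>x. (norm (f x))\<^sup>2)) < \<infinity>"
 using assms by (simp add: square_integrable_def integrable_iff_bounded)

lemma norm_l2_of_le_nn:
 assumes "f \<in> borel_measurable borel" "0 \<le> C" "nn_int (\<lambda>x. (norm (f x))\<^sup>2) \<le> ennreal (C\<^sup>2)"
 shows "f \<in> square_integrable" "norm (l2_of f) \<le> C"
proof -
 show f: "f \<in> square_integrable"
  using assms by (subst sq_int_iff_nn) (auto simp: top_unique less_top[symmetric])
 have "(norm (l2_of f))\<^sup>2 \<le> C\<^sup>2"
  using assms(3) unfolding nn_norm_l2_of[OF f] by simp
 then show "norm (l2_of f) \<le> C" using assms(2) power2_le_imp_le by blast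
qed

lemma l2_of_tendsto_dominated:
 fixes f :: "nat \<Rightarrow> 'a::euclidean_space \<Rightarrow> 'b::euclidean_space"
 assumes "\<And>n. f n \<in> borel_measurable borel" "h \<in> borel_measurable borel"
  and "AE x in lborel. (\<lambda>n. f n x) \<longlonglongrightarrow> h x"
  and w: "w \<in> square_integrable" and b: "\<And>n. AE x in lborel. norm (f n x) \<le> norm (w x)"
 shows "f n \<in> square_integrable" "h \<in> square_integrable" "(\<lambda>n. l2_of (f n)) \<longlonglongrightarrow> l2_of h"
proof -
 show f: "f n \<in> square_integrable" for n
  by (rule sq_int_bound[OF _ sq_intD(3)[OF w]])
    (use assms(1) b[of n] in \<open>auto elim!: eventually_mono simp: power_mono\<close>)
 have bh: "AE x in lborel. norm (h x) \<le> norm (w x)"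
 proof -
  have "AE x in lborel. \<forall>n. norm (f n x) \<le> norm (w x)" using b by (simp add: AE_all_countable)
  with assms(3) show ?thesis
  proof eventually_elim
   case (elim x)
   show ?case by (rule LIMSEQ_le_const2[OF tendsto_norm[OF elim(1)]]) (use elim(2) in auto)
  qed
 qed
 show h: "h \<in> square_integrable"
  by (rule sq_int_bound[OF _ sq_intD(3)[OF w]])
    (use assms(2) bh in \<open>auto elim!: eventually_mono simp: power_mono\<close>)
 have "(\<lambda>n. (LBINT x. (norm (f n x - h x))\<^sup>2)) \<longlonglongrightarrow> integral\<^sup>L (lborel :: 'a measure) (\<lambda>x. 0)"
 proof (rule integral_dominated_convergence[where w = "\<lambda>x. (2 * norm (w x))\<^sup>2"])
  show "integrable lborel (\<lambda>x. (2 * norm (w x))\<^sup>2)"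
   using sq_intD(3)[OF w] by (simp add: power_mult_distrib)
  show "AE x in lborel. (\<lambda>n. (norm (f n x - h x))\<^sup>2) \<longlonglongrightarrow> 0"
   using assms(3)
  proof eventually_elim
   case (elim x)
   have "(\<lambda>n. (norm (f n x - h x))\<^sup>2) \<longlonglongrightarrow> (norm (h x - h x))\<^sup>2"
    by (intro tendsto_intros elim)
   then show ?case by simp
  qed
  show "AE x in lborel. norm ((norm (f n x - h x))\<^sup>2) \<le> (2 * norm (w x))\<^sup>2" for n
   using b[of n] bh
  proof eventually_elim
   case (elim x)
   then have "norm (f n x - h x) \<le> 2 * norm (w x)"
    using norm_triangle_ineq4[of "f n x" "h x"] by linarith
   then show ?case using power_mono[of "norm (f n x - h x)" "2 * norm (w x)" 2] by simp
  qed
 qed (use assms(1,2) in measurable)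
 then have "(\<lambda>n. (norm (l2_of (f n) - l2_of h))\<^sup>2) \<longlonglongrightarrow> 0"
  by (simp add: l2_of_arith(2)[OF f h] norm_l2_of[OF sq_int_diff[OF f h]])
 then have "(\<lambda>n. sqrt ((norm (l2_of (f n) - l2_of h))\<^sup>2)) \<longlonglongrightarrow> sqrt 0" by (rule tendsto_real_sqrt)
 then show "(\<lambda>n. l2_of (f n)) \<longlonglongrightarrow> l2_of h"
  by (simp add: tendsto_norm_zero_iff LIM_zero_iff)
qed

text \<open>This is the Riesz-Fischer argument: a subsequence with geometrically small increments
  converges almost everywhere, and Fatou's lemma turns the pointwise limit into a limit in
  norm.\<close>

instance l2 :: (euclidean_space, euclidean_space) complete_space
proof
 fix X :: "nat \<Rightarrow> ('a, 'b) l2" assume X: "Cauchy X"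
 have "\<exists>N. \<forall>m\<ge>N. \<forall>n\<ge>N. norm (X m - X n) < 1 / 2 ^ k" for k :: nat
  using CauchyD[OF X, of "1 / 2 ^ k"] by simp
 then obtain N where N: "\<And>k m n. m \<ge> N k \<Longrightarrow> n \<ge> N k \<Longrightarrow> norm (X m - X n) < 1 / 2 ^ k" by metis
 \<comment> \<open>Partial sums of \<open>N\<close> give indices that are monotone and at least
   \<open>N k\<close>.\<close>
 define r where "r k = (\<Sum>i\<le>k. N i)" for k
 have rN: "N k \<le> r k" and rr: "r k \<le> r (Suc k)" for k
  unfolding r_def by (auto intro: member_le_sum)
 define f where "f k = l2_fun (X (r k))" for k
 have fm [measurable]: "f k \<in> borel_measurable borel" for k by (simp add: f_def)
 have fs: "f k \<in> square_integrable" for k by (simp add: f_def l2_fun_sq_int)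
 have nn: "nn_int (\<lambda>x. (norm (f m x - f k x))\<^sup>2) = ennreal ((norm (X (r m) - X (r k)))\<^sup>2)" for m k
  using nn_norm_l2_of[OF sq_int_diff[OF fs[of m] fs[of k]]] l2_of_arith(2)[OF fs[of m] fs[of k]]
  by (simp add: f_def)
 have step: "(norm (X (r (Suc k)) - X (r k)))\<^sup>2 \<le> 1 / 4 ^ k" for k
 proof -
  have "norm (X (r (Suc k)) - X (r k)) \<le> 1 / 2 ^ k"
   using N[of k "r (Suc k)" "r k"] rN[of k] rr[of k] by simp
  then have "(norm (X (r (Suc k)) - X (r k)))\<^sup>2 \<le> (1 / 2 ^ k)\<^sup>2" by (rule power_mono) simp
  also have "\<dots> = 1 / 4 ^ k" by (simp add: power_divide power2_eq_square flip: power_mult_distrib)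
  finally show ?thesis .
 qed
 have "(\<integral>\<^sup>+x. (suminf (\<lambda>k. ennreal (2 ^ k * (norm (f (Suc k) x - f k x))\<^sup>2))) \<partial>lborel)
   = (suminf (\<lambda>k. (nn_int (\<lambda>x. 2 ^ k * (norm (f (Suc k) x - f k x))\<^sup>2))))"
  by (rule nn_integral_suminf) measurable
 also have "\<dots> \<le> (suminf (\<lambda>k. ennreal ((1 / 2) ^ k)))"
 proof (intro suminf_le)
  fix k
  have "nn_int (\<lambda>x. 2 ^ k * (norm (f (Suc k) x - f k x))\<^sup>2) =
    ennreal (2 ^ k) * nn_int (\<lambda>x. (norm (f (Suc k) x - f k x))\<^sup>2)"
   by (subst nn_integral_cmult[symmetric]) (auto simp: ennreal_mult)
  also have "\<dots> = ennreal (2 ^ k * (norm (X (r (Suc k)) - X (r k)))\<^sup>2)"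
   by (simp add: nn ennreal_mult)
  also have "\<dots> \<le> ennreal (2 ^ k * (1 / 4 ^ k))"
   by (intro ennreal_leI mult_left_mono step) simp
  also have "2 ^ k * (1 / 4 ^ k) = ((1 / 2) ^ k :: real)"
   by (simp add: power_divide field_simps flip: power_mult_distrib)
  finally show "nn_int (\<lambda>x. 2 ^ k * (norm (f (Suc k) x - f k x))\<^sup>2) \<le> ennreal ((1 / 2) ^ k)" .
 qed auto
 also have "\<dots> < \<infinity>"
  by (subst suminf_ennreal2) (auto simp: summable_geometric)
 finally have "AE x in lborel. (suminf (\<lambda>k. ennreal (2 ^ k * (norm (f (Suc k) x - f k x))\<^sup>2))) \<noteq> \<infinity>"
  by (intro nn_integral_PInf_AE) auto
 then have conv: "AE x in lborel. convergent (\<lambda>k. f k x)"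
 proof eventually_elim
  case (elim x)
  \<comment> \<open>This is the purpose of the weight \<open>2 ^ k\<close>: as its products with the
    squared increments stay bounded, the increments are O(2^(-k/2)) and hence summable.\<close>
  define d where "d k = norm (f (Suc k) x - f k x)" for k
  have sm: "summable (\<lambda>k. 2 ^ k * (d k)\<^sup>2)"
   using elim summable_suminf_not_top[of "\<lambda>k. 2 ^ k * (d k)\<^sup>2"] by (simp add: d_def)
  then obtain C where C: "\<And>k. norm (2 ^ k * (d k)\<^sup>2) \<le> C"
   using summable_imp_Bseq Bseq_def by (metis (no_types, lifting) convergent_imp_Bseq summable_LIMSEQ_zero convergent_def BseqE)
  have "d k \<le> sqrt C * (1 / sqrt 2) ^ k" for k
  proof -
   have "(d k)\<^sup>2 \<le> C / 2 ^ k" using C[of k] by (simp add: field_simps)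
   then have "d k \<le> sqrt (C / 2 ^ k)" by (simp add: real_le_rsqrt)
   then show ?thesis by (simp add: real_sqrt_divide real_sqrt_power power_divide)
  qed
  moreover have "summable (\<lambda>k. sqrt C * (1 / sqrt 2) ^ k)"
   by (intro summable_mult summable_geometric) simp
  ultimately have "summable (\<lambda>k. f (Suc k) x - f k x)"
   by (intro summable_comparison_test[of "\<lambda>k. f (Suc k) x - f k x" "\<lambda>k. sqrt C * (1 / sqrt 2) ^ k"])
    (auto simp: d_def)
  then have "convergent (\<lambda>n. \<Sum>k<n. f (Suc k) x - f k x)" by (simp add: summable_iff_convergent)
  then have "convergent (\<lambda>n. f n x - f 0 x)" unfolding sum_lessThan_telescope[of "\<lambda>k. f k x"] .
  then show ?case using convergent_diff_const_right_iff by blast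
 qed
 \<comment> \<open>Replacing the sequences that are not Cauchy by 0 makes the limit exist at every
   point, which gives measurability.\<close>
 define h where "h x = lim (\<lambda>k. if Cauchy (\<lambda>k. f k x) then f k x else 0)" for x
 have hm [measurable]: "h \<in> borel_measurable borel"
  unfolding h_def by measurable
 have fh: "AE x in lborel. (\<lambda>k. f k x) \<longlonglongrightarrow> h x"
  using conv by eventually_elim (simp add: h_def convergent_LIMSEQ_iff Cauchy_convergent_iff)
 have est: "nn_int (\<lambda>x. (norm (h x - f k x))\<^sup>2) \<le> ennreal ((1 / 2 ^ k)\<^sup>2)" for k
 proof -
  have "nn_int (\<lambda>x. (norm (h x - f k x))\<^sup>2)
    = (\<integral>\<^sup>+x. liminf (\<lambda>m. ennreal ((norm (f m x - f k x))\<^sup>2)) \<partial>lborel)"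
  proof (rule nn_integral_cong_AE)
   show "AE x in lborel. ennreal ((norm (h x - f k x))\<^sup>2) = liminf (\<lambda>m. ennreal ((norm (f m x - f k x))\<^sup>2))"
    using fh
   proof eventually_elim
    case (elim x)
    have "(\<lambda>m. ennreal ((norm (f m x - f k x))\<^sup>2)) \<longlonglongrightarrow> ennreal ((norm (h x - f k x))\<^sup>2)"
     by (intro tendsto_intros elim)
    then show ?case using lim_imp_Liminf[OF sequentially_bot] by metis
   qed
  qed
  also have "\<dots> \<le> liminf (\<lambda>m. \<integral>\<^sup>+x. ennreal ((norm (f m x - f k x))\<^sup>2) \<partial>lborel)"
   by (rule nn_integral_liminf) measurable
  also have "\<dots> \<le> ennreal ((1 / 2 ^ k)\<^sup>2)"
  proof -
   have "eventually (\<lambda>m. (nn_int (\<lambda>x. (norm (f m x - f k x))\<^sup>2)) \<le> ennreal ((1 / 2 ^ k)\<^sup>2)) sequentially"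
   proof (rule eventually_sequentiallyI[of k])
    fix m assume "k \<le> m"
    then have "r k \<le> r m" using lift_Suc_mono_le[of r] rr by blast
    then have "norm (X (r m) - X (r k)) \<le> 1 / 2 ^ k"
     using N[of k "r m" "r k"] rN[of k] by simp
    then show "nn_int (\<lambda>x. (norm (f m x - f k x))\<^sup>2) \<le> ennreal ((1 / 2 ^ k)\<^sup>2)"
     unfolding nn by (intro ennreal_leI power_mono) auto
   qed
   then show ?thesis by (rule Liminf_le[OF sequentially_bot])
  qed
  finally show ?thesis .
 qed
 have hk: "(\<lambda>x. h x - f k x) \<in> square_integrable" "norm (l2_of (\<lambda>x. h x - f k x)) \<le> 1 / 2 ^ k" for k
  using norm_l2_of_le_nn[OF _ _ est[of k]] by auto
 have hs: "h \<in> square_integrable"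
  using sq_int_add[OF hk(1)[of 0] fs[of 0]] by simp
 have close: "norm (l2_of h - X (r k)) \<le> 1 / 2 ^ k" for k
  using hk(2)[of k] l2_of_arith(2)[OF hs fs[of k]] by (simp add: f_def)
 have "X \<longlonglongrightarrow> l2_of h"
 proof (rule LIMSEQ_I)
  fix e :: real assume e: "0 < e"
  obtain k where k: "(1 / 2) ^ k < e / 2" using real_arch_pow_inv[of "e / 2" "1 / 2"] e by auto
  have "norm (X n - l2_of h) < e" if "n \<ge> r k" for n
  proof -
   have "norm (X n - X (r k)) < 1 / 2 ^ k" using N[of k n "r k"] that rN[of k] by simp
   then have "norm (X n - l2_of h) < 1 / 2 ^ k + 1 / 2 ^ k"
    using close[of k] norm_triangle_ineq[of "X n - X (r k)" "X (r k) - l2_of h"]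
    by (simp add: norm_minus_commute)
   also have "\<dots> < e" using k by (simp add: power_divide)
   finally show ?thesis .
  qed
  then show "\<exists>no. \<forall>n\<ge>no. norm (X n - l2_of h) < e" by blast
 qed
 then show "convergent X" by (auto simp: convergent_def)
qed

lemma test_measurable:
 assumes "\<phi> \<in> test_functions"
 shows "\<phi> \<in> borel_measurable borel" "(\<lambda>x. deriv_at \<phi> x b) \<in> borel_measurable borel"
 using test_differentiable[OF assms] by (auto intro: borel_measurable_continuous_onI)

lemma sq_int_compact_support:
 fixes f :: "'a::euclidean_space \<Rightarrow> real"
 assumes "f \<in> borel_measurable borel" "\<And>x. \<bar>f x\<bar> \<le> C" "\<And>x. R \<le> norm x \<Longrightarrow> f x = 0"
 shows "f \<in> square_integrable"
proof (rule sq_int_bound)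
 show "integrable lborel (\<lambda>x::'a. C\<^sup>2 * indicator (cball 0 R) x)"
  by (intro integrable_mult_right integrable_real_indicator) (auto simp: emeasure_bounded_finite[unfolded infinity_ennreal_def])
 have "(norm (f x))\<^sup>2 \<le> C\<^sup>2 * indicator (cball 0 R) x" for x
  using assms(2)[of x] assms(3)[of x] abs_le_square_iff[of "f x" C] abs_ge_zero[of "f x"]
  by (auto simp: indicator_def)
 then show "AE x in lborel. (norm (f x))\<^sup>2 \<le> C\<^sup>2 * indicator (cball 0 R) x" by simp
qed (use assms(1) in simp)

lemma test_sq_int:
 assumes "\<phi> \<in> test_functions"
 shows "\<phi> \<in> square_integrable" "(\<lambda>x. deriv_at \<phi> x b) \<in> square_integrable"
proof -
 obtain R where R: "\<And>x. R \<le> norm x \<Longrightarrow> \<phi> x = 0" "\<And>x b. R \<le> norm x \<Longrightarrow> deriv_at \<phi> x b = 0"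
  by (rule test_support[OF assms]) blast
 obtain C where C: "\<And>x. \<bar>\<phi> x\<bar> \<le> C" "\<And>x. \<bar>deriv_at \<phi> x b\<bar> \<le> C"
  by (rule test_bounded[OF assms, of b]) blast
 show "\<phi> \<in> square_integrable"
  by (rule sq_int_compact_support[OF test_measurable(1)[OF assms] C(1) R(1)])
 show "(\<lambda>x. deriv_at \<phi> x b) \<in> square_integrable"
  by (rule sq_int_compact_support[OF test_measurable(2)[OF assms] C(2) R(2)])
qed

lemma test_add:
 assumes "\<phi> \<in> test_functions" "\<psi> \<in> test_functions"
 shows "(\<lambda>x. \<phi> x + \<psi> x) \<in> test_functions"
proof -
 have "{x. \<phi> x + \<psi> x \<noteq> 0} \<subseteq> closure {x. \<phi> x \<noteq> 0} \<union> closure {x. \<psi> x \<noteq> 0}"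
 proof
  fix x assume "x \<in> {x. \<phi> x + \<psi> x \<noteq> 0}"
  then have "x \<in> {x. \<phi> x \<noteq> 0} \<or> x \<in> {x. \<psi> x \<noteq> 0}" by auto
  then show "x \<in> closure {x. \<phi> x \<noteq> 0} \<union> closure {x. \<psi> x \<noteq> 0}"
   using closure_subset[of "{x. \<phi> x \<noteq> 0}"] closure_subset[of "{x. \<psi> x \<noteq> 0}"] by blast
 qed
 moreover have "bounded (closure {x. \<phi> x \<noteq> 0} \<union> closure {x. \<psi> x \<noteq> 0})"
  using assms by (simp add: test_functions_def compact_imp_bounded)
 ultimately have "compact (closure {x. \<phi> x + \<psi> x \<noteq> 0})"
  unfolding compact_closure using bounded_subset by blast
 then show ?thesis using assms by (simp add: test_functions_def continuously_differentiable_add)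
qed

lemma test_cmult:
 assumes "\<phi> \<in> test_functions"
 shows "(\<lambda>x. c * \<phi> x) \<in> test_functions"
proof -
 have "{x. c * \<phi> x \<noteq> 0} \<subseteq> closure {x. \<phi> x \<noteq> 0}"
  using closure_subset[of "{x. \<phi> x \<noteq> 0}"] by auto
 moreover have "bounded (closure {x. \<phi> x \<noteq> 0})"
  using assms by (simp add: test_functions_def compact_imp_bounded)
 ultimately have "compact (closure {x. c * \<phi> x \<noteq> 0})"
  unfolding compact_closure using bounded_subset by blast
 then show ?thesis using assms
  by (simp add: test_functions_def continuously_differentiable_mult continuously_differentiable_const)
qed

section \<open>Density of test functions in L^2\<close>

definition test_closure :: "('a::euclidean_space, real) l2 set" where
 "test_closure = closure (l2_of ` test_functions)"

lemma test_closure_lim: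
 "\<lbrakk>\<And>n. f n \<in> test_closure; f \<longlonglongrightarrow> l\<rbrakk> \<Longrightarrow> l \<in> test_closure"
 unfolding test_closure_def by (rule closed_sequentially[OF closed_closure]) auto

lemma test_closure_seq:
 assumes "f \<in> test_closure"
 obtains \<phi> where "\<And>n. \<phi> n \<in> test_functions" "(\<lambda>n. l2_of (\<phi> n)) \<longlonglongrightarrow> f"
proof -
 obtain g where g: "\<And>n. g n \<in> l2_of ` test_functions" "g \<longlonglongrightarrow> f"
  using assms unfolding test_closure_def closure_sequential by blast
 then have "\<forall>n. \<exists>\<phi>. \<phi> \<in> test_functions \<and> g n = l2_of \<phi>" by blast
 then obtain \<phi> where \<phi>: "\<And>n. \<phi> n \<in> test_functions" "\<And>n. g n = l2_of (\<phi> n)" by metis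
 from g(2) have "(\<lambda>n. l2_of (\<phi> n)) \<longlonglongrightarrow> f" unfolding \<phi>(2)[symmetric] .
 with \<phi>(1) show ?thesis by (rule that)
qed

lemma test_closureI: "\<phi> \<in> test_functions \<Longrightarrow> l2_of \<phi> \<in> test_closure"
 unfolding test_closure_def by (rule subsetD[OF closure_subset]) simp

lemma test_closure_add:
 assumes "f \<in> test_closure" "g \<in> test_closure"
 shows "f + g \<in> test_closure"
proof -
 obtain \<phi> where \<phi>: "\<And>n. \<phi> n \<in> test_functions" "(\<lambda>n. l2_of (\<phi> n)) \<longlonglongrightarrow> f"
  by (rule test_closure_seq[OF assms(1)]) blast
 obtain \<psi> where \<psi>: "\<And>n. \<psi> n \<in> test_functions" "(\<lambda>n. l2_of (\<psi> n)) \<longlonglongrightarrow> g"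
  by (rule test_closure_seq[OF assms(2)]) blast
 have "l2_of (\<phi> n) + l2_of (\<psi> n) \<in> test_closure" for n
  unfolding l2_of_arith(1)[OF test_sq_int(1)[OF \<phi>(1)] test_sq_int(1)[OF \<psi>(1)]]
  by (intro test_closureI test_add \<phi> \<psi>)
 then show ?thesis by (rule test_closure_lim[of "\<lambda>n. l2_of (\<phi> n) + l2_of (\<psi> n)"]) (intro tendsto_add \<phi> \<psi>)
qed

lemma test_closure_scaleR:
 assumes "f \<in> test_closure"
 shows "c *\<^sub>R f \<in> test_closure"
proof -
 obtain \<phi> where \<phi>: "\<And>n. \<phi> n \<in> test_functions" "(\<lambda>n. l2_of (\<phi> n)) \<longlonglongrightarrow> f"
  by (rule test_closure_seq[OF assms(1)]) blast
 have "c *\<^sub>R l2_of (\<phi> n) \<in> test_closure" for n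
  unfolding l2_of_arith(3)[OF test_sq_int(1)[OF \<phi>(1)] test_sq_int(1)[OF \<phi>(1)]]
  using test_closureI[OF test_cmult[OF \<phi>(1), of c n]] by simp
 then show ?thesis by (rule test_closure_lim[of "\<lambda>n. c *\<^sub>R l2_of (\<phi> n)"]) (intro tendsto_scaleR \<phi> tendsto_const)
qed

lemma indicator_sq_int:
 "A \<in> sets borel \<Longrightarrow> emeasure lborel A < \<infinity> \<Longrightarrow> (indicator A :: 'a::euclidean_space \<Rightarrow> real) \<in> square_integrable"
 by (simp add: square_integrable_def power2_eq_square flip: indicator_inter_arith)

lemma test_closure_box: "l2_of (indicator (box l u)) \<in> test_closure"
proof (rule test_closure_lim)
 show "(\<lambda>n. l2_of (box_bump l u n)) \<longlonglongrightarrow> l2_of (indicator (box l u))"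
 proof (rule l2_of_tendsto_dominated(3)[where w = "indicator (box l u) :: 'a \<Rightarrow> real"])
  show "(indicator (box l u) :: 'a \<Rightarrow> real) \<in> square_integrable"
   by (rule indicator_sq_int) (auto simp: emeasure_lborel_box_eq)
  show "AE x in lborel. norm (box_bump l u n x) \<le> norm (indicator (box l u) x :: real)" for n
   using box_bump_bounds[of l u n] box_bump_eq_0[of _ l u n] by (auto simp: indicator_def)
 qed (auto simp: box_bump_tendsto test_measurable box_bump_test)
 show "l2_of (box_bump l u n) \<in> test_closure" for n
  by (intro test_closureI box_bump_test)
qed

lemma test_closure_zero: "0 \<in> test_closure"
 using test_closure_scaleR[OF test_closure_box[of 0 0], of 0] by simp

text \<open>The induction runs over the sigma-algebra generated by boxes, which are stable under
  intersection. The fixed box keeps every indicator square integrable, in particular those of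
  complements.\<close>

lemma test_closure_box_Int:
 assumes "A \<in> sets borel"
 shows "l2_of (indicator (A \<inter> box l u)) \<in> test_closure"
proof -
 have fin: "emeasure lborel (B \<inter> box l u) < \<infinity>" if "B \<in> sets borel" for B :: "'a set"
 proof -
  have "emeasure lborel (B \<inter> box l u) \<le> emeasure lborel (box l u)"
   by (rule emeasure_mono) auto
  also have "\<dots> < \<infinity>" by (simp add: emeasure_lborel_box_eq)
  finally show ?thesis .
 qed
 have sq: "(indicator (B \<inter> box l u) :: 'a \<Rightarrow> real) \<in> square_integrable" if "B \<in> sets borel" for B
  by (rule indicator_sq_int) (use that fin in auto)
 have "sigma_sets UNIV (range (\<lambda>(a, b). box a b)) = sets (borel :: 'a measure)"
  unfolding borel_eq_box by simp
 then have A: "A \<in> sigma_sets UNIV (range (\<lambda>(a, b). box a b))" using assms by simp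
 have stable: "Int_stable (range (\<lambda>(a::'a, b). box a b))"
 proof (rule Int_stableI)
  fix P Q assume "P \<in> range (\<lambda>(a::'a, b). box a b)" "Q \<in> range (\<lambda>(a::'a, b). box a b)"
  then obtain a b c d where "P = box a b" "Q = box c d" by auto
  moreover obtain r s where "box a b \<inter> box c d = box r s" using box_Int_box by blast
  ultimately show "P \<inter> Q \<in> range (\<lambda>(a::'a, b). box a b)" by (intro image_eqI[of _ _ "(r, s)"]) auto
 qed
 show ?thesis
 proof (induction rule: sigma_sets_induct_disjoint[OF stable _ A, consumes 0, case_names sub basic empty compl union])
  case sub
  then show ?case by simp
 next
  case (basic B)
  then obtain a b where "B = box a b" by auto
  moreover obtain r s where "box a b \<inter> box l u = box r s" using box_Int_box by blast
  ultimately show ?case using test_closure_box by simp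
 next
  case empty
  have "l2_of (\<lambda>x::'a. 0::real) \<in> test_closure"
   by (simp add: l2_of_0 test_closure_zero)
  moreover have "(indicator ({} \<inter> box l u) :: 'a \<Rightarrow> real) = (\<lambda>x. 0)" by (auto simp: indicator_def)
  ultimately show ?case by simp
 next
  case (compl B)
  then have B: "B \<in> sets borel" unfolding borel_eq_box by simp
  have "l2_of (indicator (box l u)) + (-1) *\<^sub>R l2_of (indicator (B \<inter> box l u)) \<in> test_closure"
   by (intro test_closure_add test_closure_scaleR test_closure_box compl)
  also have "l2_of (indicator (box l u) :: 'a \<Rightarrow> real) + (-1) *\<^sub>R l2_of (indicator (B \<inter> box l u))
    = l2_of (\<lambda>x. indicator (UNIV \<inter> box l u) x - indicator (B \<inter> box l u) x)"
   using l2_of_arith(2)[OF sq[of UNIV] sq[OF B]] by simp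
  also have "(\<lambda>x. indicator (UNIV \<inter> box l u) x - indicator (B \<inter> box l u) x) = (indicator ((UNIV - B) \<inter> box l u) :: 'a \<Rightarrow> real)"
   by (auto simp: indicator_def)
  finally show ?case .
 next
  case (union B)
  then have B: "B i \<in> sets borel" for i unfolding borel_eq_box by (auto simp: image_subset_iff)
  let ?C = "\<lambda>n. \<Union>i<n. B i"
  have fin_union: "l2_of (indicator (?C n \<inter> box l u)) \<in> test_closure" for n
  proof (induction n)
   case 0
   have "l2_of (\<lambda>x::'a. 0::real) \<in> test_closure"
    by (simp add: l2_of_0 test_closure_zero)
   moreover have "(indicator (?C 0 \<inter> box l u) :: 'a \<Rightarrow> real) = (\<lambda>x. 0)" by (auto simp: indicator_def)
   ultimately show ?case by simp
  next
   case (Suc n)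
   have "(\<lambda>x. indicator (?C n \<inter> box l u) x + indicator (B n \<inter> box l u) x) = (indicator (?C (Suc n) \<inter> box l u) :: 'a \<Rightarrow> real)"
   proof -
    have "B i \<inter> B n = {}" if "i < n" for i
     using that by (intro disjoint_family_onD[OF union(1)]) auto
    then have dj: "?C n \<inter> B n = {}" by auto
    have e: "?C (Suc n) = ?C n \<union> B n" by (auto simp: lessThan_Suc)
    have "indicator (P \<inter> R) x + indicator (Q \<inter> R) x = (indicator ((P \<union> Q) \<inter> R) x :: real)"
     if "P \<inter> Q = {}" for P Q R :: "'a set" and x
     using that by (auto simp: indicator_def)
    from this[OF dj] show ?thesis unfolding e by (rule ext)
   qed
   moreover have "?C n \<in> sets borel" using B by auto
   ultimately show ?case
    using test_closure_add[OF Suc union(3)[of n]] l2_of_arith(1)[OF sq[of "?C n"] sq[OF B[of n]]] by simp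
  qed
  show ?case
  proof (rule test_closure_lim[of "\<lambda>n. l2_of (indicator (?C n \<inter> box l u))"])
   show "l2_of (indicator (?C n \<inter> box l u)) \<in> test_closure" for n by (rule fin_union)
   show "(\<lambda>n. l2_of (indicator (?C n \<inter> box l u) :: 'a \<Rightarrow> real)) \<longlonglongrightarrow> l2_of (indicator ((\<Union>i. B i) \<inter> box l u))"
   proof (rule l2_of_tendsto_dominated(3)[where w = "indicator (UNIV \<inter> box l u) :: 'a \<Rightarrow> real"])
    show "AE x in lborel. (\<lambda>n. indicator (?C n \<inter> box l u) x :: real) \<longlonglongrightarrow> indicator ((\<Union>i. B i) \<inter> box l u) x"
    proof (intro always_eventually allI)
     fix x
     show "(\<lambda>n. indicator (?C n \<inter> box l u) x :: real) \<longlonglongrightarrow> indicator ((\<Union>i. B i) \<inter> box l u) x"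
     proof (cases "x \<in> (\<Union>i. B i) \<inter> box l u")
      case True
      then obtain i where "x \<in> B i" by auto
      then have "eventually (\<lambda>n. indicator (?C n \<inter> box l u) x = (1::real)) sequentially"
       using True by (intro eventually_sequentiallyI[of "Suc i"]) (auto simp: indicator_def)
      then show ?thesis using True by (simp add: tendsto_eventually)
     next
      case False
      then have "(\<lambda>n. indicator (?C n \<inter> box l u) x :: real) = (\<lambda>n. 0)" by (auto simp: indicator_def)
      then show ?thesis using False by simp
     qed
    qed
    show "(indicator (UNIV \<inter> box l u) :: 'a \<Rightarrow> real) \<in> square_integrable" by (rule sq) simp
    show "AE x in lborel. norm (indicator (?C n \<inter> box l u) x :: real) \<le> norm (indicator (UNIV \<inter> box l u) x :: real)" for n
     by (auto simp: indicator_def)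
   qed (use B in measurable)
  qed
 qed
qed

lemma test_closure_indicator:
 assumes A: "A \<in> sets borel" and fin: "(indicator A :: 'a::euclidean_space \<Rightarrow> real) \<in> square_integrable"
 shows "l2_of (indicator A :: 'a \<Rightarrow> real) \<in> test_closure"
proof (rule test_closure_lim)
 let ?b = "\<lambda>n::nat. box (- (real n *\<^sub>R One)) (real n *\<^sub>R One) :: 'a set"
 show "l2_of (indicator (A \<inter> ?b n)) \<in> test_closure" for n by (rule test_closure_box_Int[OF A])
 show "(\<lambda>n. l2_of (indicator (A \<inter> ?b n) :: 'a \<Rightarrow> real)) \<longlonglongrightarrow> l2_of (indicator A)"
 proof (rule l2_of_tendsto_dominated(3)[OF _ _ _ fin])
  show "AE x in lborel. (\<lambda>n. indicator (A \<inter> ?b n) x :: real) \<longlonglongrightarrow> indicator A x"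
  proof (intro always_eventually allI)
   fix x :: 'a
   obtain m :: nat where m: "norm x < real m" using reals_Archimedean2 by blast
   have "x \<in> ?b n" if "n \<ge> m" for n
    using that m Basis_le_norm[of _ x] by (fastforce simp: mem_box abs_less_iff)
   then have "eventually (\<lambda>n. indicator (A \<inter> ?b n) x = (indicator A x :: real)) sequentially"
    by (intro eventually_sequentiallyI[of m]) (auto simp: indicator_def)
   then show "(\<lambda>n. indicator (A \<inter> ?b n) x :: real) \<longlonglongrightarrow> indicator A x" by (rule tendsto_eventually)
  qed
  show "AE x in lborel. norm (indicator (A \<inter> ?b n) x :: real) \<le> norm (indicator A x :: real)" for n
   by (auto simp: indicator_def)
 qed (use A in auto)
qed

text \<open>Nonnegative functions are built from indicators by sums, multiples and increasing
  limits. Square integrability is carried as a premise of the induction, because it passes down from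
  a function to its smaller constituents.\<close>

lemma test_closure_nonneg:
 assumes "u \<in> borel_measurable borel" "\<And>x. 0 \<le> u x" "u \<in> square_integrable"
 shows "l2_of (u :: 'a::euclidean_space \<Rightarrow> real) \<in> test_closure"
proof -
 have dom: "v \<in> square_integrable"
  if "v \<in> borel_measurable borel" "\<And>x. \<bar>v x\<bar> \<le> \<bar>w x\<bar>" "w \<in> square_integrable" for v w :: "'a \<Rightarrow> real"
  by (rule sq_int_bound[OF _ sq_intD(3)[OF that(3)]]) (use that in \<open>auto simp: abs_le_square_iff\<close>)
 have "u \<in> square_integrable \<longrightarrow> l2_of u \<in> test_closure"
  using assms(1,2)
 proof (induction u rule: borel_measurable_induct_real)
  case (set A)
  then show ?case using test_closure_indicator by auto
 next
  case (mult u c)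
  show ?case
  proof (cases "c = 0")
   case True
   then show ?thesis by (simp add: l2_of_0 test_closure_zero)
  next
   case False
   show ?thesis
   proof
    assume c: "(\<lambda>x. c * u x) \<in> square_integrable"
    have u: "u \<in> square_integrable" using sq_int_scaleR[OF c, of "1 / c"] False by simp
    then have "c *\<^sub>R l2_of u \<in> test_closure" using mult by (intro test_closure_scaleR) simp
    then show "l2_of (\<lambda>x. c * u x) \<in> test_closure"
     using l2_of_arith(3)[OF u u, of c] by simp
   qed
  qed
 next
  case (add u v)
  show ?case
  proof
   assume c: "(\<lambda>x. v x + u x) \<in> square_integrable"
   have "u \<in> square_integrable" "v \<in> square_integrable"
    by (rule dom[OF _ _ c]; use add in auto)+
   then show "l2_of (\<lambda>x. v x + u x) \<in> test_closure"
    using test_closure_add add by (auto simp: l2_of_arith(1)[symmetric])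
  qed
 next
  case (seq U)
  show ?case
  proof
   assume c: "u \<in> square_integrable"
   have le: "\<bar>U i x\<bar> \<le> \<bar>u x\<bar>" for i x
   proof -
    have "U i x \<le> u x"
     using seq(3,4) by (intro incseq_le[of "\<lambda>i. U i x"]) (auto simp: incseq_def le_fun_def)
    then show ?thesis using seq(2)[of i x] by simp
   qed
   have "U i \<in> square_integrable" for i
    by (rule dom[OF _ le c]) (use seq in simp)
   then have "l2_of (U i) \<in> test_closure" for i using seq(5)[of i] by simp
   moreover have "(\<lambda>i. l2_of (U i)) \<longlonglongrightarrow> l2_of u"
    by (rule l2_of_tendsto_dominated(3)[OF _ _ _ c]) (use seq le assms(1) sq_intD[OF c] in auto)
   ultimately show "l2_of u \<in> test_closure" by (rule test_closure_lim)
  qed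
 qed
 then show ?thesis using assms(3) by simp
qed

theorem test_functions_dense: "(test_closure :: ('a::euclidean_space, real) l2 set) = UNIV"
proof -
 have "f \<in> test_closure" for f :: "('a, real) l2"
 proof -
  let ?u = "l2_fun f"
  note u = l2_fun_sq_int[of f]
  have p: "(\<lambda>x. max 0 (?u x)) \<in> square_integrable" "(\<lambda>x. max 0 (- ?u x)) \<in> square_integrable"
   by (rule sq_int_bound[OF _ sq_intD(3)[OF u]]; auto simp: max_def)+
  have "l2_of (\<lambda>x. max 0 (?u x)) + (-1) *\<^sub>R l2_of (\<lambda>x. max 0 (- ?u x)) \<in> test_closure"
   using p by (intro test_closure_add test_closure_scaleR test_closure_nonneg) auto
  also have "l2_of (\<lambda>x. max 0 (?u x)) + (-1) *\<^sub>R l2_of (\<lambda>x. max 0 (- ?u x)) = l2_of ?u"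
   using l2_of_arith(2)[OF p] by (simp add: max_def if_distrib cong: if_cong)
  finally show ?thesis by simp
 qed
 then show ?thesis by auto
qed

text \<open>By density test functions approach \<open>w\<close> itself, and testing against them
  bounds the square of the norm of \<open>w\<close> by \<open>M\<close> times its norm.\<close>

lemma square_integral_le_by_tests:
 fixes w :: "'a::euclidean_space \<Rightarrow> real"
 assumes w: "w \<in> square_integrable" and M: "0 \<le> M"
  and b: "\<And>\<phi>. \<phi> \<in> test_functions \<Longrightarrow> \<bar>\<integral>x. w x * \<phi> x \<partial>lborel\<bar> \<le> M * norm (l2_of \<phi>)"
 shows "norm (l2_of w) \<le> M"
proof -
 obtain \<phi> where \<phi>: "\<And>n. \<phi> n \<in> test_functions" "(\<lambda>n. l2_of (\<phi> n)) \<longlonglongrightarrow> l2_of w"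
  using test_closure_seq[of "l2_of w"] test_functions_dense by blast
 have "(norm (l2_of w))\<^sup>2 \<le> M * norm (l2_of w)"
 proof (rule LIMSEQ_le)
  show "(\<lambda>n. l2_of w \<bullet> l2_of (\<phi> n)) \<longlonglongrightarrow> (norm (l2_of w))\<^sup>2"
   unfolding power2_norm_eq_inner by (intro tendsto_intros \<phi>)
  show "(\<lambda>n. M * norm (l2_of (\<phi> n))) \<longlonglongrightarrow> M * norm (l2_of w)" by (intro tendsto_intros \<phi>)
  have "l2_of w \<bullet> l2_of (\<phi> n) \<le> M * norm (l2_of (\<phi> n))" for n
   using b[OF \<phi>(1)[of n]] by (simp add: l2_of_arith(4)[OF w test_sq_int(1)[OF \<phi>(1)]])
  then show "\<exists>N. \<forall>n\<ge>N. l2_of w \<bullet> l2_of (\<phi> n) \<le> M * norm (l2_of (\<phi> n))" by blast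
 qed
 then show ?thesis using M by (cases "norm (l2_of w) = 0") (auto simp: power2_eq_square)
qed

section \<open>Translations and weak gradients\<close>

lemma lborel_translate:
 fixes z :: "'a::euclidean_space"
 assumes f: "f \<in> borel_measurable borel"
 shows nn_integral_translate: "(\<integral>\<^sup>+x. f (x + z) \<partial>lborel) = (\<integral>\<^sup>+x. f x \<partial>lborel)"
proof -
 have "(\<integral>\<^sup>+x. f x \<partial>lborel) = (\<integral>\<^sup>+x. f x \<partial>(distr lborel borel ((+) z)))"
  by (simp add: lborel_distr_plus)
 also have "\<dots> = (\<integral>\<^sup>+x. f (z + x) \<partial>lborel)" using f by (intro nn_integral_distr) auto
 finally show ?thesis by (simp add: add.commute)
qed

lemma integral_translate:
 fixes f :: "'a::euclidean_space \<Rightarrow> real"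
 assumes f: "f \<in> borel_measurable borel"
 shows "(LBINT x. f (x + z)) = (LBINT x. f x)"
proof -
 have "(LBINT x. f x) = (\<integral>x. f x \<partial>(distr lborel borel ((+) z)))"
  by (simp add: lborel_distr_plus)
 also have "\<dots> = (LBINT x. f (z + x))" using f by (intro integral_distr) auto
 finally show ?thesis by (simp add: add.commute)
qed

lemma sq_int_translate:
 fixes f :: "'a::euclidean_space \<Rightarrow> 'b::euclidean_space"
 assumes "f \<in> square_integrable"
 shows "(\<lambda>x. f (x + z)) \<in> square_integrable"
proof -
 have m: "f \<in> borel_measurable borel" "(\<lambda>x. f (x + z)) \<in> borel_measurable borel"
  using sq_intD(2)[OF assms] by measurable
 show ?thesis
  using assms unfolding sq_int_iff_nn[OF m(1)] sq_int_iff_nn[OF m(2)]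
  by (subst nn_integral_translate) (use m in measurable)
qed

lemma frechet_derivative_translate:
 fixes f :: "'a::euclidean_space \<Rightarrow> real"
 assumes "\<And>x. f differentiable (at x)"
 shows "(\<lambda>x. f (x + c)) differentiable (at x)"
  "frechet_derivative (\<lambda>x. f (x + c)) (at x) = deriv_at f (x + c)"
proof -
 have d: "((\<lambda>x. f (x + c)) has_derivative deriv_at f (x + c)) (at x)"
 proof -
  have "(f has_derivative deriv_at f (x + c)) (at (x + c))"
   using assms by (simp add: frechet_derivative_works)
  moreover have "((\<lambda>x. x + c) has_derivative (\<lambda>h. h)) (at x)" by (auto intro!: derivative_eq_intros)
  ultimately show ?thesis using has_derivative_compose[of "\<lambda>x. x + c" "\<lambda>h. h" x UNIV f] by simp
 qed
 then show "(\<lambda>x. f (x + c)) differentiable (at x)" by (auto simp: differentiable_def)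
 show "frechet_derivative (\<lambda>x. f (x + c)) (at x) = deriv_at f (x + c)"
  by (rule frechet_derivative_at[OF d, symmetric])
qed

lemma continuously_differentiable_translate:
 "continuously_differentiable k f \<Longrightarrow> continuously_differentiable k (\<lambda>x. f (x + c))"
proof (induction k arbitrary: f)
 case 0
 then have f: "continuous_on UNIV f" by simp
 have "continuous_on UNIV (f \<circ> (\<lambda>x. x + c))"
  by (rule continuous_on_compose) (auto intro!: continuous_intros continuous_on_subset[OF f])
 then show ?case by (simp add: o_def)
next
 case (Suc k)
 have "continuously_differentiable k (\<lambda>x. deriv_at f (x + c) b)" if "b \<in> Basis" for b
  using Suc.IH[of "\<lambda>x. deriv_at f x b"] Suc.prems that by simp
 then show ?case using Suc.prems by (simp add: frechet_derivative_translate)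
qed

lemma test_translate:
 fixes \<phi> :: "'a::euclidean_space \<Rightarrow> real"
 assumes "\<phi> \<in> test_functions"
 shows "(\<lambda>x. \<phi> (x + c)) \<in> test_functions"
proof -
 obtain R where R: "\<And>x. R \<le> norm x \<Longrightarrow> \<phi> x = 0" by (rule test_support[OF assms]) blast
 have "{x. \<phi> (x + c) \<noteq> 0} \<subseteq> cball (- c) R"
 proof
  fix x assume "x \<in> {x. \<phi> (x + c) \<noteq> 0}"
  then have "\<not> R \<le> norm (x + c)" using R by auto
  then show "x \<in> cball (- c) R" by (simp add: dist_norm norm_minus_commute add.commute)
 qed
 then have "compact (closure {x. \<phi> (x + c) \<noteq> 0})"
  unfolding compact_closure using bounded_cball bounded_subset by blast
 then show ?thesis using assms by (simp add: test_functions_def continuously_differentiable_translate)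
qed

lemma test_has_derivative:
 assumes "\<phi> \<in> test_functions"
 shows "(\<phi> has_derivative deriv_at \<phi> x) (at x)"
 using test_differentiable(1)[OF assms] by (simp add: frechet_derivative_works)

lemma test_line_derivative:
 assumes "\<phi> \<in> test_functions"
 shows "((\<lambda>s. \<phi> (x + s *\<^sub>R z)) has_real_derivative deriv_at \<phi> (x + s *\<^sub>R z) z) (at s)"
proof -
 have l: "linear (deriv_at \<phi> y)" for y by (rule has_derivative_linear[OF test_has_derivative[OF assms]])
 have "((\<lambda>s. x + s *\<^sub>R z) has_derivative (\<lambda>h. h *\<^sub>R z)) (at s)" by (auto intro!: derivative_eq_intros)
 from has_derivative_compose[OF this test_has_derivative[OF assms]]
 show ?thesis by (simp add: has_field_derivative_def linear_cmul[OF l] mult_commute_abs)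
qed

lemma test_line_Lipschitz:
 assumes \<phi>: "\<phi> \<in> test_functions" and C: "\<And>x. \<bar>deriv_at \<phi> x z\<bar> \<le> C"
 shows "\<bar>\<phi> (x + s *\<^sub>R z) - \<phi> x\<bar> \<le> C * \<bar>s\<bar>"
proof -
 have "norm ((\<lambda>s. \<phi> (x + s *\<^sub>R z)) s - (\<lambda>s. \<phi> (x + s *\<^sub>R z)) 0) \<le> C * norm (s - 0)"
 proof (rule field_differentiable_bound[of UNIV])
  show "((\<lambda>s. \<phi> (x + s *\<^sub>R z)) has_real_derivative deriv_at \<phi> (x + s *\<^sub>R z) z) (at s within UNIV)" for s
   using test_line_derivative[OF \<phi>] by simp
 qed (use C in auto)
 then show ?thesis by simp
qed

text \<open>The shift acts on the smooth factor, so differentiation under the integral is possible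
  for every square integrable \<open>u\<close>.\<close>

lemma pairing_has_derivative_0:
 fixes u \<phi> :: "'a::euclidean_space \<Rightarrow> real"
 assumes u: "u \<in> square_integrable" and \<phi>: "\<phi> \<in> test_functions"
 shows "((\<lambda>s. \<integral>x. u x * \<phi> (x + s *\<^sub>R z) \<partial>lborel) has_real_derivative
   (LBINT x. u x * deriv_at \<phi> x z)) (at 0)"
proof -
 obtain R where R: "0 < R" "\<And>x. R \<le> norm x \<Longrightarrow> \<phi> x = 0"
  by (rule test_support[OF \<phi>]) blast
 obtain C where C: "0 < C" "\<And>x. \<bar>deriv_at \<phi> x z\<bar> \<le> C"
  by (rule test_bounded[OF \<phi>, of z]) blast
 have um [measurable]: "u \<in> borel_measurable borel" by (rule sq_intD[OF u])
 have \<phi>m [measurable]: "\<phi> \<in> borel_measurable borel"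
  "(\<lambda>x. deriv_at \<phi> x z) \<in> borel_measurable borel"
  by (rule test_measurable[OF \<phi>])+
 have int: "integrable lborel (\<lambda>x. u x * \<phi> (x + c))" for c
  by (intro integrable_mult_sq_int u test_sq_int test_translate \<phi>)
 have "((\<lambda>s. ((LBINT x. u x * \<phi> (x + s *\<^sub>R z)) - (LBINT x. u x * \<phi> (x + 0 *\<^sub>R z))) / s) \<longlongrightarrow>
   (LBINT x. u x * deriv_at \<phi> x z)) (at 0)"
  unfolding tendsto_at_iff_sequentially
 proof (intro allI impI)
  fix X :: "nat \<Rightarrow> real" assume X0: "\<forall>i. X i \<in> UNIV - {0}" and X: "X \<longlonglongrightarrow> 0"
  obtain K where K: "0 < K" "\<And>i. \<bar>X i\<bar> \<le> K"
   using convergent_imp_Bseq[of X] X by (auto simp: convergent_def Bseq_def)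
  let ?q = "\<lambda>i x. u x * ((\<phi> (x + X i *\<^sub>R z) - \<phi> x) / X i)"
  \<comment> \<open>The shifts have length at most \<open>K * norm z\<close>, so all difference
    quotients vanish outside this enlarged ball; inside it they are bounded by the Lipschitz
    constant \<open>C\<close>.\<close>
  let ?B = "cball 0 (R + K * norm z) :: 'a set"
  have "(\<lambda>i. \<integral>x. ?q i x \<partial>lborel) \<longlonglongrightarrow> (LBINT x. u x * deriv_at \<phi> x z)"
  proof (rule integral_dominated_convergence[where w = "\<lambda>x. \<bar>u x\<bar> * (C * indicator ?B x)"])
   have "(\<lambda>x. \<bar>u x\<bar>) \<in> square_integrable" using u by (simp add: square_integrable_def)
   moreover have "(\<lambda>x. C * indicator ?B x) \<in> square_integrable"
    by (rule sq_int_compact_support[where C = C and R = "R + K * norm z + 1"])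
      (use C(1) in \<open>auto simp: indicator_def\<close>)
   ultimately show "integrable lborel (\<lambda>x. \<bar>u x\<bar> * (C * indicator ?B x))"
    by (rule integrable_mult_sq_int)
   show "AE x in lborel. (\<lambda>i. ?q i x) \<longlonglongrightarrow> u x * deriv_at \<phi> x z"
   proof (intro always_eventually allI tendsto_mult tendsto_const)
    fix x
    have "((\<lambda>s. \<phi> (x + s *\<^sub>R z)) has_real_derivative deriv_at \<phi> x z) (at 0)"
     using test_line_derivative[OF \<phi>, of x z 0] by simp
    then have "((\<lambda>s. (\<phi> (x + s *\<^sub>R z) - \<phi> x) / s) \<longlongrightarrow> deriv_at \<phi> x z) (at 0)"
     by (simp add: has_field_derivative_iff)
    then show "(\<lambda>i. (\<phi> (x + X i *\<^sub>R z) - \<phi> x) / X i) \<longlonglongrightarrow> deriv_at \<phi> x z"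
     unfolding tendsto_at_iff_sequentially using X X0 by (auto simp: o_def)
   qed
   show "AE x in lborel. norm (?q i x) \<le> \<bar>u x\<bar> * (C * indicator ?B x)" for i
   proof (intro always_eventually allI)
    fix x
    have "\<bar>(\<phi> (x + X i *\<^sub>R z) - \<phi> x) / X i\<bar> \<le> C * indicator ?B x"
    proof (cases "x \<in> ?B")
     case True
     have "\<bar>\<phi> (x + X i *\<^sub>R z) - \<phi> x\<bar> \<le> C * \<bar>X i\<bar>" by (rule test_line_Lipschitz[OF \<phi> C(2)])
     moreover have "X i \<noteq> 0" using X0 by auto
     ultimately show ?thesis using True by (simp add: abs_divide divide_le_eq)
    next
     case False
     have "norm (X i *\<^sub>R z) \<le> K * norm z" using K(2)[of i] by (simp add: mult_right_mono)
     then have "R \<le> norm (x + X i *\<^sub>R z)"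
      using False norm_triangle_ineq4[of "x + X i *\<^sub>R z" "X i *\<^sub>R z"] by simp
     moreover have "0 \<le> K * norm z" using K(1) by simp
     then have "R \<le> norm x" using False unfolding mem_cball dist_0_norm by linarith
     ultimately show ?thesis using R(2) False by simp
    qed
    then show "norm (?q i x) \<le> \<bar>u x\<bar> * (C * indicator ?B x)"
     by (simp only: real_norm_def abs_mult) (intro mult_left_mono, auto)
   qed
  qed measurable
  moreover have eq: "(LBINT x. ?q i x) = ((LBINT x. u x * \<phi> (x + X i *\<^sub>R z)) - (LBINT x. u x * \<phi> (x + 0 *\<^sub>R z))) / X i" for i
   using int[of "X i *\<^sub>R z"] int[of 0]
   by (simp add: right_diff_distrib diff_divide_distrib)
  ultimately have "(\<lambda>i. ((LBINT x. u x * \<phi> (x + X i *\<^sub>R z)) - (LBINT x. u x * \<phi> (x + 0 *\<^sub>R z))) / X i)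
    \<longlonglongrightarrow> (LBINT x. u x * deriv_at \<phi> x z)"
   unfolding eq by blast
  then show "((\<lambda>s. ((LBINT x. u x * \<phi> (x + s *\<^sub>R z)) - (LBINT x. u x * \<phi> (x + 0 *\<^sub>R z))) / s) \<circ> X)
    \<longlonglongrightarrow> (LBINT x. u x * deriv_at \<phi> x z)"
   by (simp add: o_def)
 qed
 then show ?thesis by (simp add: has_field_derivative_iff)
qed

lemma pairing_has_derivative:
 fixes u \<phi> :: "'a::euclidean_space \<Rightarrow> real"
 assumes u: "u \<in> square_integrable" and \<phi>: "\<phi> \<in> test_functions"
 shows "((\<lambda>s. \<integral>x. u x * \<phi> (x + s *\<^sub>R z) \<partial>lborel) has_real_derivative
   (LBINT x. u x * deriv_at \<phi> (x + s *\<^sub>R z) z)) (at s)"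
proof -
 let ?\<psi> = "\<lambda>x. \<phi> (x + s *\<^sub>R z)"
 have "((\<lambda>t. \<integral>x. u x * ?\<psi> (x + t *\<^sub>R z) \<partial>lborel) has_real_derivative
   (LBINT x. u x * deriv_at ?\<psi> x z)) (at 0)"
  by (rule pairing_has_derivative_0[OF u test_translate[OF \<phi>]])
 moreover have "?\<psi> (x + t *\<^sub>R z) = \<phi> (x + (t + s) *\<^sub>R z)" for x t
  by (simp add: algebra_simps)
 moreover have "deriv_at ?\<psi> x z = deriv_at \<phi> (x + s *\<^sub>R z) z" for x
  using frechet_derivative_translate(2)[OF test_differentiable(1)[OF \<phi>]] by simp
 ultimately have "((\<lambda>t. (\<lambda>s. \<integral>x. u x * \<phi> (x + s *\<^sub>R z) \<partial>lborel) (t + s)) has_real_derivative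
   (LBINT x. u x * deriv_at \<phi> (x + s *\<^sub>R z) z)) (at 0)"
  by simp
 then show ?thesis using DERIV_shift[of "\<lambda>s. \<integral>x. u x * \<phi> (x + s *\<^sub>R z) \<partial>lborel" _ 0 s] by simp
qed

lemma weak_gradient_direction:
 fixes u :: "'a::euclidean_space \<Rightarrow> real"
 assumes u: "u \<in> square_integrable" and g: "g \<in> square_integrable" and w: "is_weak_gradient u g"
  and \<phi>: "\<phi> \<in> test_functions"
 shows "(LBINT x. u x * deriv_at \<phi> x z) = - (LBINT x. (g x \<bullet> z) * \<phi> x)"
proof -
 have l: "linear (deriv_at \<phi> y)" for y by (rule has_derivative_linear[OF test_has_derivative[OF \<phi>]])
 have d: "deriv_at \<phi> x z = (\<Sum>i\<in>Basis. (z \<bullet> i) * deriv_at \<phi> x i)" for x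
 proof -
  have "deriv_at \<phi> x z = deriv_at \<phi> x (\<Sum>i\<in>Basis. (z \<bullet> i) *\<^sub>R i)"
   by (simp add: euclidean_representation)
  also have "\<dots> = (\<Sum>i\<in>Basis. (z \<bullet> i) * deriv_at \<phi> x i)"
   by (simp add: linear_sum[OF l] linear_cmul[OF l])
  finally show ?thesis .
 qed
 have gi: "(\<lambda>x. g x \<bullet> i) \<in> square_integrable" for i
  by (rule sq_int_bound[OF _ integrable_mult_right[OF sq_intD(3)[OF g], of "(norm i)\<^sup>2"]])
    (use sq_intD[OF g] Cauchy_Schwarz_ineq[of "g _" i] in \<open>auto simp: power2_norm_eq_inner mult.commute\<close>)
 have i1: "integrable lborel (\<lambda>x. u x * deriv_at \<phi> x i)" for i
  by (intro integrable_mult_sq_int u test_sq_int \<phi>)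
 have i2: "integrable lborel (\<lambda>x. (g x \<bullet> i) * \<phi> x)" for i
  by (intro integrable_mult_sq_int gi test_sq_int \<phi>)
 have "(LBINT x. u x * deriv_at \<phi> x z)
   = (LBINT x. (\<Sum>i\<in>Basis. (z \<bullet> i) * (u x * deriv_at \<phi> x i)))"
  by (simp add: d sum_distrib_left mult_ac)
 also have "\<dots> = (\<Sum>i\<in>Basis. (z \<bullet> i) * (LBINT x. u x * deriv_at \<phi> x i))"
  using i1 by (simp add: Bochner_Integration.integral_sum)
 also have "\<dots> = (\<Sum>i\<in>Basis. (z \<bullet> i) * - (LBINT x. (g x \<bullet> i) * \<phi> x))"
  using w \<phi> by (simp add: is_weak_gradient_def)
 also have "\<dots> = - (LBINT x. (\<Sum>i\<in>Basis. (z \<bullet> i) * ((g x \<bullet> i) * \<phi> x)))"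
  using i2 by (simp add: Bochner_Integration.integral_sum sum_negf)
 also have "(\<lambda>x. \<Sum>i\<in>Basis. (z \<bullet> i) * ((g x \<bullet> i) * \<phi> x)) = (\<lambda>x. (g x \<bullet> z) * \<phi> x)"
  by (rule ext) (simp add: euclidean_inner[of "g _" z] sum_distrib_left sum_distrib_right mult_ac)
 finally show ?thesis .
qed

lemma sq_int_inner:
 fixes g :: "'a::euclidean_space \<Rightarrow> 'b::euclidean_space"
 assumes g: "g \<in> square_integrable"
 shows "(\<lambda>x. g x \<bullet> i) \<in> square_integrable"
 by (rule sq_int_bound[OF _ integrable_mult_right[OF sq_intD(3)[OF g], of "(norm i)\<^sup>2"]])
   (use sq_intD[OF g] Cauchy_Schwarz_ineq[of "g _" i] in \<open>auto simp: power2_norm_eq_inner mult.commute\<close>)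

lemma l2_pairing_le:
 fixes f g :: "'a::euclidean_space \<Rightarrow> real"
 assumes "f \<in> square_integrable" "g \<in> square_integrable"
 shows "\<bar>\<integral>x. f x * g x \<partial>lborel\<bar> \<le> norm (l2_of f) * norm (l2_of g)"
 using Cauchy_Schwarz_ineq2[of "l2_of f" "l2_of g"] by (simp add: l2_of_arith(4)[OF assms])

lemma norm_l2_translate:
 fixes f :: "'a::euclidean_space \<Rightarrow> 'b::euclidean_space"
 assumes "f \<in> square_integrable"
 shows "norm (l2_of (\<lambda>x. f (x + c))) = norm (l2_of f)"
proof -
 have "(norm (l2_of (\<lambda>x. f (x + c))))\<^sup>2 = (norm (l2_of f))\<^sup>2"
  unfolding norm_l2_of[OF assms] norm_l2_of[OF sq_int_translate[OF assms]]
  by (rule integral_translate) (use sq_intD[OF assms] in measurable)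
 then show ?thesis by (simp add: power2_eq_iff_nonneg)
qed

text \<open>By duality the difference of \<open>u\<close> and its translate is tested against
  \<phi>, and the translation is moved to \<phi>. The resulting function of the shift parameter is
  differentiable, its derivative is a pairing with the weak gradient, and the mean value theorem
  compares the parameters 0 and 1.\<close>

lemma translation_estimate:
 fixes u :: "'a::euclidean_space \<Rightarrow> real"
 assumes u: "u \<in> square_integrable" and g: "g \<in> square_integrable" and w: "is_weak_gradient u g"
 shows "norm (l2_of (\<lambda>x. u (x + z) - u x)) \<le> norm (l2_of (\<lambda>x. g x \<bullet> z))"
proof (rule square_integral_le_by_tests)
 show "(\<lambda>x. u (x + z) - u x) \<in> square_integrable"
  by (intro sq_int_diff sq_int_translate u)
 show "0 \<le> norm (l2_of (\<lambda>x. g x \<bullet> z))" by simp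
 fix \<phi> :: "'a \<Rightarrow> real" assume \<phi>: "\<phi> \<in> test_functions"
 define \<Psi> where "\<Psi> s = (LBINT x. u x * \<phi> (x + s *\<^sub>R (- z)))" for s
 define D where "D s = (LBINT x. u x * deriv_at \<phi> (x + s *\<^sub>R (- z)) (- z))" for s
 have der: "(\<Psi> has_real_derivative D s) (at s)" for s
  unfolding \<Psi>_def D_def by (rule pairing_has_derivative[OF u \<phi>])
 have D: "\<bar>D s\<bar> \<le> norm (l2_of (\<lambda>x. g x \<bullet> z)) * norm (l2_of \<phi>)" for s
 proof -
  let ?\<psi> = "\<lambda>x. \<phi> (x + s *\<^sub>R (- z))"
  have \<psi>: "?\<psi> \<in> test_functions" by (rule test_translate[OF \<phi>])
  have "D s = (LBINT x. u x * deriv_at ?\<psi> x (- z))"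
   unfolding D_def frechet_derivative_translate(2)[OF test_differentiable(1)[OF \<phi>]] ..
  also have "\<dots> = - (LBINT x. (g x \<bullet> (- z)) * ?\<psi> x)"
   by (rule weak_gradient_direction[OF u g w \<psi>])
  also have "\<dots> = (LBINT x. (g x \<bullet> z) * ?\<psi> x)" by simp
  finally have "D s = (LBINT x. (g x \<bullet> z) * ?\<psi> x)" .
  then have "\<bar>D s\<bar> \<le> norm (l2_of (\<lambda>x. g x \<bullet> z)) * norm (l2_of ?\<psi>)"
   using l2_pairing_le[OF sq_int_inner[OF g] test_sq_int(1)[OF \<psi>], of z] by simp
  also have "norm (l2_of ?\<psi>) = norm (l2_of \<phi>)"
   by (rule norm_l2_translate[OF test_sq_int(1)[OF \<phi>]])
  finally show ?thesis .
 qed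
 obtain s where s: "\<Psi> 1 - \<Psi> 0 = (1 - 0) * D s"
  using MVT2[of 0 1 \<Psi> D] der by auto
 have um: "u \<in> borel_measurable borel" by (rule sq_intD[OF u])
 have \<phi>m: "\<phi> \<in> borel_measurable borel" by (rule test_measurable[OF \<phi>])
 have i: "integrable lborel (\<lambda>x. u (x + z) * \<phi> x)" "integrable lborel (\<lambda>x. u x * \<phi> x)"
  by (intro integrable_mult_sq_int u sq_int_translate test_sq_int \<phi>)+
 have "\<Psi> 1 = (LBINT x. u (x + z) * \<phi> x)"
  unfolding \<Psi>_def using integral_translate[of "\<lambda>x. u x * \<phi> (x - z)" z] um \<phi>m by simp
 moreover have "\<Psi> 0 = (LBINT x. u x * \<phi> x)" by (simp add: \<Psi>_def)
 ultimately have "(LBINT x. (u (x + z) - u x) * \<phi> x) = D s"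
  using s i by (simp add: left_diff_distrib)
 then show "\<bar>\<integral>x. (u (x + z) - u x) * \<phi> x \<partial>lborel\<bar> \<le> norm (l2_of (\<lambda>x. g x \<bullet> z)) * norm (l2_of \<phi>)"
  using D by simp
qed

text \<open>The functions \<open>u\<close> and \<open>u'\<close> may differ on a null set, so that
  gradients of different representatives, in particular the chosen \<open>weak_gradient\<close>, are
  identified.\<close>

lemma weak_gradient_unique:
 fixes u :: "'a::euclidean_space \<Rightarrow> real"
 assumes "g \<in> square_integrable" "g' \<in> square_integrable" "is_weak_gradient u g" "is_weak_gradient u' g'"
  and eq: "AE x in lborel. u x = u' x" and "u \<in> square_integrable" "u' \<in> square_integrable"
 shows "AE x in lborel. g x = g' x"
proof -
 have "AE x in lborel. \<forall>b\<in>Basis. (g x - g' x) \<bullet> b = 0"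
 proof (subst AE_finite_all)
  show "\<forall>b\<in>Basis. AE x in lborel. (g x - g' x) \<bullet> b = 0"
  proof
   fix b :: 'a assume b: "b \<in> Basis"
   let ?w = "\<lambda>x. (g x - g' x) \<bullet> b"
   have w: "?w \<in> square_integrable" by (intro sq_int_inner sq_int_diff assms)
   have "norm (l2_of ?w) \<le> 0"
   proof (rule square_integral_le_by_tests[OF w])
    fix \<phi> :: "'a \<Rightarrow> real" assume \<phi>: "\<phi> \<in> test_functions"
    have i: "integrable lborel (\<lambda>x. (g x \<bullet> b) * \<phi> x)" "integrable lborel (\<lambda>x. (g' x \<bullet> b) * \<phi> x)"
     by (intro integrable_mult_sq_int sq_int_inner assms test_sq_int \<phi>)+
    have "(LBINT x. u x * deriv_at \<phi> x b) = (LBINT x. u' x * deriv_at \<phi> x b)"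
     using test_measurable(2)[OF \<phi>] sq_intD[OF assms(6)] sq_intD[OF assms(7)] eq
     by (intro integral_cong_AE) auto
    then have "(LBINT x. (g x \<bullet> b) * \<phi> x) = (LBINT x. (g' x \<bullet> b) * \<phi> x)"
     using assms(3,4) \<phi> b unfolding is_weak_gradient_def by fastforce
    then show "\<bar>\<integral>x. ?w x * \<phi> x \<partial>lborel\<bar> \<le> 0 * norm (l2_of \<phi>)"
     using i by (simp add: inner_diff_left left_diff_distrib)
   qed simp
   then have "l2_of ?w = l2_of (\<lambda>x. 0)" by (simp add: l2_of_0)
   then show "AE x in lborel. ?w x = 0" by (simp add: l2_of_eq_iff[OF w sq_int_0])
  qed
 qed simp
 then show ?thesis
 proof eventually_elim
  case (elim x)
  show ?case by (rule euclidean_eqI) (use elim in \<open>simp add: inner_diff_left\<close>)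
 qed
qed

text \<open>The weak gradient is a limit of convex combinations of difference quotients.\<close>

lemma weak_gradient_from_differences:
 fixes u :: "'a::euclidean_space \<Rightarrow> real" and C :: "'a \<Rightarrow> real"
 assumes u: "u \<in> square_integrable" and C: "\<And>b. b \<in> Basis \<Longrightarrow> 0 \<le> C b"
  and d: "\<And>b h. b \<in> Basis \<Longrightarrow> norm (l2_of (\<lambda>x. u (x + h *\<^sub>R b) - u x)) \<le> \<bar>h\<bar> * C b"
 shows "\<exists>g\<in>square_integrable. is_weak_gradient u g \<and> (norm (l2_of g))\<^sup>2 \<le> (\<Sum>b\<in>Basis. (C b)\<^sup>2)"
proof -
 have um: "u \<in> borel_measurable borel" by (rule sq_intD[OF u])
 have diff: "(\<lambda>x. u (x + c) - u x) \<in> square_integrable" for c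
  by (intro sq_int_diff sq_int_translate u)
 have "\<exists>G. norm G \<le> C b \<and> (\<forall>\<phi>\<in>test_functions. G \<bullet> l2_of \<phi> = - (LBINT x. u x * deriv_at \<phi> x b))"
  if b: "b \<in> Basis" for b
 proof -
  define h where "h n = inverse (real (Suc n))" for n
  have h: "h n > 0" for n by (simp add: h_def)
  have h0: "h \<longlonglongrightarrow> 0" unfolding h_def by (rule LIMSEQ_inverse_real_of_nat)
  define X where "X n = inverse (h n) *\<^sub>R l2_of (\<lambda>x. u (x + h n *\<^sub>R b) - u x)" for n
  have XC: "norm (X n) \<le> C b" for n
  proof -
   have "norm (X n) \<le> inverse (h n) * (\<bar>h n\<bar> * C b)"
    unfolding X_def norm_scaleR using h[of n] by (intro mult_mono d b) auto
   then show ?thesis using h[of n] by (simp add: mult.assoc[symmetric])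
  qed
  obtain G Y where G: "\<And>n. Y n \<in> convex hull (X ` {n..})" "Y \<longlonglongrightarrow> G"
   by (rule bounded_convex_hull_limit[of X "C b", OF XC]) blast
  have "norm (Y n) \<le> C b" for n by (rule convex_hull_norm_le[OF _ G(1)[of n]]) (use XC in auto)
  then have "norm G \<le> C b" by (intro LIMSEQ_le_const2[OF tendsto_norm[OF G(2)]]) auto
  moreover have "G \<bullet> l2_of \<phi> = - (LBINT x. u x * deriv_at \<phi> x b)"
   if \<phi>: "\<phi> \<in> test_functions" for \<phi>
  proof (rule hull_limit_bounded_linear[OF _ G])
   show "bounded_linear (\<lambda>G. G \<bullet> l2_of \<phi>)" by (rule bounded_linear_inner_left)
   let ?\<Psi> = "\<lambda>s. \<integral>x. u x * \<phi> (x + s *\<^sub>R b) \<partial>lborel"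
   have \<phi>m: "\<phi> \<in> borel_measurable borel" by (rule test_measurable[OF \<phi>])
   \<comment> \<open>Moving the translation to the test function reverses the shift, whence the two
     minus signs.\<close>
   have eq: "X n \<bullet> l2_of \<phi> = - ((?\<Psi> (- h n) - ?\<Psi> 0) / (- h n))" for n
   proof -
    have i: "integrable lborel (\<lambda>x. u (x + h n *\<^sub>R b) * \<phi> x)" "integrable lborel (\<lambda>x. u x * \<phi> x)"
     by (intro integrable_mult_sq_int u sq_int_translate test_sq_int \<phi>)+
    have "X n \<bullet> l2_of \<phi> = inverse (h n) * (LBINT x. (u (x + h n *\<^sub>R b) - u x) * \<phi> x)"
     unfolding X_def by (simp add: l2_of_arith(4)[OF diff test_sq_int(1)[OF \<phi>]])
    also have "(LBINT x. (u (x + h n *\<^sub>R b) - u x) * \<phi> x) =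
     (LBINT x. u (x + h n *\<^sub>R b) * \<phi> x) - (LBINT x. u x * \<phi> x)"
     using i by (simp add: left_diff_distrib)
    also have "(LBINT x. u (x + h n *\<^sub>R b) * \<phi> x) = ?\<Psi> (- h n)"
     using integral_translate[of "\<lambda>x. u x * \<phi> (x - h n *\<^sub>R b)" "h n *\<^sub>R b"] um \<phi>m by simp
    finally show ?thesis using h[of n] by (simp add: field_simps)
   qed
   have "((\<lambda>s. (?\<Psi> s - ?\<Psi> 0) / s) \<longlongrightarrow> (LBINT x. u x * deriv_at \<phi> x b)) (at 0)"
    using pairing_has_derivative_0[OF u \<phi>, of b] by (simp add: has_field_derivative_iff)
   moreover have "filterlim (\<lambda>n. - h n) (at 0) sequentially"
    unfolding filterlim_at using h tendsto_minus[OF h0] by (auto simp: less_imp_neq[symmetric])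
   ultimately have "(\<lambda>n. (?\<Psi> (- h n) - ?\<Psi> 0) / (- h n)) \<longlonglongrightarrow> (LBINT x. u x * deriv_at \<phi> x b)"
    by (rule filterlim_compose)
   then show "(\<lambda>n. X n \<bullet> l2_of \<phi>) \<longlonglongrightarrow> - (LBINT x. u x * deriv_at \<phi> x b)"
    unfolding eq by (rule tendsto_minus)
  qed
  ultimately show ?thesis by blast
 qed
 then obtain G where G: "\<And>b. b \<in> Basis \<Longrightarrow> norm (G b) \<le> C b"
  "\<And>b \<phi>. b \<in> Basis \<Longrightarrow> \<phi> \<in> test_functions \<Longrightarrow> G b \<bullet> l2_of \<phi> = - (LBINT x. u x * deriv_at \<phi> x b)"
  by metis
 define g where "g x = (\<Sum>b\<in>Basis. l2_fun (G b) x *\<^sub>R b)" for x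
 have gb: "g x \<bullet> b = l2_fun (G b) x" if "b \<in> Basis" for x b
  using that by (simp add: g_def inner_sum_left inner_Basis if_distrib sum.delta cong: if_cong)
 have norm_g: "(norm (g x))\<^sup>2 = (\<Sum>b\<in>Basis. (norm (l2_fun (G b) x))\<^sup>2)" for x
  by (subst power2_norm_eq_inner, subst euclidean_inner) (simp add: gb power2_eq_square)
 have gm: "g \<in> borel_measurable borel" unfolding g_def by measurable
 have int: "integrable lborel (\<lambda>x. (norm (l2_fun (G b) x))\<^sup>2)" for b
  by (rule sq_intD[OF l2_fun_sq_int])
 have gs: "g \<in> square_integrable"
 proof -
  have "integrable lborel (\<lambda>x. (norm (g x))\<^sup>2)"
   unfolding norm_g by (intro Bochner_Integration.integrable_sum int)
  then show ?thesis using gm by (simp add: square_integrable_def)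
 qed
 have "is_weak_gradient u g"
  unfolding is_weak_gradient_def
 proof (intro ballI)
  fix \<phi> :: "'a \<Rightarrow> real" and b :: 'a assume \<phi>: "\<phi> \<in> test_functions" and b: "b \<in> Basis"
  show "(LBINT x. u x * deriv_at \<phi> x b) = - (LBINT x. (g x \<bullet> b) * \<phi> x)"
   using G(2)[OF b \<phi>] l2_of_arith(4)[OF l2_fun_sq_int test_sq_int(1)[OF \<phi>], of "G b"]
   by (simp add: gb[OF b])
 qed
 moreover have "(norm (l2_of g))\<^sup>2 \<le> (\<Sum>b\<in>Basis. (C b)\<^sup>2)"
 proof -
  have "(norm (l2_of g))\<^sup>2 = (\<Sum>b\<in>Basis. (norm (G b))\<^sup>2)"
   unfolding norm_l2_of[OF gs] norm_g norm_l2_eq[of "G b" for b] using int by (intro Bochner_Integration.integral_sum) auto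
  also have "\<dots> \<le> (\<Sum>b\<in>Basis. (C b)\<^sup>2)" by (intro sum_mono power_mono G) auto
  finally show ?thesis .
 qed
 ultimately show ?thesis using gs by blast
qed

section \<open>The Hilbert space $H^1$\<close>

text \<open>Orthogonality to this pair is the identity defining the weak derivative in direction
  \<open>b\<close>, tested with \<phi>.\<close>

definition weak_test :: "('a::euclidean_space \<Rightarrow> real) \<Rightarrow> 'a \<Rightarrow> ('a, real \<times> 'a) l2" where
 "weak_test \<phi> b = l2_of (\<lambda>x. (deriv_at \<phi> x b, \<phi> x *\<^sub>R b))"

text \<open>An element of $H^1$ is the class of a pair \<open>(u, g)\<close> for which \<open>g\<close> is a weak gradient of \<open>u\<close>.
 These pairs form a closed subspace of $L^2$.\<close>

typedef (overloaded) ('a::euclidean_space) h1 =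
 "{f :: ('a, real \<times> 'a) l2. \<forall>\<phi>\<in>test_functions. \<forall>b\<in>Basis. f \<bullet> weak_test \<phi> b = 0}"
 by (rule exI[of _ 0]) simp

setup_lifting type_definition_h1

instantiation h1 :: (euclidean_space) real_inner
begin

lift_definition zero_h1 :: "'a h1" is 0 by simp
lift_definition plus_h1 :: "'a h1 \<Rightarrow> 'a h1 \<Rightarrow> 'a h1" is "(+)" by (simp add: inner_add_left)
lift_definition minus_h1 :: "'a h1 \<Rightarrow> 'a h1 \<Rightarrow> 'a h1" is "(-)" by (simp add: inner_diff_left)
lift_definition uminus_h1 :: "'a h1 \<Rightarrow> 'a h1" is uminus by simp
lift_definition scaleR_h1 :: "real \<Rightarrow> 'a h1 \<Rightarrow> 'a h1" is scaleR by simp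
lift_definition inner_h1 :: "'a h1 \<Rightarrow> 'a h1 \<Rightarrow> real" is inner .

definition norm_h1 :: "'a h1 \<Rightarrow> real" where "norm_h1 f = sqrt (f \<bullet> f)"
definition dist_h1 :: "'a h1 \<Rightarrow> 'a h1 \<Rightarrow> real" where "dist_h1 f g = norm (f - g)"
definition sgn_h1 :: "'a h1 \<Rightarrow> 'a h1" where "sgn_h1 f = inverse (norm f) *\<^sub>R f"
definition uniformity_h1 :: "('a h1 \<times> 'a h1) filter" where
 "uniformity_h1 = (INF e\<in>{0<..}. principal {(x, y). dist x y < e})"
definition open_h1 :: "'a h1 set \<Rightarrow> bool" where
 "open_h1 U \<longleftrightarrow> (\<forall>x\<in>U. eventually (\<lambda>(x', y). x' = x \<longrightarrow> y \<in> U) uniformity)"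

instance
proof
 fix f g h :: "'a h1" and a b :: real
 show "f + g + h = f + (g + h)" by transfer (simp add: ac_simps)
 show "f + g = g + f" by transfer (simp add: ac_simps)
 show "0 + f = f" by transfer simp
 show "- f + f = 0" by transfer simp
 show "f - g = f + - g" by transfer simp
 show "a *\<^sub>R (f + g) = a *\<^sub>R f + a *\<^sub>R g" by transfer (simp add: scaleR_add_right)
 show "(a + b) *\<^sub>R f = a *\<^sub>R f + b *\<^sub>R f" by transfer (simp add: scaleR_add_left)
 show "a *\<^sub>R b *\<^sub>R f = (a * b) *\<^sub>R f" by transfer simp
 show "1 *\<^sub>R f = f" by transfer simp
 show "f \<bullet> g = g \<bullet> f" by transfer (simp add: inner_commute)
 show "(f + g) \<bullet> h = f \<bullet> h + g \<bullet> h" by transfer (simp add: inner_add_left)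
 show "(a *\<^sub>R f) \<bullet> g = a * (f \<bullet> g)" by transfer simp
 show "0 \<le> f \<bullet> f" by transfer simp
 show "f \<bullet> f = 0 \<longleftrightarrow> f = 0" by transfer simp
 show "norm f = sqrt (f \<bullet> f)" by (rule norm_h1_def)
 show "dist f g = norm (f - g)" by (rule dist_h1_def)
 show "sgn f = inverse (norm f) *\<^sub>R f" by (rule sgn_h1_def)
 show "(uniformity :: ('a h1 \<times> 'a h1) filter) = (INF e\<in>{0<..}. principal {(x, y). dist x y < e})"
  by (rule uniformity_h1_def)
 show "open U \<longleftrightarrow> (\<forall>x\<in>U. eventually (\<lambda>(x', y). x' = x \<longrightarrow> y \<in> U) uniformity)" for U :: "'a h1 set"
  by (rule open_h1_def)
qed

end

lemma norm_Rep_h1: "norm (Rep_h1 f) = norm f"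
 by (simp add: norm_eq_sqrt_inner inner_h1.rep_eq)

instance h1 :: (euclidean_space) complete_space
proof
 fix X :: "nat \<Rightarrow> 'a h1" assume X: "Cauchy X"
 have "norm (Rep_h1 (X m) - Rep_h1 (X n)) = norm (X m - X n)" for m n
  by (simp add: norm_Rep_h1[symmetric] minus_h1.rep_eq)
 then have "Cauchy (\<lambda>n. Rep_h1 (X n))"
  using X by (simp add: Cauchy_iff)
 then obtain f where f: "(\<lambda>n. Rep_h1 (X n)) \<longlonglongrightarrow> f"
  using Cauchy_convergent convergentD by blast
 have mem: "f \<bullet> weak_test \<phi> b = 0" if "\<phi> \<in> test_functions" "b \<in> Basis" for \<phi> b
 proof -
  have "(\<lambda>n. Rep_h1 (X n) \<bullet> weak_test \<phi> b) \<longlonglongrightarrow> f \<bullet> weak_test \<phi> b"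
   by (intro tendsto_intros f)
  moreover have "Rep_h1 (X n) \<bullet> weak_test \<phi> b = 0" for n
   using Rep_h1[of "X n"] that by auto
  ultimately show ?thesis by (simp add: LIMSEQ_const_iff)
 qed
 then have R: "Rep_h1 (Abs_h1 f) = f" by (intro Abs_h1_inverse) auto
 have "(\<lambda>n. norm (Rep_h1 (X n) - f)) \<longlonglongrightarrow> 0"
  using f by (simp add: tendsto_norm_zero_iff LIM_zero_iff)
 moreover have "norm (Rep_h1 (X n) - f) = norm (X n - Abs_h1 f)" for n
  by (simp add: norm_Rep_h1[symmetric] minus_h1.rep_eq R)
 ultimately have "X \<longlonglongrightarrow> Abs_h1 f"
  by (simp add: tendsto_norm_zero_iff LIM_zero_iff)
 then show "convergent X" by (auto simp: convergent_def)
qed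

definition h1_fun :: "'a::euclidean_space h1 \<Rightarrow> 'a \<Rightarrow> real" where
 "h1_fun h x = fst (l2_fun (Rep_h1 h) x)"

definition h1_grad :: "'a::euclidean_space h1 \<Rightarrow> 'a \<Rightarrow> 'a" where
 "h1_grad h x = snd (l2_fun (Rep_h1 h) x)"

lemma sq_int_Pair_iff:
 fixes u :: "'a::euclidean_space \<Rightarrow> 'b::euclidean_space" and g :: "'a \<Rightarrow> 'c::euclidean_space"
 shows "(\<lambda>x. (u x, g x)) \<in> square_integrable \<longleftrightarrow> u \<in> square_integrable \<and> g \<in> square_integrable"
proof
 assume p: "(\<lambda>x. (u x, g x)) \<in> square_integrable"
 have m: "u \<in> borel_measurable borel" "g \<in> borel_measurable borel"
 proof -
  have "(\<lambda>x. fst (u x, g x)) \<in> borel_measurable borel" "(\<lambda>x. snd (u x, g x)) \<in> borel_measurable borel"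
   by (intro borel_measurable_continuous_on[OF _ sq_intD(2)[OF p]] continuous_intros)+
  then show "u \<in> borel_measurable borel" "g \<in> borel_measurable borel" by simp_all
 qed
 have "(norm (u x))\<^sup>2 \<le> (norm (u x, g x))\<^sup>2" "(norm (g x))\<^sup>2 \<le> (norm (u x, g x))\<^sup>2" for x
  by (simp_all add: norm_Pair)
 then show "u \<in> square_integrable \<and> g \<in> square_integrable"
  using m by (auto intro!: sq_int_bound[OF _ sq_intD(3)[OF p]] always_eventually simp del: norm_Pair)
next
 assume a: "u \<in> square_integrable \<and> g \<in> square_integrable"
 show "(\<lambda>x. (u x, g x)) \<in> square_integrable"
 proof (rule sq_int_bound)
  show "integrable lborel (\<lambda>x. (norm (u x))\<^sup>2 + (norm (g x))\<^sup>2)" using a by (simp add: square_integrable_def)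
  show "(\<lambda>x. (u x, g x)) \<in> borel_measurable lborel"
   using a sq_intD(1)[of u] sq_intD(1)[of g] by (intro borel_measurable_Pair) auto
 qed (simp add: norm_Pair)
qed

lemma h1_sq_int: "h1_fun h \<in> square_integrable" "h1_grad h \<in> square_integrable"
proof -
 have "(\<lambda>x. (h1_fun h x, h1_grad h x)) \<in> square_integrable"
  using l2_fun_sq_int[of "Rep_h1 h"] by (simp add: h1_fun_def[abs_def] h1_grad_def[abs_def])
 then show "h1_fun h \<in> square_integrable" "h1_grad h \<in> square_integrable"
  by (simp_all add: sq_int_Pair_iff)
qed

lemma h1_measurable [measurable]:
 "h1_fun h \<in> borel_measurable borel" "h1_grad h \<in> borel_measurable borel"
 using sq_intD(2)[OF h1_sq_int(1)] sq_intD(2)[OF h1_sq_int(2)] by auto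

lemma weak_test_sq_int:
 assumes "\<phi> \<in> test_functions"
 shows "(\<lambda>x. (deriv_at \<phi> x b, \<phi> x *\<^sub>R b)) \<in> square_integrable"
proof -
 have "(\<lambda>x. \<phi> x *\<^sub>R b) \<in> square_integrable"
 proof (rule sq_int_bound)
  show "integrable lborel (\<lambda>x. (norm b)\<^sup>2 * (norm (\<phi> x))\<^sup>2)"
   using sq_intD(3)[OF test_sq_int(1)[OF assms]] by simp
  show "(\<lambda>x. \<phi> x *\<^sub>R b) \<in> borel_measurable lborel" using test_measurable(1)[OF assms] by simp
 qed (simp add: power_mult_distrib mult.commute)
 then show ?thesis unfolding sq_int_Pair_iff using test_sq_int[OF assms] by simp
qed

lemma weak_gradient_iff_inner:
 fixes u :: "'a::euclidean_space \<Rightarrow> real"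
 assumes u: "u \<in> square_integrable" and g: "g \<in> square_integrable"
 shows "is_weak_gradient u g \<longleftrightarrow> (\<forall>\<phi>\<in>test_functions. \<forall>b\<in>Basis. l2_of (\<lambda>x. (u x, g x)) \<bullet> weak_test \<phi> b = 0)"
proof -
 have "l2_of (\<lambda>x. (u x, g x)) \<bullet> weak_test \<phi> b =
   (LBINT x. u x * deriv_at \<phi> x b) + (LBINT x. (g x \<bullet> b) * \<phi> x)"
  if \<phi>: "\<phi> \<in> test_functions" for \<phi> b
 proof -
  have "(\<lambda>x. (u x, g x)) \<in> square_integrable" by (simp add: sq_int_Pair_iff u g)
  from l2_of_arith(4)[OF this weak_test_sq_int[OF \<phi>, of b]]
  have "l2_of (\<lambda>x. (u x, g x)) \<bullet> weak_test \<phi> b =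
    (LBINT x. u x * deriv_at \<phi> x b + (g x \<bullet> b) * \<phi> x)"
   by (simp add: weak_test_def mult.commute)
  also have "\<dots> = (LBINT x. u x * deriv_at \<phi> x b) + (LBINT x. (g x \<bullet> b) * \<phi> x)"
   by (intro Bochner_Integration.integral_add integrable_mult_sq_int u sq_int_inner g test_sq_int \<phi>)
  finally show ?thesis .
 qed
 then show ?thesis by (simp add: is_weak_gradient_def eq_neg_iff_add_eq_0)
qed

lemma h1_weak_gradient: "is_weak_gradient (h1_fun h) (h1_grad h)"
proof -
 have "l2_of (\<lambda>x. (h1_fun h x, h1_grad h x)) = Rep_h1 h"
  by (simp add: h1_fun_def h1_grad_def)
 then show ?thesis using Rep_h1[of h]
  by (simp add: weak_gradient_iff_inner h1_sq_int)
qed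

lemma h1_fun_H1: "h1_fun h \<in> H1"
 using h1_weak_gradient h1_sq_int by (auto simp: H1_def)

lemma weak_gradient_H1:
 assumes "u \<in> H1"
 shows "weak_gradient u \<in> square_integrable" "is_weak_gradient u (weak_gradient u)"
proof -
 have "\<exists>g. g \<in> square_integrable \<and> is_weak_gradient u g" using assms by (auto simp: H1_def)
 from someI_ex[OF this] show "weak_gradient u \<in> square_integrable" "is_weak_gradient u (weak_gradient u)"
  by (simp_all add: weak_gradient_def)
qed

lemma H1_sq_int: "u \<in> H1 \<Longrightarrow> u \<in> square_integrable"
 by (simp add: H1_def)

definition h1_of :: "('a::euclidean_space \<Rightarrow> real) \<Rightarrow> 'a h1" where
 "h1_of u = Abs_h1 (l2_of (\<lambda>x. (u x, weak_gradient u x)))"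

lemma h1_of_AE:
 assumes "u \<in> H1"
 shows "AE x in lborel. h1_fun (h1_of u) x = u x \<and> h1_grad (h1_of u) x = weak_gradient u x"
proof -
 have p: "(\<lambda>x. (u x, weak_gradient u x)) \<in> square_integrable"
  using weak_gradient_H1(1)[OF assms] H1_sq_int[OF assms] by (simp add: sq_int_Pair_iff)
 have "l2_of (\<lambda>x. (u x, weak_gradient u x)) \<in> {f. \<forall>\<phi>\<in>test_functions. \<forall>b\<in>Basis. f \<bullet> weak_test \<phi> b = 0}"
  using weak_gradient_iff_inner[OF H1_sq_int[OF assms] weak_gradient_H1(1)[OF assms]]
   weak_gradient_H1(2)[OF assms] by simp
 then have "Rep_h1 (h1_of u) = l2_of (\<lambda>x. (u x, weak_gradient u x))"
  unfolding h1_of_def by (rule Abs_h1_inverse)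
 with l2_fun_of_AE[OF p] show ?thesis
  by (auto elim!: eventually_mono simp: h1_fun_def h1_grad_def)
qed

lemma h1_fun_of_AE: "u \<in> H1 \<Longrightarrow> AE x in lborel. h1_fun (h1_of u) x = u x"
 and h1_grad_of_AE: "u \<in> H1 \<Longrightarrow> AE x in lborel. h1_grad (h1_of u) x = weak_gradient u x"
 using h1_of_AE[of u] by (auto elim: eventually_mono)

lemma h1_eqI:
 assumes "AE x in lborel. h1_fun h x = h1_fun k x"
 shows "h = k"
proof -
 have "AE x in lborel. h1_grad h x = h1_grad k x"
  by (rule weak_gradient_unique[OF h1_sq_int(2) h1_sq_int(2) h1_weak_gradient h1_weak_gradient assms
     h1_sq_int(1) h1_sq_int(1)])
 with assms have "AE x in lborel. l2_fun (Rep_h1 h) x = l2_fun (Rep_h1 k) x"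
  by eventually_elim (simp add: h1_fun_def h1_grad_def prod_eq_iff)
 then show ?thesis using l2_eqI Rep_h1_inject by blast
qed

lemma h1_of_fun [simp]: "h1_of (h1_fun h) = h"
 by (rule h1_eqI[OF h1_fun_of_AE[OF h1_fun_H1]])

lemma inner_h1_eq: "h \<bullet> k = (LBINT x. h1_grad h x \<bullet> h1_grad k x + h1_fun h x * h1_fun k x)"
 by (simp add: inner_h1.rep_eq inner_l2_eq h1_fun_def h1_grad_def inner_prod_def add.commute)

lemma H1_inner_eq:
 assumes "u \<in> H1" "w \<in> H1"
 shows "(LBINT x. weak_gradient u x \<bullet> weak_gradient w x + u x * w x) = h1_of u \<bullet> h1_of w"
 unfolding inner_h1_eq
proof (rule integral_cong_AE)
 show "AE x in lborel. weak_gradient u x \<bullet> weak_gradient w x + u x * w x =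
   h1_grad (h1_of u) x \<bullet> h1_grad (h1_of w) x + h1_fun (h1_of u) x * h1_fun (h1_of w) x"
  using h1_of_AE[OF assms(1)] h1_of_AE[OF assms(2)] by eventually_elim simp
qed (use assms[THEN weak_gradient_H1(1), THEN sq_intD(1)]
   assms[THEN H1_sq_int, THEN sq_intD(1)] in measurable)

lemma norm_h1_eq: "(norm h)\<^sup>2 = (norm (l2_of (h1_grad h)))\<^sup>2 + (norm (l2_of (h1_fun h)))\<^sup>2"
 unfolding power2_norm_eq_inner inner_h1_eq
 using l2_of_arith(4)[OF h1_sq_int(2) h1_sq_int(2), of h h]
  l2_of_arith(4)[OF h1_sq_int(1) h1_sq_int(1), of h h]
  integrable_inner[OF h1_sq_int(2) h1_sq_int(2), of h h]
  integrable_inner[OF h1_sq_int(1) h1_sq_int(1), of h h]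
 by simp

lemma h1_fun_norm_le: "norm (l2_of (h1_fun h)) \<le> norm h" "norm (l2_of (h1_grad h)) \<le> norm h"
 by (rule power2_le_imp_le; simp add: norm_h1_eq[of h])+

lemma h1_fun_arith_AE:
 shows "AE x in lborel. h1_fun (h + k) x = h1_fun h x + h1_fun k x"
  "AE x in lborel. h1_fun (h - k) x = h1_fun h x - h1_fun k x"
  "AE x in lborel. h1_fun (c *\<^sub>R h) x = c * h1_fun h x"
proof -
 show "AE x in lborel. h1_fun (h + k) x = h1_fun h x + h1_fun k x"
  using l2_fun_arith_AE(1)[of "Rep_h1 h" "Rep_h1 k"]
  by eventually_elim (simp add: h1_fun_def plus_h1.rep_eq)
 show "AE x in lborel. h1_fun (h - k) x = h1_fun h x - h1_fun k x"
  using l2_fun_arith_AE(2)[of "Rep_h1 h" "Rep_h1 k"]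
  by eventually_elim (simp add: h1_fun_def minus_h1.rep_eq)
 show "AE x in lborel. h1_fun (c *\<^sub>R h) x = c * h1_fun h x"
  using l2_fun_arith_AE(3)[of c "Rep_h1 h"]
  by eventually_elim (simp add: h1_fun_def scaleR_h1.rep_eq)
qed

lemma h1_fun_0_AE: "AE x in lborel. h1_fun (0 :: 'a::euclidean_space h1) x = 0"
 unfolding h1_fun_def zero_h1.rep_eq by (rule eventually_mono[OF l2_fun_0_AE[where 'a = 'a and 'b = "real \<times> 'a"]]) simp

lemma h1_fun_uminus_AE: "AE x in lborel. h1_fun (- h) x = - h1_fun h x"
 using h1_fun_arith_AE(3)[of "-1" h] by simp

lemma h1_eq_0_iff: "h = 0 \<longleftrightarrow> (AE x in lborel. h1_fun h x = 0)"
proof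
 show "AE x in lborel. h1_fun h x = 0" if "h = 0" using that h1_fun_0_AE by simp
 assume "AE x in lborel. h1_fun h x = 0"
 with h1_fun_0_AE have "AE x in lborel. h1_fun h x = h1_fun 0 x" by eventually_elim simp
 then show "h = 0" by (rule h1_eqI)
qed

lemma H1_add: "u \<in> H1 \<Longrightarrow> w \<in> H1 \<Longrightarrow> (\<lambda>x. u x + w x) \<in> H1"
 and h1_of_add: "u \<in> H1 \<Longrightarrow> w \<in> H1 \<Longrightarrow> h1_of (\<lambda>x. u x + w x) = h1_of u + h1_of w"
proof -
 assume u: "u \<in> H1" and w: "w \<in> H1"
 note uw = H1_sq_int[OF u] H1_sq_int[OF w]
 note g = weak_gradient_H1[OF u] weak_gradient_H1[OF w]
 have "is_weak_gradient (\<lambda>x. u x + w x) (\<lambda>x. weak_gradient u x + weak_gradient w x)"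
  unfolding is_weak_gradient_def
 proof (intro ballI)
  fix \<phi> :: "'a \<Rightarrow> real" and b :: 'a assume \<phi>: "\<phi> \<in> test_functions" and b: "b \<in> Basis"
  note i = integrable_mult_sq_int[OF uw(1) test_sq_int(2)[OF \<phi>, of b]]
   integrable_mult_sq_int[OF uw(2) test_sq_int(2)[OF \<phi>, of b]]
   integrable_mult_sq_int[OF sq_int_inner[OF g(1), of b] test_sq_int(1)[OF \<phi>]]
   integrable_mult_sq_int[OF sq_int_inner[OF g(3), of b] test_sq_int(1)[OF \<phi>]]
  have "(LBINT x. (u x + w x) * deriv_at \<phi> x b) =
    (LBINT x. u x * deriv_at \<phi> x b) + (LBINT x. w x * deriv_at \<phi> x b)"
   using i by (simp add: distrib_right)
  also have "\<dots> = - (LBINT x. (weak_gradient u x \<bullet> b) * \<phi> x) + - (LBINT x. (weak_gradient w x \<bullet> b) * \<phi> x)"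
   using g(2,4) \<phi> b by (simp add: is_weak_gradient_def)
  also have "\<dots> = - (LBINT x. ((weak_gradient u x + weak_gradient w x) \<bullet> b) * \<phi> x)"
   using i by (simp add: inner_add_left distrib_right)
  finally show "(LBINT x. (u x + w x) * deriv_at \<phi> x b) =
    - (LBINT x. ((weak_gradient u x + weak_gradient w x) \<bullet> b) * \<phi> x)" .
 qed
 then show H: "(\<lambda>x. u x + w x) \<in> H1"
  using sq_int_add[OF uw] sq_int_add[OF g(1) g(3)] by (auto simp: H1_def)
 show "h1_of (\<lambda>x. u x + w x) = h1_of u + h1_of w"
 proof (rule h1_eqI)
  show "AE x in lborel. h1_fun (h1_of (\<lambda>x. u x + w x)) x = h1_fun (h1_of u + h1_of w) x"
   using h1_fun_of_AE[OF H] h1_fun_of_AE[OF u] h1_fun_of_AE[OF w] h1_fun_arith_AE(1)[of "h1_of u" "h1_of w"]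
   by eventually_elim simp
 qed
qed

text \<open>Differences of |u| are pointwise at most those of u, so |u| inherits the bounds on
  difference quotients in every basis direction. The gradient norm does not increase, because the
  squares of these directional bounds add up to the squared norm of the gradient of u.\<close>

lemma h1_abs:
 fixes h :: "'a::euclidean_space h1"
 obtains k where "AE x in lborel. h1_fun k x = \<bar>h1_fun h x\<bar>" "norm k \<le> norm h"
proof -
 let ?u = "\<lambda>x. \<bar>h1_fun h x\<bar>"
 note h = h1_sq_int[of h]
 have u: "?u \<in> square_integrable" using h(1) by (simp add: square_integrable_def)
 define C where "C b = norm (l2_of (\<lambda>x. h1_grad h x \<bullet> b))" for b
 have nu: "norm (l2_of (\<lambda>x. ?u (x + t *\<^sub>R b) - ?u x)) \<le> \<bar>t\<bar> * C b" for t b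
 proof -
  have "norm (l2_of (\<lambda>x. ?u (x + t *\<^sub>R b) - ?u x)) \<le> norm (l2_of (\<lambda>x. h1_fun h (x + t *\<^sub>R b) - h1_fun h x))"
  proof (rule power2_le_imp_le)
   have s: "(\<lambda>x. ?u (x + t *\<^sub>R b) - ?u x) \<in> square_integrable"
    "(\<lambda>x. h1_fun h (x + t *\<^sub>R b) - h1_fun h x) \<in> square_integrable"
    by (intro sq_int_diff sq_int_translate[OF u] u sq_int_translate[OF h(1)] h(1))+
   show "(norm (l2_of (\<lambda>x. ?u (x + t *\<^sub>R b) - ?u x)))\<^sup>2 \<le> (norm (l2_of (\<lambda>x. h1_fun h (x + t *\<^sub>R b) - h1_fun h x)))\<^sup>2"
    unfolding norm_l2_of[OF s(1)] norm_l2_of[OF s(2)]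
    by (intro integral_mono sq_intD s power_mono) auto
  qed simp
  also have "\<dots> \<le> norm (l2_of (\<lambda>x. h1_grad h x \<bullet> (t *\<^sub>R b)))"
   by (rule translation_estimate[OF h h1_weak_gradient])
  also have "\<dots> = \<bar>t\<bar> * C b"
   using l2_of_arith(3)[OF sq_int_inner[OF h(2), of b] sq_int_inner[OF h(2), of b], of t]
   by (simp add: C_def flip: norm_scaleR)
  finally show ?thesis .
 qed
 obtain g where g: "g \<in> square_integrable" "is_weak_gradient ?u g" "(norm (l2_of g))\<^sup>2 \<le> (\<Sum>b\<in>Basis. (C b)\<^sup>2)"
  using weak_gradient_from_differences[OF u _ nu] unfolding C_def by auto
 have H: "?u \<in> H1" using u g by (auto simp: H1_def)
 let ?k = "h1_of ?u"
 have k: "AE x in lborel. h1_fun ?k x = ?u x" by (rule h1_fun_of_AE[OF H])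
 have "AE x in lborel. h1_grad ?k x = g x"
  by (rule weak_gradient_unique[OF h1_sq_int(2) g(1) h1_weak_gradient g(2) k h1_sq_int(1) u])
 then have kg: "l2_of (h1_grad ?k) = l2_of g" by (simp add: l2_of_eq_iff h1_sq_int g)
 have ku: "l2_of (h1_fun ?k) = l2_of ?u" using k by (simp add: l2_of_eq_iff h1_sq_int u)
 have "(\<Sum>b\<in>Basis. (C b)\<^sup>2) = (norm (l2_of (h1_grad h)))\<^sup>2"
 proof -
  have "(\<Sum>b\<in>Basis. (C b)\<^sup>2) = (\<Sum>b\<in>Basis. \<integral>x. (norm (h1_grad h x \<bullet> b))\<^sup>2 \<partial>lborel)"
   unfolding C_def by (intro sum.cong refl norm_l2_of sq_int_inner h)
  also have "\<dots> = (LBINT x. (\<Sum>b\<in>Basis. (norm (h1_grad h x \<bullet> b))\<^sup>2))"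
   by (intro Bochner_Integration.integral_sum[symmetric] sq_intD sq_int_inner h)
  also have "(\<lambda>x. \<Sum>b\<in>Basis. (norm (h1_grad h x \<bullet> b))\<^sup>2) = (\<lambda>x. (norm (h1_grad h x))\<^sup>2)"
   by (rule ext, subst power2_norm_eq_inner, subst euclidean_inner) (simp add: power2_eq_square)
  also have "(LBINT x. (norm (h1_grad h x))\<^sup>2) = (norm (l2_of (h1_grad h)))\<^sup>2"
   by (rule norm_l2_of[OF h(2), symmetric])
  finally show ?thesis .
 qed
 moreover have "(norm (l2_of ?u))\<^sup>2 = (norm (l2_of (h1_fun h)))\<^sup>2"
  using norm_l2_of[OF u] norm_l2_of[OF h(1)] by simp
 ultimately have "(norm ?k)\<^sup>2 \<le> (norm h)\<^sup>2"
  unfolding norm_h1_eq kg ku using g(3) by simp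
 then have "norm ?k \<le> norm h" using power2_le_imp_le norm_ge_zero by blast
 with k show ?thesis by (rule that)
qed

section \<open>The subcritical Sobolev embedding\<close>

lemma nn_integral_le_imp:
 fixes f :: "'b \<Rightarrow> real"
 assumes "f \<in> borel_measurable M" "\<And>x. 0 \<le> f x" "0 \<le> X" "(\<integral>\<^sup>+x. ennreal (f x) \<partial>M) \<le> ennreal X"
 shows "integrable M f" "(\<integral>x. f x \<partial>M) \<le> X"
proof -
 show i: "integrable M f"
  using assms by (intro integrableI_bounded) (auto simp: less_top[symmetric] top_unique)
 have "ennreal (\<integral>x. f x \<partial>M) \<le> ennreal X"
  using nn_integral_eq_integral[OF i] assms by simp
 then show "(\<integral>x. f x \<partial>M) \<le> X" using assms(3) by simp
qed

section \<open>Averages over half-open dyadic cubes\<close>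

definition cell :: "nat \<Rightarrow> 'a::euclidean_space \<Rightarrow> 'a set" where
 "cell k x = {y. \<forall>b\<in>Basis. \<lfloor>2 ^ k * (y \<bullet> b)\<rfloor> = \<lfloor>2 ^ k * (x \<bullet> b)\<rfloor>}"

definition cell_vol :: "'a::euclidean_space itself \<Rightarrow> nat \<Rightarrow> real" where
 "cell_vol _ k = (1 / 2 ^ k) ^ DIM('a)"

definition cell_avg :: "nat \<Rightarrow> ('a::euclidean_space \<Rightarrow> real) \<Rightarrow> 'a \<Rightarrow> real" where
 "cell_avg k v x = (LBINT y. indicator (cell k x) y * v y) / cell_vol TYPE('a) k"

lemma cell_vol_pos: "0 < cell_vol TYPE('a::euclidean_space) k"
 by (simp add: cell_vol_def)

lemma cell_eq: "y \<in> cell k x \<Longrightarrow> cell k y = cell k x"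
 by (auto simp: cell_def)

lemma cell_avg_eq: "y \<in> cell k x \<Longrightarrow> cell_avg k v y = cell_avg k v x"
 by (simp add: cell_avg_def cell_eq)

text \<open>The coarser floor is the finer one divided by 2, so the cubes are nested.\<close>

lemma cell_Suc: "cell (Suc k) x \<subseteq> cell k (x :: 'a::euclidean_space)"
proof
 fix y assume y: "y \<in> cell (Suc k) x"
 have half: "\<lfloor>t / 2\<rfloor> = \<lfloor>t\<rfloor> div 2" for t :: real
  using floor_divide_real_eq_div[of 2 t] by simp
 have "\<lfloor>2 ^ k * (y \<bullet> b)\<rfloor> = \<lfloor>2 ^ k * (x \<bullet> b)\<rfloor>" if "b \<in> Basis" for b
 proof -
  have "\<lfloor>2 ^ k * (z \<bullet> b)\<rfloor> = \<lfloor>2 ^ Suc k * (z \<bullet> b)\<rfloor> div 2" for z :: 'a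
   using half[of "2 ^ Suc k * (z \<bullet> b)"] by simp
  then show ?thesis using y that by (simp add: cell_def)
 qed
 then show "y \<in> cell k x" by (simp add: cell_def)
qed

lemma cell_rel_measurable [measurable]:
 "Measurable.pred (borel \<Otimes>\<^sub>M borel) (\<lambda>p :: 'a::euclidean_space \<times> 'a. snd p \<in> cell k (fst p))"
 unfolding cell_def mem_Collect_eq by measurable

lemma cell_sets [measurable]: "cell k x \<in> sets borel"
proof -
 have "(\<lambda>y. (x, y)) \<in> borel \<rightarrow>\<^sub>M borel \<Otimes>\<^sub>M borel" by simp
 from measurable_compose[OF this cell_rel_measurable[of k]]
 have "Measurable.pred borel (\<lambda>y. y \<in> cell k x)" by simp
 then show ?thesis by (simp add: pred_def)
qed

lemma cell_near:
 assumes "y \<in> cell k x"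
 shows "y - x \<in> cbox (- (1 / 2 ^ k) *\<^sub>R One) ((1 / 2 ^ k) *\<^sub>R One)"
proof -
 have "\<bar>(y - x) \<bullet> b\<bar> \<le> 1 / 2 ^ k" if "b \<in> Basis" for b
 proof -
  have "\<lfloor>2 ^ k * (y \<bullet> b)\<rfloor> = \<lfloor>2 ^ k * (x \<bullet> b)\<rfloor>" using assms that by (simp add: cell_def)
  then have "\<bar>2 ^ k * (y \<bullet> b) - 2 ^ k * (x \<bullet> b)\<bar> \<le> 1" by linarith
  then have "2 ^ k * \<bar>(y - x) \<bullet> b\<bar> \<le> 1"
   by (simp add: inner_diff_left abs_mult flip: right_diff_distrib)
  then show ?thesis by (simp add: field_simps)
 qed
 then show ?thesis by (auto simp: mem_box abs_le_iff minus_le_iff)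
qed

lemma emeasure_cell: "emeasure lborel (cell k (x :: 'a::euclidean_space)) = ennreal (cell_vol TYPE('a) k)"
proof -
 let ?l = "\<Sum>b\<in>Basis. (real_of_int \<lfloor>2 ^ k * (x \<bullet> b)\<rfloor> / 2 ^ k) *\<^sub>R b"
 let ?u = "\<Sum>b\<in>Basis. ((real_of_int \<lfloor>2 ^ k * (x \<bullet> b)\<rfloor> + 1) / 2 ^ k) *\<^sub>R b"
 have l: "?l \<bullet> b = real_of_int \<lfloor>2 ^ k * (x \<bullet> b)\<rfloor> / 2 ^ k" if "b \<in> Basis" for b
  using that by (simp add: inner_sum_left inner_Basis if_distrib sum.delta cong: if_cong)
 have u: "?u \<bullet> b = (real_of_int \<lfloor>2 ^ k * (x \<bullet> b)\<rfloor> + 1) / 2 ^ k" if "b \<in> Basis" for b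
  using that by (simp add: inner_sum_left inner_Basis if_distrib sum.delta cong: if_cong)
 have lu: "?l \<bullet> b \<le> ?u \<bullet> b" if "b \<in> Basis" for b
  using l[OF that] u[OF that] by (simp add: divide_right_mono)
 have ul: "(?u - ?l) \<bullet> b = 1 / 2 ^ k" if "b \<in> Basis" for b
  using l[OF that] u[OF that] by (simp add: inner_diff_left add_divide_distrib)
 have fl: "\<lfloor>t\<rfloor> = m \<longleftrightarrow> real_of_int m \<le> t \<and> t < real_of_int m + 1" for t :: real and m
  by (auto simp: floor_eq_iff)
 have cellI: "y \<in> cell k x \<longleftrightarrow> (\<forall>b\<in>Basis. ?l \<bullet> b \<le> y \<bullet> b \<and> y \<bullet> b < ?u \<bullet> b)" for y
 proof -
  have "(\<lfloor>2 ^ k * (y \<bullet> b)\<rfloor> = \<lfloor>2 ^ k * (x \<bullet> b)\<rfloor>) \<longleftrightarrow> (?l \<bullet> b \<le> y \<bullet> b \<and> y \<bullet> b < ?u \<bullet> b)" if "b \<in> Basis" for b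
   unfolding l[OF that] u[OF that] fl by (simp add: divide_le_eq less_divide_eq mult.commute)
  then show ?thesis by (simp add: cell_def)
 qed
 have "box ?l ?u \<subseteq> cell k x" "cell k x \<subseteq> cbox ?l ?u"
  unfolding subset_iff cellI mem_box by (auto intro: less_imp_le)
 then have "emeasure lborel (box ?l ?u) \<le> emeasure lborel (cell k x)"
  "emeasure lborel (cell k x) \<le> emeasure lborel (cbox ?l ?u)"
  by (auto intro!: emeasure_mono)
 moreover have "(\<Prod>b\<in>Basis. (?u - ?l) \<bullet> b) = cell_vol TYPE('a) k"
  by (simp add: ul cell_vol_def del: power_one_over)
 ultimately show ?thesis using lu by (simp add: emeasure_lborel_box emeasure_lborel_cbox antisym)
qed

lemma indicator_cell_sq_int: "(indicator (cell k x) :: 'a::euclidean_space \<Rightarrow> real) \<in> square_integrable"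
 by (rule indicator_sq_int) (auto simp: emeasure_cell)

lemma norm_indicator_cell: "(norm (l2_of (indicator (cell k (x::'a::euclidean_space)) :: 'a \<Rightarrow> real)))\<^sup>2 = cell_vol TYPE('a) k"
proof -
 have "(norm (l2_of (indicator (cell k x) :: 'a \<Rightarrow> real)))\<^sup>2 = (LBINT y. (norm (indicator (cell k x) y :: real))\<^sup>2)"
  by (rule norm_l2_of[OF indicator_cell_sq_int])
 also have "(\<lambda>y. (norm (indicator (cell k x) y :: real))\<^sup>2) = indicator (cell k x)" by (auto simp: indicator_def)
 finally show ?thesis
  using emeasure_cell[of k x] cell_vol_pos[where 'a='a, of k] by (simp add: measure_def)
qed

lemma cell_avg_inner:
 fixes v :: "'a::euclidean_space \<Rightarrow> real"
 assumes "v \<in> square_integrable"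
 shows "cell_avg k v x = (l2_of v \<bullet> l2_of (indicator (cell k x))) / cell_vol TYPE('a) k"
 unfolding cell_avg_def by (simp add: l2_of_arith(4)[OF assms indicator_cell_sq_int] mult.commute)

lemma cell_avg_measurable [measurable]:
 fixes v :: "'a::euclidean_space \<Rightarrow> real"
 assumes [measurable]: "v \<in> borel_measurable borel"
 shows "cell_avg k v \<in> borel_measurable borel"
proof -
 have [measurable]: "(\<lambda>p :: 'a \<times> 'a. indicator (cell k (fst p)) (snd p) :: real) \<in> borel_measurable (borel \<Otimes>\<^sub>M lborel)"
 proof -
  have "(\<lambda>p :: 'a \<times> 'a. if snd p \<in> cell k (fst p) then 1 else 0 :: real) \<in> borel_measurable (borel \<Otimes>\<^sub>M borel)"
   by measurable
  then show ?thesis by (simp add: indicator_def of_bool_def cong: if_cong measurable_cong_sets)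
 qed
 have "(\<lambda>x. \<integral>y. indicator (cell k x) y * v y \<partial>lborel) \<in> borel_measurable borel"
 proof (rule lborel.borel_measurable_lebesgue_integral)
  have "(\<lambda>p. indicator (cell k (fst p)) (snd p) * v (snd p)) \<in> borel_measurable (borel \<Otimes>\<^sub>M lborel)"
   by measurable
  then show "case_prod (\<lambda>x y. indicator (cell k x) y * v y) \<in> borel_measurable (borel \<Otimes>\<^sub>M lborel)"
   by (simp add: case_prod_beta')
 qed
 then show ?thesis unfolding cell_avg_def[abs_def] by simp
qed

text \<open>Cauchy-Schwarz bounds the deviation from the average by the mean square of v(x) - v(y)
  over the cell. With y = x + z the cell is enlarged to a cube of shifts \<open>z\<close> that does
  not depend on \<open>x\<close>, which prepares the exchange of integrals.\<close>

lemma cell_avg_diff_le: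
 fixes v :: "'a::euclidean_space \<Rightarrow> real"
 assumes v: "v \<in> square_integrable"
 shows "ennreal ((v x - cell_avg k v x)\<^sup>2) \<le>
  ennreal (1 / cell_vol TYPE('a) k) *
   (\<integral>\<^sup>+z. indicator (cbox (- (1 / 2 ^ k) *\<^sub>R One) ((1 / 2 ^ k) *\<^sub>R One)) z * ennreal ((v (x + z) - v x)\<^sup>2) \<partial>lborel)"
proof -
 have [measurable]: "v \<in> borel_measurable borel" by (rule sq_intD[OF v])
 let ?V = "cell_vol TYPE('a) k"
 let ?c = "indicator (cell k x) :: 'a \<Rightarrow> real"
 let ?f = "\<lambda>y. ?c y * (v x - v y)"
 note V = cell_vol_pos[where 'a='a, of k]
 have cs: "?c \<in> square_integrable" by (rule indicator_cell_sq_int)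
 have fs: "?f \<in> square_integrable"
 proof (rule sq_int_bound)
  have "(\<lambda>y. v x * ?c y - v y) \<in> square_integrable"
   using sq_int_diff[OF sq_int_scaleR[OF cs, of "v x"] v] by simp
  then show "integrable lborel (\<lambda>y. (norm (v x * ?c y - v y))\<^sup>2)" by (rule sq_intD)
  show "AE y in lborel. (norm (?f y))\<^sup>2 \<le> (norm (v x * ?c y - v y))\<^sup>2" by (auto simp: indicator_def)
 qed measurable
 have "?V * (v x - cell_avg k v x) = l2_of ?f \<bullet> l2_of ?c"
 proof -
  have "l2_of ?f \<bullet> l2_of ?c = (LBINT y. v x * (?c y * ?c y) - v y * ?c y)"
   unfolding l2_of_arith(4)[OF fs cs]
   by (intro Bochner_Integration.integral_cong) (auto simp: indicator_def)
  also have "\<dots> = v x * (LBINT y. ?c y * ?c y) - (LBINT y. v y * ?c y)"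
   using integrable_mult_sq_int[OF cs cs] integrable_mult_sq_int[OF v cs] by simp
  also have "(LBINT y. ?c y * ?c y) = ?V"
   using norm_indicator_cell[of k x] by (simp add: power2_norm_eq_inner l2_of_arith(4)[OF cs cs])
  also have "(LBINT y. v y * ?c y) = ?V * cell_avg k v x"
   using V by (simp add: cell_avg_def mult.commute)
  finally show ?thesis by (simp add: algebra_simps)
 qed
 then have "(?V * (v x - cell_avg k v x))\<^sup>2 \<le> (norm (l2_of ?f))\<^sup>2 * (norm (l2_of ?c))\<^sup>2"
  using Cauchy_Schwarz_ineq[of "l2_of ?f" "l2_of ?c"] by (simp add: power2_norm_eq_inner)
 then have "?V * (?V * (v x - cell_avg k v x)\<^sup>2) \<le> ?V * (norm (l2_of ?f))\<^sup>2"
  unfolding norm_indicator_cell by (simp add: power_mult_distrib power2_eq_square mult_ac)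
 then have "?V * (v x - cell_avg k v x)\<^sup>2 \<le> (norm (l2_of ?f))\<^sup>2" using V by simp
 then have "(v x - cell_avg k v x)\<^sup>2 \<le> 1 / ?V * (norm (l2_of ?f))\<^sup>2"
  using V by (simp add: field_simps)
 then have "ennreal ((v x - cell_avg k v x)\<^sup>2) \<le> ennreal (1 / ?V) * ennreal ((norm (l2_of ?f))\<^sup>2)"
  using V by (subst ennreal_mult[symmetric]) (auto intro: ennreal_leI)
 also have "ennreal ((norm (l2_of ?f))\<^sup>2) = nn_int (\<lambda>y. (norm (?f y))\<^sup>2)"
  by (rule nn_norm_l2_of[OF fs, symmetric])
 also have "\<dots> = nn_int (\<lambda>z. (norm (?f (z + x)))\<^sup>2)"
  by (rule nn_integral_translate[symmetric]) measurable
 also have "\<dots> \<le> (\<integral>\<^sup>+z. indicator (cbox (- (1 / 2 ^ k) *\<^sub>R One) ((1 / 2 ^ k) *\<^sub>R One)) z * ennreal ((v (x + z) - v x)\<^sup>2) \<partial>lborel)"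
 proof (rule nn_integral_mono)
  fix z
  show "ennreal ((norm (?f (z + x)))\<^sup>2) \<le> indicator (cbox (- (1 / 2 ^ k) *\<^sub>R One) ((1 / 2 ^ k) *\<^sub>R One)) z * ennreal ((v (x + z) - v x)\<^sup>2)"
  proof (cases "z + x \<in> cell k x")
   case True
   then have "z \<in> cbox (- (1 / 2 ^ k) *\<^sub>R One) ((1 / 2 ^ k) *\<^sub>R One)"
    using cell_near[of "z + x" k x] by simp
   then show ?thesis using True by (simp add: add.commute power2_commute)
  qed simp
 qed
 finally show ?thesis by (simp add: mult_left_mono)
qed

text \<open>The factor 2^N compares the volume of the cube of shifts, of side 2 * 2^(-k), with that
  of a cell; the factor N bounds 4^k |z|^2 on that cube.\<close>

definition cell_const :: "'a::euclidean_space itself \<Rightarrow> real" where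
 "cell_const _ = 2 ^ DIM('a) * real DIM('a)"

lemma cell_const_pos: "0 < cell_const TYPE('a::euclidean_space)"
 by (simp add: cell_const_def)

text \<open>After the exchange of integrals the inner integral is the squared norm of a difference
  of translates, which \<open>translation_estimate\<close> bounds by |z|^2 times the squared norm of
  the gradient.\<close>

lemma cell_poincare:
 fixes h :: "'a::euclidean_space h1"
 shows "nn_int (\<lambda>x. (h1_fun h x - cell_avg k (h1_fun h) x)\<^sup>2)
  \<le> ennreal (cell_const TYPE('a) * (1 / 4 ^ k) * (norm h)\<^sup>2)"
proof -
 let ?v = "h1_fun h"
 let ?V = "cell_vol TYPE('a) k"
 let ?Q = "cbox (- (1 / 2 ^ k) *\<^sub>R One) ((1 / 2 ^ k) *\<^sub>R One) :: 'a set"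
 note V = cell_vol_pos[where 'a='a, of k]
 note v = h1_sq_int(1)[of h]
 have [measurable]: "?Q \<in> sets borel" by simp
 have est: "nn_int (\<lambda>x. (?v (x + z) - ?v x)\<^sup>2) \<le> ennreal (real DIM('a) * (1 / 4 ^ k) * (norm h)\<^sup>2)"
  if "z \<in> ?Q" for z
 proof -
  have s: "(\<lambda>x. ?v (x + z) - ?v x) \<in> square_integrable"
   by (intro sq_int_diff sq_int_translate v)
  have g: "(\<lambda>x. h1_grad h x \<bullet> z) \<in> square_integrable"
   by (intro sq_int_inner h1_sq_int)
  have z: "(norm z)\<^sup>2 \<le> real DIM('a) * (1 / 4 ^ k)"
  proof -
   have "(norm z)\<^sup>2 = (\<Sum>b\<in>Basis. (z \<bullet> b)\<^sup>2)"
    by (subst power2_norm_eq_inner, subst euclidean_inner) (simp add: power2_eq_square)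
   also have "\<dots> \<le> (\<Sum>b\<in>(Basis :: 'a set). 1 / 4 ^ k)"
   proof (rule sum_mono)
    fix b :: 'a assume "b \<in> Basis"
    then have "\<bar>z \<bullet> b\<bar> \<le> 1 / 2 ^ k" using that by (auto simp: mem_box abs_le_iff)
    then have "\<bar>z \<bullet> b\<bar>\<^sup>2 \<le> (1 / 2 ^ k)\<^sup>2" by (rule power_mono) simp
    also have "(1 / 2 ^ k)\<^sup>2 = (1 / 4 ^ k :: real)" by (simp add: power_divide power2_eq_square flip: power_mult_distrib)
    finally show "(z \<bullet> b)\<^sup>2 \<le> 1 / 4 ^ k" by simp
   qed
   finally show ?thesis by simp
  qed
  have "(norm (l2_of (\<lambda>x. ?v (x + z) - ?v x)))\<^sup>2 \<le> (norm (l2_of (\<lambda>x. h1_grad h x \<bullet> z)))\<^sup>2"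
   by (intro power_mono translation_estimate v h1_sq_int h1_weak_gradient) simp
  also have "\<dots> \<le> (LBINT x. (norm z)\<^sup>2 * (norm (h1_grad h x))\<^sup>2)"
   unfolding norm_l2_of[OF g]
  proof (rule integral_mono)
   show "(norm (h1_grad h x \<bullet> z))\<^sup>2 \<le> (norm z)\<^sup>2 * (norm (h1_grad h x))\<^sup>2" for x
    using Cauchy_Schwarz_ineq[of "h1_grad h x" z] by (simp add: power2_norm_eq_inner mult.commute)
  qed (use sq_intD(3)[OF g] sq_intD(3)[OF h1_sq_int(2)[of h]] in auto)
  also have "\<dots> = (norm z)\<^sup>2 * (norm (l2_of (h1_grad h)))\<^sup>2"
   by (simp add: norm_l2_of[OF h1_sq_int(2)])
  also have "\<dots> \<le> (real DIM('a) * (1 / 4 ^ k)) * (norm h)\<^sup>2"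
   by (intro mult_mono z power_mono h1_fun_norm_le) auto
  finally show ?thesis
   using nn_norm_l2_of[OF s] by (simp add: ennreal_leI)
 qed
 have "nn_int (\<lambda>x. (?v x - cell_avg k ?v x)\<^sup>2)
   \<le> (\<integral>\<^sup>+x. ennreal (1 / ?V) * (\<integral>\<^sup>+z. indicator ?Q z * ennreal ((?v (x + z) - ?v x)\<^sup>2) \<partial>lborel) \<partial>lborel)"
  by (intro nn_integral_mono cell_avg_diff_le v)
 also have "\<dots> = ennreal (1 / ?V) * (\<integral>\<^sup>+x. (\<integral>\<^sup>+z. indicator ?Q z * ennreal ((?v (x + z) - ?v x)\<^sup>2) \<partial>lborel) \<partial>lborel)"
  by (rule nn_integral_cmult) measurable
 also have "(\<integral>\<^sup>+x. (\<integral>\<^sup>+z. indicator ?Q z * ennreal ((?v (x + z) - ?v x)\<^sup>2) \<partial>lborel) \<partial>lborel)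
   = (\<integral>\<^sup>+z. (\<integral>\<^sup>+x. indicator ?Q z * ennreal ((?v (x + z) - ?v x)\<^sup>2) \<partial>lborel) \<partial>lborel)"
  by (rule lborel_pair.Fubini'[symmetric]) measurable
 also have "\<dots> = (\<integral>\<^sup>+z. indicator ?Q z * nn_int (\<lambda>x. (?v (x + z) - ?v x)\<^sup>2) \<partial>lborel)"
  by (intro nn_integral_cong nn_integral_cmult) measurable
 also have "\<dots> \<le> (\<integral>\<^sup>+z. ennreal (real DIM('a) * (1 / 4 ^ k) * (norm h)\<^sup>2) * indicator ?Q z \<partial>lborel)"
  by (intro nn_integral_mono) (use est in \<open>auto simp: indicator_def\<close>)
 also have "\<dots> = ennreal (real DIM('a) * (1 / 4 ^ k) * (norm h)\<^sup>2) * emeasure lborel ?Q"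
  by (rule nn_integral_cmult_indicator) simp
 also have "emeasure lborel ?Q = ennreal ((2 / 2 ^ k) ^ DIM('a))"
  by (subst emeasure_lborel_cbox) (auto simp: algebra_simps)
 finally have "nn_int (\<lambda>x. (?v x - cell_avg k ?v x)\<^sup>2)
   \<le> ennreal (1 / ?V) * (ennreal (real DIM('a) * (1 / 4 ^ k) * (norm h)\<^sup>2) * ennreal ((2 / 2 ^ k) ^ DIM('a)))"
  by (simp add: mult_left_mono)
 also have "\<dots> = ennreal (1 / ?V * (real DIM('a) * (1 / 4 ^ k) * (norm h)\<^sup>2 * (2 / 2 ^ k) ^ DIM('a)))"
 proof -
  have *: "ennreal a * (ennreal b * ennreal c) = ennreal (a * (b * c))" if "0 \<le> a" "0 \<le> b" "0 \<le> c" for a b c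
   using that by (simp add: ennreal_mult)
  show ?thesis by (rule *) (use V in auto)
 qed
 also have "1 / ?V * (real DIM('a) * (1 / 4 ^ k) * (norm h)\<^sup>2 * (2 / 2 ^ k) ^ DIM('a)) = cell_const TYPE('a) * (1 / 4 ^ k) * (norm h)\<^sup>2"
  by (simp add: cell_vol_def cell_const_def power_divide field_simps)
 finally show ?thesis .
qed

section \<open>Convergence of the averages in L^q and the embedding\<close>

definition cell_jump :: "nat \<Rightarrow> 'a::euclidean_space h1 \<Rightarrow> 'a \<Rightarrow> real" where
 "cell_jump k h x = cell_avg (Suc k) (h1_fun h) x - cell_avg k (h1_fun h) x"

lemma cell_jump_measurable [measurable]: "cell_jump k h \<in> borel_measurable borel"
 unfolding cell_jump_def[abs_def] by measurable

lemma cell_jump_L2: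
 fixes h :: "'a::euclidean_space h1"
 shows "nn_int (\<lambda>x. (cell_jump k h x)\<^sup>2) \<le> ennreal (4 * cell_const TYPE('a) * (1 / 4 ^ k) * (norm h)\<^sup>2)"
proof -
 let ?v = "h1_fun h" and ?c = "cell_const TYPE('a)"
 note c = cell_const_pos[where 'a = 'a]
 have "nn_int (\<lambda>x. (cell_jump k h x)\<^sup>2)
   \<le> (\<integral>\<^sup>+x. 2 * ennreal ((?v x - cell_avg (Suc k) ?v x)\<^sup>2) + 2 * ennreal ((?v x - cell_avg k ?v x)\<^sup>2) \<partial>lborel)"
 proof (rule nn_integral_mono)
  fix x
  have "(b - a)\<^sup>2 \<le> 2 * (t - b)\<^sup>2 + 2 * (t - a)\<^sup>2" for a b t :: real
  proof -
   have "0 \<le> (2 * t - a - b)\<^sup>2" by simp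
   then show ?thesis by (simp add: power2_eq_square algebra_simps)
  qed
  then have "ennreal ((cell_jump k h x)\<^sup>2) \<le> ennreal (2 * (?v x - cell_avg (Suc k) ?v x)\<^sup>2 + 2 * (?v x - cell_avg k ?v x)\<^sup>2)"
   unfolding cell_jump_def by (intro ennreal_leI) blast
  then show "ennreal ((cell_jump k h x)\<^sup>2) \<le> 2 * ennreal ((?v x - cell_avg (Suc k) ?v x)\<^sup>2) + 2 * ennreal ((?v x - cell_avg k ?v x)\<^sup>2)"
   by (simp add: ennreal_plus ennreal_mult)
 qed
 also have "\<dots> = 2 * nn_int (\<lambda>x. (?v x - cell_avg (Suc k) ?v x)\<^sup>2)
   + 2 * nn_int (\<lambda>x. (?v x - cell_avg k ?v x)\<^sup>2)"
  by (subst nn_integral_add) (auto simp: nn_integral_cmult)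
 also have "\<dots> \<le> 2 * ennreal (?c * (1 / 4 ^ Suc k) * (norm h)\<^sup>2) + 2 * ennreal (?c * (1 / 4 ^ k) * (norm h)\<^sup>2)"
  by (intro add_mono mult_left_mono cell_poincare) auto
 also have "\<dots> = ennreal (2 * (?c * (1 / 4 ^ Suc k) * (norm h)\<^sup>2) + 2 * (?c * (1 / 4 ^ k) * (norm h)\<^sup>2))"
 proof -
  have *: "2 * ennreal x + 2 * ennreal y = ennreal (2 * x + 2 * y)" if "0 \<le> x" "0 \<le> y" for x y
   using that by (simp add: ennreal_mult ennreal_plus)
  show ?thesis by (rule *) (use c in auto)
 qed
 also have "\<dots> \<le> ennreal (4 * ?c * (1 / 4 ^ k) * (norm h)\<^sup>2)"
 proof (rule ennreal_leI)
  have "0 \<le> ?c * (1 / 4 ^ k) * (norm h)\<^sup>2" using c by simp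
  moreover have "?c * (1 / 4 ^ Suc k) * (norm h)\<^sup>2 = (?c * (1 / 4 ^ k) * (norm h)\<^sup>2) / 4" by simp
  moreover have "4 * ?c * (1 / 4 ^ k) * (norm h)\<^sup>2 = 4 * (?c * (1 / 4 ^ k) * (norm h)\<^sup>2)" by simp
  ultimately show "2 * (?c * (1 / 4 ^ Suc k) * (norm h)\<^sup>2) + 2 * (?c * (1 / 4 ^ k) * (norm h)\<^sup>2) \<le> 4 * ?c * (1 / 4 ^ k) * (norm h)\<^sup>2"
   by argo
 qed
 finally show ?thesis .
qed

text \<open>The jump is constant on each cell of level \<open>Suc k\<close>, so its square times the
  volume of that cell is at most its squared L^2 norm.\<close>

lemma cell_jump_sup:
 fixes h :: "'a::euclidean_space h1"
 shows "(cell_jump k h x)\<^sup>2 \<le> 4 * cell_const TYPE('a) * (1 / 4 ^ k) * (norm h)\<^sup>2 / cell_vol TYPE('a) (Suc k)"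
proof -
 let ?V = "cell_vol TYPE('a) (Suc k)"
 note V = cell_vol_pos[where 'a = 'a, of "Suc k"] and c = cell_const_pos[where 'a = 'a]
 have "ennreal ((cell_jump k h x)\<^sup>2 * ?V) = ennreal ((cell_jump k h x)\<^sup>2) * emeasure lborel (cell (Suc k) x)"
  using V by (simp add: emeasure_cell ennreal_mult)
 also have "\<dots> = (\<integral>\<^sup>+y. ennreal ((cell_jump k h x)\<^sup>2) * indicator (cell (Suc k) x) y \<partial>lborel)"
  by (rule nn_integral_cmult_indicator[symmetric]) simp
 also have "\<dots> \<le> nn_int (\<lambda>y. (cell_jump k h y)\<^sup>2)"
 proof (rule nn_integral_mono)
  fix y
  have "cell_jump k h y = cell_jump k h x" if "y \<in> cell (Suc k) x"
   using that cell_Suc[of k x] by (auto simp: cell_jump_def cell_avg_eq[of y "Suc k" x] cell_avg_eq[of y k x])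
  then show "ennreal ((cell_jump k h x)\<^sup>2) * indicator (cell (Suc k) x) y \<le> ennreal ((cell_jump k h y)\<^sup>2)"
   by (auto simp: indicator_def)
 qed
 also have "\<dots> \<le> ennreal (4 * cell_const TYPE('a) * (1 / 4 ^ k) * (norm h)\<^sup>2)" by (rule cell_jump_L2)
 finally have "(cell_jump k h x)\<^sup>2 * ?V \<le> 4 * cell_const TYPE('a) * (1 / 4 ^ k) * (norm h)\<^sup>2"
  using c by (subst (asm) ennreal_le_iff) auto
 then show ?thesis unfolding pos_le_divide_eq[OF V] .
qed

text \<open>The squared L^2 errors are dominated by a geometric series, so almost everywhere the
  errors are square summable over the scales.\<close>

lemma cell_avg_converges:
 fixes h :: "'a::euclidean_space h1"
 shows "AE x in lborel. (\<lambda>k. cell_avg k (h1_fun h) x) \<longlonglongrightarrow> h1_fun h x"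
proof -
 let ?v = "h1_fun h" and ?c = "cell_const TYPE('a)"
 note c = cell_const_pos[where 'a = 'a]
 have "(\<integral>\<^sup>+x. (suminf (\<lambda>k. ennreal ((?v x - cell_avg k ?v x)\<^sup>2))) \<partial>lborel) = (suminf (\<lambda>k. \<integral>\<^sup>+x. ennreal ((?v x - cell_avg k ?v x)\<^sup>2) \<partial>lborel))"
  by (rule nn_integral_suminf) measurable
 also have "\<dots> \<le> (suminf (\<lambda>k. ennreal (?c * (norm h)\<^sup>2 * (1 / 4) ^ k)))"
  by (intro suminf_le) (use cell_poincare[of h] in \<open>auto simp: power_one_over mult.commute mult.left_commute\<close>)
 also have "\<dots> < \<infinity>"
  using c by (subst suminf_ennreal2) (auto intro!: summable_mult summable_geometric)
 finally have "AE x in lborel. (suminf (\<lambda>k. ennreal ((?v x - cell_avg k ?v x)\<^sup>2))) \<noteq> \<infinity>"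
  by (intro nn_integral_PInf_AE) auto
 then show ?thesis
 proof eventually_elim
  case (elim x)
  have "summable (\<lambda>k. (?v x - cell_avg k ?v x)\<^sup>2)"
   using elim by (intro summable_suminf_not_top) auto
  then have "(\<lambda>k. (?v x - cell_avg k ?v x)\<^sup>2) \<longlonglongrightarrow> 0" by (rule summable_LIMSEQ_zero)
  then have "(\<lambda>k. sqrt ((?v x - cell_avg k ?v x)\<^sup>2)) \<longlonglongrightarrow> sqrt 0" by (rule tendsto_real_sqrt)
  then have "(\<lambda>k. ?v x - cell_avg k ?v x) \<longlonglongrightarrow> 0" by (simp add: tendsto_rabs_zero_iff)
  then have "(\<lambda>k. ?v x - (?v x - cell_avg k ?v x)) \<longlonglongrightarrow> ?v x - 0" by (intro tendsto_intros)
  then show ?case by simp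
 qed
qed

text \<open>If the weighted sum has the finite value W, each term of the series is at most W^(1/q)
  2^(-\<theta> i), and the geometric series gives the constant. Used pointwise, this reduces the L^q
  norm of a sum of jumps to integrals of single jumps.\<close>

lemma powr_series_bound:
 fixes d :: "nat \<Rightarrow> real"
 assumes s: "(\<lambda>n. \<Sum>i<n. d i) \<longlonglongrightarrow> s" and \<theta>: "0 < \<theta>" and q: "0 < q"
 shows "ennreal (\<bar>s\<bar> powr q) \<le> ennreal ((1 / (1 - 2 powr - \<theta>)) powr q) * (suminf (\<lambda>i. ennreal (2 powr (\<theta> * q * real i) * \<bar>d i\<bar> powr q)))"
proof (cases "(suminf (\<lambda>i. ennreal (2 powr (\<theta> * q * real i) * \<bar>d i\<bar> powr q))) = \<infinity>")
 case True
 have "2 powr - \<theta> < 1" using \<theta> by (simp add: powr_less_one)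
 then show ?thesis using True \<theta> by (simp add: ennreal_mult_top ennreal_eq_0_iff)
next
 case False
 define \<rho> where "\<rho> = 2 powr - \<theta>"
 have \<rho>: "0 < \<rho>" "\<rho> < 1" using \<theta> by (simp_all add: \<rho>_def powr_less_one)
 define w where "w i = 2 powr (\<theta> * q * real i) * \<bar>d i\<bar> powr q" for i
 have w0: "0 \<le> w i" for i by (simp add: w_def)
 have sw: "summable w" using False by (intro summable_suminf_not_top) (auto simp: w_def)
 define W where "W = suminf w"
 have W: "(suminf (\<lambda>i. ennreal (w i))) = ennreal W" unfolding W_def by (rule suminf_ennreal2[OF w0 sw])
 have wW: "w i \<le> W" for i
  unfolding W_def using sum_le_suminf[OF sw, of "{i}"] w0 by simp
 have W0: "0 \<le> W" using wW[of 0] w0[of 0] by linarith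
 have d: "\<bar>d i\<bar> \<le> W powr (1 / q) * \<rho> ^ i" for i
 proof -
  have "\<bar>d i\<bar> powr q = w i * 2 powr (- (\<theta> * q * real i))"
   by (simp add: w_def powr_minus field_simps)
  also have "\<dots> \<le> W * 2 powr (- (\<theta> * q * real i))" by (intro mult_right_mono wW) simp
  finally have "(\<bar>d i\<bar> powr q) powr (1 / q) \<le> (W * 2 powr (- (\<theta> * q * real i))) powr (1 / q)"
   using q by (intro powr_mono2) auto
  also have "\<dots> = W powr (1 / q) * 2 powr (- (\<theta> * real i))"
   using q W0 by (simp add: powr_mult powr_powr)
  also have "2 powr (- (\<theta> * real i)) = \<rho> ^ i"
   by (simp add: \<rho>_def powr_realpow[symmetric] powr_powr)
  finally show ?thesis using q by (simp add: powr_powr)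
 qed
 have part: "\<bar>\<Sum>i<n. d i\<bar> \<le> W powr (1 / q) * (1 / (1 - \<rho>))" for n
 proof -
  have "\<bar>\<Sum>i<n. d i\<bar> \<le> (\<Sum>i<n. W powr (1 / q) * \<rho> ^ i)"
   by (rule order_trans[OF sum_abs sum_mono[OF d]])
  also have "\<dots> = W powr (1 / q) * (\<Sum>i<n. \<rho> ^ i)" by (simp add: sum_distrib_left)
  also have "\<dots> \<le> W powr (1 / q) * (1 / (1 - \<rho>))"
   using \<rho> by (intro mult_left_mono) (auto simp: sum_gp_strict divide_right_mono)
  finally show ?thesis .
 qed
 have "\<bar>s\<bar> \<le> W powr (1 / q) * (1 / (1 - \<rho>))"
  by (rule LIMSEQ_le_const2[OF tendsto_rabs[OF s]]) (use part in auto)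
 then have "\<bar>s\<bar> powr q \<le> (W powr (1 / q) * (1 / (1 - \<rho>))) powr q"
  using q by (intro powr_mono2) auto
 also have "\<dots> = W * (1 / (1 - \<rho>)) powr q"
 proof -
  have "(W powr (1 / q)) powr q = W" using q W0 by (simp add: powr_powr)
  then show ?thesis using \<rho> by (subst powr_mult) auto
 qed
 finally have "ennreal (\<bar>s\<bar> powr q) \<le> ennreal ((1 / (1 - \<rho>)) powr q * W)"
  by (intro ennreal_leI) (simp add: mult.commute)
 also have "\<dots> = ennreal ((1 / (1 - \<rho>)) powr q) * (suminf (\<lambda>i. ennreal (w i)))"
  unfolding W using W0 by (simp add: ennreal_mult)
 finally show ?thesis by (simp add: w_def \<rho>_def)
qed

text \<open>The difference of the averages at scales $2^{-k}$ and $2^{-k-1}$ is $O(2^{-k})$ in $L^2$ and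
 $O(2^{k(N-2)/2})$ in the supremum norm, so the integral of its \<open>q\<close>-th power is $O(2^{-k\gamma})$, where
 $\gamma$ is the following number. It is positive if and only if $q$ is subcritical.\<close>

definition sobolev_gap :: "'a::euclidean_space itself \<Rightarrow> real \<Rightarrow> real" where
 "sobolev_gap _ q = 2 - (real DIM('a) - 2) * (q - 2) / 2"

text \<open>This interpolates between the supremum and the L^2 bound: |t|^q is at most t^2 times the
  supremum to the power q - 2. As \<open>S\<close> bounds the square of the jump, the exponent
  \<open>r\<close> is half of q - 2.\<close>

lemma cell_jump_Lq:
 assumes q: "2 < q"
 shows "\<exists>A\<ge>0. \<forall>k (h :: 'a::euclidean_space h1).
  (nn_int (\<lambda>x. \<bar>cell_jump k h x\<bar> powr q))
   \<le> ennreal (A * 2 powr (- sobolev_gap TYPE('a) q * real k) * norm h powr q)"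
proof -
 let ?c = "cell_const TYPE('a)" and ?N = "real DIM('a)" and ?g = "sobolev_gap TYPE('a) q"
 note c = cell_const_pos[where 'a = 'a]
 define r where "r = (q - 2) / 2"
 have r: "0 < r" using q by (simp add: r_def)
 have rq: "2 * r + 2 = q" by (simp add: r_def field_simps)
 define A where "A = (4 * ?c * 2 powr ?N) powr r * (4 * ?c)"
 have "nn_int (\<lambda>x. \<bar>cell_jump k h x\<bar> powr q) \<le> ennreal (A * 2 powr (- ?g * real k) * norm h powr q)"
  for k and h :: "'a h1"
 proof (cases "h = 0")
  case True
  have "cell_jump k h x = 0" for x using cell_jump_sup[of k h x] True by simp
  then show ?thesis by simp
 next
  case False
  then have h: "0 < norm h" by simp
  define S where "S = 4 * ?c * (1 / 4 ^ k) * (norm h)\<^sup>2 / cell_vol TYPE('a) (Suc k)"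
  have S0: "0 \<le> S" using c cell_vol_pos[where 'a = 'a, of "Suc k"] by (simp add: S_def)
  have four: "1 / 4 ^ k = (2 powr (- 2 * real k) :: real)"
  proof -
   have "(2::real) powr (2 * real k) = 4 ^ k"
    using powr_powr[of 2 2 "real k"] by (simp add: powr_realpow)
   then show ?thesis by (simp add: powr_minus divide_inverse)
  qed
  have vol: "1 / cell_vol TYPE('a) (Suc k) = 2 powr ?N * 2 powr (?N * real k)"
  proof -
   have "1 / cell_vol TYPE('a) (Suc k) = (2 ^ Suc k) ^ DIM('a)" by (simp add: cell_vol_def power_divide)
   also have "\<dots> = 2 ^ (Suc k * DIM('a))" by (rule power_mult[symmetric])
   also have "\<dots> = 2 powr (real (Suc k * DIM('a)))" by (rule powr_realpow[symmetric]) simp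
   also have "real (Suc k * DIM('a)) = ?N + ?N * real k" by (simp add: algebra_simps)
   finally have "1 / cell_vol TYPE('a) (Suc k) = 2 powr (?N + ?N * real k)" .
   also have "\<dots> = 2 powr ?N * 2 powr (?N * real k)" by (rule powr_add)
   finally show ?thesis .
  qed
  have Seq: "S = (4 * ?c * 2 powr ?N) * (norm h powr 2 * 2 powr ((?N - 2) * real k))"
  proof -
   have "S = 4 * ?c * (1 / 4 ^ k) * (norm h)\<^sup>2 * (1 / cell_vol TYPE('a) (Suc k))" by (simp add: S_def)
   also have "\<dots> = (4 * ?c * 2 powr ?N) * (norm h powr 2 * (2 powr (- 2 * real k) * 2 powr (?N * real k)))"
    unfolding four vol using h by (simp add: powr_numeral)
   also have "2 powr (- 2 * real k) * 2 powr (?N * real k) = 2 powr ((?N - 2) * real k)"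
    by (simp add: powr_add[symmetric] algebra_simps)
   finally show ?thesis .
  qed
  have pt: "\<bar>t\<bar> powr q \<le> S powr r * t\<^sup>2" if "t\<^sup>2 \<le> S" for t
  proof (cases "t = 0")
   case False
   have "\<bar>t\<bar> powr q = \<bar>t\<bar> powr (2 * r) * \<bar>t\<bar> powr 2"
    by (simp only: powr_add[symmetric] rq)
   also have "\<dots> = (t\<^sup>2) powr r * t\<^sup>2"
    using False by (simp add: powr_powr[symmetric] powr_numeral)
   also have "\<dots> \<le> S powr r * t\<^sup>2"
    using that r by (intro mult_right_mono powr_mono2) auto
   finally show ?thesis .
  qed simp
  have "nn_int (\<lambda>x. \<bar>cell_jump k h x\<bar> powr q) \<le> (\<integral>\<^sup>+x. ennreal (S powr r) * ennreal ((cell_jump k h x)\<^sup>2) \<partial>lborel)"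
  proof (rule nn_integral_mono)
   fix x
   have "(cell_jump k h x)\<^sup>2 \<le> S" unfolding S_def by (rule cell_jump_sup)
   from pt[OF this] show "ennreal (\<bar>cell_jump k h x\<bar> powr q) \<le> ennreal (S powr r) * ennreal ((cell_jump k h x)\<^sup>2)"
    by (subst ennreal_mult[symmetric]) (auto intro: ennreal_leI)
  qed
  also have "\<dots> = ennreal (S powr r) * nn_int (\<lambda>x. (cell_jump k h x)\<^sup>2)"
   by (rule nn_integral_cmult) measurable
  also have "\<dots> \<le> ennreal (S powr r) * ennreal (4 * ?c * (1 / 4 ^ k) * (norm h)\<^sup>2)"
   by (intro mult_left_mono cell_jump_L2) simp
  also have "\<dots> = ennreal (S powr r * (4 * ?c * (1 / 4 ^ k) * (norm h)\<^sup>2))"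
   using c by (subst ennreal_mult) auto
  also have "S powr r * (4 * ?c * (1 / 4 ^ k) * (norm h)\<^sup>2) = A * 2 powr (- ?g * real k) * norm h powr q"
  proof -
   have "S powr r = (4 * ?c * 2 powr ?N) powr r * (norm h powr (2 * r) * 2 powr ((?N - 2) * real k * r))"
    unfolding Seq using c by (simp add: powr_mult powr_powr del: powr_numeral)
   then have "S powr r * (4 * ?c * (1 / 4 ^ k) * (norm h)\<^sup>2)
     = A * ((2 powr ((?N - 2) * real k * r) * 2 powr (- 2 * real k)) * (norm h powr (2 * r) * norm h powr 2))"
    unfolding four A_def using h by (simp add: powr_numeral mult_ac)
   also have "2 powr ((?N - 2) * real k * r) * 2 powr (- 2 * real k) = 2 powr (- ?g * real k)"
    by (simp add: powr_add[symmetric] sobolev_gap_def r_def algebra_simps add_divide_distrib diff_divide_distrib)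
   also have "norm h powr (2 * r) * norm h powr 2 = norm h powr q"
    by (simp only: powr_add[symmetric] rq)
   finally show ?thesis by (simp add: mult.assoc)
  qed
  finally show ?thesis .
 qed
 moreover have "0 \<le> A" using c by (simp add: A_def)
 ultimately show ?thesis by blast
qed

theorem cell_avg_approx:
 assumes q: "2 < q" and gap: "0 < sobolev_gap TYPE('a::euclidean_space) q"
 shows "\<exists>K\<ge>0. \<forall>k (h :: 'a h1).
  (nn_int (\<lambda>x. \<bar>h1_fun h x - cell_avg k (h1_fun h) x\<bar> powr q))
   \<le> ennreal (K * 2 powr (- sobolev_gap TYPE('a) q * real k) * norm h powr q)"
proof -
 let ?g = "sobolev_gap TYPE('a) q"
 obtain A where A: "0 \<le> A" "\<And>k (h :: 'a h1). (nn_int (\<lambda>x. \<bar>cell_jump k h x\<bar> powr q))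
   \<le> ennreal (A * 2 powr (- ?g * real k) * norm h powr q)"
  using cell_jump_Lq[OF q, where 'a = 'a] by blast
 \<comment> \<open>Half of the gap is spent on the weights 2^(\<theta> q i); the other half keeps
   the weighted series geometric.\<close>
 define \<theta> where "\<theta> = ?g / (2 * q)"
 have \<theta>: "0 < \<theta>" "\<theta> * q = ?g / 2" using gap q by (simp_all add: \<theta>_def)
 define C where "C = (1 / (1 - 2 powr - \<theta>)) powr q"
 have C: "0 \<le> C" by (simp add: C_def)
 define \<rho> where "\<rho> = 2 powr (- ?g / 2)"
 have \<rho>: "0 < \<rho>" "\<rho> < 1" using gap by (simp_all add: \<rho>_def powr_less_one)
 define K where "K = C * A * (1 / (1 - \<rho>))"
 have "nn_int (\<lambda>x. \<bar>h1_fun h x - cell_avg k (h1_fun h) x\<bar> powr q)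
   \<le> ennreal (K * 2 powr (- ?g * real k) * norm h powr q)" for k and h :: "'a h1"
 proof -
  let ?v = "h1_fun h"
  have "nn_int (\<lambda>x. \<bar>?v x - cell_avg k ?v x\<bar> powr q)
    \<le> (\<integral>\<^sup>+x. ennreal C * (suminf (\<lambda>i. ennreal (2 powr (\<theta> * q * real i) * \<bar>cell_jump (k + i) h x\<bar> powr q))) \<partial>lborel)"
  proof (rule nn_integral_mono_AE)
   show "AE x in lborel. ennreal (\<bar>?v x - cell_avg k ?v x\<bar> powr q)
     \<le> ennreal C * (suminf (\<lambda>i. ennreal (2 powr (\<theta> * q * real i) * \<bar>cell_jump (k + i) h x\<bar> powr q)))"
    using cell_avg_converges[of h]
   proof eventually_elim
    case (elim x)
    have "(\<Sum>i<n. cell_jump (k + i) h x) = cell_avg (k + n) ?v x - cell_avg k ?v x" for n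
     by (induction n) (simp_all add: cell_jump_def)
    moreover have "(\<lambda>n. cell_avg (k + n) ?v x - cell_avg k ?v x) \<longlonglongrightarrow> ?v x - cell_avg k ?v x"
     using LIMSEQ_ignore_initial_segment[OF elim, of k] by (intro tendsto_intros) (simp add: add.commute)
    ultimately have "(\<lambda>n. \<Sum>i<n. cell_jump (k + i) h x) \<longlonglongrightarrow> ?v x - cell_avg k ?v x" by simp
    then show ?case unfolding C_def by (rule powr_series_bound[OF _ \<theta>(1)]) (use q in simp)
   qed
  qed
  also have "\<dots> = ennreal C * (suminf (\<lambda>i. \<integral>\<^sup>+x. ennreal (2 powr (\<theta> * q * real i) * \<bar>cell_jump (k + i) h x\<bar> powr q) \<partial>lborel))"
   by (subst nn_integral_cmult) (auto simp: nn_integral_suminf)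
  also have "\<dots> \<le> ennreal C * (suminf (\<lambda>i. ennreal (A * 2 powr (- ?g * real k) * norm h powr q * \<rho> ^ i)))"
  proof (intro mult_left_mono suminf_le)
   fix i
   have "nn_int (\<lambda>x. 2 powr (\<theta> * q * real i) * \<bar>cell_jump (k + i) h x\<bar> powr q)
     = ennreal (2 powr (\<theta> * q * real i)) * nn_int (\<lambda>x. \<bar>cell_jump (k + i) h x\<bar> powr q)"
    by (subst nn_integral_cmult[symmetric]) (auto simp: ennreal_mult)
   also have "\<dots> \<le> ennreal (2 powr (\<theta> * q * real i)) * ennreal (A * 2 powr (- ?g * real (k + i)) * norm h powr q)"
    by (intro mult_left_mono A(2)) simp
   also have "\<dots> = ennreal (2 powr (\<theta> * q * real i) * (A * 2 powr (- ?g * real (k + i)) * norm h powr q))"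
    using A(1) by (subst ennreal_mult) auto
   also have "2 powr (\<theta> * q * real i) * (A * 2 powr (- ?g * real (k + i)) * norm h powr q)
     = A * (2 powr (?g / 2 * real i) * 2 powr (- ?g * real (k + i))) * norm h powr q"
    unfolding \<theta>(2) by simp
   also have "2 powr (?g / 2 * real i) * 2 powr (- ?g * real (k + i)) = 2 powr (- ?g * real k) * \<rho> ^ i"
   proof -
    have "\<rho> ^ i = 2 powr (- ?g / 2 * real i)" by (simp add: \<rho>_def powr_realpow[symmetric] powr_powr)
    moreover have "?g / 2 * real i + - ?g * real (k + i) = - ?g * real k + - ?g / 2 * real i" by (simp add: field_simps)
    ultimately show ?thesis by (simp only: powr_add[symmetric])
   qed
   finally show "nn_int (\<lambda>x. 2 powr (\<theta> * q * real i) * \<bar>cell_jump (k + i) h x\<bar> powr q)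
     \<le> ennreal (A * 2 powr (- ?g * real k) * norm h powr q * \<rho> ^ i)"
    by (simp add: mult_ac)
  qed auto
  also have "(suminf (\<lambda>i. ennreal (A * 2 powr (- ?g * real k) * norm h powr q * \<rho> ^ i)))
    = ennreal (A * 2 powr (- ?g * real k) * norm h powr q * (1 / (1 - \<rho>)))"
   using \<rho> A(1) by (subst suminf_ennreal2) (auto simp: suminf_mult suminf_geometric intro!: summable_mult summable_geometric)
  also have "ennreal C * ennreal (A * 2 powr (- ?g * real k) * norm h powr q * (1 / (1 - \<rho>)))
    = ennreal (C * (A * 2 powr (- ?g * real k) * norm h powr q * (1 / (1 - \<rho>))))"
   using \<rho> A(1) C by (subst ennreal_mult) auto
  also have "C * (A * 2 powr (- ?g * real k) * norm h powr q * (1 / (1 - \<rho>))) = K * 2 powr (- ?g * real k) * norm h powr q"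
   by (simp add: K_def)
  finally show ?thesis .
 qed
 moreover have "0 \<le> K" using A(1) C \<rho> by (simp add: K_def)
 ultimately show ?thesis by blast
qed

lemma abs_add_powr_le:
 fixes a b q :: real
 assumes "0 < q"
 shows "\<bar>a + b\<bar> powr q \<le> 2 powr q * (\<bar>a\<bar> powr q + \<bar>b\<bar> powr q)"
proof -
 have "\<bar>a + b\<bar> powr q \<le> (2 * max \<bar>a\<bar> \<bar>b\<bar>) powr q"
  using assms by (intro powr_mono2) auto
 also have "\<dots> = 2 powr q * max \<bar>a\<bar> \<bar>b\<bar> powr q" by (simp add: powr_mult)
 also have "\<dots> \<le> 2 powr q * (\<bar>a\<bar> powr q + \<bar>b\<bar> powr q)"
  by (intro mult_left_mono) (auto simp: max_def)
 finally show ?thesis .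
qed

lemma l2_of_h1_arith:
 "l2_of (h1_fun (h + k)) = l2_of (h1_fun h) + l2_of (h1_fun k)"
 "l2_of (h1_fun (c *\<^sub>R h)) = c *\<^sub>R l2_of (h1_fun h)"
proof -
 note s = h1_sq_int(1)
 show "l2_of (h1_fun (h + k)) = l2_of (h1_fun h) + l2_of (h1_fun k)"
  unfolding l2_of_arith(1)[OF s s] by (subst l2_of_eq_iff) (auto intro: s sq_int_add h1_fun_arith_AE)
 show "l2_of (h1_fun (c *\<^sub>R h)) = c *\<^sub>R l2_of (h1_fun h)"
  unfolding l2_of_arith(3)[OF s s]
  using h1_fun_arith_AE(3)[of c h] sq_int_scaleR[OF s[of h], of c]
  by (subst l2_of_eq_iff) (auto intro: s)
qed

lemma bounded_linear_h1_l2: "bounded_linear (\<lambda>h. l2_of (h1_fun h))"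
 by (rule bounded_linear_intro[where K = 1]) (auto simp: l2_of_h1_arith h1_fun_norm_le)

lemma bounded_linear_cell_avg: "bounded_linear (\<lambda>h. cell_avg k (h1_fun h) a)"
 unfolding cell_avg_inner[OF h1_sq_int(1)]
 by (rule bounded_linear_compose[OF bounded_linear_divide
    bounded_linear_compose[OF bounded_linear_inner_left bounded_linear_h1_l2]])

text \<open>Cells of level 0 have volume 1, so Cauchy-Schwarz gives the constant 1.\<close>

lemma cell_avg_0_le:
 fixes h :: "'a::euclidean_space h1"
 shows "\<bar>cell_avg 0 (h1_fun h) x\<bar> \<le> norm h"
proof -
 have "\<bar>cell_avg 0 (h1_fun h) x\<bar> = \<bar>l2_of (h1_fun h) \<bullet> l2_of (indicator (cell 0 x) :: 'a \<Rightarrow> real)\<bar>"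
  unfolding cell_avg_inner[OF h1_sq_int(1)] by (simp add: cell_vol_def)
 also have "\<dots> \<le> norm (l2_of (h1_fun h)) * norm (l2_of (indicator (cell 0 x) :: 'a \<Rightarrow> real))"
  by (rule Cauchy_Schwarz_ineq2)
 also have "norm (l2_of (indicator (cell 0 x) :: 'a \<Rightarrow> real)) = 1"
  using norm_indicator_cell[of 0 x] by (simp add: cell_vol_def power2_eq_1_iff)
   (metis norm_ge_zero not_one_le_zero neg_0_le_iff_le)
 finally show ?thesis using h1_fun_norm_le(1)[of h] by simp
qed

lemma cell_avg_0_L2:
 fixes h :: "'a::euclidean_space h1"
 shows "nn_int (\<lambda>x. (cell_avg 0 (h1_fun h) x)\<^sup>2) \<le> ennreal ((2 + 2 * cell_const TYPE('a)) * (norm h)\<^sup>2)"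
proof -
 let ?v = "h1_fun h" and ?c = "cell_const TYPE('a)"
 note c = cell_const_pos[where 'a = 'a]
 have "nn_int (\<lambda>x. (cell_avg 0 ?v x)\<^sup>2)
   \<le> (\<integral>\<^sup>+x. 2 * ennreal ((norm (?v x))\<^sup>2) + 2 * ennreal ((?v x - cell_avg 0 ?v x)\<^sup>2) \<partial>lborel)"
 proof (rule nn_integral_mono)
  fix x
  have "a\<^sup>2 \<le> 2 * (norm t)\<^sup>2 + 2 * (t - a)\<^sup>2" for a t :: real
  proof -
   have "0 \<le> (2 * t - a)\<^sup>2" by simp
   then show ?thesis by (simp add: power2_eq_square algebra_simps)
  qed
  then have "ennreal ((cell_avg 0 ?v x)\<^sup>2) \<le> ennreal (2 * (norm (?v x))\<^sup>2 + 2 * (?v x - cell_avg 0 ?v x)\<^sup>2)"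
   by (intro ennreal_leI) blast
  then show "ennreal ((cell_avg 0 ?v x)\<^sup>2) \<le> 2 * ennreal ((norm (?v x))\<^sup>2) + 2 * ennreal ((?v x - cell_avg 0 ?v x)\<^sup>2)"
   by (simp add: ennreal_plus ennreal_mult)
 qed
 also have "\<dots> = 2 * nn_int (\<lambda>x. (norm (?v x))\<^sup>2)
   + 2 * nn_int (\<lambda>x. (?v x - cell_avg 0 ?v x)\<^sup>2)"
  by (subst nn_integral_add) (auto simp: nn_integral_cmult)
 also have "\<dots> \<le> 2 * ennreal ((norm h)\<^sup>2) + 2 * ennreal (?c * (1 / 4 ^ 0) * (norm h)\<^sup>2)"
  unfolding nn_norm_l2_of[OF h1_sq_int(1)]
  by (intro add_mono mult_left_mono cell_poincare ennreal_leI power_mono h1_fun_norm_le) auto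
 also have "\<dots> = ennreal ((2 + 2 * ?c) * (norm h)\<^sup>2)"
 proof -
  have *: "2 * ennreal x + 2 * ennreal y = ennreal (2 * x + 2 * y)" if "0 \<le> x" "0 \<le> y" for x y
   using that by (simp add: ennreal_mult ennreal_plus)
  have "2 * ennreal ((norm h)\<^sup>2) + 2 * ennreal (?c * (1 / 4 ^ 0) * (norm h)\<^sup>2) =
    ennreal (2 * (norm h)\<^sup>2 + 2 * (?c * (1 / 4 ^ 0) * (norm h)\<^sup>2))"
   by (rule *) (use c in auto)
  then show ?thesis by (simp add: algebra_simps)
 qed
 finally show ?thesis .
qed

text \<open>The deviation from the averages over unit cells is controlled by
  \<open>cell_avg_approx\<close>, and the averages themselves by their supremum and L^2 bounds. The
  constant stands inside the power, so that it multiplies the norm.\<close>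

theorem sobolev_embedding:
 assumes q: "2 < q" and gap: "0 < sobolev_gap TYPE('a::euclidean_space) q"
 shows "\<exists>K>0. \<forall>h :: 'a h1. integrable lborel (\<lambda>x. \<bar>h1_fun h x\<bar> powr q) \<and>
  (LBINT x. \<bar>h1_fun h x\<bar> powr q) \<le> (K * norm h) powr q"
proof -
 obtain K0 where K0: "0 \<le> K0" "\<And>k (h :: 'a h1).
  (nn_int (\<lambda>x. \<bar>h1_fun h x - cell_avg k (h1_fun h) x\<bar> powr q))
   \<le> ennreal (K0 * 2 powr (- sobolev_gap TYPE('a) q * real k) * norm h powr q)"
  using cell_avg_approx[OF q gap] by blast
 let ?c = "2 + 2 * cell_const TYPE('a)"
 have c: "0 < ?c" using cell_const_pos[where 'a = 'a] by simp
 define K where "K = 2 powr q * (K0 + ?c)"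
 have K: "0 < K" using K0(1) c by (simp add: K_def)
 define K' where "K' = K powr (1 / q)"
 have K': "0 < K'" "K' powr q = K" using K q by (simp_all add: K'_def powr_powr)
 have "integrable lborel (\<lambda>x. \<bar>h1_fun h x\<bar> powr q) \<and> (LBINT x. \<bar>h1_fun h x\<bar> powr q) \<le> (K' * norm h) powr q" for h :: "'a h1"
 proof -
  let ?v = "h1_fun h" and ?a = "cell_avg 0 (h1_fun h)"
  have a: "nn_int (\<lambda>x. \<bar>?a x\<bar> powr q) \<le> ennreal (?c * norm h powr q)"
  proof (cases "h = 0")
   case True
   then have "?a x = 0" for x using cell_avg_0_le[of h x] by simp
   then show ?thesis by simp
  next
   case False
   have split: "t powr q = t powr (q - 2) * t\<^sup>2" if "0 \<le> t" for t :: real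
   proof (cases "t = 0")
    case False
    then have "t\<^sup>2 = t powr 2" using that by (simp add: powr_numeral)
    then show ?thesis by (simp only: powr_add[symmetric]) simp
   qed simp
   have "nn_int (\<lambda>x. \<bar>?a x\<bar> powr q) \<le> (\<integral>\<^sup>+x. ennreal (norm h powr (q - 2)) * ennreal ((?a x)\<^sup>2) \<partial>lborel)"
   proof (rule nn_integral_mono)
    fix x
    have "\<bar>?a x\<bar> powr q = \<bar>?a x\<bar> powr (q - 2) * (?a x)\<^sup>2" using split[of "\<bar>?a x\<bar>"] by simp
    also have "\<dots> \<le> norm h powr (q - 2) * (?a x)\<^sup>2"
     using q by (intro mult_right_mono powr_mono2 cell_avg_0_le) auto
    finally show "ennreal (\<bar>?a x\<bar> powr q) \<le> ennreal (norm h powr (q - 2)) * ennreal ((?a x)\<^sup>2)"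
     by (subst ennreal_mult[symmetric]) (auto intro: ennreal_leI)
   qed
   also have "\<dots> = ennreal (norm h powr (q - 2)) * nn_int (\<lambda>x. (?a x)\<^sup>2)"
    by (rule nn_integral_cmult) measurable
   also have "\<dots> \<le> ennreal (norm h powr (q - 2)) * ennreal (?c * (norm h)\<^sup>2)"
    by (intro mult_left_mono cell_avg_0_L2) simp
   also have "\<dots> = ennreal (?c * norm h powr q)"
    using c split[of "norm h"] by (subst ennreal_mult[symmetric]) (auto simp: mult_ac)
   finally show ?thesis .
  qed
  have "nn_int (\<lambda>x. \<bar>?v x\<bar> powr q)
    \<le> (\<integral>\<^sup>+x. ennreal (2 powr q) * (ennreal (\<bar>?v x - ?a x\<bar> powr q) + ennreal (\<bar>?a x\<bar> powr q)) \<partial>lborel)"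
  proof (rule nn_integral_mono)
   fix x
   have "\<bar>?v x\<bar> powr q \<le> 2 powr q * (\<bar>?v x - ?a x\<bar> powr q + \<bar>?a x\<bar> powr q)"
    using abs_add_powr_le[of q "?v x - ?a x" "?a x"] q by simp
   then show "ennreal (\<bar>?v x\<bar> powr q) \<le> ennreal (2 powr q) * (ennreal (\<bar>?v x - ?a x\<bar> powr q) + ennreal (\<bar>?a x\<bar> powr q))"
    by (subst ennreal_plus[symmetric], simp, simp, subst ennreal_mult[symmetric]) (auto intro: ennreal_leI)
  qed
  also have "\<dots> = ennreal (2 powr q) * ((nn_int (\<lambda>x. \<bar>?v x - ?a x\<bar> powr q)) + (nn_int (\<lambda>x. \<bar>?a x\<bar> powr q)))"
   by (subst nn_integral_cmult, measurable, subst nn_integral_add) auto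
  also have "\<dots> \<le> ennreal (2 powr q) * (ennreal (K0 * norm h powr q) + ennreal (?c * norm h powr q))"
   using K0(2)[of h 0] by (intro mult_left_mono add_mono a) auto
  also have "\<dots> = ennreal (2 powr q * (K0 * norm h powr q + ?c * norm h powr q))"
   using K0(1) c by (subst ennreal_plus[symmetric], simp, simp, subst ennreal_mult[symmetric]) auto
  also have "2 powr q * (K0 * norm h powr q + ?c * norm h powr q) = (K' * norm h) powr q"
   using K' by (simp add: powr_mult K_def algebra_simps)
  finally have "nn_int (\<lambda>x. \<bar>?v x\<bar> powr q) \<le> ennreal ((K' * norm h) powr q)" .
  from nn_integral_le_imp[OF _ _ _ this] show ?thesis by auto
 qed
 with K'(1) show ?thesis by blast
qed

section \<open>Local compactness\<close>

lemma finite_cell_cover: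
 obtains F :: "'a::euclidean_space set" where "finite F" "\<And>x. norm x \<le> R \<Longrightarrow> \<exists>a\<in>F. x \<in> cell k a"
proof -
 define f where "f x = (\<lambda>b\<in>Basis. \<lfloor>2 ^ k * (x \<bullet> b)\<rfloor>)" for x :: 'a
 define M where "M = \<lceil>2 ^ k * \<bar>R\<bar>\<rceil> + 1"
 have "f ` cball 0 R \<subseteq> (\<Pi>\<^sub>E b\<in>Basis. {-M..M})"
 proof
  fix g assume "g \<in> f ` cball 0 R"
  then obtain x where x: "norm x \<le> R" "g = f x" by auto
  have "\<lfloor>2 ^ k * (x \<bullet> b)\<rfloor> \<in> {-M..M}" if "b \<in> Basis" for b
  proof -
   have "\<bar>x \<bullet> b\<bar> \<le> \<bar>R\<bar>" using Basis_le_norm[OF that, of x] x(1) by linarith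
   then have "2 ^ k * \<bar>x \<bullet> b\<bar> \<le> 2 ^ k * \<bar>R\<bar>" by (intro mult_left_mono) auto
   then have "\<bar>2 ^ k * (x \<bullet> b)\<bar> \<le> 2 ^ k * \<bar>R\<bar>" by (simp add: abs_mult)
   moreover have "\<lfloor>t\<rfloor> \<in> {- (\<lceil>T\<rceil> + 1)..\<lceil>T\<rceil> + 1}" if "\<bar>t\<bar> \<le> T" for t T :: real
    using that by (simp add: abs_le_iff) linarith
   ultimately show ?thesis unfolding M_def by blast
  qed
  then show "g \<in> (\<Pi>\<^sub>E b\<in>Basis. {-M..M})" using x(2) by (auto simp: f_def)
 qed
 then have "finite (f ` cball 0 R)" by (rule finite_subset) (auto intro: finite_PiE)
 then obtain F where F: "finite F" "f ` cball 0 R = f ` F"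
  using finite_subset_image[of "f ` cball 0 R" f "cball 0 R"] by blast
 have "\<exists>a\<in>F. x \<in> cell k a" if "norm x \<le> R" for x
 proof -
  have "f x \<in> f ` F" using that F(2) by auto
  then obtain a where a: "a \<in> F" "f x = f a" by auto
  have "\<lfloor>2 ^ k * (x \<bullet> b)\<rfloor> = \<lfloor>2 ^ k * (a \<bullet> b)\<rfloor>" if "b \<in> Basis" for b
   using fun_cong[OF a(2), of b] that by (simp add: f_def)
  then show ?thesis using a(1) by (auto simp: cell_def)
 qed
 with F(1) show ?thesis by (rule that)
qed

text \<open>The scale \<open>k\<close> is chosen so fine that the approximation error costs at most
  \<open>e\<close>. At this scale finitely many cells cover the ball, so the rest depends on
  finitely many averages.\<close>

lemma local_estimate:
 assumes q: "2 < q" and gap: "0 < sobolev_gap TYPE('a::euclidean_space) q" and e: "0 < e"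
 obtains k :: nat and F :: "'a::euclidean_space set" and M where "finite F" "0 < M"
  "\<And>(h :: 'a::euclidean_space h1) \<eta>. 0 \<le> \<eta> \<Longrightarrow> (\<And>a. a \<in> F \<Longrightarrow> \<bar>cell_avg k (h1_fun h) a\<bar> \<le> \<eta>) \<Longrightarrow>
   (LBINT x. indicator (cball 0 R) x * \<bar>h1_fun h x\<bar> powr q) \<le> e * norm h powr q + M * \<eta> powr q"
proof -
 obtain K0 where K0: "0 \<le> K0" "\<And>k (h :: 'a h1).
  (nn_int (\<lambda>x. \<bar>h1_fun h x - cell_avg k (h1_fun h) x\<bar> powr q))
   \<le> ennreal (K0 * 2 powr (- sobolev_gap TYPE('a) q * real k) * norm h powr q)"
  using cell_avg_approx[OF q gap] by blast
 have "(\<lambda>k. 2 powr q * (K0 * 2 powr (- sobolev_gap TYPE('a) q * real k))) \<longlonglongrightarrow> 2 powr q * (K0 * 0)"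
 proof (intro tendsto_mult tendsto_const)
  have "(\<lambda>k. (2 powr (- sobolev_gap TYPE('a) q)) ^ k) \<longlonglongrightarrow> 0"
   using gap by (intro LIMSEQ_power_zero) (simp add: powr_less_one)
  then show "(\<lambda>k. 2 powr (- sobolev_gap TYPE('a) q * real k)) \<longlonglongrightarrow> 0"
   by (simp add: powr_realpow[symmetric] powr_powr)
 qed
 then have "eventually (\<lambda>k. 2 powr q * (K0 * 2 powr (- sobolev_gap TYPE('a) q * real k)) < e) sequentially"
  using e by (intro order_tendstoD) auto
 then obtain k where k: "2 powr q * (K0 * 2 powr (- sobolev_gap TYPE('a) q * real k)) < e"
  by (auto simp: eventually_sequentially)
 obtain F :: "'a set" where F: "finite F" "\<And>x. norm x \<le> R \<Longrightarrow> \<exists>a\<in>F. x \<in> cell k a"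
  by (rule finite_cell_cover[of R k]) blast
 define m where "m = measure lborel (cball 0 R :: 'a set)"
 have m: "0 \<le> m" "emeasure lborel (cball 0 R :: 'a set) = ennreal m"
  using emeasure_bounded_finite[OF bounded_cball[of "0::'a" R]] by (auto simp: m_def emeasure_eq_ennreal_measure)
 \<comment> \<open>The summand 1 keeps \<open>M\<close> positive when the ball is a null
   set.\<close>
 define M where "M = 2 powr q * m + 1"
 have M: "0 < M" using m(1) by (simp add: M_def add_nonneg_pos)
 show ?thesis
 proof (rule that[OF F(1) M])
  fix h :: "'a h1" and \<eta> :: real
  assume \<eta>: "0 \<le> \<eta>" and le: "\<And>a. a \<in> F \<Longrightarrow> \<bar>cell_avg k (h1_fun h) a\<bar> \<le> \<eta>"
  let ?v = "h1_fun h" and ?a = "cell_avg k (h1_fun h)"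
  have ale: "\<bar>?a x\<bar> \<le> \<eta>" if "norm x \<le> R" for x
  proof -
   obtain a where "a \<in> F" "x \<in> cell k a" using F(2)[OF \<open>norm x \<le> R\<close>] by blast
   then show ?thesis using le[of a] cell_avg_eq[of x k a ?v] by simp
  qed
  have "nn_int (\<lambda>x. indicator (cball 0 R) x * \<bar>?v x\<bar> powr q)
    \<le> (\<integral>\<^sup>+x. ennreal (2 powr q) * ennreal (\<bar>?v x - ?a x\<bar> powr q) + ennreal (2 powr q * \<eta> powr q) * indicator (cball 0 R) x \<partial>lborel)"
  proof (rule nn_integral_mono)
   fix x
   show "ennreal (indicator (cball 0 R) x * \<bar>?v x\<bar> powr q)
    \<le> ennreal (2 powr q) * ennreal (\<bar>?v x - ?a x\<bar> powr q) + ennreal (2 powr q * \<eta> powr q) * indicator (cball 0 R) x"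
   proof (cases "norm x \<le> R")
    case True
    have "\<bar>?v x\<bar> powr q \<le> 2 powr q * (\<bar>?v x - ?a x\<bar> powr q + \<bar>?a x\<bar> powr q)"
     using abs_add_powr_le[of q "?v x - ?a x" "?a x"] q by simp
    also have "\<dots> \<le> 2 powr q * (\<bar>?v x - ?a x\<bar> powr q + \<eta> powr q)"
     using q ale[OF True] by (intro mult_left_mono add_left_mono powr_mono2) auto
    finally have "ennreal (\<bar>?v x\<bar> powr q) \<le> ennreal (2 powr q * \<bar>?v x - ?a x\<bar> powr q + 2 powr q * \<eta> powr q)"
     by (intro ennreal_leI) (simp add: distrib_left)
    then show ?thesis using True by (simp add: ennreal_plus ennreal_mult)
   qed simp
  qed
  also have "\<dots> = ennreal (2 powr q) * nn_int (\<lambda>x. \<bar>?v x - ?a x\<bar> powr q)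
    + ennreal (2 powr q * \<eta> powr q) * emeasure lborel (cball 0 R :: 'a set)"
  proof -
   have 1: "(\<integral>\<^sup>+x. ennreal (2 powr q) * ennreal (\<bar>?v x - ?a x\<bar> powr q) \<partial>lborel)
     = ennreal (2 powr q) * nn_int (\<lambda>x. \<bar>?v x - ?a x\<bar> powr q)"
    by (rule nn_integral_cmult) measurable
   have 2: "(\<integral>\<^sup>+x. ennreal (2 powr q * \<eta> powr q) * indicator (cball 0 R :: 'a set) x \<partial>lborel)
     = ennreal (2 powr q * \<eta> powr q) * emeasure lborel (cball 0 R :: 'a set)"
    by (rule nn_integral_cmult_indicator) simp
   have m1: "(\<lambda>x. ennreal (2 powr q) * ennreal (\<bar>?v x - ?a x\<bar> powr q)) \<in> borel_measurable lborel" by measurable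
   have m2: "(\<lambda>x::'a. ennreal (2 powr q * \<eta> powr q) * indicator (cball 0 R) x) \<in> borel_measurable lborel"
    by (intro borel_measurable_times_ennreal borel_measurable_const borel_measurable_indicator) simp
   show ?thesis using nn_integral_add[OF m1 m2] unfolding 1 2 .
  qed
  also have "\<dots> \<le> ennreal (2 powr q) * ennreal (K0 * 2 powr (- sobolev_gap TYPE('a) q * real k) * norm h powr q)
    + ennreal (2 powr q * \<eta> powr q) * ennreal m"
   unfolding m(2) by (intro add_right_mono mult_left_mono K0(2)) simp
  also have "\<dots> = ennreal (2 powr q * (K0 * 2 powr (- sobolev_gap TYPE('a) q * real k) * norm h powr q) + 2 powr q * \<eta> powr q * m)"
   using K0(1) m(1) by (simp add: ennreal_plus ennreal_mult)
  also have "\<dots> \<le> ennreal (e * norm h powr q + M * \<eta> powr q)"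
  proof (intro ennreal_leI add_mono)
   have "2 powr q * (K0 * 2 powr (- sobolev_gap TYPE('a) q * real k)) * norm h powr q \<le> e * norm h powr q"
    using k by (intro mult_right_mono) auto
   then show "2 powr q * (K0 * 2 powr (- sobolev_gap TYPE('a) q * real k) * norm h powr q) \<le> e * norm h powr q"
    by (simp add: mult.assoc)
   show "2 powr q * \<eta> powr q * m \<le> M * \<eta> powr q" by (simp add: M_def algebra_simps)
  qed
  finally have "nn_int (\<lambda>x. indicator (cball 0 R) x * \<bar>?v x\<bar> powr q) \<le> ennreal (e * norm h powr q + M * \<eta> powr q)" .
  note fin = this
  have mm: "(\<lambda>x. indicator (cball 0 R) x * \<bar>?v x\<bar> powr q) \<in> borel_measurable lborel"
  proof (rule borel_measurable_times)
   show "(indicator (cball 0 R) :: 'a \<Rightarrow> real) \<in> borel_measurable lborel"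
    by (intro borel_measurable_indicator) simp
  qed measurable
  from nn_integral_le_imp(2)[OF mm _ _ fin]
  show "(LBINT x. indicator (cball 0 R) x * \<bar>?v x\<bar> powr q) \<le> e * norm h powr q + M * \<eta> powr q"
   using e M by simp
 qed
qed

text \<open>Cell averages are bounded functionals, so along a weakly null sequence the finitely many
  averages in \<open>local_estimate\<close> tend to 0.\<close>

lemma weak_null_local_convergence:
 fixes w :: "nat \<Rightarrow> 'a::euclidean_space h1"
 assumes q: "2 < q" and gap: "0 < sobolev_gap TYPE('a) q"
  and C: "\<And>n. norm (w n) \<le> C" and weak: "\<And>z. (\<lambda>n. w n \<bullet> z) \<longlonglongrightarrow> 0"
 shows "(\<lambda>n. \<integral>x. indicator (cball 0 R) x * \<bar>h1_fun (w n) x\<bar> powr q \<partial>lborel) \<longlonglongrightarrow> 0"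
proof (rule LIMSEQ_I)
 fix r :: real assume r: "0 < r"
 have C0: "0 \<le> C" using C[of 0] norm_ge_zero order_trans by blast
 define e where "e = r / (2 * (C powr q + 1))"
 have e: "0 < e" using r by (simp add: e_def add_nonneg_pos)
 have "e * (C powr q + 1) = r / 2"
  using powr_ge_zero[of C q] by (simp add: e_def field_simps add_nonneg_eq_0_iff)
 then have eC: "e * C powr q < r / 2" using e by (simp add: distrib_left)
 obtain k :: nat and F :: "'a set" and M where F: "finite F" "0 < M"
  "\<And>(h :: 'a h1) \<eta>. 0 \<le> \<eta> \<Longrightarrow> (\<And>a. a \<in> F \<Longrightarrow> \<bar>cell_avg k (h1_fun h) a\<bar> \<le> \<eta>) \<Longrightarrow>
   (LBINT x. indicator (cball 0 R) x * \<bar>h1_fun h x\<bar> powr q) \<le> e * norm h powr q + M * \<eta> powr q"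
  by (rule local_estimate[OF q gap e, of R]) blast
 define \<eta> where "\<eta> = (r / (2 * M)) powr (1 / q)"
 have \<eta>: "0 < \<eta>" "M * \<eta> powr q = r / 2" using r F(2) q by (simp_all add: \<eta>_def powr_powr)
 have "eventually (\<lambda>n. \<bar>cell_avg k (h1_fun (w n)) a\<bar> \<le> \<eta>) sequentially" for a
 proof -
  obtain u where u: "\<And>h. cell_avg k (h1_fun h) a = u \<bullet> h"
   using Riesz_representation[OF bounded_linear_cell_avg, of k a] by blast
  have "(\<lambda>n. cell_avg k (h1_fun (w n)) a) \<longlonglongrightarrow> 0"
   unfolding u using weak[of u] by (simp add: inner_commute)
  from LIMSEQ_D[OF this \<eta>(1)] obtain N where "\<And>n. n \<ge> N \<Longrightarrow> \<bar>cell_avg k (h1_fun (w n)) a\<bar> < \<eta>" by auto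
  then show ?thesis by (intro eventually_sequentiallyI[of N] less_imp_le)
 qed
 then have "eventually (\<lambda>n. \<forall>a\<in>F. \<bar>cell_avg k (h1_fun (w n)) a\<bar> \<le> \<eta>) sequentially"
  using F(1) by (simp add: eventually_ball_finite)
 then obtain N where N: "\<And>n a. n \<ge> N \<Longrightarrow> a \<in> F \<Longrightarrow> \<bar>cell_avg k (h1_fun (w n)) a\<bar> \<le> \<eta>"
  by (auto simp: eventually_sequentially)
 have "norm ((LBINT x. indicator (cball 0 R) x * \<bar>h1_fun (w n) x\<bar> powr q) - 0) < r" if "n \<ge> N" for n
 proof -
  have "(LBINT x. indicator (cball 0 R) x * \<bar>h1_fun (w n) x\<bar> powr q) \<le> e * norm (w n) powr q + M * \<eta> powr q"
   using N[OF that] \<eta>(1) by (intro F(3)) auto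
  also have "\<dots> \<le> e * C powr q + M * \<eta> powr q"
   using e q C by (intro add_right_mono mult_left_mono powr_mono2) auto
  also have "\<dots> < r" using eC \<eta>(2) by simp
  finally show ?thesis by (simp add: integral_nonneg_AE)
 qed
 then show "\<exists>N. \<forall>n\<ge>N. norm ((LBINT x. indicator (cball 0 R) x * \<bar>h1_fun (w n) x\<bar> powr q) - 0) < r" by blast
qed

text \<open>The functionals are the averages of \<open>local_estimate\<close>, used with \<eta> = 0.
  Their number depends on the norm bound \<open>C\<close> but not on \<open>h\<close>.\<close>

lemma finitely_many_functionals_detect:
 assumes q: "2 < q" and gap: "0 < sobolev_gap TYPE('a::euclidean_space) q" and c: "0 < c"
 obtains m :: nat and \<Lambda> :: "nat \<Rightarrow> 'a::euclidean_space h1 \<Rightarrow> real" where "\<And>j. bounded_linear (\<Lambda> j)"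
  "\<And>h. norm h \<le> C \<Longrightarrow> (\<And>j. j < m \<Longrightarrow> \<Lambda> j h = 0) \<Longrightarrow>
   (LBINT x. indicator (cball 0 R) x * \<bar>h1_fun h x\<bar> powr q) < c"
proof -
 define e where "e = c / (2 * (C powr q + 1))"
 have e: "0 < e" using c by (simp add: e_def add_nonneg_pos)
 have "e * (C powr q + 1) = c / 2"
  using powr_ge_zero[of C q] by (simp add: e_def field_simps add_nonneg_eq_0_iff)
 then have eC: "e * C powr q < c" using e c by (simp add: distrib_left)
 obtain k :: nat and F :: "'a set" and M where F: "finite F" "0 < M"
  "\<And>(h :: 'a h1) \<eta>. 0 \<le> \<eta> \<Longrightarrow> (\<And>a. a \<in> F \<Longrightarrow> \<bar>cell_avg k (h1_fun h) a\<bar> \<le> \<eta>) \<Longrightarrow>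
   (LBINT x. indicator (cball 0 R) x * \<bar>h1_fun h x\<bar> powr q) \<le> e * norm h powr q + M * \<eta> powr q"
  by (rule local_estimate[OF q gap e, of R]) blast
 obtain m and a :: "nat \<Rightarrow> 'a" where a: "F = a ` {i. i < m}"
  using finite_imp_nat_seg_image_inj_on[OF F(1)] by auto
 show ?thesis
 proof (rule that[of "\<lambda>j h. cell_avg k (h1_fun h) (a j)" m])
  fix h :: "'a h1" assume h: "norm h \<le> C" and z: "\<And>j. j < m \<Longrightarrow> cell_avg k (h1_fun h) (a j) = 0"
  have "(LBINT x. indicator (cball 0 R) x * \<bar>h1_fun h x\<bar> powr q) \<le> e * norm h powr q + M * 0 powr q"
   by (rule F(3)) (use z a in auto)
  also have "\<dots> \<le> e * C powr q"
   using e q h by (auto intro!: mult_left_mono powr_mono2)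
  also have "\<dots> < c" by (rule eC)
  finally show "(LBINT x. indicator (cball 0 R) x * \<bar>h1_fun h x\<bar> powr q) < c" .
 qed (rule bounded_linear_cell_avg)
qed

section \<open>Abstract Nehari functionals\<close>

definition rescale :: "real ^ 'l \<Rightarrow> 'h::real_vector ^ 'l \<Rightarrow> 'h ^ 'l" where
 "rescale t v = (\<chi> i. t $ i *\<^sub>R v $ i)"

lemma rescale_nth [simp]: "rescale t v $ i = t $ i *\<^sub>R v $ i"
 by (simp add: rescale_def)

lemma rescale_1 [simp]: "rescale 1 v = v"
 by (simp add: vec_eq_iff)

lemma rescale_rescale: "rescale t (rescale s v) = rescale (\<chi> i. t $ i * s $ i) v"
 by (simp add: vec_eq_iff)

lemma rescale_diff: "rescale t (v - w) = rescale t v - rescale t w"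
 by (simp add: vec_eq_iff scaleR_diff_right)

lemma rescale_scaleR: "rescale t (c *\<^sub>R v) = c *\<^sub>R rescale t v"
 by (simp add: vec_eq_iff mult.commute)

lemma rescale_uminus: "rescale t (- v) = - rescale t v"
 by (simp add: vec_eq_iff)

lemma norm_vec_le:
 fixes v :: "'h::real_inner ^ 'l" and w :: "'g::real_inner ^ 'l"
 assumes "\<And>i. norm (v $ i) \<le> K * norm (w $ i)" "0 \<le> K"
 shows "norm v \<le> K * norm w"
proof -
 have "norm v \<le> L2_set (\<lambda>i. K * norm (w $ i)) UNIV"
  unfolding norm_vec_def by (rule L2_set_mono) (use assms in auto)
 also have "\<dots> = K * norm w"
  unfolding norm_vec_def by (rule L2_set_right_distrib[symmetric]) (use assms(2) in auto)
 finally show ?thesis .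
qed

lemma norm_rescale_le:
 fixes v :: "'h::real_inner ^ 'l"
 assumes "\<And>i. \<bar>t $ i\<bar> \<le> K"
 shows "norm (rescale t v) \<le> K * norm v"
proof (rule norm_vec_le)
 show "norm (rescale t v $ i) \<le> K * norm (v $ i)" for i
  using assms[of i] by (simp add: mult_right_mono)
 show "0 \<le> K" using assms[of undefined] by linarith
qed

lemma norm_rescale_diff_le:
 fixes v :: "'h::real_inner ^ 'l"
 assumes "\<And>i. \<bar>t $ i - 1\<bar> \<le> r"
 shows "norm (rescale t v - v) \<le> r * norm v"
proof (rule norm_vec_le)
 show "norm ((rescale t v - v) $ i) \<le> r * norm (v $ i)" for i
 proof -
  have "(rescale t v - v) $ i = (t $ i - 1) *\<^sub>R v $ i" by (simp add: scaleR_left_diff_distrib)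
  then show ?thesis using assms[of i] by (simp add: mult_right_mono)
 qed
 show "0 \<le> r" using assms[of undefined] by linarith
qed

lemma norm_vec_squared: "(norm (v :: 'h::real_inner ^ 'l))\<^sup>2 = (\<Sum>i\<in>UNIV. (norm (v $ i))\<^sup>2)"
 by (simp add: norm_vec_def L2_set_def sum_nonneg)

lemma inner_axis_vec: "(u :: 'h::real_inner ^ 'l) \<bullet> axis k h = u $ k \<bullet> h"
 by (simp add: inner_vec_def axis_def if_distrib[of "inner _"] cong: if_cong)

text \<open>The energy lost, per unit of squared norm, when a component of an element of the Nehari set
 is multiplied by \<open>t\<close>; see \<open>I_rescale_le\<close> below.\<close>

definition nehari_gap :: "real \<Rightarrow> real \<Rightarrow> real" where
 "nehari_gap p t = (1 / 2 - 1 / (2 * p)) - (t\<^sup>2 / 2 - t powr (2 * p) / (2 * p))"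

text \<open>With s = t^2, the function s/2 - s^p/(2p) has its strict maximum at s = 1, where its
  derivative (1 - s^(p-1))/2 changes sign.\<close>

lemma nehari_gap_pos:
 assumes p: "1 < p" and t: "0 < t" "t \<noteq> 1"
 shows "0 < nehari_gap p t"
proof -
 define s where "s = t\<^sup>2"
 have s: "0 < s" "s \<noteq> 1" using t by (auto simp: s_def power2_eq_1_iff)
 have ts: "t powr (2 * p) = s powr p" using t by (simp add: s_def powr_powr[symmetric] powr_numeral)
 define f where "f x = x powr p / (2 * p) - x / 2" for x
 have der: "(f has_real_derivative (x powr (p - 1) - 1) / 2) (at x)" if "0 < x" for x
  unfolding f_def using that p by (auto intro!: derivative_eq_intros simp: field_simps)
 have "f 1 < f s"
 proof (cases "s < 1")
  case True
  obtain z where z: "s < z" "z < 1" "f 1 - f s = (1 - s) * ((z powr (p - 1) - 1) / 2)"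
   using MVT2[OF True, of f "\<lambda>x. (x powr (p - 1) - 1) / 2"] der s(1) by auto
  have "z powr (p - 1) < 1 powr (p - 1)" using z s p by (intro powr_less_mono2) auto
  then have "(1 - s) * ((z powr (p - 1) - 1) / 2) < 0" using True by (intro mult_pos_neg) auto
  then show ?thesis using z(3) by linarith
 next
  case False
  then have "1 < s" using s by simp
  then obtain z where z: "1 < z" "z < s" "f s - f 1 = (s - 1) * ((z powr (p - 1) - 1) / 2)"
   using MVT2[of 1 s f "\<lambda>x. (x powr (p - 1) - 1) / 2"] der by auto
  have "1 powr (p - 1) < z powr (p - 1)" using z p by (intro powr_less_mono2) auto
  then have "0 < (s - 1) * ((z powr (p - 1) - 1) / 2)" using \<open>1 < s\<close> by (intro mult_pos_pos) auto
  then show ?thesis using z(3) by linarith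
 qed
 then show ?thesis by (simp add: nehari_gap_def f_def ts s_def)
qed

lemma nehari_gap_nonneg: "1 < p \<Longrightarrow> 0 < t \<Longrightarrow> 0 \<le> nehari_gap p t"
 using nehari_gap_pos[of p t] by (cases "t = 1") (auto simp: nehari_gap_def)

abbreviation total :: "('l::finite \<Rightarrow> 'l \<Rightarrow> 'b \<Rightarrow> real) \<Rightarrow> 'b \<Rightarrow> real" where
 "total B v \<equiv> \<Sum>i\<in>UNIV. \<Sum>j\<in>UNIV. B i j v"

text \<open>The model for \<open>\<beta> i j\<close> is the integral of a coefficient times |v_i|^p
  |v_j|^p, and \<open>G\<close> is the gradient of \<open>total \<beta> / (2 * p)\<close>, in which
  every pair of distinct indices occurs twice. \<open>G_weak\<close> is one-sided, as only an upper
  bound follows from the sign of the coefficients far away. \<open>\<beta>_detect\<close> and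
  \<open>spheres\<close> are the two opposing ingredients of the Borsuk-Ulam argument.\<close>

locale nehari_functional =
 fixes p :: real
  and \<beta> :: "'l::finite \<Rightarrow> 'l \<Rightarrow> 'h::{real_inner,complete_space} ^ 'l \<Rightarrow> real"
  and G :: "'h ^ 'l \<Rightarrow> 'h ^ 'l"
 assumes p: "1 < p"
  and \<beta>_sym: "\<And>i j v. \<beta> i j v = \<beta> j i v"
  and \<beta>_nonpos: "\<And>i j v. i \<noteq> j \<Longrightarrow> \<beta> i j v \<le> 0"
  and \<beta>_rescale: "\<And>i j t v. (\<And>i. 0 \<le> t $ i) \<Longrightarrow>
    \<beta> i j (rescale t v) = (t $ i) powr p * (t $ j) powr p * \<beta> i j v"
  and G_odd: "\<And>v. G (- v) = - G v"
  and \<beta>_even: "\<And>i j v. \<beta> i j (- v) = \<beta> i j v"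
  and G_euler: "\<And>v i. G v $ i \<bullet> v $ i = (\<Sum>j\<in>UNIV. \<beta> i j v)"
  and G_deriv: "\<And>R e. 0 < e \<Longrightarrow> \<exists>d>0. \<forall>v h. norm v \<le> R \<longrightarrow> norm h \<le> d \<longrightarrow>
    \<bar>total \<beta> (v + h) / (2 * p) - total \<beta> v / (2 * p) - G v \<bullet> h\<bar>
     \<le> e * norm h"
  and G_uniform: "\<And>R e. 0 < e \<Longrightarrow> \<exists>d>0. \<forall>v w. norm v \<le> R \<longrightarrow> norm w \<le> R \<longrightarrow> norm (v - w) \<le> d \<longrightarrow>
    norm (G v - G w) \<le> e"
  and G_bounded: "\<And>R. \<exists>K. \<forall>v. norm v \<le> R \<longrightarrow> norm (G v) \<le> K"
  and \<beta>_bound: "\<exists>K>0. \<forall>i v. \<beta> i i v \<le> K * norm (v $ i) powr (2 * p)"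
  and G_weak: "\<And>(x :: nat \<Rightarrow> 'h ^ 'l) v C e. (\<And>n. norm (x n) \<le> C) \<Longrightarrow>
    (\<And>w. (\<lambda>n. x n \<bullet> w) \<longlonglongrightarrow> v \<bullet> w) \<Longrightarrow> 0 < e \<Longrightarrow>
    eventually (\<lambda>n. G (x n) \<bullet> (x n - v) \<le> e) sequentially"
  and \<beta>_detect: "\<And>R c i. 0 < c \<Longrightarrow> \<exists>m (\<Lambda> :: nat \<Rightarrow> 'h ^ 'l \<Rightarrow> real). (\<forall>j. bounded_linear (\<Lambda> j)) \<and>
    (\<forall>v. norm v \<le> R \<longrightarrow> (\<forall>j<m. \<Lambda> j v = 0) \<longrightarrow> \<beta> i i v < c)"
  and spheres: "\<And>n. \<exists>f. continuous_on (topspace (nsphere n)) f \<and>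
    (\<forall>x\<in>topspace (nsphere n). f (\<lambda>i. - x i) = - f x \<and>
     (\<forall>i. f x $ i \<noteq> 0 \<and> 0 < \<beta> i i (f x) \<and> (\<forall>j. j \<noteq> i \<longrightarrow> \<beta> i j (f x) = 0)))"
begin

definition I :: "'h ^ 'l \<Rightarrow> real" where
 "I v = (norm v)\<^sup>2 / 2 - total \<beta> v / (2 * p)"

definition grad :: "'h ^ 'l \<Rightarrow> 'h ^ 'l" where
 "grad v = v - G v"

definition N :: "('h ^ 'l) set" where
 "N = {v. \<forall>i. v $ i \<noteq> 0 \<and> (norm (v $ i))\<^sup>2 = (\<Sum>j\<in>UNIV. \<beta> i j v)}"

lemma I_even: "I (- v) = I v" by (simp add: I_def \<beta>_even)

lemma grad_odd: "grad (- v) = - grad v" by (simp add: grad_def G_odd)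

lemma N_minus: "v \<in> N \<Longrightarrow> - v \<in> N" by (simp add: N_def \<beta>_even)

lemma I_deriv:
 assumes "0 < e"
 shows "\<exists>d>0. \<forall>v h. norm v \<le> R \<longrightarrow> norm h \<le> d \<longrightarrow> \<bar>I (v + h) - I v - grad v \<bullet> h\<bar> \<le> e * norm h"
proof -
 obtain d where d: "0 < d" "\<And>v h. norm v \<le> R \<Longrightarrow> norm h \<le> d \<Longrightarrow>
   \<bar>total \<beta> (v + h) / (2 * p) - total \<beta> v / (2 * p) - G v \<bullet> h\<bar>
     \<le> e / 2 * norm h"
  using G_deriv[of "e / 2" R] assms by auto
 show ?thesis
 proof (intro exI[of _ "min d e"] conjI allI impI)
  fix v h :: "'h ^ 'l" assume v: "norm v \<le> R" and h: "norm h \<le> min d e"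
  let ?P = "\<lambda>v. total \<beta> v / (2 * p)"
  have "I (v + h) - I v - grad v \<bullet> h = (norm h)\<^sup>2 / 2 - (?P (v + h) - ?P v - G v \<bullet> h)"
   by (simp add: I_def grad_def power2_norm_eq_inner inner_simps inner_commute field_simps)
  moreover have "(norm h)\<^sup>2 / 2 \<le> e / 2 * norm h"
   using h by (simp add: power2_eq_square mult_right_mono)
  moreover have "0 \<le> (norm h)\<^sup>2 / 2" by simp
  moreover have "\<bar>?P (v + h) - ?P v - G v \<bullet> h\<bar> \<le> e / 2 * norm h" using d(2)[of v h] v h by simp
  moreover have "e * norm h = e / 2 * norm h + e / 2 * norm h" by simp
  ultimately show "\<bar>I (v + h) - I v - grad v \<bullet> h\<bar> \<le> e * norm h" by linarith
 qed (use d(1) assms in simp)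
qed

lemma grad_bounded: "\<exists>K>0. \<forall>v. norm v \<le> R \<longrightarrow> norm (grad v) \<le> K"
proof -
 obtain K where K: "\<And>v. norm v \<le> R \<Longrightarrow> norm (G v) \<le> K" using G_bounded by blast
 have "norm (grad v) \<le> \<bar>R\<bar> + \<bar>K\<bar> + 1" if "norm v \<le> R" for v
  using norm_triangle_ineq4[of v "G v"] K[OF that] that by (simp add: grad_def)
 then show ?thesis by (intro exI[of _ "\<bar>R\<bar> + \<bar>K\<bar> + 1"]) auto
qed

lemma grad_uniform:
 assumes "0 < e"
 shows "\<exists>d>0. \<forall>v w. norm v \<le> R \<longrightarrow> norm w \<le> R \<longrightarrow> norm (v - w) \<le> d \<longrightarrow> norm (grad v - grad w) \<le> e"
proof -
 obtain d where d: "0 < d" "\<And>v w. norm v \<le> R \<Longrightarrow> norm w \<le> R \<Longrightarrow> norm (v - w) \<le> d \<Longrightarrow> norm (G v - G w) \<le> e / 2"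
  using G_uniform[of "e / 2" R] assms by auto
 have "norm (grad v - grad w) \<le> e" if "norm v \<le> R" "norm w \<le> R" "norm (v - w) \<le> min d (e / 2)" for v w
 proof -
  have "grad v - grad w = (v - w) - (G v - G w)" by (simp add: grad_def)
  then have "norm (grad v - grad w) \<le> norm (v - w) + norm (G v - G w)" by (simp add: norm_triangle_ineq4)
  then show ?thesis using d(2)[of v w] that by simp
 qed
 then show ?thesis using d(1) assms by (intro exI[of _ "min d (e / 2)"]) auto
qed

lemma I_uniform:
 assumes "0 < e"
 shows "\<exists>d>0. \<forall>v w. norm v \<le> R \<longrightarrow> norm (w - v) \<le> d \<longrightarrow> \<bar>I w - I v\<bar> \<le> e"
proof -
 obtain d where d: "0 < d" "\<And>v h. norm v \<le> R \<Longrightarrow> norm h \<le> d \<Longrightarrow> \<bar>I (v + h) - I v - grad v \<bullet> h\<bar> \<le> 1 * norm h"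
  using I_deriv[of 1 R] by auto
 obtain K where K: "0 < K" "\<And>v. norm v \<le> R \<Longrightarrow> norm (grad v) \<le> K" using grad_bounded by blast
 have "\<bar>I w - I v\<bar> \<le> e" if v: "norm v \<le> R" and h: "norm (w - v) \<le> min d (e / (K + 1))" for v w
 proof -
  have "\<bar>I w - I v - grad v \<bullet> (w - v)\<bar> \<le> norm (w - v)" using d(2)[of v "w - v"] v h by simp
  moreover have "\<bar>grad v \<bullet> (w - v)\<bar> \<le> K * norm (w - v)"
   using Cauchy_Schwarz_ineq2[of "grad v" "w - v"] mult_right_mono[OF K(2)[OF v], of "norm (w - v)"] by simp
  moreover have "(K + 1) * norm (w - v) \<le> e" using h K(1) by (simp add: pos_le_divide_eq mult.commute)
  ultimately show ?thesis by (simp add: distrib_right)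
 qed
 then show ?thesis using d(1) assms K(1) by (intro exI[of _ "min d (e / (K + 1))"]) auto
qed

lemma continuous_on_I: "continuous_on UNIV I"
proof (intro continuous_at_imp_continuous_on ballI)
 fix v :: "'h ^ 'l"
 show "isCont I v" unfolding continuous_at_eps_delta
 proof (intro allI impI)
  fix e :: real assume e: "0 < e"
  obtain d where d: "0 < d" "\<And>u w. norm u \<le> norm v \<Longrightarrow> norm (w - u) \<le> d \<Longrightarrow> \<bar>I w - I u\<bar> \<le> e / 2"
   using I_uniform[of "e / 2" "norm v"] e by auto
  have "dist (I x) (I v) < e" if "dist x v < d" for x
   using d(2)[of v x] that e by (simp add: dist_norm)
  then show "\<exists>d>0. \<forall>x'. dist x' v < d \<longrightarrow> dist (I x') (I v) < e"
   using d(1) by blast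
 qed
qed

lemma continuous_on_grad: "continuous_on UNIV grad"
proof (intro continuous_at_imp_continuous_on ballI)
 fix v :: "'h ^ 'l"
 show "isCont grad v" unfolding continuous_at_eps_delta
 proof (intro allI impI)
  fix e :: real assume e: "0 < e"
  obtain d where d: "0 < d" "\<And>u w. norm u \<le> norm v + 1 \<Longrightarrow> norm w \<le> norm v + 1 \<Longrightarrow> norm (u - w) \<le> d \<Longrightarrow> norm (grad u - grad w) \<le> e / 2"
   using grad_uniform[of "e / 2" "norm v + 1"] e by auto
  have "dist (grad x) (grad v) < e" if "dist x v < min d 1" for x
  proof -
   have "norm x \<le> norm v + 1" using norm_triangle_sub[of x v] that by (simp add: dist_norm)
   then show ?thesis using d(2)[of x v] that e by (simp add: dist_norm)
  qed
  then show "\<exists>d>0. \<forall>x'. dist x' v < d \<longrightarrow> dist (grad x') (grad v) < e"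
   using d(1) by (intro exI[of _ "min d 1"]) auto
 qed
qed

lemma grad_euler: "grad v $ i \<bullet> v $ i = (norm (v $ i))\<^sup>2 - (\<Sum>j\<in>UNIV. \<beta> i j v)"
 by (simp add: grad_def inner_diff_left G_euler power2_norm_eq_inner)

lemma N_iff: "v \<in> N \<longleftrightarrow> (\<forall>i. v $ i \<noteq> 0 \<and> grad v $ i \<bullet> v $ i = 0)"
 by (auto simp: N_def grad_euler)

lemma I_on_N: "v \<in> N \<Longrightarrow> I v = (1 / 2 - 1 / (2 * p)) * (norm v)\<^sup>2"
 using p by (simp add: I_def N_def norm_vec_squared field_simps)

lemma I_coeff_pos: "0 < 1 / 2 - 1 / (2 * p)" using p by (simp add: field_simps)

text \<open>On \<open>N\<close> the couplings only subtract, so |v_i|^2 is at most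
  \<open>\<beta> i i v\<close> and hence at most K |v_i|^(2p). As 2p > 2, this bounds |v_i| from
  below.\<close>

lemma N_lower_bound: "\<exists>c>0. \<forall>v\<in>N. \<forall>i. c \<le> norm (v $ i) \<and> c\<^sup>2 \<le> \<beta> i i v"
proof -
 obtain K where K: "0 < K" "\<And>i v. \<beta> i i v \<le> K * norm (v $ i) powr (2 * p)" using \<beta>_bound by blast
 define c where "c = (1 / K) powr (1 / (2 * p - 2))"
 have c: "0 < c" using K(1) by (simp add: c_def)
 have "c \<le> norm (v $ i) \<and> c\<^sup>2 \<le> \<beta> i i v" if v: "v \<in> N" for v i
 proof -
  let ?n = "norm (v $ i)"
  have n: "0 < ?n" using v by (simp add: N_def)
  have "?n\<^sup>2 = \<beta> i i v + (\<Sum>j\<in>UNIV - {i}. \<beta> i j v)"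
   using v by (simp add: N_def sum.remove[of UNIV i])
  moreover have "(\<Sum>j\<in>UNIV - {i}. \<beta> i j v) \<le> 0" by (rule sum_nonpos) (auto intro: \<beta>_nonpos)
  ultimately have le: "?n\<^sup>2 \<le> \<beta> i i v" by simp
  also have "\<dots> \<le> K * ?n powr (2 * p)" by (rule K)
  also have "?n powr (2 * p) = ?n powr (2 * p - 2) * ?n powr 2"
   using powr_add[of ?n "2 * p - 2" 2] by (simp del: powr_numeral)
  also have "\<dots> = ?n powr (2 * p - 2) * ?n\<^sup>2" using n by (simp add: powr_numeral)
  finally have "1 * ?n\<^sup>2 \<le> (K * ?n powr (2 * p - 2)) * ?n\<^sup>2" by (simp add: mult.assoc)
  then have "1 \<le> K * ?n powr (2 * p - 2)" using n by (subst (asm) mult_le_cancel_right) simp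
  then have "1 / K \<le> ?n powr (2 * p - 2)" using K(1) by (simp add: field_simps)
  then have "c \<le> (?n powr (2 * p - 2)) powr (1 / (2 * p - 2))"
   unfolding c_def using K(1) p by (intro powr_mono2) auto
  also have "\<dots> = ?n" using p n by (simp add: powr_powr)
  finally have "c \<le> ?n" .
  moreover from this have "c\<^sup>2 \<le> ?n\<^sup>2" using c by (intro power_mono) auto
  ultimately show ?thesis using le by simp
 qed
 then show ?thesis using c by blast
qed

text \<open>Put s_i = t_i^p. Since s_i s_j is at most the mean of s_i^2 and s_j^2 and the
  off-diagonal \<beta> are nonpositive, the total after rescaling is at least the sum of s_i^2
  |v_i|^2. The bound thus decouples into functions of one factor each.\<close>

lemma I_rescale_le:
 assumes v: "v \<in> N" and t: "\<And>i. 0 < t $ i"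
 shows "I (rescale t v) \<le> I v - (\<Sum>i\<in>UNIV. (norm (v $ i))\<^sup>2 * nehari_gap p (t $ i))"
proof -
 let ?a = "\<lambda>i. (norm (v $ i))\<^sup>2"
 let ?s = "\<lambda>i. (t $ i) powr p"
 have a: "?a i = (\<Sum>j\<in>UNIV. \<beta> i j v)" for i using v by (simp add: N_def)
 have sq: "(?s i)\<^sup>2 = (t $ i) powr (2 * p)" for i
  using t[of i] by (simp add: power2_eq_square flip: powr_add)
 have pair: "\<beta> i j v * ((?s i)\<^sup>2 + (?s j)\<^sup>2) / 2 \<le> ?s i * ?s j * \<beta> i j v" for i j
 proof (cases "i = j")
  case True
  then show ?thesis by (simp add: power2_eq_square)
 next
  case False
  have "0 \<le> (?s i - ?s j)\<^sup>2" by simp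
  then have "?s i * ?s j \<le> ((?s i)\<^sup>2 + (?s j)\<^sup>2) / 2" by (simp add: power2_eq_square algebra_simps)
  from mult_left_mono_neg[OF this \<beta>_nonpos[OF False, of v]] show ?thesis by (simp add: mult_ac)
 qed
 have "(\<Sum>i\<in>UNIV. (?s i)\<^sup>2 * ?a i) = (\<Sum>i\<in>UNIV. \<Sum>j\<in>UNIV. \<beta> i j v * ((?s i)\<^sup>2 + (?s j)\<^sup>2) / 2)"
 proof -
  have "(\<Sum>i\<in>UNIV. \<Sum>j\<in>UNIV. \<beta> i j v * ((?s i)\<^sup>2 + (?s j)\<^sup>2) / 2)
    = (\<Sum>i\<in>UNIV. \<Sum>j\<in>UNIV. \<beta> i j v * (?s i)\<^sup>2 / 2) + (\<Sum>i\<in>UNIV. \<Sum>j\<in>UNIV. \<beta> i j v * (?s j)\<^sup>2 / 2)"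
   by (simp add: sum.distrib[symmetric] distrib_left add_divide_distrib)
  also have "(\<Sum>i\<in>UNIV. \<Sum>j\<in>UNIV. \<beta> i j v * (?s j)\<^sup>2 / 2) = (\<Sum>i\<in>UNIV. \<Sum>j\<in>UNIV. \<beta> i j v * (?s i)\<^sup>2 / 2)"
   by (subst sum.swap) (simp add: \<beta>_sym)
  also have "(\<Sum>i\<in>UNIV. \<Sum>j\<in>UNIV. \<beta> i j v * (?s i)\<^sup>2 / 2) = (\<Sum>i\<in>UNIV. (?s i)\<^sup>2 * ?a i / 2)"
   unfolding a by (intro sum.cong refl) (simp add: sum_distrib_left sum_distrib_right sum_divide_distrib mult.commute)
  finally show ?thesis by (simp add: sum_divide_distrib[symmetric])
 qed
 also have "\<dots> \<le> (\<Sum>i\<in>UNIV. \<Sum>j\<in>UNIV. ?s i * ?s j * \<beta> i j v)" by (intro sum_mono pair)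
 finally have key: "(\<Sum>i\<in>UNIV. (?s i)\<^sup>2 * ?a i) \<le> total \<beta> (rescale t v)"
  using \<beta>_rescale[of t] t by (simp add: less_imp_le)
 have "I (rescale t v) = (\<Sum>i\<in>UNIV. (t $ i)\<^sup>2 * ?a i) / 2 - total \<beta> (rescale t v) / (2 * p)"
  by (simp add: I_def norm_vec_squared power_mult_distrib)
 also have "\<dots> \<le> (\<Sum>i\<in>UNIV. (t $ i)\<^sup>2 * ?a i) / 2 - (\<Sum>i\<in>UNIV. (?s i)\<^sup>2 * ?a i) / (2 * p)"
  using p key by (simp add: divide_right_mono)
 also have "\<dots> = (\<Sum>i\<in>UNIV. ?a i * ((t $ i)\<^sup>2 / 2 - (t $ i) powr (2 * p) / (2 * p)))"
  by (simp add: sq sum_divide_distrib sum_subtractf[symmetric] algebra_simps)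
 also have "\<dots> = (\<Sum>i\<in>UNIV. (1 / 2 - 1 / (2 * p)) * ?a i) - (\<Sum>i\<in>UNIV. ?a i * nehari_gap p (t $ i))"
  by (simp add: nehari_gap_def sum_subtractf[symmetric] algebra_simps)
 also have "(\<Sum>i\<in>UNIV. (1 / 2 - 1 / (2 * p)) * ?a i) = I v"
  by (simp add: I_on_N[OF v] norm_vec_squared sum_distrib_left)
 finally show ?thesis .
qed

text \<open>Each of the two elements of \<open>N\<close> is a rescaling of the other, so neither has
  the smaller energy and all gaps vanish.\<close>

lemma N_rescale_unique:
 assumes v: "v \<in> N" and t: "\<And>i. 0 < t $ i" and tv: "rescale t v \<in> N"
 shows "t = 1"
proof -
 define s where "s = (\<chi> i. 1 / t $ i)"
 have s: "0 < s $ i" for i using t by (simp add: s_def)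
 have st: "rescale s (rescale t v) = v"
  using t by (simp add: s_def rescale_rescale vec_eq_iff less_imp_neq[symmetric])
 have n: "0 \<le> (\<Sum>i\<in>UNIV. (norm (rescale t v $ i))\<^sup>2 * nehari_gap p (s $ i))"
  by (intro sum_nonneg mult_nonneg_nonneg nehari_gap_nonneg p s) simp
 have "I v \<le> I (rescale t v)" using I_rescale_le[OF tv s] n unfolding st by linarith
 then have z: "(\<Sum>i\<in>UNIV. (norm (v $ i))\<^sup>2 * nehari_gap p (t $ i)) \<le> 0"
  using I_rescale_le[OF v t] by linarith
 have nn: "0 \<le> (norm (v $ i))\<^sup>2 * nehari_gap p (t $ i)" for i
  by (intro mult_nonneg_nonneg nehari_gap_nonneg p t) simp
 have "(norm (v $ i))\<^sup>2 * nehari_gap p (t $ i) = 0" for i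
  using z nn by (metis (no_types, lifting) UNIV_I antisym finite_class.finite_UNIV sum_nonneg sum_nonneg_eq_0_iff)
 then have "t $ i = 1" for i
  using nehari_gap_pos[OF p t[of i]] v by (force simp: N_def)
 then show ?thesis by (simp add: vec_eq_iff)
qed

lemma rescale_coordinate_deriv:
 "((\<lambda>s. I (rescale (t + s *\<^sub>R axis k 1) w)) has_real_derivative grad (rescale t w) $ k \<bullet> w $ k) (at 0)"
proof -
 let ?h = "axis k (w $ k) :: 'h ^ 'l"
 have eq: "rescale (t + s *\<^sub>R axis k 1) w = rescale t w + s *\<^sub>R ?h" for s
  by (simp add: vec_eq_iff axis_def scaleR_add_left)
 have "((\<lambda>s. (I (rescale t w + s *\<^sub>R ?h) - I (rescale t w)) / s) \<longlongrightarrow> grad (rescale t w) \<bullet> ?h) (at 0)"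
  unfolding LIM_eq
 proof (intro allI impI)
  fix e :: real assume e: "0 < e"
  define e' where "e' = e / (2 * (norm ?h + 1))"
  have e': "0 < e'" using e by (simp add: e'_def add_nonneg_pos)
  obtain d where d: "0 < d" "\<And>v h. norm v \<le> norm (rescale t w) \<Longrightarrow> norm h \<le> d \<Longrightarrow> \<bar>I (v + h) - I v - grad v \<bullet> h\<bar> \<le> e' * norm h"
   using I_deriv[OF e', of "norm (rescale t w)"] by auto
  have "norm ((I (rescale t w + s *\<^sub>R ?h) - I (rescale t w)) / s - grad (rescale t w) \<bullet> ?h) < e"
   if s: "s \<noteq> 0" "norm (s - 0) < d / (norm ?h + 1)" for s
  proof -
   have "\<bar>s\<bar> * (norm ?h + 1) < d" using s(2) by (simp add: pos_less_divide_eq add_nonneg_pos)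
   then have "norm (s *\<^sub>R ?h) \<le> d" by (simp add: distrib_left)
   from d(2)[OF order_refl this]
   have "\<bar>I (rescale t w + s *\<^sub>R ?h) - I (rescale t w) - s * (grad (rescale t w) \<bullet> ?h)\<bar> \<le> \<bar>s\<bar> * (e' * norm ?h)"
    by (simp add: mult_ac)
   moreover have "I (rescale t w + s *\<^sub>R ?h) - I (rescale t w) - s * (grad (rescale t w) \<bullet> ?h)
     = s * ((I (rescale t w + s *\<^sub>R ?h) - I (rescale t w)) / s - grad (rescale t w) \<bullet> ?h)"
    using s(1) by (simp add: field_simps)
   ultimately have "\<bar>(I (rescale t w + s *\<^sub>R ?h) - I (rescale t w)) / s - grad (rescale t w) \<bullet> ?h\<bar> \<le> e' * norm ?h"
    using s(1) by (simp only: abs_mult) simp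
   also have "\<dots> < e' * (norm ?h + 1) + e' * (norm ?h + 1)"
    using e' by (simp add: distrib_left add_nonneg_pos)
   also have "\<dots> = e" by (simp add: e'_def field_simps add_nonneg_eq_0_iff)
   finally show ?thesis by simp
  qed
  then show "\<exists>sa>0. \<forall>s. s \<noteq> 0 \<and> norm (s - 0) < sa \<longrightarrow>
    norm ((I (rescale t w + s *\<^sub>R ?h) - I (rescale t w)) / s - grad (rescale t w) \<bullet> ?h) < e"
   using d(1) by (intro exI[of _ "d / (norm ?h + 1)"]) (auto simp: add_nonneg_pos)
 qed
 then show ?thesis
  unfolding has_field_derivative_iff by (simp add: eq inner_axis_vec)
qed

section \<open>Maximal rescalings, the projection onto the Nehari set, and descent\<close>

lemma continuous_on_rescale:
 fixes w :: "'h ^ 'l"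
 shows "continuous_on A (\<lambda>t. rescale t w)"
proof -
 have "continuous_on A (\<lambda>t. t $ i *\<^sub>R w $ i)" for i
  by (intro continuous_on_scaleR continuous_on_const continuous_on_component continuous_on_id)
 then show ?thesis unfolding rescale_def by (rule continuous_on_vec_lambda)
qed

text \<open>The last two properties are the first order conditions at a maximum over a box; at an
  interior factor they make the partial derivative vanish.\<close>

lemma rescale_maximizer:
 assumes lh: "(lo :: real) < hi"
 obtains t where "\<And>i. lo \<le> t $ i" "\<And>i. t $ i \<le> hi"
  "\<And>s. (\<And>i. lo \<le> s $ i \<and> s $ i \<le> hi) \<Longrightarrow> I (rescale s w) \<le> I (rescale t w)"
  "\<And>k. t $ k < hi \<Longrightarrow> grad (rescale t w) $ k \<bullet> w $ k \<le> 0"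
  "\<And>k. lo < t $ k \<Longrightarrow> 0 \<le> grad (rescale t w) $ k \<bullet> w $ k"
proof -
 let ?B = "cbox (\<chi> i. lo) (\<chi> i. hi) :: (real ^ 'l) set"
 have B: "s \<in> ?B \<longleftrightarrow> (\<forall>i. lo \<le> s $ i \<and> s $ i \<le> hi)" for s by (simp add: mem_box_cart)
 have "(\<chi> i. lo) \<in> ?B" using lh by (simp add: B)
 then have "?B \<noteq> {}" by blast
 moreover have "continuous_on ?B (I \<circ> (\<lambda>s. rescale s w))"
  by (intro continuous_on_compose continuous_on_rescale continuous_on_subset[OF continuous_on_I]) simp
 ultimately obtain t where t: "t \<in> ?B" "\<And>s. s \<in> ?B \<Longrightarrow> I (rescale s w) \<le> I (rescale t w)"
  using continuous_attains_sup[of ?B "I \<circ> (\<lambda>s. rescale s w)"] compact_cbox by auto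
 let ?D = "\<lambda>k. grad (rescale t w) $ k \<bullet> w $ k"
 let ?f = "\<lambda>k s. I (rescale (t + s *\<^sub>R axis k 1) w)"
 have inB: "t + s *\<^sub>R axis k 1 \<in> ?B" if "lo \<le> t $ k + s" "t $ k + s \<le> hi" for k s
  using t(1) that unfolding B by (auto simp: axis_def)
 have up: "?D k \<le> 0" if k: "t $ k < hi" for k
 proof (rule ccontr)
  assume "\<not> ?D k \<le> 0"
  then have "0 < ?D k" by simp
  from DERIV_pos_inc_right[OF rescale_coordinate_deriv this]
  obtain d where d: "0 < d" "\<And>h. 0 < h \<Longrightarrow> h < d \<Longrightarrow> ?f k 0 < ?f k (0 + h)" by blast
  define h where "h = min (d / 2) (hi - t $ k)"
  have h: "0 < h" "h < d" "t $ k + h \<le> hi" using d(1) k by (auto simp: h_def)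
  have "t + h *\<^sub>R axis k 1 \<in> ?B" using h t(1)[unfolded B] by (intro inB) (auto intro: add_increasing2)
  then show False using d(2)[OF h(1,2)] t(2) by fastforce
 qed
 have dn: "0 \<le> ?D k" if k: "lo < t $ k" for k
 proof (rule ccontr)
  assume "\<not> 0 \<le> ?D k"
  then have "?D k < 0" by simp
  from DERIV_neg_dec_left[OF rescale_coordinate_deriv this]
  obtain d where d: "0 < d" "\<And>h. 0 < h \<Longrightarrow> h < d \<Longrightarrow> ?f k 0 < ?f k (0 - h)" by blast
  define h where "h = min (d / 2) (t $ k - lo)"
  have h: "0 < h" "h < d" "lo \<le> t $ k - h" using d(1) k by (auto simp: h_def)
  have "t $ k \<le> hi" using t(1) unfolding B by blast
  then have "t $ k - h \<le> hi" using h by linarith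
  then have "t + (- h) *\<^sub>R axis k 1 \<in> ?B" using h by (intro inB) auto
  then show False using d(2)[OF h(1,2)] t(2) by fastforce
 qed
 show ?thesis using t up dn unfolding B by (intro that[of t]) auto
qed

text \<open>A factor on the boundary of the box costs \<open>v\<close> a fixed amount of energy, and
  \<open>I\<close> is uniformly continuous on bounded sets. For \<open>w\<close> close to
  \<open>v\<close> the maximiser over the box is therefore interior, and there the first order
  conditions place the rescaling in \<open>N\<close>.\<close>

lemma rescale_near_N:
 assumes \<rho>: "0 < \<rho>" "\<rho> \<le> 1 / 2"
 shows "\<exists>r>0. \<forall>v\<in>N. norm v \<le> R \<longrightarrow> (\<forall>w. norm (w - v) < r \<longrightarrow>
  (\<exists>t. (\<forall>i. \<bar>t $ i - 1\<bar> \<le> \<rho>) \<and> rescale t w \<in> N))"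
proof -
 obtain c where c: "0 < c" "\<And>v i. v \<in> N \<Longrightarrow> c \<le> norm (v $ i)" using N_lower_bound by blast
 \<comment> \<open>This is a lower bound for the energy lost when some factor equals 1 - \<rho> or 1
   + \<rho>. Replacing \<open>w\<close> by \<open>v\<close> twice costs \<delta>/3 each time, which
   is less.\<close>
 define \<delta> where "\<delta> = c\<^sup>2 * min (nehari_gap p (1 - \<rho>)) (nehari_gap p (1 + \<rho>))"
 have gap: "0 < nehari_gap p (1 - \<rho>)" "0 < nehari_gap p (1 + \<rho>)"
  using nehari_gap_pos[OF p] \<rho> by auto
 then have \<delta>: "0 < \<delta>" using c by (simp add: \<delta>_def)
 obtain d where d: "0 < d" "\<And>v w. norm v \<le> 2 * R \<Longrightarrow> norm (w - v) \<le> d \<Longrightarrow> \<bar>I w - I v\<bar> \<le> \<delta> / 3"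
  using I_uniform[of "\<delta> / 3" "2 * R"] \<delta> by auto
 have "\<exists>t. (\<forall>i. \<bar>t $ i - 1\<bar> \<le> \<rho>) \<and> rescale t w \<in> N"
  if v: "v \<in> N" "norm v \<le> R" and w: "norm (w - v) < min (d / 2) c" for v w
 proof -
  have lh: "1 - \<rho> < 1 + \<rho>" using \<rho> by simp
  obtain t where t: "\<And>i. 1 - \<rho> \<le> t $ i" "\<And>i. t $ i \<le> 1 + \<rho>"
   "\<And>s. (\<And>i. 1 - \<rho> \<le> s $ i \<and> s $ i \<le> 1 + \<rho>) \<Longrightarrow> I (rescale s w) \<le> I (rescale t w)"
   "\<And>k. t $ k < 1 + \<rho> \<Longrightarrow> grad (rescale t w) $ k \<bullet> w $ k \<le> 0"
   "\<And>k. 1 - \<rho> < t $ k \<Longrightarrow> 0 \<le> grad (rescale t w) $ k \<bullet> w $ k"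
   using rescale_maximizer[OF lh, of w] by blast
  have tpos: "0 < t $ i" for i using t(1)[of i] \<rho> by linarith
  have t2: "\<bar>t $ i\<bar> \<le> 2" for i using t(2)[of i] tpos[of i] \<rho> by linarith
  have "I w \<le> I (rescale t w)" using t(3)[of 1] \<rho> by simp
  moreover have "\<bar>I w - I v\<bar> \<le> \<delta> / 3"
   using v w d(1) norm_ge_zero[of v] by (intro d(2)) linarith+
  moreover have "\<bar>I (rescale t w) - I (rescale t v)\<bar> \<le> \<delta> / 3"
  proof (rule d(2))
   show "norm (rescale t v) \<le> 2 * R" using norm_rescale_le[OF t2, of v] v by linarith
   show "norm (rescale t w - rescale t v) \<le> d"
    using norm_rescale_le[OF t2, of "w - v"] w by (simp add: rescale_diff)
  qed
  ultimately have big: "I v - \<delta> < I (rescale t v)" using \<delta> by linarith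
  have inner: "t $ k \<noteq> 1 - \<rho> \<and> t $ k \<noteq> 1 + \<rho>" for k
  proof (rule ccontr)
   assume "\<not> (t $ k \<noteq> 1 - \<rho> \<and> t $ k \<noteq> 1 + \<rho>)"
   then have "min (nehari_gap p (1 - \<rho>)) (nehari_gap p (1 + \<rho>)) \<le> nehari_gap p (t $ k)" by auto
   moreover have "c\<^sup>2 \<le> (norm (v $ k))\<^sup>2" using c v by (intro power_mono) auto
   ultimately have "\<delta> \<le> (norm (v $ k))\<^sup>2 * nehari_gap p (t $ k)"
    unfolding \<delta>_def using gap by (intro mult_mono) auto
   also have "\<dots> \<le> (\<Sum>i\<in>UNIV. (norm (v $ i))\<^sup>2 * nehari_gap p (t $ i))"
    by (rule member_le_sum) (auto intro!: mult_nonneg_nonneg nehari_gap_nonneg p tpos)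
   finally show False using I_rescale_le[OF v(1) tpos] big by linarith
  qed
  have "rescale t w \<in> N" unfolding N_iff
  proof (intro allI conjI)
   fix k
   have "norm (v $ k) - norm (w $ k) \<le> norm ((w - v) $ k)"
    using norm_triangle_ineq2[of "v $ k" "w $ k"] by (simp add: norm_minus_commute)
   also have "\<dots> \<le> norm (w - v)" by (rule Finite_Cartesian_Product.norm_nth_le)
   finally have "w $ k \<noteq> 0" using c(2)[OF v(1), of k] w by auto
   then show "rescale t w $ k \<noteq> 0" using tpos[of k] by simp
   have "t $ k < 1 + \<rho>" "1 - \<rho> < t $ k"
    using inner[of k] t(1)[of k] t(2)[of k] by linarith+
   then have "grad (rescale t w) $ k \<bullet> w $ k = 0" using t(4)[of k] t(5)[of k] by linarith
   then show "grad (rescale t w) $ k \<bullet> rescale t w $ k = 0" by simp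
  qed
  moreover have "\<bar>t $ i - 1\<bar> \<le> \<rho>" for i using t(1)[of i] t(2)[of i] by linarith
  ultimately show ?thesis by blast
 qed
 then show ?thesis using d(1) c(1) by (intro exI[of _ "min (d / 2) c"]) auto
qed

definition U :: "('h ^ 'l) set" where
 "U = {w. \<exists>t. (\<forall>i. 0 < t $ i) \<and> rescale t w \<in> N}"

definition proj :: "'h ^ 'l \<Rightarrow> 'h ^ 'l" where
 "proj w = rescale (SOME t. (\<forall>i. 0 < t $ i) \<and> rescale t w \<in> N) w"

text \<open>Two rescalings of \<open>w\<close> in \<open>N\<close> differ by positive factors, so
  \<open>N_rescale_unique\<close> identifies them and the choice in \<open>proj\<close> is
  immaterial.\<close>

lemma proj_eq:
 assumes t: "\<And>i. 0 < t $ i" "rescale t w \<in> N"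
 shows "proj w = rescale t w"
proof -
 define s where "s = (SOME t. (\<forall>i. 0 < t $ i) \<and> rescale t w \<in> N)"
 have s: "0 < s $ i" "rescale s w \<in> N" for i
  using someI[of "\<lambda>t. (\<forall>i. 0 < t $ i) \<and> rescale t w \<in> N" t] t by (auto simp: s_def)
 define q where "q = (\<chi> i. s $ i / t $ i)"
 have qs: "rescale q (rescale t w) = rescale s w"
  using t(1) by (simp add: q_def vec_eq_iff less_imp_neq[symmetric])
 moreover have "q = 1" using t s by (intro N_rescale_unique[OF t(2)]) (auto simp: qs, simp add: q_def)
 ultimately show ?thesis by (simp add: proj_def s_def)
qed

lemma proj_in_N: "w \<in> U \<Longrightarrow> proj w \<in> N"
 using proj_eq by (fastforce simp: U_def)

lemma proj_on_N: "v \<in> N \<Longrightarrow> proj v = v"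
 using proj_eq[of 1 v] by simp

lemma proj_minus: "w \<in> U \<Longrightarrow> - w \<in> U \<and> proj (- w) = - proj w"
proof -
 assume "w \<in> U"
 then obtain t where t: "\<And>i. 0 < t $ i" "rescale t w \<in> N" by (auto simp: U_def)
 then have "rescale t (- w) \<in> N" using N_minus by (simp add: rescale_uminus)
 with t show ?thesis using proj_eq[of t "- w"] proj_eq[of t w] by (auto simp: U_def rescale_uminus)
qed

lemma proj_near_N:
 assumes \<rho>: "0 < \<rho>" "\<rho> \<le> 1 / 2"
 shows "\<exists>r>0. \<forall>v\<in>N. norm v \<le> R \<longrightarrow> (\<forall>w. norm (w - v) < r \<longrightarrow>
  w \<in> U \<and> (\<exists>t. (\<forall>i. \<bar>t $ i - 1\<bar> \<le> \<rho>) \<and> proj w = rescale t w))"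
proof -
 obtain r where r: "0 < r" "\<And>v w. v \<in> N \<Longrightarrow> norm v \<le> R \<Longrightarrow> norm (w - v) < r \<Longrightarrow>
  \<exists>t. (\<forall>i. \<bar>t $ i - 1\<bar> \<le> \<rho>) \<and> rescale t w \<in> N"
  using rescale_near_N[OF \<rho>, of R] by blast
 have "w \<in> U \<and> (\<exists>t. (\<forall>i. \<bar>t $ i - 1\<bar> \<le> \<rho>) \<and> proj w = rescale t w)"
  if "v \<in> N" "norm v \<le> R" "norm (w - v) < r" for v w
 proof -
  from r(2)[OF that] obtain t where t: "\<And>i. \<bar>t $ i - 1\<bar> \<le> \<rho>" "rescale t w \<in> N" by blast
  have "0 < t $ i" for i using t(1)[of i] \<rho> by linarith
  with t show ?thesis using proj_eq[of t w] by (auto simp: U_def)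
 qed
 with r(1) show ?thesis by blast
qed

text \<open>A point of \<open>U\<close> may be far from \<open>N\<close>. A fixed rescaling
  \<open>s\<close> carries \<open>w0\<close> into \<open>N\<close>, and \<open>proj\<close> is
  invariant under rescaling, so the estimate near \<open>N\<close> applies to the rescaled
  points.\<close>

lemma continuous_on_proj: "continuous_on U proj"
proof (unfold continuous_on_iff, intro ballI allI impI)
 fix w0 and e :: real assume "w0 \<in> U" and e: "0 < e"
 then obtain s where s: "\<And>i. 0 < s $ i" "rescale s w0 \<in> N" by (auto simp: U_def)
 let ?v = "rescale s w0"
 define \<rho> where "\<rho> = min (1 / 2) (e / (4 * (norm ?v + 1)))"
 have \<rho>: "0 < \<rho>" using e by (auto simp: \<rho>_def add_nonneg_pos)
 have \<rho>2: "\<rho> \<le> 1 / 2" unfolding \<rho>_def by (rule min.cobounded1)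
 have "\<rho> * (norm ?v + 1) \<le> e / (4 * (norm ?v + 1)) * (norm ?v + 1)"
  by (rule mult_right_mono) (auto simp: \<rho>_def)
 also have "\<dots> = e / 4" by (simp add: field_simps add_nonneg_eq_0_iff)
 finally have \<rho>e: "\<rho> * (norm ?v + 1) \<le> e / 4" .
 obtain r where r: "0 < r" "\<And>w. norm (w - ?v) < r \<Longrightarrow>
  w \<in> U \<and> (\<exists>t. (\<forall>i. \<bar>t $ i - 1\<bar> \<le> \<rho>) \<and> proj w = rescale t w)"
  using proj_near_N[OF \<rho> \<rho>2, of "norm ?v"] s(2) by blast
 \<comment> \<open>\<open>K\<close> bounds the factors of \<open>s\<close> and is thus a Lipschitz
   constant of the rescaling by \<open>s\<close>.\<close>
 define K where "K = (\<Sum>i\<in>UNIV. s $ i) + 1"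
 have sK: "\<bar>s $ i\<bar> \<le> K" for i
  using member_le_sum[of i UNIV "\<lambda>i. s $ i"] s(1) by (simp add: K_def less_imp_le)
 have K: "0 < K" using sK[of undefined] s(1)[of undefined] by linarith
 have "dist (proj w) (proj w0) < e" if w: "w \<in> U" "dist w w0 < min r (min 1 (e / 4)) / K" for w
 proof -
  let ?w = "rescale s w"
  have "norm (?w - ?v) \<le> K * norm (w - w0)" using norm_rescale_le[OF sK, of "w - w0"] by (simp add: rescale_diff)
  also have "\<dots> < min r (min 1 (e / 4))"
   using w(2) K by (simp add: dist_norm pos_less_divide_eq mult.commute)
  finally have n: "norm (?w - ?v) < r" "norm (?w - ?v) < 1" "norm (?w - ?v) < e / 4" by simp_all
  obtain t where t: "\<And>i. \<bar>t $ i - 1\<bar> \<le> \<rho>" "proj ?w = rescale t ?w" and "?w \<in> U" using r(2)[OF n(1)] by blast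
  have tp: "0 < t $ i" for i using t(1)[of i] \<rho>2 by linarith
  have "rescale (\<chi> i. t $ i * s $ i) w \<in> N"
   using proj_in_N[OF \<open>?w \<in> U\<close>] t(2) by (simp add: rescale_rescale)
  then have "proj w = rescale t ?w"
   using proj_eq[of "\<chi> i. t $ i * s $ i" w] tp s(1) by (simp add: rescale_rescale)
  then have "norm (proj w - ?w) \<le> \<rho> * norm ?w" using norm_rescale_diff_le[OF t(1)] by simp
  also have "\<dots> \<le> \<rho> * (norm ?v + 1)"
   using n(2) norm_triangle_sub[of ?w ?v] \<rho> by (intro mult_left_mono) linarith+
  finally have "norm (proj w - ?w) \<le> e / 4" using \<rho>e by linarith
  moreover have "proj w0 = ?v" by (rule proj_eq[OF s])
  ultimately have "dist (proj w) (proj w0) \<le> e / 4 + e / 4"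
   using n(3) norm_triangle_ineq[of "proj w - ?w" "?w - ?v"] by (simp add: dist_norm)
  then show ?thesis using e by linarith
 qed
 then show "\<exists>d>0. \<forall>x'\<in>U. dist x' w0 < d \<longrightarrow> dist (proj x') (proj w0) < e"
  using r(1) e K by (intro exI[of _ "min r (min 1 (e / 4)) / K"]) auto
qed

text \<open>Let \<open>t\<close> be the factors of \<open>proj\<close> at v - \<sigma> grad v. As
  \<open>v\<close> lies in \<open>N\<close>, rescaling it by \<open>t\<close> does not raise the
  energy, so the projection is compared with a gradient step that starts at the rescaled
  \<open>v\<close>. The factors are close to 1, which preserves most of the first order
  decrease.\<close>

lemma descent:
 assumes \<delta>: "0 < \<delta>"
 shows "\<exists>\<tau>>0. \<forall>v\<in>N. norm v \<le> R \<longrightarrow> (\<forall>\<sigma>. 0 \<le> \<sigma> \<longrightarrow> \<sigma> \<le> \<tau> \<longrightarrow>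
  v - \<sigma> *\<^sub>R grad v \<in> U \<and>
  (\<delta> \<le> norm (grad v) \<longrightarrow> I (proj (v - \<sigma> *\<^sub>R grad v)) \<le> I v - \<sigma> * (\<delta>\<^sup>2 / 2)))"
proof -
 define R' where "R' = \<bar>R\<bar>"
 have e: "0 < \<delta> / 16" using \<delta> by simp
 obtain d1 where d1: "0 < d1" "\<And>v h. norm v \<le> 2 * R' \<Longrightarrow> norm h \<le> d1 \<Longrightarrow>
   \<bar>I (v + h) - I v - grad v \<bullet> h\<bar> \<le> \<delta> / 16 * norm h"
  using I_deriv[OF e, of "2 * R'"] by blast
 obtain d2 where d2: "0 < d2" "\<And>v w. norm v \<le> 2 * R' \<Longrightarrow> norm w \<le> 2 * R' \<Longrightarrow> norm (v - w) \<le> d2 \<Longrightarrow>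
   norm (grad v - grad w) \<le> \<delta> / 16"
  using grad_uniform[OF e, of "2 * R'"] by blast
 \<comment> \<open>The bound 1/4 keeps all factors at least 3/4. The other bound keeps the rescaled
   \<open>v\<close> so close to \<open>v\<close> that their gradients differ by at most
   \<delta>/16.\<close>
 define \<rho> where "\<rho> = min (1 / 4) (d2 / (R' + 1))"
 have R': "0 \<le> R'" by (simp add: R'_def)
 have "\<rho> \<le> 1 / 4" unfolding \<rho>_def by (rule min.cobounded1)
 moreover have "0 < \<rho>" using R' d2(1) by (simp add: \<rho>_def)
 ultimately have \<rho>: "0 < \<rho>" "\<rho> \<le> 1 / 2" "\<rho> \<le> 1 / 4" by linarith+
 have "\<rho> * (R' + 1) \<le> d2 / (R' + 1) * (R' + 1)" using R' by (intro mult_right_mono) (auto simp: \<rho>_def)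
 then have \<rho>d: "\<rho> * (R' + 1) \<le> d2" using R' by simp
 obtain r where r: "0 < r" "\<And>v w. v \<in> N \<Longrightarrow> norm v \<le> R' \<Longrightarrow> norm (w - v) < r \<Longrightarrow>
  w \<in> U \<and> (\<exists>t. (\<forall>i. \<bar>t $ i - 1\<bar> \<le> \<rho>) \<and> proj w = rescale t w)"
  using proj_near_N[OF \<rho>(1,2), of R'] by blast
 obtain K where K: "0 < K" "\<And>v. norm v \<le> R' \<Longrightarrow> norm (grad v) \<le> K" using grad_bounded by blast
 define \<tau> where "\<tau> = min (r / 2) (d1 / 2) / K"
 have \<tau>: "0 < \<tau>" using r(1) d1(1) K(1) by (simp add: \<tau>_def)
 have "v - \<sigma> *\<^sub>R grad v \<in> U \<and>
  (\<delta> \<le> norm (grad v) \<longrightarrow> I (proj (v - \<sigma> *\<^sub>R grad v)) \<le> I v - \<sigma> * (\<delta>\<^sup>2 / 2))"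
  if v: "v \<in> N" "norm v \<le> R" and \<sigma>: "0 \<le> \<sigma>" "\<sigma> \<le> \<tau>" for v \<sigma>
 proof -
  let ?g = "grad v"
  let ?w = "v - \<sigma> *\<^sub>R ?g"
  have vR: "norm v \<le> R'" using v(2) by (simp add: R'_def)
  have "\<sigma> * norm ?g \<le> \<tau> * K" using \<sigma> K(2)[OF vR] by (intro mult_mono) auto
  also have "\<dots> = min (r / 2) (d1 / 2)" using K(1) by (simp add: \<tau>_def)
  finally have \<sigma>g: "\<sigma> * norm ?g \<le> r / 2" "\<sigma> * norm ?g \<le> d1 / 2" by simp_all
  have "norm (?w - v) < r" using \<sigma>g(1) r(1) \<sigma>(1) by simp
  from r(2)[OF v(1) vR this] obtain t where wU: "?w \<in> U"
   and t: "\<And>i. \<bar>t $ i - 1\<bar> \<le> \<rho>" "proj ?w = rescale t ?w" by blast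
  have tpos: "0 < t $ i" for i using t(1)[of i] \<rho> by linarith
  have t2: "\<bar>t $ i\<bar> \<le> 2" for i using t(1)[of i] \<rho> by linarith
  have "I (proj ?w) \<le> I v - \<sigma> * (\<delta>\<^sup>2 / 2)" if g: "\<delta> \<le> norm ?g"
  proof -
   let ?h = "- (\<sigma> *\<^sub>R rescale t ?g)"
   have ng: "norm (rescale t ?g) \<le> 2 * norm ?g" by (rule norm_rescale_le[OF t2])
   have tv: "norm (rescale t v) \<le> 2 * R'" using norm_rescale_le[OF t2, of v] vR by linarith
   have "norm ?h \<le> \<sigma> * (2 * norm ?g)" using \<sigma>(1) ng by (simp add: mult_left_mono del: mult_le_cancel_left_pos)
   then have h: "norm ?h \<le> 2 * (\<sigma> * norm ?g)" by simp
   have "norm (rescale t v - v) \<le> \<rho> * norm v" by (rule norm_rescale_diff_le[OF t(1)])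
   also have "\<dots> \<le> \<rho> * (R' + 1)" using vR \<rho> by (intro mult_left_mono) auto
   finally have E: "norm (grad (rescale t v) - ?g) \<le> \<delta> / 16" using \<rho>d vR tv R' by (intro d2(2)) auto
   have "rescale t ?w = rescale t v + ?h" by (simp add: rescale_diff rescale_scaleR)
   then have "I (rescale t ?w) \<le> I (rescale t v) + grad (rescale t v) \<bullet> ?h + \<delta> / 16 * norm ?h"
   proof -
    have "norm ?h \<le> d1" using h \<sigma>g(2) by linarith
    from d1(2)[OF tv this] show ?thesis unfolding \<open>rescale t ?w = rescale t v + ?h\<close> by linarith
   qed
   moreover have "I (rescale t v) \<le> I v"
   proof -
    have "0 \<le> (\<Sum>i\<in>UNIV. (norm (v $ i))\<^sup>2 * nehari_gap p (t $ i))"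
     by (intro sum_nonneg mult_nonneg_nonneg nehari_gap_nonneg p tpos) simp
    then show ?thesis using I_rescale_le[OF v(1) tpos] by linarith
   qed
   moreover have "grad (rescale t v) \<bullet> ?h = (grad (rescale t v) - ?g) \<bullet> ?h - \<sigma> * (?g \<bullet> rescale t ?g)"
    by (simp add: inner_diff_left right_diff_distrib)
   moreover have "(grad (rescale t v) - ?g) \<bullet> ?h \<le> \<delta> / 16 * norm ?h"
    using norm_cauchy_schwarz[of "grad (rescale t v) - ?g" ?h] mult_right_mono[OF E, of "norm ?h"] by simp
   moreover have "3 / 4 * (norm ?g)\<^sup>2 \<le> ?g \<bullet> rescale t ?g"
   proof -
    have "3 / 4 * (norm ?g)\<^sup>2 = (\<Sum>i\<in>UNIV. 3 / 4 * (norm (?g $ i))\<^sup>2)"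
     by (simp add: norm_vec_squared sum_distrib_left)
    also have "\<dots> \<le> (\<Sum>i\<in>UNIV. t $ i * (norm (?g $ i))\<^sup>2)"
    proof (intro sum_mono mult_right_mono)
     show "3 / 4 \<le> t $ i" for i using t(1)[of i] \<rho> by linarith
    qed simp
    also have "\<dots> = ?g \<bullet> rescale t ?g" by (simp add: inner_vec_def power2_norm_eq_inner)
    finally show ?thesis .
   qed
   moreover have "\<delta> / 16 * norm ?h \<le> \<delta> / 16 * (2 * (\<sigma> * norm ?g))"
    using h \<delta> by (intro mult_left_mono) auto
   \<comment> \<open>The Taylor error and the gradient error are each at most \<delta>/16 times 2
     \<sigma> |grad v|, together \<delta>/4 times \<sigma> |grad v|. As \<delta> is at most |grad
     v|, half of \<sigma> |grad v|^2 remains out of three quarters.\<close>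
   moreover have "\<sigma> * (\<delta>\<^sup>2 / 2) \<le> \<sigma> * (3 / 4 * (norm ?g)\<^sup>2) - 2 * (\<delta> / 16 * (2 * (\<sigma> * norm ?g)))"
   proof -
    have "\<delta> * norm ?g \<le> norm ?g * norm ?g" using g by (intro mult_right_mono) auto
    moreover have "\<delta> * \<delta> \<le> norm ?g * norm ?g" using g \<delta> by (intro mult_mono) auto
    ultimately have "\<delta>\<^sup>2 / 2 \<le> 3 / 4 * (norm ?g)\<^sup>2 - \<delta> / 4 * norm ?g" by (simp add: power2_eq_square)
    from mult_left_mono[OF this \<sigma>(1)] show ?thesis by (simp add: algebra_simps)
   qed
   moreover have "\<sigma> * (3 / 4 * (norm ?g)\<^sup>2) \<le> \<sigma> * (?g \<bullet> rescale t ?g)"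
    if "3 / 4 * (norm ?g)\<^sup>2 \<le> ?g \<bullet> rescale t ?g" using that \<sigma>(1) by (rule mult_left_mono)
   ultimately show ?thesis unfolding t(2) by argo
  qed
  with wU show ?thesis by blast
 qed
 with \<tau> show ?thesis by blast
qed

text \<open>The uniform lower bound on the components turns the condition of being nonzero into a
  closed one.\<close>

lemma closed_N: "closed N"
proof -
 obtain c where c: "0 < c" "\<And>v i. v \<in> N \<Longrightarrow> c \<le> norm (v $ i)" using N_lower_bound by blast
 have "v \<in> N" if "\<forall>i. c \<le> norm (v $ i) \<and> grad v $ i \<bullet> v $ i = 0" for v
  unfolding N_iff using that c(1) by (metis norm_zero not_le)
 moreover have "grad v $ i \<bullet> v $ i = 0" if "v \<in> N" for v i using that N_iff by blast
 ultimately have "N = {v. \<forall>i. c \<le> norm (v $ i) \<and> grad v $ i \<bullet> v $ i = 0}"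
  using c(2) by blast
 moreover have "closed {v :: 'h ^ 'l. \<forall>i. c \<le> norm (v $ i) \<and> grad v $ i \<bullet> v $ i = 0}"
  by (intro closed_Collect_all closed_Collect_conj closed_Collect_le closed_Collect_eq
    continuous_on_const continuous_on_norm continuous_on_inner continuous_on_component
    continuous_on_id continuous_on_grad)
 ultimately show ?thesis by simp
qed

section \<open>The Palais-Smale condition and minimisers\<close>

lemma N_norm_bound: "\<exists>R\<ge>0. \<forall>v\<in>N. I v \<le> C \<longrightarrow> norm v \<le> R"
proof -
 let ?k = "1 / 2 - 1 / (2 * p)"
 have "norm v \<le> sqrt (\<bar>C\<bar> / ?k)" if "v \<in> N" "I v \<le> C" for v
 proof -
  have "?k * (norm v)\<^sup>2 \<le> \<bar>C\<bar>" using I_on_N[OF that(1)] that(2) by linarith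
  then have "(norm v)\<^sup>2 \<le> \<bar>C\<bar> / ?k" using I_coeff_pos by (simp add: pos_le_divide_eq mult.commute)
  then show ?thesis by (rule real_le_rsqrt)
 qed
 moreover have "0 \<le> sqrt (\<bar>C\<bar> / ?k)" using I_coeff_pos by simp
 ultimately show ?thesis by blast
qed

text \<open>Since x n = grad (x n) + G (x n), the squared distance to the weak limit splits into
  three terms. The first tends to 0 with the gradient, the last by weak convergence, and
  \<open>G_weak\<close> bounds the middle one from above.\<close>

lemma Palais_Smale:
 assumes x: "\<And>n. x n \<in> N" and I: "\<And>n. I (x n) \<le> C" and g: "(\<lambda>n. grad (x n)) \<longlonglongrightarrow> 0"
 obtains v r where "strict_mono (r :: nat \<Rightarrow> nat)" "v \<in> N" "grad v = 0" "(\<lambda>n. x (r n)) \<longlonglongrightarrow> v"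
proof -
 obtain R where R: "0 \<le> R" "\<And>n. norm (x n) \<le> R" using N_norm_bound x I by blast
 obtain v r where r: "strict_mono (r :: nat \<Rightarrow> nat)" and w: "\<And>w. (\<lambda>n. x (r n) \<bullet> w) \<longlonglongrightarrow> v \<bullet> w"
  by (rule bounded_weakly_convergent_subseq[of x R, OF R(2)]) blast
 let ?y = "\<lambda>n. x (r n)"
 have gr: "(\<lambda>n. grad (?y n)) \<longlonglongrightarrow> 0" using LIMSEQ_subseq_LIMSEQ[OF g r] by (simp add: o_def)
 have A: "(\<lambda>n. grad (?y n) \<bullet> (?y n - v)) \<longlonglongrightarrow> 0"
 proof (rule Lim_null_comparison)
  show "eventually (\<lambda>n. norm (grad (?y n) \<bullet> (?y n - v)) \<le> norm (grad (?y n)) * (R + norm v)) sequentially"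
  proof (intro always_eventually allI)
   fix n
   have "norm (?y n - v) \<le> R + norm v" using norm_triangle_ineq4[of "?y n" v] R(2)[of "r n"] by linarith
   then show "norm (grad (?y n) \<bullet> (?y n - v)) \<le> norm (grad (?y n)) * (R + norm v)"
    using Cauchy_Schwarz_ineq2[of "grad (?y n)" "?y n - v"]
     mult_left_mono[of _ _ "norm (grad (?y n))", OF _ norm_ge_zero]
    unfolding real_norm_def by (meson order_trans)
  qed
  show "(\<lambda>n. norm (grad (?y n)) * (R + norm v)) \<longlonglongrightarrow> 0"
   using tendsto_mult_right[OF tendsto_norm[OF gr], of "R + norm v"] by simp
 qed
 have B: "(\<lambda>n. v \<bullet> (?y n - v)) \<longlonglongrightarrow> 0"
  using tendsto_diff[OF w[of v] tendsto_const[of "v \<bullet> v"]] by (simp add: inner_diff_right inner_commute)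
 have "(\<lambda>n. (norm (?y n - v))\<^sup>2) \<longlonglongrightarrow> 0"
 proof (rule tendstoI)
  fix e :: real assume e: "0 < e"
  have "eventually (\<lambda>n. dist (grad (?y n) \<bullet> (?y n - v)) 0 < e / 3) sequentially"
   using A e by (intro tendstoD) auto
  moreover have "eventually (\<lambda>n. dist (v \<bullet> (?y n - v)) 0 < e / 3) sequentially"
   using B e by (intro tendstoD) auto
  moreover have "eventually (\<lambda>n. G (?y n) \<bullet> (?y n - v) \<le> e / 6) sequentially"
   using e R(2) w by (intro G_weak[of ?y R]) auto
  ultimately show "eventually (\<lambda>n. dist ((norm (?y n - v))\<^sup>2) 0 < e) sequentially"
  proof eventually_elim
   case (elim n)
   have "(norm (?y n - v))\<^sup>2 = grad (?y n) \<bullet> (?y n - v) + G (?y n) \<bullet> (?y n - v) - v \<bullet> (?y n - v)"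
    by (simp add: grad_def power2_norm_eq_inner inner_simps)
   then have "(norm (?y n - v))\<^sup>2 < e" using elim e unfolding dist_real_def by argo
   then show ?case by simp
  qed
 qed
 then have "(\<lambda>n. norm (?y n - v)) \<longlonglongrightarrow> 0" by (simp add: power_tendsto_0_iff)
 then have lim: "?y \<longlonglongrightarrow> v" by (simp add: tendsto_norm_zero_iff LIM_zero_iff)
 have "(\<lambda>n. grad (?y n)) \<longlonglongrightarrow> grad v"
  using continuous_on_tendsto_compose[OF continuous_on_grad lim] by simp
 then have "grad v = 0" by (rule LIMSEQ_unique[OF _ gr])
 moreover have "v \<in> N" by (rule closed_sequentially[OF closed_N _ lim]) (rule x)
 ultimately show ?thesis using that[OF r _ _ lim] by blast
qed

text \<open>With vanishing couplings the equations separate, and t_i solves t_i^2 |w_i|^2 = t_i^(2p)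
  \<open>\<beta> i i w\<close>.\<close>

lemma decoupled_in_U:
 assumes w: "\<And>i. w $ i \<noteq> 0" "\<And>i. 0 < \<beta> i i w" "\<And>i j. j \<noteq> i \<Longrightarrow> \<beta> i j w = 0"
 shows "w \<in> U"
proof -
 define t where "t = (\<chi> i. ((norm (w $ i))\<^sup>2 / \<beta> i i w) powr (1 / (2 * p - 2)))"
 have t: "0 < t $ i" for i using w(1)[of i] w(2)[of i] by (simp add: t_def)
 have "rescale t w \<in> N" unfolding N_def
 proof (intro CollectI allI conjI)
  fix i
  show "rescale t w $ i \<noteq> 0" using t[of i] w(1) by simp
  have \<beta>t: "\<beta> i j (rescale t w) = (t $ i) powr p * (t $ j) powr p * \<beta> i j w" for j
   using t by (intro \<beta>_rescale) (auto intro: less_imp_le)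
  have "(\<Sum>j\<in>UNIV. \<beta> i j (rescale t w)) = \<beta> i i (rescale t w)"
   unfolding sum.remove[of UNIV i "\<lambda>j. \<beta> i j (rescale t w)", OF finite UNIV_I] using w(3) by (simp add: \<beta>t)
  also have "\<dots> = (t $ i) powr (2 + (2 * p - 2)) * \<beta> i i w" unfolding \<beta>t by (simp flip: powr_add)
  also have "\<dots> = (t $ i)\<^sup>2 * ((t $ i) powr (2 * p - 2) * \<beta> i i w)" unfolding powr_add using t[of i] by simp
  also have "(t $ i) powr (2 * p - 2) = (norm (w $ i))\<^sup>2 / \<beta> i i w"
   using p w(1)[of i] w(2)[of i] by (simp add: t_def powr_powr)
  finally show "(norm (rescale t w $ i))\<^sup>2 = (\<Sum>j\<in>UNIV. \<beta> i j (rescale t w))"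
   using w(2)[of i] by (simp add: power_mult_distrib)
 qed
 with t show ?thesis unfolding U_def by blast
qed

lemma odd_sphere_in_N:
 "\<exists>f. continuous_on (topspace (nsphere n)) f \<and> (\<forall>x\<in>topspace (nsphere n). f x \<in> N \<and> f (\<lambda>i. - x i) = - f x)"
proof -
 obtain f where f: "continuous_on (topspace (nsphere n)) f"
  "\<And>x. x \<in> topspace (nsphere n) \<Longrightarrow> f (\<lambda>i. - x i) = - f x"
  "\<And>x. x \<in> topspace (nsphere n) \<Longrightarrow> f x \<in> U"
  using spheres[of n] decoupled_in_U by meson
 have "continuous_on (topspace (nsphere n)) (\<lambda>x. proj (f x))"
  by (rule continuous_on_compose2[OF continuous_on_proj f(1)]) (use f(3) in auto)
 then show ?thesis using f proj_in_N proj_minus by (intro exI[of _ "\<lambda>x. proj (f x)"]) auto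
qed

lemma N_nonempty: "N \<noteq> {}"
 using odd_sphere_in_N[of 0] in_topspace_nsphere[of 0] by blast

lemma minimizer_grad_0:
 assumes v: "v \<in> N" and min: "\<And>w. w \<in> N \<Longrightarrow> I v \<le> I w"
 shows "grad v = 0"
proof (rule ccontr)
 assume "grad v \<noteq> 0"
 then have \<delta>: "0 < norm (grad v)" by simp
 obtain \<tau> where \<tau>: "0 < \<tau>" "v - \<tau> *\<^sub>R grad v \<in> U"
  "I (proj (v - \<tau> *\<^sub>R grad v)) \<le> I v - \<tau> * ((norm (grad v))\<^sup>2 / 2)"
  using descent[OF \<delta>, of "norm v"] v by (meson less_imp_le order_refl)
 moreover have "0 < \<tau> * ((norm (grad v))\<^sup>2 / 2)" using \<tau>(1) \<delta> by simp
 ultimately show False using min[OF proj_in_N[OF \<tau>(2)]] by linarith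
qed

text \<open>A point whose energy exceeds the infimum by less than the guaranteed loss of one descent
  step has a small gradient, as the step would otherwise pass below the infimum. So a suitable
  minimising sequence is a Palais-Smale sequence.\<close>

lemma exists_minimizer: "\<exists>v\<in>N. \<forall>w\<in>N. I v \<le> I w"
proof -
 define m where "m = Inf (I ` N)"
 have "0 \<le> I v" if "v \<in> N" for v using I_on_N[OF that] I_coeff_pos by simp
 then have bdd: "bdd_below (I ` N)" by (intro bdd_belowI[of _ 0]) auto
 have low: "m \<le> I v" if "v \<in> N" for v unfolding m_def using that bdd by (intro cInf_lower) auto
 have "\<exists>x. x \<in> N \<and> I x \<le> m + inverse (real (Suc n)) \<and> norm (grad x) \<le> inverse (real (Suc n))" for n
 proof -
  let ?d = "inverse (real (Suc n))"
  obtain R where R: "\<And>v. v \<in> N \<Longrightarrow> I v \<le> m + 1 \<Longrightarrow> norm v \<le> R" using N_norm_bound by blast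
  have d: "0 < ?d" by simp
  obtain \<tau> where \<tau>: "0 < \<tau>" "\<And>v. v \<in> N \<Longrightarrow> norm v \<le> R \<Longrightarrow> v - \<tau> *\<^sub>R grad v \<in> U \<and>
    (?d \<le> norm (grad v) \<longrightarrow> I (proj (v - \<tau> *\<^sub>R grad v)) \<le> I v - \<tau> * (?d\<^sup>2 / 2))"
   using descent[OF d, of R] by (meson less_imp_le order_refl)
  \<comment> \<open>\<open>?k\<close> is the guaranteed loss of one step. The excess energy is also
    kept below \<open>?d\<close>, which is at most 1, so that the norm bound for energies up to m +
    1 applies.\<close>
  let ?k = "\<tau> * (?d\<^sup>2 / 2)"
  have k: "0 < ?k" using \<tau>(1) d by (intro mult_pos_pos divide_pos_pos zero_less_power) auto
  have "Inf (I ` N) < m + min ?d ?k" unfolding m_def[symmetric] using d k by linarith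
  then obtain x where x: "x \<in> N" "I x < m + min ?d ?k"
   using cInf_lessD[of "I ` N"] N_nonempty by blast
  have "?d \<le> 1" by (simp add: field_simps)
  then have "norm x \<le> R" using x by (intro R) linarith+
  from \<tau>(2)[OF x(1) this] have xU: "x - \<tau> *\<^sub>R grad x \<in> U"
   and xd: "?d \<le> norm (grad x) \<Longrightarrow> I (proj (x - \<tau> *\<^sub>R grad x)) \<le> I x - ?k" by blast+
  have "\<not> ?d \<le> norm (grad x)"
  proof
   assume "?d \<le> norm (grad x)"
   from xd[OF this] show False using low[OF proj_in_N[OF xU]] x(2) by linarith
  qed
  then show ?thesis using x by (intro exI[of _ x] conjI) linarith+
 qed
 then obtain x where x: "\<And>n. x n \<in> N" "\<And>n. I (x n) \<le> m + inverse (real (Suc n))"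
   "\<And>n. norm (grad (x n)) \<le> inverse (real (Suc n))" by metis
 have g: "(\<lambda>n. grad (x n)) \<longlonglongrightarrow> 0"
  by (rule Lim_null_comparison[OF always_eventually LIMSEQ_inverse_real_of_nat]) (use x(3) in auto)
 have "inverse (real (Suc n)) \<le> 1" for n by (simp add: field_simps)
 then have "I (x n) \<le> m + 1" for n using x(2)[of n] order_trans by (meson add_left_mono)
 from Palais_Smale[OF x(1) this g] obtain v r where v: "strict_mono (r :: nat \<Rightarrow> nat)" "v \<in> N" "(\<lambda>n. x (r n)) \<longlonglongrightarrow> v"
  by blast
 have "(\<lambda>n. I (x (r n))) \<longlonglongrightarrow> I v" using continuous_on_tendsto_compose[OF continuous_on_I v(3)] by simp
 moreover have "(\<lambda>n. m + inverse (real (Suc n))) \<longlonglongrightarrow> m"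
  using tendsto_add[OF tendsto_const[of m] LIMSEQ_inverse_real_of_nat] by simp
 then have "(\<lambda>n. m + inverse (real (Suc (r n)))) \<longlonglongrightarrow> m"
  using LIMSEQ_subseq_LIMSEQ[OF _ v(1)] by (fastforce simp: o_def)
 ultimately have "I v \<le> m" using x(2) by (intro LIMSEQ_le[of "\<lambda>n. I (x (r n))"]) auto
 then show ?thesis using v(2) low by (meson order_trans)
qed

lemma grad_rescale_coordinate:
 assumes t: "\<And>i. 0 < t $ i"
 shows "t $ k * (grad (rescale t w) $ k \<bullet> w $ k) =
  (t $ k)\<^sup>2 * (norm (w $ k))\<^sup>2 - (t $ k) powr p * (\<Sum>j\<in>UNIV. (t $ j) powr p * \<beta> k j w)"
proof -
 have "t $ k * (grad (rescale t w) $ k \<bullet> w $ k) = grad (rescale t w) $ k \<bullet> rescale t w $ k" by simp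
 also have "\<dots> = (norm (rescale t w $ k))\<^sup>2 - (\<Sum>j\<in>UNIV. \<beta> k j (rescale t w))" by (rule grad_euler)
 also have "(\<Sum>j\<in>UNIV. \<beta> k j (rescale t w)) = (t $ k) powr p * (\<Sum>j\<in>UNIV. (t $ j) powr p * \<beta> k j w)"
  using \<beta>_rescale[of t k _ w] t by (simp add: sum_distrib_left less_imp_le mult.assoc)
 finally show ?thesis by (simp add: power_mult_distrib)
qed

text \<open>The energy of the rescalings of \<open>w\<close> is maximised over \<open>[\<rho>, 1]\<close> in each factor. No factor of the maximiser
 is \<open>\<rho>\<close>, as \<open>\<rho>\<close> is small. At a factor 1 the partial derivative is nonpositive, since the norm
 has not increased and the couplings are nonpositive. So the maximiser yields an element of \<open>N\<close> without the need
 of an upper bound for the factors.\<close>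

lemma minimizer_rearrangement:
 assumes v: "v \<in> N" and min: "\<And>w. w \<in> N \<Longrightarrow> I v \<le> I w"
  and w: "\<And>i. w $ i \<noteq> 0" "\<And>i. norm (w $ i) \<le> norm (v $ i)" "\<And>i j. \<beta> i j w = \<beta> i j v"
 shows "w \<in> N \<and> I w = I v"
proof -
 \<comment> \<open>As 2p - 2 > 0, the left side tends to 0 with \<rho>, while no component of
   \<open>w\<close> vanishes.\<close>
 have "\<exists>\<rho>>0. \<rho> < 1 \<and> (\<forall>k. \<rho> powr (2 * p - 2) * \<beta> k k w < (norm (w $ k))\<^sup>2)"
 proof -
  have "((\<lambda>\<rho>. \<rho> powr (2 * p - 2) * \<beta> k k w) \<longlongrightarrow> 0 * \<beta> k k w) (at_right 0)" for k
   using p by (intro tendsto_intros tendsto_eq_rhs[OF tendsto_powr'[of "\<lambda>x. x" 0 _ "\<lambda>_. 2 * p - 2" "2 * p - 2"]])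
    (auto simp: eventually_at_filter)
  then have "eventually (\<lambda>\<rho>. \<rho> powr (2 * p - 2) * \<beta> k k w < (norm (w $ k))\<^sup>2) (at_right 0)" for k
   using w(1) by (intro order_tendstoD(2)[of _ 0]) auto
  then have "eventually (\<lambda>\<rho>. \<forall>k. \<rho> powr (2 * p - 2) * \<beta> k k w < (norm (w $ k))\<^sup>2) (at_right 0)"
   by (rule eventually_all_finite)
  moreover have "eventually (\<lambda>\<rho>::real. 0 < \<rho> \<and> \<rho> < 1) (at_right 0)"
   by (auto simp: eventually_at_right_field intro: exI[of _ 1])
  ultimately have "eventually (\<lambda>\<rho>. 0 < \<rho> \<and> \<rho> < 1 \<and> (\<forall>k. \<rho> powr (2 * p - 2) * \<beta> k k w < (norm (w $ k))\<^sup>2)) (at_right 0)"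
   by eventually_elim auto
  from eventually_happens'[OF _ this] show ?thesis by auto
 qed
 then obtain \<rho> where \<rho>: "0 < \<rho>" "\<rho> < 1" "\<And>k. \<rho> powr (2 * p - 2) * \<beta> k k w < (norm (w $ k))\<^sup>2" by blast
 obtain t where t: "\<And>i. \<rho> \<le> t $ i" "\<And>i. t $ i \<le> 1"
  "\<And>s. (\<And>i. \<rho> \<le> s $ i \<and> s $ i \<le> 1) \<Longrightarrow> I (rescale s w) \<le> I (rescale t w)"
  "\<And>k. t $ k < 1 \<Longrightarrow> grad (rescale t w) $ k \<bullet> w $ k \<le> 0"
  "\<And>k. \<rho> < t $ k \<Longrightarrow> 0 \<le> grad (rescale t w) $ k \<bullet> w $ k"
  using rescale_maximizer[OF \<rho>(2), of w] by blast
 have tpos: "0 < t $ i" for i using t(1)[of i] \<rho>(1) by linarith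
 note gr = grad_rescale_coordinate[of t, OF tpos, of _ w]
 have off: "(\<Sum>j\<in>UNIV. (t $ j) powr p * \<beta> k j w) = (t $ k) powr p * \<beta> k k w + (\<Sum>j\<in>UNIV - {k}. (t $ j) powr p * \<beta> k j w)" for k
  by (simp add: sum.remove[of UNIV k])
 have zero: "grad (rescale t w) $ k \<bullet> w $ k = 0" for k
 proof -
  let ?D = "grad (rescale t w) $ k \<bullet> w $ k"
  have lower: "t $ k \<noteq> \<rho>"
  proof
   assume tk: "t $ k = \<rho>"
   have "(\<Sum>j\<in>UNIV - {k}. (t $ j) powr p * \<beta> k j w) \<le> 0"
    by (intro sum_nonpos mult_nonneg_nonpos \<beta>_nonpos) auto
   then have "\<rho> powr p * (\<Sum>j\<in>UNIV. (t $ j) powr p * \<beta> k j w) \<le> \<rho> powr p * (\<rho> powr p * \<beta> k k w)"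
    unfolding off tk by (intro mult_left_mono) auto
   also have "\<dots> = \<rho>\<^sup>2 * (\<rho> powr (2 * p - 2) * \<beta> k k w)"
   proof -
    have "\<rho> powr p * \<rho> powr p = \<rho> powr (2 + (2 * p - 2))" by (simp flip: powr_add)
    also have "\<dots> = \<rho>\<^sup>2 * \<rho> powr (2 * p - 2)" using \<rho>(1) by (subst powr_add) (simp add: powr_numeral)
    finally show ?thesis by (simp add: mult.assoc[symmetric])
   qed
   also have "\<dots> < \<rho>\<^sup>2 * (norm (w $ k))\<^sup>2" using \<rho> by (intro mult_strict_left_mono) auto
   finally have "0 < \<rho> * ?D" using gr[of k] by (simp add: tk)
   then have "0 < ?D" using \<rho>(1) by (simp add: zero_less_mult_iff)
   moreover have "?D \<le> 0" using t(4)[of k] tk \<rho>(2) by simp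
   ultimately show False by simp
  qed
  then have nn: "0 \<le> ?D" using t(1)[of k] by (intro t(5)) linarith
  show ?thesis
  proof (cases "t $ k < 1")
   case True
   with nn t(4)[of k] show ?thesis by simp
  next
   case False
   then have tk: "t $ k = 1" using t(2)[of k] by linarith
   have "(\<Sum>j\<in>UNIV. \<beta> k j w) \<le> (\<Sum>j\<in>UNIV. (t $ j) powr p * \<beta> k j w)"
   proof (rule sum_mono)
    fix j
    show "\<beta> k j w \<le> (t $ j) powr p * \<beta> k j w"
    proof (cases "j = k")
     case False
     have "(t $ j) powr p \<le> 1" using tpos[of j] t(2)[of j] p by (intro powr_le1) auto
     from mult_right_mono_neg[OF this \<beta>_nonpos[of k j w]] False show ?thesis by simp
    qed (simp add: tk)
   qed
   then have "?D \<le> (norm (w $ k))\<^sup>2 - (\<Sum>j\<in>UNIV. \<beta> k j w)" using gr[of k] by (simp add: tk)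
   also have "\<dots> \<le> (norm (v $ k))\<^sup>2 - (\<Sum>j\<in>UNIV. \<beta> k j v)" using w by (simp add: power_mono)
   also have "\<dots> = 0" using v by (simp add: N_def)
   finally show ?thesis using nn by simp
  qed
 qed
 have tw: "rescale t w \<in> N" unfolding N_iff using zero w(1) tpos by (simp add: less_imp_neq[symmetric])
 let ?k = "1 / 2 - 1 / (2 * p)"
 have le: "norm (rescale t w $ i) \<le> norm (v $ i)" for i
 proof -
  have "norm (rescale t w $ i) \<le> 1 * norm (w $ i)"
   using tpos[of i] t(2)[of i] by (simp add: mult_left_le_one_le)
  then show ?thesis using w(2)[of i] by simp
 qed
 have sq: "(norm (rescale t w $ i))\<^sup>2 \<le> (norm (v $ i))\<^sup>2" for i using le by (intro power_mono) auto
 \<comment> \<open>On \<open>N\<close> the energy is a multiple of the squared norm. The rescaled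
   \<open>w\<close> has at least the energy of \<open>v\<close>, but none of its components is
   longer, so all component norms agree; this forces all factors to be 1.\<close>
 have "?k * (norm v)\<^sup>2 \<le> ?k * (norm (rescale t w))\<^sup>2" using min[OF tw] I_on_N[OF v] I_on_N[OF tw] by simp
 then have "(\<Sum>i\<in>UNIV. (norm (v $ i))\<^sup>2 - (norm (rescale t w $ i))\<^sup>2) \<le> 0"
  using I_coeff_pos by (simp add: norm_vec_squared sum_subtractf)
 then have "(norm (v $ i))\<^sup>2 - (norm (rescale t w $ i))\<^sup>2 = 0" for i
  using sq by (subst sum_nonneg_0[of UNIV "\<lambda>i. (norm (v $ i))\<^sup>2 - (norm (rescale t w $ i))\<^sup>2"])
   (auto intro!: antisym sum_nonneg)
 then have eq: "norm (v $ i) = norm (rescale t w $ i)" for i by (metis eq_iff_diff_eq_0 norm_ge_zero power2_eq_iff_nonneg)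
 have "t $ i = 1" for i
 proof (rule ccontr)
  assume "t $ i \<noteq> 1"
  then have "t $ i * norm (w $ i) < 1 * norm (w $ i)"
   using t(2)[of i] w(1)[of i] by (intro mult_strict_right_mono) auto
  then show False using eq[of i] w(2)[of i] tpos[of i] by simp
 qed
 then have "t = 1" by (simp add: vec_eq_iff)
 then have "w \<in> N" using tw by simp
 moreover have "norm w = norm v" using eq \<open>t = 1\<close> by (simp add: norm_vec_def)
 ultimately show ?thesis using I_on_N v by simp
qed

text \<open>The descent step is cut off below the level \<open>C + 1\<close>, where critical points may exist.\<close>

lemma critical_points_unbounded: "\<exists>v\<in>N. grad v = 0 \<and> C < I v"
proof (rule ccontr)
 assume "\<not> ?thesis"
 then have none: "\<And>v. v \<in> N \<Longrightarrow> grad v = 0 \<Longrightarrow> I v \<le> C" by force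
 obtain c where c: "0 < c" "\<And>v i. v \<in> N \<Longrightarrow> c\<^sup>2 \<le> \<beta> i i v" using N_lower_bound by blast
 obtain R0 where R0: "\<And>v. v \<in> N \<Longrightarrow> I v \<le> C + 2 \<Longrightarrow> norm v \<le> R0" using N_norm_bound by blast
 \<comment> \<open>The functionals are adapted to a single component; on \<open>N\<close> its
   diagonal term is at least c^2, which a common zero will contradict.\<close>
 fix i0 :: 'l
 have "0 < c\<^sup>2" using c(1) by simp
 then obtain m and \<Lambda> :: "nat \<Rightarrow> 'h ^ 'l \<Rightarrow> real" where \<Lambda>: "\<And>j. bounded_linear (\<Lambda> j)"
   "\<And>v. norm v \<le> R0 \<Longrightarrow> (\<forall>j<m. \<Lambda> j v = 0) \<Longrightarrow> \<beta> i0 i0 v < c\<^sup>2"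
  using \<beta>_detect[of "c\<^sup>2" R0 i0] by blast
 \<comment> \<open>The dimension of the sphere is the number of functionals, as required for the
   Borsuk-Ulam theorem.\<close>
 let ?S = "topspace (nsphere m)"
 obtain f where f: "continuous_on ?S f" and fN: "\<And>x. x \<in> ?S \<Longrightarrow> f x \<in> N"
  and odd: "\<And>x. x \<in> ?S \<Longrightarrow> f (\<lambda>i. - x i) = - f x"
  using odd_sphere_in_N[of m] by blast
 have "compact ((\<lambda>x. I (f x)) ` ?S)"
  by (intro compact_continuous_image compact_nsphere continuous_on_compose2[OF continuous_on_I f]) auto
 then obtain b where "\<And>r. r \<in> (\<lambda>x. I (f x)) ` ?S \<Longrightarrow> norm r \<le> b"
  using compact_imp_bounded bounded_iff by metis
 then have fb: "I (f x) \<le> b" if "x \<in> ?S" for x using that by fastforce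
 \<comment> \<open>By the Palais-Smale condition, gradients tending to 0 within these levels would
   produce a critical point of energy at least C + 1.\<close>
 have "\<exists>\<delta>>0. \<forall>v\<in>N. C + 1 \<le> I v \<longrightarrow> I v \<le> b \<longrightarrow> \<delta> \<le> norm (grad v)"
 proof (rule ccontr)
  assume neg: "\<not> ?thesis"
  have "\<exists>v. v \<in> N \<and> C + 1 \<le> I v \<and> I v \<le> b \<and> norm (grad v) \<le> inverse (real (Suc n))" for n
  proof -
   have "0 < inverse (real (Suc n))" by simp
   with neg obtain v where "v \<in> N" "C + 1 \<le> I v" "I v \<le> b" "\<not> inverse (real (Suc n)) \<le> norm (grad v)"
    by meson
   then show ?thesis by (intro exI[of _ v]) auto
  qed
  then obtain x where x: "\<And>n. x n \<in> N" "\<And>n. C + 1 \<le> I (x n)" "\<And>n. I (x n) \<le> b"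
   "\<And>n. norm (grad (x n)) \<le> inverse (real (Suc n))" by metis
  have g: "(\<lambda>n. grad (x n)) \<longlonglongrightarrow> 0"
   by (rule Lim_null_comparison[OF always_eventually LIMSEQ_inverse_real_of_nat]) (use x(4) in auto)
  obtain v r where v: "v \<in> N" "grad v = 0" "(\<lambda>n. x (r n)) \<longlonglongrightarrow> v"
   using Palais_Smale[OF x(1,3) g] by blast
  have "(\<lambda>n. I (x (r n))) \<longlonglongrightarrow> I v" using continuous_on_tendsto_compose[OF continuous_on_I v(3)] by simp
  then have "C + 1 \<le> I v" using x(2) by (intro LIMSEQ_le_const) auto
  then show False using none[OF v(1,2)] by linarith
 qed
 then obtain \<delta> where \<delta>: "0 < \<delta>" "\<And>v. v \<in> N \<Longrightarrow> C + 1 \<le> I v \<Longrightarrow> I v \<le> b \<Longrightarrow> \<delta> \<le> norm (grad v)" by blast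
 obtain R where R: "\<And>v. v \<in> N \<Longrightarrow> I v \<le> b \<Longrightarrow> norm v \<le> R" using N_norm_bound by blast
 obtain \<tau> where \<tau>: "0 < \<tau>" "\<And>v \<sigma>. v \<in> N \<Longrightarrow> norm v \<le> R \<Longrightarrow> 0 \<le> \<sigma> \<Longrightarrow> \<sigma> \<le> \<tau> \<Longrightarrow>
  v - \<sigma> *\<^sub>R grad v \<in> U \<and> (\<delta> \<le> norm (grad v) \<longrightarrow> I (proj (v - \<sigma> *\<^sub>R grad v)) \<le> I v - \<sigma> * (\<delta>\<^sup>2 / 2))"
  using descent[OF \<delta>(1), of R] by blast
 \<comment> \<open>The step length rises continuously from 0 at level C + 1 to \<tau> at level C +
   2. It depends on \<open>v\<close> through the even function \<open>I\<close>, so \<eta> is odd,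
   and above C + 2 every step loses the full amount.\<close>
 define cut where "cut v = \<tau> * max 0 (min 1 (I v - (C + 1)))" for v
 define \<eta> where "\<eta> v = proj (v - cut v *\<^sub>R grad v)" for v
 define S where "S = N \<inter> {v. I v \<le> b}"
 have cut: "0 \<le> cut v" "cut v \<le> \<tau>" for v using \<tau>(1) by (auto simp: cut_def intro: mult_left_le)
 have SU: "v - cut v *\<^sub>R grad v \<in> U" if "v \<in> S" for v
  using \<tau>(2)[OF _ _ cut, of v v] R that by (auto simp: S_def)
 have cont: "continuous_on S \<eta>"
 proof -
  have "continuous_on S (\<lambda>v. v - cut v *\<^sub>R grad v)"
   unfolding cut_def
   by (intro continuous_intros continuous_on_subset[OF continuous_on_grad] continuous_on_subset[OF continuous_on_I]) auto
  then show ?thesis unfolding \<eta>_def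
   by (rule continuous_on_compose2[OF continuous_on_proj]) (use SU in auto)
 qed
 have \<eta>N: "\<eta> v \<in> N" if "v \<in> S" for v unfolding \<eta>_def by (rule proj_in_N[OF SU[OF that]])
 have \<eta>I: "I (\<eta> v) \<le> I v - cut v * (\<delta>\<^sup>2 / 2)" if v: "v \<in> S" for v
 proof (cases "C + 1 \<le> I v")
  case True
  then show ?thesis unfolding \<eta>_def using \<tau>(2)[OF _ _ cut, of v v] R \<delta>(2)[of v] v by (auto simp: S_def)
 next
  case False
  then have "cut v = 0" by (simp add: cut_def)
  then show ?thesis using v proj_on_N by (simp add: \<eta>_def S_def)
 qed
 have \<eta>le: "I (\<eta> v) \<le> I v" if "v \<in> S" for v
  using \<eta>I[OF that] mult_nonneg_nonneg[OF cut(1)[of v], of "\<delta>\<^sup>2 / 2"] by simp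
 have \<eta>S: "\<eta> v \<in> S" if "v \<in> S" for v using \<eta>N[OF that] \<eta>le[OF that] that by (simp add: S_def)
 have \<eta>odd: "- v \<in> S \<and> \<eta> (- v) = - \<eta> v" if v: "v \<in> S" for v
 proof -
  have "- v - cut (- v) *\<^sub>R grad (- v) = - (v - cut v *\<^sub>R grad v)" by (simp add: cut_def I_even grad_odd)
  then have "\<eta> (- v) = - \<eta> v" unfolding \<eta>_def using proj_minus[OF SU[OF v]] by (simp only:)
  then show ?thesis using v N_minus unfolding S_def by (simp add: I_even)
 qed
 have drop: "I ((\<eta> ^^ k) v) \<le> max (C + 2) (b - real k * (\<tau> * (\<delta>\<^sup>2 / 2))) \<and> (\<eta> ^^ k) v \<in> S" if v: "v \<in> S" for v k
 proof (induction k)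
  case 0
  then show ?case using v by (simp add: S_def le_max_iff_disj)
 next
  case (Suc k)
  let ?u = "(\<eta> ^^ k) v"
  have u: "?u \<in> S" using Suc by blast
  have "I (\<eta> ?u) \<le> max (C + 2) (b - real (Suc k) * (\<tau> * (\<delta>\<^sup>2 / 2)))"
  proof (cases "I ?u \<le> C + 2")
   case True
   then show ?thesis using \<eta>le[OF u] by simp
  next
   case False
   then have "cut ?u = \<tau>" by (simp add: cut_def)
   then have "I (\<eta> ?u) \<le> I ?u - \<tau> * (\<delta>\<^sup>2 / 2)" using \<eta>I[OF u] by simp
   moreover have "I ?u \<le> b - real k * (\<tau> * (\<delta>\<^sup>2 / 2))" using Suc False by auto
   moreover have "real (Suc k) * (\<tau> * (\<delta>\<^sup>2 / 2)) = real k * (\<tau> * (\<delta>\<^sup>2 / 2)) + \<tau> * (\<delta>\<^sup>2 / 2)"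
    by (simp add: distrib_right)
   ultimately show ?thesis by linarith
  qed
  then show ?case using \<eta>S[OF u] by simp
 qed
 obtain k where k: "b - (C + 2) \<le> real k * (\<tau> * (\<delta>\<^sup>2 / 2))"
 proof -
  have pos: "0 < \<tau> * (\<delta>\<^sup>2 / 2)" using \<tau>(1) \<delta>(1) by simp
  obtain k where "(b - (C + 2)) / (\<tau> * (\<delta>\<^sup>2 / 2)) \<le> real k" using real_arch_simple by blast
  then show ?thesis using pos by (intro that[of k]) (simp add: pos_divide_le_eq)
 qed
 have Sk: "I ((\<eta> ^^ k) v) \<le> C + 2 \<and> (\<eta> ^^ k) v \<in> N" if "v \<in> S" for v
  using drop[OF that, of k] k by (auto simp: S_def)
 have itc: "continuous_on S (\<eta> ^^ k)" for k
 proof (induction k)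
  case (Suc k)
  have "(\<eta> ^^ k) ` S \<subseteq> S" using drop by blast
  then show ?case using continuous_on_compose2[OF cont Suc] by (simp add: o_def)
 qed (simp add: id_def)
 have ito: "(\<eta> ^^ k) (- v) = - (\<eta> ^^ k) v" if "v \<in> S" for v k
 proof (induction k)
  case (Suc k)
  then show ?case using \<eta>odd drop[OF that, of k] by simp
 qed simp
 have fS: "f x \<in> S" if "x \<in> ?S" for x using fN[OF that] fb[OF that] by (simp add: S_def)
 let ?F = "\<lambda>j x. \<Lambda> j ((\<eta> ^^ k) (f x))"
 have "\<exists>x\<in>?S. \<forall>j<m. ?F j x = 0"
 proof (rule Borsuk_Ulam_nsphere)
  fix j assume "j < m"
  have "continuous_on ?S (\<lambda>x. (\<eta> ^^ k) (f x))" by (rule continuous_on_compose2[OF itc f]) (use fS in auto)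
  then show "continuous_map (nsphere m) euclideanreal (?F j)"
   unfolding continuous_map_nsphere by (rule bounded_linear.continuous_on[OF \<Lambda>(1)])
 next
  fix j x assume "j < m" "x \<in> ?S"
  then show "?F j (\<lambda>i. - x i) = - ?F j x"
   by (simp add: odd ito fS linear_neg[OF bounded_linear.linear[OF \<Lambda>(1)]])
 qed simp
 then obtain x where x: "x \<in> ?S" "\<forall>j<m. ?F j x = 0" by blast
 let ?u = "(\<eta> ^^ k) (f x)"
 have u: "I ?u \<le> C + 2" "?u \<in> N" using Sk[OF fS[OF x(1)]] by auto
 have "\<beta> i0 i0 ?u < c\<^sup>2" using x(2) R0 u by (intro \<Lambda>(2)) auto
 then show False using c(2)[OF u(2), of i0] by linarith
qed

end

section \<open>The functional of the system\<close>

text \<open>For p > 1 this is, up to the factor \<open>p\<close>, the derivative of |t|^p, including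
  at t = 0.\<close>

definition odd_powr :: "real \<Rightarrow> real \<Rightarrow> real" where
 "odd_powr p t = \<bar>t\<bar> powr (p - 2) * t"

lemma abs_odd_powr: "\<bar>odd_powr p t\<bar> = \<bar>t\<bar> powr (p - 1)"
proof (cases "t = 0")
 case False
 have "\<bar>odd_powr p t\<bar> = \<bar>t\<bar> powr (p - 2) * \<bar>t\<bar> powr 1" using False by (simp add: odd_powr_def abs_mult)
 also have "\<dots> = \<bar>t\<bar> powr (p - 1)" unfolding powr_add[symmetric] by simp
 finally show ?thesis .
qed (simp add: odd_powr_def)

lemma odd_powr_eq: "odd_powr p t = sgn t * \<bar>t\<bar> powr (p - 1)"
proof -
 have "sgn (odd_powr p t) = sgn t" by (cases "t = 0") (auto simp: odd_powr_def sgn_mult)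
 then show ?thesis using abs_odd_powr[of p t] by (metis mult_sgn_abs)
qed

lemma odd_powr_minus [simp]: "odd_powr p (- t) = - odd_powr p t"
 by (simp add: odd_powr_def)

lemma odd_powr_mult: "odd_powr p t * t = \<bar>t\<bar> powr p"
proof (cases "t = 0")
 case False
 have "odd_powr p t * t = \<bar>t\<bar> powr (p - 2) * \<bar>t\<bar> powr 2" by (simp add: odd_powr_def power2_eq_square)
 also have "\<dots> = \<bar>t\<bar> powr p" unfolding powr_add[symmetric] by simp
 finally show ?thesis .
qed (simp add: odd_powr_def)

lemma odd_powr_scale: "0 \<le> c \<Longrightarrow> odd_powr p (c * t) = c powr (p - 1) * odd_powr p t"
 by (cases "c = 0") (auto simp: odd_powr_eq abs_mult powr_mult sgn_mult)

lemma odd_powr_diagonal: "odd_powr p t * \<bar>t\<bar> powr p = \<bar>t\<bar> powr (2 * p - 2) * t"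
proof -
 have "odd_powr p t * \<bar>t\<bar> powr p = (\<bar>t\<bar> powr (p - 2) * \<bar>t\<bar> powr p) * t" by (simp add: odd_powr_def)
 then show ?thesis unfolding powr_add[symmetric] by simp
qed

lemma abs_powr_deriv:
 assumes p: "1 < p"
 shows "((\<lambda>t. \<bar>t\<bar> powr p) has_real_derivative p * odd_powr p t) (at t)"
proof -
 consider "0 < t" | "t < 0" | "t = 0" by linarith
 then show ?thesis
 proof cases
  case 1
  then have "((\<lambda>t. t powr p) has_real_derivative p * odd_powr p t) (at t)"
   by (auto intro!: derivative_eq_intros simp: odd_powr_eq)
  then show ?thesis
   by (rule has_field_derivative_transform_within_open[of _ _ _ "{0<..}"]) (use 1 in auto)
 next
  case 2
  then have "((\<lambda>t. (- t) powr p) has_real_derivative p * odd_powr p t) (at t)"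
   by (auto intro!: derivative_eq_intros simp: odd_powr_eq)
  then show ?thesis
   by (rule has_field_derivative_transform_within_open[of _ _ _ "{..<0}"]) (use 2 in auto)
 next
  case 3
  have "((\<lambda>h. \<bar>h\<bar> powr p / h) \<longlongrightarrow> 0) (at 0)"
  proof (rule Lim_null_comparison)
   have "norm (\<bar>h\<bar> powr p / h) \<le> \<bar>h\<bar> powr (p - 1)" for h :: real
    by (cases "h = 0") (simp_all add: powr_diff)
   then show "eventually (\<lambda>h. norm (\<bar>h\<bar> powr p / h) \<le> \<bar>h\<bar> powr (p - 1)) (at (0 :: real))" by simp
   have "((\<lambda>h::real. \<bar>h\<bar> powr (p - 1)) \<longlongrightarrow> \<bar>0\<bar> powr (p - 1)) (at 0)"
    using p by (intro tendsto_powr' tendsto_intros) auto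
   then show "((\<lambda>h::real. \<bar>h\<bar> powr (p - 1)) \<longlongrightarrow> 0) (at 0)" by simp
  qed
  then show ?thesis using 3 by (simp add: has_field_derivative_iff odd_powr_def)
 qed
qed

lemma continuous_on_abs_powr:
 assumes "0 < p" shows "continuous_on A (\<lambda>t::real. \<bar>t\<bar> powr p)"
 by (rule continuous_on_powr') (use assms in \<open>auto intro!: continuous_intros\<close>)

lemma continuous_on_odd_powr:
 assumes p: "1 < p"
 shows "continuous_on A (odd_powr p)"
proof -
 have "isCont (odd_powr p) t" for t
 proof (cases "t = 0")
  case True
  have "((\<lambda>h::real. \<bar>h\<bar> powr (p - 1)) \<longlongrightarrow> \<bar>0\<bar> powr (p - 1)) (at 0)"
   using p by (intro tendsto_powr' tendsto_intros) auto
  then have "((\<lambda>h. \<bar>odd_powr p h\<bar>) \<longlongrightarrow> 0) (at 0)" by (simp add: abs_odd_powr)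
  then have "(odd_powr p \<longlongrightarrow> 0) (at 0)" by (simp add: tendsto_rabs_zero_iff)
  then show ?thesis using True by (simp add: isCont_def odd_powr_def)
 next
  case False
  then show ?thesis unfolding odd_powr_def[abs_def] by (intro continuous_intros) auto
 qed
 then show ?thesis by (simp add: continuous_at_imp_continuous_on)
qed

lemma odd_powr_measurable [measurable]: "odd_powr p \<in> borel_measurable borel"
 unfolding odd_powr_def[abs_def] by measurable

section \<open>Pointwise estimates for the nonlinearity\<close>

lemma kernel_le:
 fixes a b :: real
 assumes p: "1 < p"
 shows "\<bar>odd_powr p a * \<bar>b\<bar> powr p\<bar> \<le> (\<bar>a\<bar> + \<bar>b\<bar>) powr (2 * p - 1)"
proof -
 have "\<bar>odd_powr p a * \<bar>b\<bar> powr p\<bar> = \<bar>a\<bar> powr (p - 1) * \<bar>b\<bar> powr p" by (simp add: abs_mult abs_odd_powr)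
 also have "\<dots> \<le> (\<bar>a\<bar> + \<bar>b\<bar>) powr (p - 1) * (\<bar>a\<bar> + \<bar>b\<bar>) powr p"
  using p by (intro mult_mono powr_mono2) auto
 also have "\<dots> = (\<bar>a\<bar> + \<bar>b\<bar>) powr (2 * p - 1)" unfolding powr_add[symmetric] by simp
 finally show ?thesis .
qed

text \<open>The kernel is homogeneous of degree \<open>2 p - 1\<close>, so uniform continuity on a compact set
 gives a scale invariant modulus of continuity.\<close>

lemma kernel_modulus:
 assumes p: "1 < p" and e: "0 < e"
 shows "\<exists>C\<ge>0. \<forall>a b a' b'. \<bar>odd_powr p a' * \<bar>b'\<bar> powr p - odd_powr p a * \<bar>b\<bar> powr p\<bar> \<le>
  e * (\<bar>a\<bar> + \<bar>b\<bar>) powr (2 * p - 1) + C * (\<bar>a' - a\<bar> + \<bar>b' - b\<bar>) powr (2 * p - 1)"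
proof -
 let ?r = "2 * p - 1"
 let ?K = "\<lambda>z :: real \<times> real. odd_powr p (fst z) * \<bar>snd z\<bar> powr p"
 have r: "0 < ?r" using p by simp
 have "continuous_on (cball 0 4) ?K"
  using p by (intro continuous_on_mult continuous_on_compose2[OF continuous_on_odd_powr[of p UNIV]]
   continuous_on_compose2[OF continuous_on_abs_powr[of p UNIV]] continuous_intros) auto
 from compact_uniformly_continuous[OF this compact_cball] e
 obtain d where d: "0 < d" "\<And>z z'. z \<in> cball 0 4 \<Longrightarrow> z' \<in> cball 0 4 \<Longrightarrow> dist z' z < d \<Longrightarrow> \<bar>?K z' - ?K z\<bar> < e"
  unfolding uniformly_continuous_on_def dist_real_def by meson
 define \<delta> where "\<delta> = min (d / 2) 1"
 have \<delta>: "0 < \<delta>" "\<delta> \<le> 1" "\<delta> < d" using d(1) by (auto simp: \<delta>_def)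
 have nrm: "norm (a, b) \<le> \<bar>a\<bar> + \<bar>b\<bar>" for a b :: real
  unfolding norm_Pair by (simp add: sqrt_sum_squares_le_sum_abs)
 define C where "C = (1 / \<delta>) powr ?r + (1 / \<delta> + 1) powr ?r"
 have "\<bar>?K (a', b') - ?K (a, b)\<bar> \<le> e * (\<bar>a\<bar> + \<bar>b\<bar>) powr ?r + C * (\<bar>a' - a\<bar> + \<bar>b' - b\<bar>) powr ?r" for a b a' b'
 proof -
  define m where "m = \<bar>a\<bar> + \<bar>b\<bar>"
  define D where "D = \<bar>a' - a\<bar> + \<bar>b' - b\<bar>"
  have mD: "0 \<le> m" "0 \<le> D" by (auto simp: m_def D_def)
  show ?thesis
  proof (cases "0 < m \<and> D \<le> \<delta> * m")
   \<comment> \<open>Here the increment is small relative to the base point, and division by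
     \<open>m\<close> brings both points into the compact ball. In the other case \<open>m\<close>
     is at most D/\<delta>, and both values are bounded separately by a power of the
     increment.\<close>
   case True
   let ?z = "(a / m, b / m)" and ?z' = "(a' / m, b' / m)"
   have sc: "?K (m * x, m * y) = m powr ?r * ?K (x, y)" for x y
   proof -
    have "?K (m * x, m * y) = (m powr (p - 1) * m powr p) * ?K (x, y)"
     using mD by (simp add: odd_powr_scale abs_mult powr_mult)
    then show ?thesis unfolding powr_add[symmetric] by simp
   qed
   have "norm ?z \<le> 1" using nrm[of "a / m" "b / m"] True by (simp add: m_def flip: add_divide_distrib)
   then have z: "?z \<in> cball 0 4" by simp
   have "norm (?z' - ?z) \<le> \<bar>a' / m - a / m\<bar> + \<bar>b' / m - b / m\<bar>" using nrm by simp
   also have "\<dots> = D / m" using True by (simp add: D_def abs_divide add_divide_distrib flip: diff_divide_distrib)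
   also have "\<dots> \<le> \<delta>" using True by (simp add: divide_le_eq)
   finally have dz: "norm (?z' - ?z) \<le> \<delta>" .
   then have "norm ?z' \<le> 4" using norm_triangle_sub[of ?z' ?z] \<open>norm ?z \<le> 1\<close> \<delta> by linarith
   then have z': "?z' \<in> cball 0 4" by simp
   have "dist ?z' ?z < d" using dz \<delta>(3) unfolding dist_norm by linarith
   from d(2)[OF z z' this] have "\<bar>?K ?z' - ?K ?z\<bar> < e" .
   moreover have "?K (a', b') - ?K (a, b) = m powr ?r * (?K ?z' - ?K ?z)"
    using sc[of "a' / m" "b' / m"] sc[of "a / m" "b / m"] True by (simp add: right_diff_distrib)
   ultimately have "\<bar>?K (a', b') - ?K (a, b)\<bar> \<le> m powr ?r * e" by (simp add: abs_mult mult_left_mono)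
   moreover have "0 \<le> C * D powr ?r" by (simp add: C_def)
   ultimately show ?thesis unfolding m_def[symmetric] D_def[symmetric] by (simp add: mult.commute)
  next
   case False
   then have mle: "m \<le> D / \<delta>" using mD \<delta> by (auto simp: pos_le_divide_eq mult.commute not_less)
   have "\<bar>?K (a, b)\<bar> \<le> m powr ?r" using kernel_le[OF p, of a b] by (simp add: m_def)
   also have "\<dots> \<le> (1 / \<delta> * D) powr ?r" using mle mD r by (intro powr_mono2) auto
   also have "\<dots> = (1 / \<delta>) powr ?r * D powr ?r" using mD \<delta> by (intro powr_mult)
   finally have 1: "\<bar>?K (a, b)\<bar> \<le> (1 / \<delta>) powr ?r * D powr ?r" .
   have "\<bar>?K (a', b')\<bar> \<le> (\<bar>a'\<bar> + \<bar>b'\<bar>) powr ?r" using kernel_le[OF p, of a' b'] by simp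
   also have "\<dots> \<le> ((1 / \<delta> + 1) * D) powr ?r"
   proof (rule powr_mono2)
    have "\<bar>a'\<bar> + \<bar>b'\<bar> \<le> m + D" by (simp add: m_def D_def)
    also have "\<dots> \<le> (1 / \<delta> + 1) * D" using mle by (simp add: distrib_right)
    finally show "\<bar>a'\<bar> + \<bar>b'\<bar> \<le> (1 / \<delta> + 1) * D" .
   qed (use r in auto)
   also have "\<dots> = (1 / \<delta> + 1) powr ?r * D powr ?r" using mD \<delta> by (intro powr_mult)
   finally have "\<bar>?K (a', b')\<bar> \<le> (1 / \<delta> + 1) powr ?r * D powr ?r" .
   with 1 have "\<bar>?K (a', b') - ?K (a, b)\<bar> \<le> C * D powr ?r" by (simp add: C_def distrib_right)
   moreover have "0 \<le> e * m powr ?r" using e by simp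
   ultimately show ?thesis unfolding m_def[symmetric] D_def[symmetric] by linarith
  qed
 qed
 moreover have "0 \<le> C" by (simp add: C_def)
 ultimately show ?thesis by auto
qed

text \<open>The mean value theorem on the segment expresses the increment through the two partial
  derivatives at an intermediate point. Both are values of the same kernel with its arguments in
  either order, so the modulus applies to each.\<close>

lemma product_expansion:
 assumes p: "1 < p" and C: "\<And>a b a' b'. \<bar>odd_powr p a' * \<bar>b'\<bar> powr p - odd_powr p a * \<bar>b\<bar> powr p\<bar> \<le>
  e * (\<bar>a\<bar> + \<bar>b\<bar>) powr (2 * p - 1) + C * (\<bar>a' - a\<bar> + \<bar>b' - b\<bar>) powr (2 * p - 1)" and C0: "0 \<le> C"
 shows "\<bar>\<bar>a + h\<bar> powr p * \<bar>b + k\<bar> powr p - \<bar>a\<bar> powr p * \<bar>b\<bar> powr p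
   - p * (odd_powr p a * \<bar>b\<bar> powr p * h + odd_powr p b * \<bar>a\<bar> powr p * k)\<bar>
  \<le> p * (e * (\<bar>a\<bar> + \<bar>b\<bar>) powr (2 * p - 1) + C * (\<bar>h\<bar> + \<bar>k\<bar>) powr (2 * p - 1)) * (\<bar>h\<bar> + \<bar>k\<bar>)"
proof -
 let ?r = "2 * p - 1"
 let ?c = "\<lambda>t::real. \<bar>t\<bar> powr p" and ?s = "odd_powr p"
 let ?f = "\<lambda>t. ?c (a + t * h) * ?c (b + t * k)"
 let ?f' = "\<lambda>t. p * ?s (a + t * h) * h * ?c (b + t * k) + ?c (a + t * h) * (p * ?s (b + t * k) * k)"
 have "(?f has_real_derivative ?f' t) (at t)" for t
 proof -
  have "((\<lambda>t. ?c (a + t * h)) has_real_derivative p * ?s (a + t * h) * h) (at t)" for a h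
   by (rule DERIV_chain2[OF abs_powr_deriv[OF p]]) (auto intro!: derivative_eq_intros)
  from DERIV_mult[OF this[of a h] this[of b k]] show ?thesis by (simp add: mult_ac add.commute)
 qed
 then obtain t where t: "0 < t" "t < 1" "?f 1 - ?f 0 = (1 - 0) * ?f' t"
  using MVT2[of 0 1 ?f ?f'] by auto
 let ?B = "e * (\<bar>a\<bar> + \<bar>b\<bar>) powr ?r + C * (\<bar>h\<bar> + \<bar>k\<bar>) powr ?r"
 have small: "\<bar>t * x\<bar> \<le> \<bar>x\<bar>" for x using t by (simp add: abs_mult mult_left_le_one_le)
 have mono: "C * (\<bar>t * h\<bar> + \<bar>t * k\<bar>) powr ?r \<le> C * (\<bar>h\<bar> + \<bar>k\<bar>) powr ?r"
  using p C0 by (intro mult_left_mono powr_mono2 add_mono small) auto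
 have 1: "\<bar>?s (a + t * h) * ?c (b + t * k) - ?s a * ?c b\<bar> \<le> ?B"
  using C[of "a + t * h" "b + t * k" a b] mono by simp
 have 2: "\<bar>?s (b + t * k) * ?c (a + t * h) - ?s b * ?c a\<bar> \<le> ?B"
  using C[of "b + t * k" "a + t * h" b a] mono by (simp add: add.commute)
 have "?c (a + h) * ?c (b + k) - ?c a * ?c b - p * (?s a * ?c b * h + ?s b * ?c a * k)
   = p * ((?s (a + t * h) * ?c (b + t * k) - ?s a * ?c b) * h + (?s (b + t * k) * ?c (a + t * h) - ?s b * ?c a) * k)"
  using t(3) by (simp add: algebra_simps)
 also have "\<bar>\<dots>\<bar> = p * \<bar>(?s (a + t * h) * ?c (b + t * k) - ?s a * ?c b) * h + (?s (b + t * k) * ?c (a + t * h) - ?s b * ?c a) * k\<bar>"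
  using p by (simp add: abs_mult)
 also have "\<dots> \<le> p * (?B * \<bar>h\<bar> + ?B * \<bar>k\<bar>)"
 proof (rule mult_left_mono)
  have "\<bar>(?s (a + t * h) * ?c (b + t * k) - ?s a * ?c b) * h\<bar> \<le> ?B * \<bar>h\<bar>"
   unfolding abs_mult using 1 by (rule mult_right_mono) simp
  moreover have "\<bar>(?s (b + t * k) * ?c (a + t * h) - ?s b * ?c a) * k\<bar> \<le> ?B * \<bar>k\<bar>"
   unfolding abs_mult using 2 by (rule mult_right_mono) simp
  ultimately show "\<bar>(?s (a + t * h) * ?c (b + t * k) - ?s a * ?c b) * h + (?s (b + t * k) * ?c (a + t * h) - ?s b * ?c a) * k\<bar>
    \<le> ?B * \<bar>h\<bar> + ?B * \<bar>k\<bar>" by (intro order_trans[OF abs_triangle_ineq] add_mono)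
 qed (use p in simp)
 also have "\<dots> = p * ?B * (\<bar>h\<bar> + \<bar>k\<bar>)"
 proof -
  have "x * (y * u + y * v) = x * y * (u + v)" for x y u v :: real by (simp add: distrib_left mult.assoc)
  then show ?thesis .
 qed
 finally show ?thesis .
qed

section \<open>Bounds in L^q\<close>

definition power_bounded :: "real \<Rightarrow> ('a::euclidean_space \<Rightarrow> real) \<Rightarrow> real \<Rightarrow> bool" where
 "power_bounded q f A \<longleftrightarrow> f \<in> borel_measurable borel \<and> 0 \<le> A \<and>
   integrable lborel (\<lambda>x. \<bar>f x\<bar> powr q) \<and> (LBINT x. \<bar>f x\<bar> powr q) \<le> A powr q"

lemma power_bounded_mono:
 assumes "power_bounded q f A" "g \<in> borel_measurable borel" "AE x in lborel. \<bar>g x\<bar> \<le> \<bar>f x\<bar>" "A \<le> B" "0 < q"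
 shows "power_bounded q g B"
proof -
 have i: "integrable lborel (\<lambda>x. \<bar>f x\<bar> powr q)" using assms(1) by (simp add: power_bounded_def)
 have le: "AE x in lborel. \<bar>g x\<bar> powr q \<le> \<bar>f x\<bar> powr q"
  using assms(3) by eventually_elim (use assms(5) in \<open>auto intro: powr_mono2\<close>)
 have gi: "integrable lborel (\<lambda>x. \<bar>g x\<bar> powr q)"
  by (rule Bochner_Integration.integrable_bound[OF i]) (use le assms(2) in auto)
 have "(LBINT x. \<bar>g x\<bar> powr q) \<le> (LBINT x. \<bar>f x\<bar> powr q)" by (rule integral_mono_AE[OF gi i le])
 also have "\<dots> \<le> A powr q" using assms(1) by (simp add: power_bounded_def)
 also have "\<dots> \<le> B powr q" using assms(1,4,5) by (intro powr_mono2) (auto simp: power_bounded_def)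
 finally show ?thesis using assms gi by (auto simp: power_bounded_def)
qed

text \<open>A factor 2^q is paid twice, for the pointwise sum and for comparing A^q + B^q with (A +
  B)^q. Together they put the 4 inside the power.\<close>

lemma power_bounded_add:
 assumes f: "power_bounded q f A" and g: "power_bounded q g B" and q: "1 \<le> q"
 shows "power_bounded q (\<lambda>x. \<bar>f x\<bar> + \<bar>g x\<bar>) (4 * (A + B))"
proof -
 note f = f[unfolded power_bounded_def] and g = g[unfolded power_bounded_def]
 have [measurable]: "f \<in> borel_measurable borel" "g \<in> borel_measurable borel" using f g by auto
 have le: "\<bar>\<bar>f x\<bar> + \<bar>g x\<bar>\<bar> powr q \<le> 2 powr q * (\<bar>f x\<bar> powr q + \<bar>g x\<bar> powr q)" for x
  using abs_add_powr_le[of q "\<bar>f x\<bar>" "\<bar>g x\<bar>"] q by simp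
 have i: "integrable lborel (\<lambda>x. 2 powr q * (\<bar>f x\<bar> powr q + \<bar>g x\<bar> powr q))" using f g by auto
 have s: "integrable lborel (\<lambda>x. \<bar>\<bar>f x\<bar> + \<bar>g x\<bar>\<bar> powr q)"
  by (rule Bochner_Integration.integrable_bound[OF i]) (use le in \<open>auto simp: abs_mult\<close>)
 have "(LBINT x. \<bar>\<bar>f x\<bar> + \<bar>g x\<bar>\<bar> powr q) \<le> (LBINT x. 2 powr q * (\<bar>f x\<bar> powr q + \<bar>g x\<bar> powr q))"
  by (rule integral_mono[OF s i le])
 also have "\<dots> \<le> 2 powr q * (A powr q + B powr q)" using f g by (simp add: mult_left_mono add_mono)
 also have "\<dots> \<le> 2 powr q * (2 powr q * (A + B) powr q)"
 proof (rule mult_left_mono)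
  have "A powr q \<le> (A + B) powr q" "B powr q \<le> (A + B) powr q" using f g q by (auto intro!: powr_mono2)
  moreover have "2 \<le> (2 :: real) powr q" using powr_mono[of 1 q 2] q by simp
  then have "2 * (A + B) powr q \<le> 2 powr q * (A + B) powr q" by (rule mult_right_mono) simp
  ultimately show "A powr q + B powr q \<le> 2 powr q * (A + B) powr q" by linarith
 qed simp
 also have "\<dots> = (4 * (A + B)) powr q"
 proof -
  have "(4::real) powr q = 2 powr q * 2 powr q" using powr_mult[of 2 2 q] by simp
  then show ?thesis using f g powr_mult[of 4 "A + B" q] by simp
 qed
 finally show ?thesis using f g s by (simp add: power_bounded_def)
qed

text \<open>After division by \<open>A\<close> and \<open>B\<close>, the crude inequality x^(q-1) y
  \<le> x^q + y^q gives the estimate with constant 2. If one of the bounds is 0, the corresponding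
  function vanishes almost everywhere.\<close>

lemma power_bounded_Hoelder:
 assumes f: "power_bounded q f A" and g: "power_bounded q g B" and q: "1 < q"
 shows "integrable lborel (\<lambda>x. \<bar>f x\<bar> powr (q - 1) * \<bar>g x\<bar>)"
  "(LBINT x. \<bar>f x\<bar> powr (q - 1) * \<bar>g x\<bar>) \<le> 2 * A powr (q - 1) * B"
proof -
 note f = f[unfolded power_bounded_def] and g = g[unfolded power_bounded_def]
 have [measurable]: "f \<in> borel_measurable borel" "g \<in> borel_measurable borel" using f g by auto
 have Young: "x powr (q - 1) * y \<le> x powr q + y powr q" if "0 \<le> x" "0 \<le> y" for x y :: real
 proof -
  have "x powr (q - 1) * y \<le> max x y powr (q - 1) * max x y powr 1"
   using that q by (intro mult_mono powr_mono2) auto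
  also have "\<dots> = max x y powr q" unfolding powr_add[symmetric] by simp
  also have "\<dots> \<le> x powr q + y powr q" by (auto simp: max_def)
  finally show ?thesis .
 qed
 show int: "integrable lborel (\<lambda>x. \<bar>f x\<bar> powr (q - 1) * \<bar>g x\<bar>)"
  by (rule Bochner_Integration.integrable_bound[of _ "\<lambda>x. \<bar>f x\<bar> powr q + \<bar>g x\<bar> powr q"])
   (use f g Young in \<open>auto simp: abs_mult\<close>)
 show "(LBINT x. \<bar>f x\<bar> powr (q - 1) * \<bar>g x\<bar>) \<le> 2 * A powr (q - 1) * B"
 proof (cases "0 < A \<and> 0 < B")
  case True
  let ?k = "A powr (q - 1) * B"
  have le: "\<bar>f x\<bar> powr (q - 1) * \<bar>g x\<bar> \<le> ?k * (\<bar>f x\<bar> powr q / A powr q + \<bar>g x\<bar> powr q / B powr q)" for x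
  proof -
   have "\<bar>f x\<bar> powr (q - 1) * \<bar>g x\<bar> = ?k * ((\<bar>f x\<bar> / A) powr (q - 1) * (\<bar>g x\<bar> / B))"
    using True by (simp add: powr_divide)
   also have "\<dots> \<le> ?k * ((\<bar>f x\<bar> / A) powr q + (\<bar>g x\<bar> / B) powr q)"
    using True by (intro mult_left_mono Young) auto
   finally show ?thesis using True by (simp add: powr_divide)
  qed
  have "(LBINT x. \<bar>f x\<bar> powr (q - 1) * \<bar>g x\<bar>)
    \<le> (LBINT x. ?k * (\<bar>f x\<bar> powr q / A powr q + \<bar>g x\<bar> powr q / B powr q))"
   by (rule integral_mono[OF int _ le]) (use f g in auto)
  also have "\<dots> = ?k * ((LBINT x. \<bar>f x\<bar> powr q) / A powr q + (LBINT x. \<bar>g x\<bar> powr q) / B powr q)"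
   using f g by simp
  also have "\<dots> \<le> ?k * (1 + 1)"
   using f g True by (intro mult_left_mono add_mono) (auto simp: divide_le_eq_1)
  finally show ?thesis by simp
 next
  case False
  have zero: "AE x in lborel. u x = 0" if "power_bounded q u 0" for u :: "'a \<Rightarrow> real"
  proof -
   have i: "integrable lborel (\<lambda>x. \<bar>u x\<bar> powr q)" "(LBINT x. \<bar>u x\<bar> powr q) \<le> 0"
    using that by (auto simp: power_bounded_def)
   then have "(LBINT x. \<bar>u x\<bar> powr q) = 0" by (intro antisym integral_nonneg_AE) auto
   then have "AE x in lborel. \<bar>u x\<bar> powr q = 0" using integral_nonneg_eq_0_iff_AE[OF i(1)] by simp
   then show ?thesis by simp
  qed
  have "A = 0 \<or> B = 0" using False f g by linarith
  then have "AE x in lborel. \<bar>f x\<bar> powr (q - 1) * \<bar>g x\<bar> = 0"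
   using zero[of f] zero[of g] assms(1,2) by auto
  then have "(LBINT x. \<bar>f x\<bar> powr (q - 1) * \<bar>g x\<bar>) = 0" by (rule integral_eq_zero_AE)
  then show ?thesis using f g by simp
 qed
qed

text \<open>Integration by parts comes from translation invariance: in the integral of a product,
  shifting one factor by \<open>s\<close> amounts to shifting the other by \<open>- s\<close>.
  Differentiating both expressions at 0 gives the identity.\<close>

lemma test_function_H1:
 fixes \<phi> :: "'a::euclidean_space \<Rightarrow> real"
 assumes \<phi>: "\<phi> \<in> test_functions"
 shows "\<phi> \<in> H1"
proof -
 let ?D = "\<lambda>x b. deriv_at \<phi> x b"
 define g :: "'a \<Rightarrow> 'a" where "g x = (\<Sum>b\<in>Basis. ?D x b *\<^sub>R b)" for x
 have gb: "g x \<bullet> b = ?D x b" if "b \<in> Basis" for x b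
  unfolding g_def using that by (rule inner_sum_left_Basis)
 have g: "g \<in> square_integrable"
 proof (rule sq_int_bound)
  show "g \<in> borel_measurable lborel"
   unfolding g_def using test_measurable(2)[OF \<phi>] by measurable
  show "integrable lborel (\<lambda>x. \<Sum>b\<in>Basis. (norm (?D x b))\<^sup>2)"
   using sq_intD(3)[OF test_sq_int(2)[OF \<phi>]] by (intro Bochner_Integration.integrable_sum) auto
  have "(norm (g x))\<^sup>2 = (\<Sum>b\<in>Basis. (norm (?D x b))\<^sup>2)" for x
   unfolding power2_norm_eq_inner euclidean_inner[of "g x" "g x"] by (simp add: gb)
  then show "AE x in lborel. (norm (g x))\<^sup>2 \<le> (\<Sum>b\<in>Basis. (norm (?D x b))\<^sup>2)" by simp
 qed
 have "is_weak_gradient \<phi> g" unfolding is_weak_gradient_def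
 proof (intro ballI)
  fix \<psi> :: "'a \<Rightarrow> real" and b :: 'a assume \<psi>: "\<psi> \<in> test_functions" and b: "b \<in> Basis"
  have m[measurable]: "\<phi> \<in> borel_measurable borel" "\<psi> \<in> borel_measurable borel"
   using test_measurable(1) \<phi> \<psi> by auto
  have "(LBINT x. \<phi> x * \<psi> (x + s *\<^sub>R b)) = (LBINT x. \<psi> x * \<phi> (x + s *\<^sub>R (- b)))" for s
   using integral_translate[of "\<lambda>x. \<phi> (x - s *\<^sub>R b) * \<psi> x" "s *\<^sub>R b"] by (simp add: mult.commute)
  then have "((\<lambda>s. \<integral>x. \<phi> x * \<psi> (x + s *\<^sub>R b) \<partial>lborel) has_real_derivative
    (LBINT x. \<psi> x * deriv_at \<phi> x (- b))) (at 0)"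
   using pairing_has_derivative_0[OF test_sq_int(1)[OF \<psi>] \<phi>, of "- b"] by simp
  then have "(LBINT x. \<phi> x * deriv_at \<psi> x b) = (LBINT x. \<psi> x * deriv_at \<phi> x (- b))"
   using pairing_has_derivative_0[OF test_sq_int(1)[OF \<phi>] \<psi>, of b] by (rule DERIV_unique[symmetric])
  also have "\<dots> = - (LBINT x. (g x \<bullet> b) * \<phi>' x)" if "\<phi>' = \<psi>" for \<phi>'
  proof -
   have "deriv_at \<phi> x (- b) = - (g x \<bullet> b)" for x
    using linear_neg[OF has_derivative_linear[OF test_has_derivative[OF \<phi>]]] gb[OF b] by simp
   then show ?thesis using that by (simp add: mult.commute)
  qed
  finally show "(LBINT x. \<phi> x * deriv_at \<psi> x b) = - (LBINT x. (g x \<bullet> b) * \<psi> x)"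
   by simp
 qed
 then show ?thesis using g test_sq_int(1)[OF \<phi>] by (auto simp: H1_def)
qed

section \<open>Disjoint bumps near the centres\<close>

lemma distinct_representatives:
 assumes "finite J" "\<And>j. j \<in> J \<Longrightarrow> infinite (S j)"
 shows "\<exists>z. inj_on z J \<and> (\<forall>j\<in>J. z j \<in> S j)"
 using assms
proof (induction J rule: finite_induct)
 case (insert j J)
 then obtain z where z: "inj_on z J" "\<forall>j\<in>J. z j \<in> S j" by auto
 have "infinite (S j - z ` J)" using insert by (auto simp: Diff_infinite_finite)
 then obtain w where w: "w \<in> S j - z ` J" using infinite_imp_nonempty by blast
 have "(z(j := w)) ` J = z ` J" using insert(2) by auto
 then have "inj_on (z(j := w)) (insert j J)"
  using z(1) w insert(2) by (auto simp: inj_on_def)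
 moreover have "\<forall>i\<in>insert j J. (z(j := w)) i \<in> S i" using z(2) w by auto
 ultimately show ?case by blast
qed simp

lemma separated_balls:
 fixes z :: "'j \<Rightarrow> 'a::metric_space"
 assumes J: "finite J" and z: "inj_on z J" and B: "\<And>j. j \<in> J \<Longrightarrow> open (B j) \<and> z j \<in> B j"
 shows "\<exists>\<rho>>0. (\<forall>j\<in>J. ball (z j) \<rho> \<subseteq> B j) \<and> (\<forall>i\<in>J. \<forall>j\<in>J. i \<noteq> j \<longrightarrow> ball (z i) \<rho> \<inter> ball (z j) \<rho> = {})"
proof -
 have "\<exists>\<rho>>0. \<forall>j\<in>J. ball (z j) \<rho> \<subseteq> B j"
 proof -
  have "\<forall>j\<in>J. \<exists>\<rho>>0. ball (z j) \<rho> \<subseteq> B j" using B open_contains_ball by blast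
  then obtain r where r: "\<And>j. j \<in> J \<Longrightarrow> 0 < r j" "\<And>j. j \<in> J \<Longrightarrow> ball (z j) (r j) \<subseteq> B j" by metis
  have "Min (insert 1 (r ` J)) \<le> r j" if "j \<in> J" for j using that J by auto
  moreover have "0 < Min (insert 1 (r ` J))" using J r(1) by auto
  ultimately show ?thesis using r(2) by (intro exI[of _ "Min (insert 1 (r ` J))"]) (meson order_trans subset_ball)
 qed
 then obtain \<rho>1 where \<rho>1: "0 < \<rho>1" "\<And>j. j \<in> J \<Longrightarrow> ball (z j) \<rho>1 \<subseteq> B j" by blast
 define D where "D = (\<lambda>(i, j). dist (z i) (z j)) ` {(i, j). i \<in> J \<and> j \<in> J \<and> i \<noteq> j}"
 have "finite D" unfolding D_def
  by (rule finite_imageI) (rule finite_subset[OF _ finite_cartesian_product[OF J J]], auto)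
 define \<rho> where "\<rho> = min \<rho>1 (Min (insert 1 D) / 2)"
 have "0 < Min (insert 1 D)" using \<open>finite D\<close> z by (auto simp: D_def inj_on_def)
 then have "0 < \<rho>" using \<rho>1(1) by (simp add: \<rho>_def)
 moreover have "ball (z j) \<rho> \<subseteq> B j" if "j \<in> J" for j using \<rho>1(2)[OF that] by (auto simp: \<rho>_def)
 moreover have "ball (z i) \<rho> \<inter> ball (z j) \<rho> = {}" if "i \<in> J" "j \<in> J" "i \<noteq> j" for i j
 proof (rule disjoint_ballI)
  have "dist (z i) (z j) \<in> D" using that by (force simp: D_def)
  then have "Min (insert 1 D) \<le> dist (z i) (z j)" using \<open>finite D\<close> by simp
  then show "\<rho> + \<rho> \<le> dist (z i) (z j)" by (simp add: \<rho>_def)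
 qed
 ultimately show ?thesis by blast
qed

text \<open>The balls around the \<open>y i\<close> may overlap or coincide. Hence distinct points
  are chosen first, one for each pair (i, k), and then small disjoint balls around them inside the
  prescribed ones.\<close>

lemma disjoint_bumps:
 fixes y :: "'l::finite \<Rightarrow> 'a::euclidean_space"
 assumes e: "0 < e" and q: "0 < q"
 obtains \<phi> :: "'l \<Rightarrow> nat \<Rightarrow> 'a h1" where
  "\<And>i k. k \<le> n \<Longrightarrow> AE x in lborel. x \<notin> ball (y i) e \<longrightarrow> h1_fun (\<phi> i k) x = 0"
  "\<And>i k i' k'. k \<le> n \<Longrightarrow> k' \<le> n \<Longrightarrow> (i, k) \<noteq> (i', k') \<Longrightarrow>
    AE x in lborel. h1_fun (\<phi> i k) x = 0 \<or> h1_fun (\<phi> i' k') x = 0"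
  "\<And>i k. k \<le> n \<Longrightarrow> \<not> (AE x in lborel. h1_fun (\<phi> i k) x = 0)"
proof -
 let ?J = "UNIV \<times> {..n} :: ('l \<times> nat) set"
 have "finite ?J" by simp
 moreover have "infinite (ball (y (fst j)) e)" for j :: "'l \<times> nat"
  using e uncountable_ball[of e "y (fst j)"] countable_finite by blast
 ultimately obtain z where z: "inj_on z ?J" "\<And>j. j \<in> ?J \<Longrightarrow> z j \<in> ball (y (fst j)) e"
  using distinct_representatives[of ?J "\<lambda>j. ball (y (fst j)) e"] by auto
 obtain \<rho> where \<rho>: "0 < \<rho>" "\<And>j. j \<in> ?J \<Longrightarrow> ball (z j) \<rho> \<subseteq> ball (y (fst j)) e"
  "\<And>i j. i \<in> ?J \<Longrightarrow> j \<in> ?J \<Longrightarrow> i \<noteq> j \<Longrightarrow> ball (z i) \<rho> \<inter> ball (z j) \<rho> = {}"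
  using separated_balls[OF \<open>finite ?J\<close> z(1), of "\<lambda>j. ball (y (fst j)) e"] z(2) by auto
 have "\<forall>j. \<exists>a b. z j \<in> box a b \<and> box a b \<subseteq> ball (z j) \<rho>"
  using rational_boxes[OF \<rho>(1)] by blast
 then obtain a b where ab: "\<And>j. z j \<in> box (a j) (b j)" "\<And>j. box (a j) (b j) \<subseteq> ball (z j) \<rho>" by metis
 define \<psi> where "\<psi> j = box_bump (a j) (b j) 1" for j
 define \<phi> where "\<phi> i k = h1_of (\<psi> (i, k))" for i k
 have \<phi>: "AE x in lborel. h1_fun (\<phi> i k) x = \<psi> (i, k) x" for i k
  unfolding \<phi>_def \<psi>_def by (intro h1_fun_of_AE test_function_H1 box_bump_test)
 have supp: "\<psi> j x = 0" if "x \<notin> ball (z j) \<rho>" for j x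
  unfolding \<psi>_def using ab(2)[of j] that by (intro box_bump_eq_0) auto
 show ?thesis
 proof (rule that[of \<phi>])
  fix i :: 'l and k assume "k \<le> n"
  then have J: "(i, k) \<in> ?J" by simp
  show "AE x in lborel. x \<notin> ball (y i) e \<longrightarrow> h1_fun (\<phi> i k) x = 0"
   using \<phi>[of i k]
  proof eventually_elim
   case (elim x)
   show ?case
   proof
    assume "x \<notin> ball (y i) e"
    then have "x \<notin> ball (z (i, k)) \<rho>" using \<rho>(2)[OF J] by auto
    then show "h1_fun (\<phi> i k) x = 0" using supp elim by simp
   qed
  qed
  show "\<not> (AE x in lborel. h1_fun (\<phi> i k) x = 0)"
  proof
   assume "AE x in lborel. h1_fun (\<phi> i k) x = 0"
   with \<phi>[of i k] have "AE x in lborel. x \<notin> box (a (i, k)) (b (i, k))"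
   proof eventually_elim
    case (elim x)
    then show ?case using box_bump_pos[of x "a (i, k)" "b (i, k)" 1] by (auto simp: \<psi>_def)
   qed
   then have "emeasure lborel (box (a (i, k)) (b (i, k))) = 0"
    by (subst (asm) AE_iff_measurable[OF _ refl]) auto
   moreover have "\<forall>d\<in>Basis. a (i, k) \<bullet> d < b (i, k) \<bullet> d" using ab(1)[of "(i, k)"] by (force simp: mem_box)
   then have "0 < (\<Prod>d\<in>Basis. (b (i, k) - a (i, k)) \<bullet> d)" by (intro prod_pos) (simp add: inner_diff_left)
   ultimately show False
    using \<open>\<forall>d\<in>Basis. a (i, k) \<bullet> d < b (i, k) \<bullet> d\<close> by (auto simp: emeasure_lborel_box_eq less_imp_le inner_diff_left)
  qed
 next
  fix i i' :: 'l and k k' assume "k \<le> n" "k' \<le> n" and ne: "(i, k) \<noteq> (i', k')"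
  then have J: "(i, k) \<in> ?J" "(i', k') \<in> ?J" by auto
  show "AE x in lborel. h1_fun (\<phi> i k) x = 0 \<or> h1_fun (\<phi> i' k') x = 0"
   using \<phi>[of i k] \<phi>[of i' k']
  proof eventually_elim
   case (elim x)
   have "x \<notin> ball (z (i, k)) \<rho> \<or> x \<notin> ball (z (i', k')) \<rho>" using \<rho>(3)[OF J ne] by blast
   then show ?case using supp elim by auto
  qed
 qed
qed

text \<open>Hoelder's inequality in the shape of the kernel modulus: \<open>m\<close> measures the
  base point, \<open>d\<close> the increment and \<open>g\<close> the test function.\<close>

lemma integral_modulus_le:
 assumes m: "power_bounded q m A" and d: "power_bounded q d D" and g: "power_bounded q g B" and q: "1 < q"
  and F [measurable]: "F \<in> borel_measurable borel" and eC: "0 \<le> e" "0 \<le> C"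
  and le: "AE x in lborel. \<bar>F x\<bar> \<le> (e * \<bar>m x\<bar> powr (q - 1) + C * \<bar>d x\<bar> powr (q - 1)) * \<bar>g x\<bar>"
 shows "integrable lborel F" "\<bar>\<integral>x. F x \<partial>lborel\<bar> \<le> (e * A powr (q - 1) + C * D powr (q - 1)) * (2 * B)"
proof -
 let ?E = "\<lambda>x. e * (\<bar>m x\<bar> powr (q - 1) * \<bar>g x\<bar>) + C * (\<bar>d x\<bar> powr (q - 1) * \<bar>g x\<bar>)"
 note M = power_bounded_Hoelder[OF m g q] and N = power_bounded_Hoelder[OF d g q]
 have i: "integrable lborel ?E" using M(1) N(1) by auto
 have le': "AE x in lborel. \<bar>F x\<bar> \<le> ?E x" using le by eventually_elim (simp add: algebra_simps)
 show F: "integrable lborel F"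
  by (rule Bochner_Integration.integrable_bound[OF i])
   (use le' eC in \<open>auto elim!: eventually_mono simp: abs_of_nonneg\<close>)
 have "\<bar>\<integral>x. F x \<partial>lborel\<bar> \<le> (LBINT x. \<bar>F x\<bar>)" by (rule integral_abs_bound)
 also have "\<dots> \<le> (LBINT x. ?E x)" using F i le' by (intro integral_mono_AE) auto
 also have "\<dots> = e * (LBINT x. \<bar>m x\<bar> powr (q - 1) * \<bar>g x\<bar>) + C * (LBINT x. \<bar>d x\<bar> powr (q - 1) * \<bar>g x\<bar>)"
  using M(1) N(1) by simp
 also have "\<dots> \<le> e * (2 * A powr (q - 1) * B) + C * (2 * D powr (q - 1) * B)"
  using M(2) N(2) eC by (intro add_mono mult_left_mono) auto
 finally show "\<bar>\<integral>x. F x \<partial>lborel\<bar> \<le> (e * A powr (q - 1) + C * D powr (q - 1)) * (2 * B)" by (simp add: algebra_simps)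
qed

lemma norm_le_of_inner_bound:
 fixes z :: "'h::real_inner"
 assumes "\<And>h. \<bar>z \<bullet> h\<bar> \<le> B * norm h" "0 \<le> B"
 shows "norm z \<le> B"
proof (cases "z = 0")
 case False
 have "norm z * norm z \<le> B * norm z" using assms(1)[of z] by (simp add: power2_norm_eq_inner[symmetric] power2_eq_square)
 then show ?thesis using False by simp
qed (use assms in simp)

section \<open>The coupling integrals and their gradient\<close>

locale schroedinger_system =
 fixes p \<epsilon> :: real
  and y :: "'l::finite \<Rightarrow> 'a::euclidean_space"
  and \<mu> :: "'l \<Rightarrow> real"
  and lam :: "'l \<Rightarrow> 'l \<Rightarrow> real"
 assumes p: "1 < p" and gap: "0 < sobolev_gap TYPE('a) (2 * p)" and \<epsilon>: "0 < \<epsilon>"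
  and \<mu>: "\<And>i. 0 < \<mu> i" and lam_sym: "\<And>i j. i \<noteq> j \<Longrightarrow> lam i j = lam j i"
  and lam_neg: "\<And>i j. i \<noteq> j \<Longrightarrow> lam i j < 0"
begin

text \<open>With both kinds of coefficients in one function, the diagonal and the coupling terms
  share all estimates.\<close>

definition coef :: "'l \<Rightarrow> 'l \<Rightarrow> 'a \<Rightarrow> real" where
 "coef i j x = (if i = j then \<mu> i * Q \<epsilon> (x - y i) else lam i j)"

definition coef_bound :: real where
 "coef_bound = (\<Sum>i\<in>UNIV. \<mu> i) + (\<Sum>i\<in>UNIV. \<Sum>j\<in>UNIV. \<bar>lam i j\<bar>)"

definition \<beta> :: "'l \<Rightarrow> 'l \<Rightarrow> 'a h1 ^ 'l \<Rightarrow> real" where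
 "\<beta> i j v = (LBINT x. coef i j x * \<bar>h1_fun (v $ i) x\<bar> powr p * \<bar>h1_fun (v $ j) x\<bar> powr p)"

text \<open>\<open>p * kern i j v h\<close> is the derivative of the (i, j) integral in its first
  factor, in direction \<open>h\<close>.\<close>

definition kern :: "'l \<Rightarrow> 'l \<Rightarrow> 'a h1 ^ 'l \<Rightarrow> 'a h1 \<Rightarrow> real" where
 "kern i j v h = (LBINT x. coef i j x * (odd_powr p (h1_fun (v $ i) x) * \<bar>h1_fun (v $ j) x\<bar> powr p) * h1_fun h x)"

definition sob :: real where
 "sob = (SOME K. 0 < K \<and> (\<forall>h :: 'a h1. power_bounded (2 * p) (h1_fun h) (K * norm h)))"

lemma sob: "0 < sob" "power_bounded (2 * p) (h1_fun (h :: 'a h1)) (sob * norm h)"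
proof -
 obtain K where K: "K > 0" "\<forall>h :: 'a h1. integrable lborel (\<lambda>x. \<bar>h1_fun h x\<bar> powr (2 * p)) \<and>
  (LBINT x. \<bar>h1_fun h x\<bar> powr (2 * p)) \<le> (K * norm h) powr (2 * p)"
  using sobolev_embedding[where 'a = 'a, of "2 * p"] p gap by auto
 then have "0 < K \<and> (\<forall>h :: 'a h1. power_bounded (2 * p) (h1_fun h) (K * norm h))"
  by (auto simp: power_bounded_def)
 from someI[of "\<lambda>K. 0 < K \<and> (\<forall>h :: 'a h1. power_bounded (2 * p) (h1_fun h) (K * norm h))", OF this]
 show "0 < sob" "power_bounded (2 * p) (h1_fun h) (sob * norm h)" by (auto simp: sob_def)
qed

lemma coef_bound_pos: "0 < coef_bound"
proof -
 have "0 < (\<Sum>i\<in>UNIV. \<mu> i)" using \<mu> by (intro sum_pos) auto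
 moreover have "0 \<le> (\<Sum>i\<in>UNIV. \<Sum>j\<in>UNIV. \<bar>lam i j\<bar>)" by (intro sum_nonneg) auto
 ultimately show ?thesis by (simp add: coef_bound_def)
qed

lemma coef_le: "\<bar>coef i j x\<bar> \<le> coef_bound"
proof (cases "i = j")
 case True
 have "\<mu> i \<le> (\<Sum>i\<in>UNIV. \<mu> i)" using \<mu> by (intro member_le_sum) (auto simp: less_imp_le)
 moreover have "0 \<le> (\<Sum>i\<in>UNIV. \<Sum>j\<in>UNIV. \<bar>lam i j\<bar>)" by (intro sum_nonneg) auto
 ultimately show ?thesis using True \<mu>[of i] by (simp add: coef_def coef_bound_def Q_def abs_mult)
next
 case False
 have "\<bar>lam i j\<bar> \<le> (\<Sum>j\<in>UNIV. \<bar>lam i j\<bar>)" by (rule member_le_sum) auto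
 also have "\<dots> \<le> (\<Sum>i\<in>UNIV. \<Sum>j\<in>UNIV. \<bar>lam i j\<bar>)"
  by (rule member_le_sum[of i UNIV "\<lambda>i. \<Sum>j\<in>UNIV. \<bar>lam i j\<bar>"]) (auto intro: sum_nonneg)
 moreover have "0 \<le> (\<Sum>i\<in>UNIV. \<mu> i)" using \<mu> by (intro sum_nonneg) (auto simp: less_imp_le)
 ultimately show ?thesis using False by (simp add: coef_def coef_bound_def)
qed

lemma coef_sym: "coef i j x = coef j i x"
 using lam_sym[of i j] by (auto simp: coef_def)

lemma coef_measurable [measurable]: "coef i j \<in> borel_measurable borel"
proof -
 have "(\<lambda>x. Q \<epsilon> (x - y i)) \<in> borel_measurable borel" unfolding Q_def by measurable
 then show ?thesis unfolding coef_def[abs_def] by (cases "i = j") auto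
qed

definition pair_sum :: "'l \<Rightarrow> 'l \<Rightarrow> 'a h1 ^ 'l \<Rightarrow> 'a \<Rightarrow> real" where
 "pair_sum i j v x = \<bar>h1_fun (v $ i) x\<bar> + \<bar>h1_fun (v $ j) x\<bar>"

lemma power_bounded_pair_sum:
 assumes "norm v \<le> R"
 shows "power_bounded (2 * p) (pair_sum i j v) (8 * sob * R)"
proof (rule power_bounded_mono)
 show b: "power_bounded (2 * p) (pair_sum i j v) (4 * (sob * norm (v $ i) + sob * norm (v $ j)))"
  unfolding pair_sum_def[abs_def] using p by (intro power_bounded_add sob) auto
 then show "pair_sum i j v \<in> borel_measurable borel" by (simp add: power_bounded_def)
 have "norm (v $ k) \<le> R" for k using Finite_Cartesian_Product.norm_nth_le[of v k] assms by linarith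
 then have "sob * norm (v $ k) \<le> sob * R" for k using sob(1) by simp
 from add_mono[OF this[of i] this[of j]] show "4 * (sob * norm (v $ i) + sob * norm (v $ j)) \<le> 8 * sob * R"
  by (simp add: mult.commute mult.left_commute)
qed (use p in auto)

lemma pair_sum_nonneg: "0 \<le> pair_sum i j v x" by (simp add: pair_sum_def)

lemma kern_integrable:
 "integrable lborel (\<lambda>x. coef i j x * (odd_powr p (h1_fun (v $ i) x) * \<bar>h1_fun (v $ j) x\<bar> powr p) * h1_fun h x)"
 (is "integrable lborel ?F")
 and kern_le: "norm v \<le> R \<Longrightarrow> \<bar>kern i j v h\<bar> \<le> coef_bound * (8 * sob * R) powr (2 * p - 1) * (2 * sob) * norm h"
proof -
 have *: "integrable lborel ?F \<and> \<bar>kern i j v h\<bar> \<le> coef_bound * (8 * sob * R) powr (2 * p - 1) * (2 * sob) * norm h"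
  if R: "norm v \<le> R" for R
 proof -
  note b = power_bounded_pair_sum[OF R, of i j]
  \<comment> \<open>The summand with coefficient 0 brings the bound into the form of
    \<open>integral_modulus_le\<close>.\<close>
  have le: "\<bar>?F x\<bar> \<le> (coef_bound * \<bar>pair_sum i j v x\<bar> powr (2 * p - 1) + 0 * \<bar>pair_sum i j v x\<bar> powr (2 * p - 1)) * \<bar>h1_fun h x\<bar>" for x
  proof -
   have "\<bar>?F x\<bar> = \<bar>coef i j x\<bar> * \<bar>odd_powr p (h1_fun (v $ i) x) * \<bar>h1_fun (v $ j) x\<bar> powr p\<bar> * \<bar>h1_fun h x\<bar>"
    by (simp add: abs_mult)
   also have "\<dots> \<le> coef_bound * pair_sum i j v x powr (2 * p - 1) * \<bar>h1_fun h x\<bar>"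
    unfolding pair_sum_def using coef_bound_pos
    by (intro mult_right_mono mult_mono coef_le kernel_le p) auto
   finally show ?thesis by (simp add: abs_of_nonneg[OF pair_sum_nonneg])
  qed
  have "?F \<in> borel_measurable borel" by measurable
  from integral_modulus_le[OF b b sob(2)[of h] _ this _ _ always_eventually[OF allI[OF le]]] p coef_bound_pos
  show ?thesis by (simp add: kern_def mult_ac)
 qed
 from *[of "norm v"] show "integrable lborel ?F" by simp
 show "norm v \<le> R \<Longrightarrow> \<bar>kern i j v h\<bar> \<le> coef_bound * (8 * sob * R) powr (2 * p - 1) * (2 * sob) * norm h"
  using * by blast
qed

lemma bounded_linear_kern: "bounded_linear (kern i j v)"
proof (rule bounded_linear_intro)
 let ?k = "\<lambda>x. coef i j x * (odd_powr p (h1_fun (v $ i) x) * \<bar>h1_fun (v $ j) x\<bar> powr p)"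
 show "kern i j v (h + k) = kern i j v h + kern i j v k" for h k
 proof -
  have "kern i j v (h + k) = (LBINT x. ?k x * h1_fun h x + ?k x * h1_fun k x)"
   unfolding kern_def by (rule integral_cong_AE) (measurable, use h1_fun_arith_AE(1)[of h k] in \<open>auto elim!: eventually_mono simp: distrib_left\<close>)
  then show ?thesis unfolding kern_def using kern_integrable by simp
 qed
 show "kern i j v (c *\<^sub>R h) = c *\<^sub>R kern i j v h" for c h
 proof -
  have "kern i j v (c *\<^sub>R h) = (LBINT x. c * (?k x * h1_fun h x))"
   unfolding kern_def by (rule integral_cong_AE) (measurable, use h1_fun_arith_AE(3)[of c h] in \<open>auto elim!: eventually_mono\<close>)
  then show ?thesis by (simp add: kern_def)
 qed
 show "norm (kern i j v h) \<le> norm h * (coef_bound * (8 * sob * norm v) powr (2 * p - 1) * (2 * sob))" for h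
  using kern_le[OF order_refl, of i j v h] by (simp add: mult_ac)
qed

definition G :: "'a h1 ^ 'l \<Rightarrow> 'a h1 ^ 'l" where
 "G v = (\<chi> i. SOME u. \<forall>h. (\<Sum>j\<in>UNIV. kern i j v h) = u \<bullet> h)"

lemma G_inner_nth: "G v $ i \<bullet> h = (\<Sum>j\<in>UNIV. kern i j v h)"
proof -
 have L: "bounded_linear (\<lambda>h. \<Sum>j\<in>UNIV. kern i j v h)" by (intro bounded_linear_sum bounded_linear_kern)
 have "\<forall>h. (\<Sum>j\<in>UNIV. kern i j v h) = G v $ i \<bullet> h"
  unfolding G_def vec_lambda_beta by (rule someI_ex[OF Riesz_representation[OF L]])
 from this[THEN spec, of h] show ?thesis by (rule sym)
qed

lemma G_inner: "G v \<bullet> h = (\<Sum>i\<in>UNIV. \<Sum>j\<in>UNIV. kern i j v (h $ i))"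
 by (simp add: inner_vec_def G_inner_nth)

lemma norm_G_le:
 assumes "\<And>i j h. \<bar>kern i j v h - kern i j w h\<bar> \<le> B * norm h" "0 \<le> B"
 shows "norm (G v - G w) \<le> real CARD('l) * (real CARD('l) * B)"
proof -
 have "norm ((G v - G w) $ i) \<le> real CARD('l) * B" for i
 proof (rule norm_le_of_inner_bound)
  fix h
  have "(G v - G w) $ i \<bullet> h = (\<Sum>j\<in>UNIV. kern i j v h - kern i j w h)"
   by (simp add: inner_diff_left G_inner_nth sum_subtractf)
  also have "\<bar>\<dots>\<bar> \<le> (\<Sum>j\<in>(UNIV :: 'l set). B * norm h)"
   by (intro order_trans[OF sum_abs] sum_mono assms)
  finally show "\<bar>(G v - G w) $ i \<bullet> h\<bar> \<le> real CARD('l) * B * norm h" by simp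
 qed (use assms(2) in simp)
 then have "(\<Sum>i\<in>UNIV. norm ((G v - G w) $ i)) \<le> (\<Sum>i\<in>(UNIV :: 'l set). real CARD('l) * B)" by (intro sum_mono)
 moreover have "norm (G v - G w) \<le> (\<Sum>i\<in>UNIV. norm ((G v - G w) $ i))"
  unfolding norm_vec_def by (rule L2_set_le_sum) simp
 ultimately show ?thesis by simp
qed

lemma kern_0: "kern i j 0 h = 0"
proof -
 have "kern i j 0 h = (\<integral>x. 0 \<partial>(lborel :: 'a measure))"
  unfolding kern_def by (rule integral_cong_AE) (measurable, use h1_fun_0_AE[where 'a = 'a] in \<open>auto elim!: eventually_mono simp: odd_powr_def\<close>)
 then show ?thesis by simp
qed

lemma G_bounded: "\<exists>K. \<forall>v. norm v \<le> R \<longrightarrow> norm (G v) \<le> K"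
proof (intro exI allI impI)
 fix v :: "'a h1 ^ 'l" assume v: "norm v \<le> R"
 let ?B = "coef_bound * (8 * sob * R) powr (2 * p - 1) * (2 * sob)"
 have "kern i j 0 h = 0" for i j h by (rule kern_0)
 then have "G 0 $ i \<bullet> h = 0" for i h by (simp add: G_inner_nth)
 then have "G 0 $ i = 0" for i using inner_eq_zero_iff by blast
 then have "G 0 = 0" by (simp add: vec_eq_iff)
 then show "norm (G v) \<le> real CARD('l) * (real CARD('l) * ?B)"
  using norm_G_le[of v 0 ?B] kern_le[OF v] coef_bound_pos sob(1) by (simp add: kern_0)
qed

definition modulus :: "real \<Rightarrow> real \<Rightarrow> bool" where
 "modulus e C \<longleftrightarrow> 0 < e \<and> 0 \<le> C \<and> (\<forall>a b a' b'. \<bar>odd_powr p a' * \<bar>b'\<bar> powr p - odd_powr p a * \<bar>b\<bar> powr p\<bar> \<le>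
  e * (\<bar>a\<bar> + \<bar>b\<bar>) powr (2 * p - 1) + C * (\<bar>a' - a\<bar> + \<bar>b' - b\<bar>) powr (2 * p - 1))"

text \<open>The order of choices matters: \<open>e\<close> makes the first term at most s/2 for the
  given \<open>R\<close>, this fixes \<open>C\<close>, and then \<open>d\<close> makes the second
  term at most s/2.\<close>

lemma modulus_small:
 assumes s: "0 < s" and R: "0 \<le> R"
 shows "\<exists>d>0. \<exists>e C. modulus e C \<and>
  (\<forall>r. 0 \<le> r \<longrightarrow> r \<le> d \<longrightarrow> e * (8 * sob * R) powr (2 * p - 1) + C * (8 * sob * r) powr (2 * p - 1) \<le> s)"
proof -
 let ?r = "2 * p - 1"
 have r: "0 < ?r" using p by simp
 define X where "X = (8 * sob * R) powr ?r"
 define e where "e = s / (2 * (X + 1))"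
 have X: "0 \<le> X" by (simp add: X_def)
 then have e: "0 < e" using s by (simp add: e_def)
 obtain C where C: "0 \<le> C" "modulus e C" using kernel_modulus[OF p e] e by (auto simp: modulus_def)
 define Y where "Y = (s / (2 * (C + 1))) powr (1 / ?r)"
 have Y: "0 < Y" "Y powr ?r = s / (2 * (C + 1))" using s C(1) r by (auto simp: Y_def powr_powr)
 have "e * X + C * (8 * sob * t) powr ?r \<le> s" if t: "0 \<le> t" "t \<le> Y / (8 * sob)" for t
 proof -
  have "8 * sob * t \<le> Y" using t sob(1) by (simp add: field_simps)
  then have "(8 * sob * t) powr ?r \<le> s / (2 * (C + 1))" unfolding Y(2)[symmetric] using t sob(1) r by (intro powr_mono2) auto
  then have "C * (8 * sob * t) powr ?r \<le> (C + 1) * (s / (2 * (C + 1)))" using C(1) s by (intro mult_mono) auto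
  also have "\<dots> = s / 2" using C(1) by (simp add: field_simps)
  finally have 1: "C * (8 * sob * t) powr ?r \<le> s / 2" .
  have "e * X \<le> e * (X + 1)" using e by simp
  also have "\<dots> = s / 2" using X by (simp add: e_def field_simps)
  finally show ?thesis using 1 by linarith
 qed
 then show ?thesis using C(2) Y(1) sob(1) unfolding X_def by (intro exI[of _ "Y / (8 * sob)"]) auto
qed

lemma kern_diff_le:
 assumes eC: "modulus e C" and w: "norm w \<le> R" and vw: "norm (v - w) \<le> r"
 shows "\<bar>kern i j v h - kern i j w h\<bar> \<le>
  coef_bound * (e * (8 * sob * R) powr (2 * p - 1) + C * (8 * sob * r) powr (2 * p - 1)) * (2 * (sob * norm h))"
proof -
 let ?K = "\<lambda>v x. odd_powr p (h1_fun (v $ i) x) * \<bar>h1_fun (v $ j) x\<bar> powr p"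
 let ?F = "\<lambda>x. coef i j x * ?K v x * h1_fun h x - coef i j x * ?K w x * h1_fun h x"
 let ?r = "2 * p - 1"
 have eC': "0 < e" "0 \<le> C" using eC by (auto simp: modulus_def)
 have "AE x in lborel. \<bar>?F x\<bar> \<le> (coef_bound * e * \<bar>pair_sum i j w x\<bar> powr ?r + coef_bound * C * \<bar>pair_sum i j (v - w) x\<bar> powr ?r) * \<bar>h1_fun h x\<bar>"
  using h1_fun_arith_AE(2)[of "v $ i" "w $ i"] h1_fun_arith_AE(2)[of "v $ j" "w $ j"]
 proof eventually_elim
  case (elim x)
  have "\<bar>?F x\<bar> = \<bar>coef i j x\<bar> * \<bar>?K v x - ?K w x\<bar> * \<bar>h1_fun h x\<bar>"
   by (simp add: left_diff_distrib right_diff_distrib flip: abs_mult)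
  also have "\<dots> \<le> coef_bound * (e * pair_sum i j w x powr ?r + C * pair_sum i j (v - w) x powr ?r) * \<bar>h1_fun h x\<bar>"
  proof (intro mult_right_mono mult_mono coef_le)
   show "\<bar>?K v x - ?K w x\<bar> \<le> e * pair_sum i j w x powr ?r + C * pair_sum i j (v - w) x powr ?r"
    using eC elim by (simp add: modulus_def pair_sum_def)
  qed (use coef_bound_pos in auto)
  also have "\<dots> = (coef_bound * e * \<bar>pair_sum i j w x\<bar> powr ?r + coef_bound * C * \<bar>pair_sum i j (v - w) x\<bar> powr ?r) * \<bar>h1_fun h x\<bar>"
   unfolding abs_of_nonneg[OF pair_sum_nonneg] by (simp add: distrib_left distrib_right mult_ac)
  finally show ?case .
 qed
 note le = this
 have m: "?F \<in> borel_measurable borel" by measurable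
 have "\<bar>\<integral>x. ?F x \<partial>lborel\<bar> \<le> (coef_bound * e * (8 * sob * R) powr ?r + coef_bound * C * (8 * sob * r) powr ?r) * (2 * (sob * norm h))"
  by (rule integral_modulus_le(2)[OF power_bounded_pair_sum[OF w] power_bounded_pair_sum[OF vw] sob(2) _ m _ _ le])
   (use p coef_bound_pos eC' in auto)
 also have "(LBINT x. ?F x) = kern i j v h - kern i j w h"
  unfolding kern_def by (rule Bochner_Integration.integral_diff[OF kern_integrable kern_integrable])
 also have "(coef_bound * e * (8 * sob * R) powr ?r + coef_bound * C * (8 * sob * r) powr ?r) * (2 * (sob * norm h))
   = coef_bound * (e * (8 * sob * R) powr ?r + C * (8 * sob * r) powr ?r) * (2 * (sob * norm h))"
  by (simp add: distrib_left mult.assoc)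
 finally show ?thesis .
qed

lemma G_uniform:
 assumes e: "0 < e"
 shows "\<exists>d>0. \<forall>v w. norm v \<le> R \<longrightarrow> norm w \<le> R \<longrightarrow> norm (v - w) \<le> d \<longrightarrow> norm (G v - G w) \<le> e"
proof -
 let ?L = "real CARD('l)"
 have L: "0 < ?L" by simp
 define s where "s = e / (?L * (?L * (coef_bound * (2 * sob))))"
 have s: "0 < s" using e L coef_bound_pos sob(1) by (simp add: s_def)
 obtain d e' C where d: "0 < d" "modulus e' C"
  "\<And>r. 0 \<le> r \<Longrightarrow> r \<le> d \<Longrightarrow> e' * (8 * sob * \<bar>R\<bar>) powr (2 * p - 1) + C * (8 * sob * r) powr (2 * p - 1) \<le> s"
  using modulus_small[OF s, of "\<bar>R\<bar>"] by auto
 have "norm (G v - G w) \<le> e" if "norm w \<le> R" "norm (v - w) \<le> d" for v w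
 proof -
  have w: "norm w \<le> \<bar>R\<bar>" using that by linarith
  have "norm (G v - G w) \<le> ?L * (?L * (coef_bound * s * (2 * sob)))"
  proof (rule norm_G_le)
   fix i j and h :: "'a h1"
   have "coef_bound * (e' * (8 * sob * \<bar>R\<bar>) powr (2 * p - 1) + C * (8 * sob * norm (v - w)) powr (2 * p - 1)) * (2 * (sob * norm h))
     \<le> coef_bound * s * (2 * (sob * norm h))"
    using d(3)[of "norm (v - w)"] that(2) coef_bound_pos sob(1) by (intro mult_right_mono mult_left_mono) auto
   then show "\<bar>kern i j v h - kern i j w h\<bar> \<le> coef_bound * s * (2 * sob) * norm h"
    using kern_diff_le[OF d(2) w order_refl, where v = v and i = i and j = j and h = h] by (simp add: mult_ac)
  qed (use s coef_bound_pos sob(1) in simp)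
  also have "\<dots> = e" using L coef_bound_pos sob(1) by (simp add: s_def field_simps)
  finally show ?thesis .
 qed
 with d(1) show ?thesis by blast
qed

lemma \<beta>_integrable:
 "integrable lborel (\<lambda>x. coef i j x * \<bar>h1_fun (v $ i) x\<bar> powr p * \<bar>h1_fun (v $ j) x\<bar> powr p)"
 and kern_self: "kern i j v (v $ i) = \<beta> i j v"
proof -
 have eq: "coef i j x * (odd_powr p (h1_fun (v $ i) x) * \<bar>h1_fun (v $ j) x\<bar> powr p) * h1_fun (v $ i) x
  = coef i j x * \<bar>h1_fun (v $ i) x\<bar> powr p * \<bar>h1_fun (v $ j) x\<bar> powr p" for x
 proof -
  have "a * (s * c) * t = a * (s * t) * c" for a s c t :: real by simp
  then show ?thesis unfolding odd_powr_mult[symmetric] .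
 qed
 show "integrable lborel (\<lambda>x. coef i j x * \<bar>h1_fun (v $ i) x\<bar> powr p * \<bar>h1_fun (v $ j) x\<bar> powr p)"
  using kern_integrable[of i j v "v $ i"] unfolding eq .
 show "kern i j v (v $ i) = \<beta> i j v" unfolding kern_def \<beta>_def eq ..
qed

lemma G_euler: "G v $ i \<bullet> v $ i = (\<Sum>j\<in>UNIV. \<beta> i j v)"
 by (simp add: G_inner_nth kern_self)

lemma \<beta>_sym: "\<beta> i j v = \<beta> j i v"
 unfolding \<beta>_def by (subst coef_sym) (simp add: mult_ac)

lemma \<beta>_nonpos:
 assumes "i \<noteq> j"
 shows "\<beta> i j v \<le> 0"
proof -
 have "\<beta> i j v \<le> (\<integral>x. 0 \<partial>(lborel :: 'a measure))"
  unfolding \<beta>_def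
 proof (rule integral_mono[OF \<beta>_integrable])
  show "coef i j x * \<bar>h1_fun (v $ i) x\<bar> powr p * \<bar>h1_fun (v $ j) x\<bar> powr p \<le> 0" for x
   using lam_neg[OF assms] assms by (simp add: coef_def mult_nonpos_nonneg)
 qed simp
 then show ?thesis by simp
qed

lemma \<beta>_cong:
 assumes "\<And>i. AE x in lborel. \<bar>h1_fun (v $ i) x\<bar> = \<bar>h1_fun (w $ i) x\<bar>"
 shows "\<beta> i j v = \<beta> i j w"
 unfolding \<beta>_def
proof (rule integral_cong_AE)
 show "AE x in lborel. coef i j x * \<bar>h1_fun (v $ i) x\<bar> powr p * \<bar>h1_fun (v $ j) x\<bar> powr p =
   coef i j x * \<bar>h1_fun (w $ i) x\<bar> powr p * \<bar>h1_fun (w $ j) x\<bar> powr p"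
  using assms[of i] assms[of j] by eventually_elim simp
qed measurable

lemma \<beta>_even: "\<beta> i j (- v) = \<beta> i j v"
proof (rule \<beta>_cong)
 show "AE x in lborel. \<bar>h1_fun ((- v) $ i) x\<bar> = \<bar>h1_fun (v $ i) x\<bar>" for i
  using h1_fun_uminus_AE[of "v $ i"] by eventually_elim simp
qed

lemma \<beta>_rescale:
 assumes "\<And>i. 0 \<le> t $ i"
 shows "\<beta> i j (rescale t v) = (t $ i) powr p * (t $ j) powr p * \<beta> i j v"
proof -
 have "\<beta> i j (rescale t v) = (LBINT x. ((t $ i) powr p * (t $ j) powr p) * (coef i j x * \<bar>h1_fun (v $ i) x\<bar> powr p * \<bar>h1_fun (v $ j) x\<bar> powr p))"
  unfolding \<beta>_def
 proof (rule integral_cong_AE)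
  show "AE x in lborel. coef i j x * \<bar>h1_fun (rescale t v $ i) x\<bar> powr p * \<bar>h1_fun (rescale t v $ j) x\<bar> powr p =
    ((t $ i) powr p * (t $ j) powr p) * (coef i j x * \<bar>h1_fun (v $ i) x\<bar> powr p * \<bar>h1_fun (v $ j) x\<bar> powr p)"
   using h1_fun_arith_AE(3)[of "t $ i" "v $ i"] h1_fun_arith_AE(3)[of "t $ j" "v $ j"]
  proof eventually_elim
   case (elim x)
   then show ?case using assms by (simp add: abs_mult powr_mult)
  qed
 qed measurable
 then show ?thesis by (simp add: \<beta>_def)
qed

lemma kern_minus: "kern i j (- v) h = - kern i j v h"
proof -
 have "kern i j (- v) h = (LBINT x. - (coef i j x * (odd_powr p (h1_fun (v $ i) x) * \<bar>h1_fun (v $ j) x\<bar> powr p) * h1_fun h x))"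
  unfolding kern_def
 proof (rule integral_cong_AE)
  show "AE x in lborel. coef i j x * (odd_powr p (h1_fun ((- v) $ i) x) * \<bar>h1_fun ((- v) $ j) x\<bar> powr p) * h1_fun h x =
    - (coef i j x * (odd_powr p (h1_fun (v $ i) x) * \<bar>h1_fun (v $ j) x\<bar> powr p) * h1_fun h x)"
   using h1_fun_uminus_AE[of "v $ i"] h1_fun_uminus_AE[of "v $ j"] by eventually_elim simp
 qed measurable
 then show ?thesis by (simp add: kern_def)
qed

lemma G_odd: "G (- v) = - G v"
proof -
 have "(G (- v) $ i - (- G v) $ i) \<bullet> h = 0" for i h
  by (simp add: inner_add_left G_inner_nth kern_minus sum_negf)
 then have "G (- v) $ i - (- G v) $ i = 0" for i using inner_eq_zero_iff by blast
 then show ?thesis by (simp add: vec_eq_iff eq_neg_iff_add_eq_0)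
qed

text \<open>For i = j the two kernel terms are added to the factor 2p of a diagonal power, so one
  formula covers diagonal and coupling terms.\<close>

lemma \<beta>_expansion:
 assumes eC: "modulus e C" and v: "norm v \<le> R" and h: "norm h \<le> r"
 shows "\<bar>\<beta> i j (v + h) - \<beta> i j v - p * (kern i j v (h $ i) + kern j i v (h $ j))\<bar> \<le>
  coef_bound * p * (e * (8 * sob * R) powr (2 * p - 1) + C * (8 * sob * r) powr (2 * p - 1)) * (2 * (8 * sob * norm h))"
proof -
 let ?V = "\<lambda>i x. h1_fun (v $ i) x" and ?H = "\<lambda>i x. h1_fun (h $ i) x" and ?W = "\<lambda>i x. h1_fun ((v + h) $ i) x"
 let ?F = "\<lambda>x. coef i j x * \<bar>?W i x\<bar> powr p * \<bar>?W j x\<bar> powr p - coef i j x * \<bar>?V i x\<bar> powr p * \<bar>?V j x\<bar> powr p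
  - p * (coef i j x * (odd_powr p (?V i x) * \<bar>?V j x\<bar> powr p) * ?H i x + coef j i x * (odd_powr p (?V j x) * \<bar>?V i x\<bar> powr p) * ?H j x)"
 let ?r = "2 * p - 1"
 have eC': "0 < e" "0 \<le> C" using eC by (auto simp: modulus_def)
 have "AE x in lborel. \<bar>?F x\<bar> \<le> (coef_bound * p * e * \<bar>pair_sum i j v x\<bar> powr ?r + coef_bound * p * C * \<bar>pair_sum i j h x\<bar> powr ?r) * \<bar>pair_sum i j h x\<bar>"
  using h1_fun_arith_AE(1)[of "v $ i" "h $ i"] h1_fun_arith_AE(1)[of "v $ j" "h $ j"]
 proof eventually_elim
  case (elim x)
  let ?\<Delta> = "\<bar>?V i x + ?H i x\<bar> powr p * \<bar>?V j x + ?H j x\<bar> powr p - \<bar>?V i x\<bar> powr p * \<bar>?V j x\<bar> powr p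
   - p * (odd_powr p (?V i x) * \<bar>?V j x\<bar> powr p * ?H i x + odd_powr p (?V j x) * \<bar>?V i x\<bar> powr p * ?H j x)"
  let ?B = "p * (e * pair_sum i j v x powr ?r + C * pair_sum i j h x powr ?r) * pair_sum i j h x"
  have "?F x = coef i j x * ?\<Delta>"
   unfolding coef_sym[of j i] using elim by (simp add: algebra_simps)
  then have "\<bar>?F x\<bar> = \<bar>coef i j x\<bar> * \<bar>?\<Delta>\<bar>" by (simp add: abs_mult)
  also have "\<dots> \<le> coef_bound * ?B"
  proof (intro mult_mono coef_le)
   show "\<bar>?\<Delta>\<bar> \<le> ?B"
    unfolding pair_sum_def by (rule product_expansion[OF p]) (use eC in \<open>auto simp: modulus_def\<close>)
  qed (use coef_bound_pos in auto)
  also have "\<dots> = (coef_bound * p * e * \<bar>pair_sum i j v x\<bar> powr ?r + coef_bound * p * C * \<bar>pair_sum i j h x\<bar> powr ?r) * \<bar>pair_sum i j h x\<bar>"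
   unfolding abs_of_nonneg[OF pair_sum_nonneg] by (simp add: distrib_left distrib_right mult_ac)
  finally show ?case .
 qed
 note le = this
 have m: "?F \<in> borel_measurable borel" by measurable
 have "\<bar>\<integral>x. ?F x \<partial>lborel\<bar> \<le> (coef_bound * p * e * (8 * sob * R) powr ?r + coef_bound * p * C * (8 * sob * r) powr ?r) * (2 * (8 * sob * norm h))"
  by (rule integral_modulus_le(2)[OF power_bounded_pair_sum[OF v] power_bounded_pair_sum[OF h]
   power_bounded_pair_sum[OF order_refl] _ m _ _ le]) (use p coef_bound_pos eC' in auto)
 also have "(LBINT x. ?F x) = \<beta> i j (v + h) - \<beta> i j v - p * (kern i j v (h $ i) + kern j i v (h $ j))"
 proof -
  have "(LBINT x. f1 x - f2 x - p * (f3 x + f4 x)) =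
    (LBINT x. f1 x) - (LBINT x. f2 x) - p * ((LBINT x. f3 x) + (LBINT x. f4 x))"
   if "integrable lborel f1" "integrable lborel f2" "integrable lborel f3" "integrable lborel f4"
   for f1 f2 f3 f4 :: "'a \<Rightarrow> real" using that by simp
  from this[OF \<beta>_integrable \<beta>_integrable kern_integrable kern_integrable]
  show ?thesis unfolding kern_def \<beta>_def .
 qed
 also have "(coef_bound * p * e * (8 * sob * R) powr ?r + coef_bound * p * C * (8 * sob * r) powr ?r) * (2 * (8 * sob * norm h))
   = coef_bound * p * (e * (8 * sob * R) powr ?r + C * (8 * sob * r) powr ?r) * (2 * (8 * sob * norm h))"
  by (simp add: distrib_left mult.assoc)
 finally show ?thesis .
qed

lemma G_deriv:
 assumes e: "0 < e"
 shows "\<exists>d>0. \<forall>v h. norm v \<le> R \<longrightarrow> norm h \<le> d \<longrightarrow>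
    \<bar>total \<beta> (v + h) / (2 * p) - total \<beta> v / (2 * p) - G v \<bullet> h\<bar>
     \<le> e * norm h"
proof -
 let ?L = "real CARD('l)"
 have L: "0 < ?L" by simp
 \<comment> \<open>\<open>k\<close> collects the number of pairs and the constants of
   \<open>\<beta>_expansion\<close>, so that the sum of all errors, divided by 2p, is at most e
   times the norm of \<open>h\<close>.\<close>
 define k where "k = ?L * (?L * (coef_bound * (8 * sob)))"
 have k: "0 < k" using L coef_bound_pos sob(1) by (simp add: k_def)
 then have s: "0 < e / k" using e by simp
 obtain d e' C where d: "0 < d" "modulus e' C"
  "\<And>r. 0 \<le> r \<Longrightarrow> r \<le> d \<Longrightarrow> e' * (8 * sob * \<bar>R\<bar>) powr (2 * p - 1) + C * (8 * sob * r) powr (2 * p - 1) \<le> e / k"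
  using modulus_small[OF s, of "\<bar>R\<bar>"] by auto
 have "\<bar>total \<beta> (v + h) / (2 * p) - total \<beta> v / (2 * p) - G v \<bullet> h\<bar> \<le> e * norm h"
  if v: "norm v \<le> R" and h: "norm h \<le> d" for v h
 proof -
  have vR: "norm v \<le> \<bar>R\<bar>" using v by linarith
  let ?\<Delta> = "\<lambda>i j. \<beta> i j (v + h) - \<beta> i j v - p * (kern i j v (h $ i) + kern j i v (h $ j))"
  have sw: "(\<Sum>i\<in>UNIV. \<Sum>j\<in>UNIV. kern j i v (h $ j)) = G v \<bullet> h"
   unfolding G_inner by (rule sum.swap)
  have "(\<Sum>i\<in>UNIV. \<Sum>j\<in>UNIV. ?\<Delta> i j) = total \<beta> (v + h) - total \<beta> v
    - p * ((\<Sum>i\<in>UNIV. \<Sum>j\<in>UNIV. kern i j v (h $ i)) + (\<Sum>i\<in>UNIV. \<Sum>j\<in>UNIV. kern j i v (h $ j)))"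
   by (simp add: sum_subtractf sum_distrib_left sum.distrib distrib_left)
  also have "\<dots> = (2 * p) * (total \<beta> (v + h) / (2 * p) - total \<beta> v / (2 * p) - G v \<bullet> h)"
   unfolding sw G_inner[symmetric] using p by (simp add: right_diff_distrib)
  finally have eq: "(2 * p) * \<bar>total \<beta> (v + h) / (2 * p) - total \<beta> v / (2 * p) - G v \<bullet> h\<bar>
    = \<bar>\<Sum>i\<in>UNIV. \<Sum>j\<in>UNIV. ?\<Delta> i j\<bar>" using p by (simp add: abs_mult)
  have \<Delta>: "\<bar>?\<Delta> i j\<bar> \<le> coef_bound * p * (e / k) * (2 * (8 * sob * norm h))" for i j
  proof -
   have "coef_bound * p * (e' * (8 * sob * \<bar>R\<bar>) powr (2 * p - 1) + C * (8 * sob * norm h) powr (2 * p - 1)) * (2 * (8 * sob * norm h))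
    \<le> coef_bound * p * (e / k) * (2 * (8 * sob * norm h))"
    using d(3)[of "norm h"] h coef_bound_pos sob(1) p by (intro mult_right_mono mult_left_mono) auto
   then show ?thesis using \<beta>_expansion[OF d(2) vR order_refl, where i = i and j = j and h = h] by linarith
  qed
  have "\<bar>\<Sum>i\<in>UNIV. \<Sum>j\<in>UNIV. ?\<Delta> i j\<bar> \<le> (\<Sum>i\<in>(UNIV::'l set). \<Sum>j\<in>(UNIV::'l set). coef_bound * p * (e / k) * (2 * (8 * sob * norm h)))"
   by (intro order_trans[OF sum_abs] sum_mono \<Delta>)
  also have "\<dots> = (2 * p) * ((e / k) * k * norm h)" by (simp add: k_def)
  also have "\<dots> = (2 * p) * (e * norm h)" using k by simp
  finally show ?thesis unfolding eq[symmetric] using p by simp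
 qed
 with d(1) show ?thesis by blast
qed

lemma \<beta>_diag_le: "\<beta> i i v \<le> coef_bound * (sob * norm (v $ i)) powr (2 * p)"
proof -
 note s = sob(2)[of "v $ i", unfolded power_bounded_def]
 have "\<beta> i i v \<le> (LBINT x. coef_bound * \<bar>h1_fun (v $ i) x\<bar> powr (2 * p))"
  unfolding \<beta>_def
 proof (rule integral_mono[OF \<beta>_integrable])
  fix x
  have "coef i i x * \<bar>h1_fun (v $ i) x\<bar> powr p * \<bar>h1_fun (v $ i) x\<bar> powr p = coef i i x * \<bar>h1_fun (v $ i) x\<bar> powr (2 * p)"
   by (simp add: mult.assoc flip: powr_add)
  also have "\<dots> \<le> coef_bound * \<bar>h1_fun (v $ i) x\<bar> powr (2 * p)"
   using coef_le[of i i x] by (intro mult_right_mono) auto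
  finally show "coef i i x * \<bar>h1_fun (v $ i) x\<bar> powr p * \<bar>h1_fun (v $ i) x\<bar> powr p \<le> coef_bound * \<bar>h1_fun (v $ i) x\<bar> powr (2 * p)" .
 qed (use s in auto)
 also have "\<dots> \<le> coef_bound * (sob * norm (v $ i)) powr (2 * p)" using s coef_bound_pos by simp
 finally show ?thesis .
qed

lemma \<beta>_bound: "\<exists>K>0. \<forall>i v. \<beta> i i v \<le> K * norm (v $ i) powr (2 * p)"
proof (intro exI conjI allI)
 show "0 < coef_bound * sob powr (2 * p)" using coef_bound_pos sob(1) by simp
 show "\<beta> i i v \<le> coef_bound * sob powr (2 * p) * norm (v $ i) powr (2 * p)" for i v
  using \<beta>_diag_le[of i v] sob(1) by (simp add: powr_mult mult.assoc)
qed

section \<open>Consequences of the sign of the coefficients\<close>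

definition core :: real where
 "core = (\<Sum>i\<in>UNIV. norm (y i)) + \<epsilon>"

text \<open>The ball of radius \<open>core\<close> contains every ball of radius \<epsilon> around a
  centre \<open>y i\<close>, so outside it each shifted \<open>Q\<close> equals -1.\<close>

lemma coef_nonpos_outside: "x \<notin> cball 0 core \<Longrightarrow> coef i j x \<le> 0"
proof (cases "i = j")
 case True
 assume x: "x \<notin> cball 0 core"
 have "norm (y i) \<le> (\<Sum>i\<in>UNIV. norm (y i))" by (rule member_le_sum) auto
 moreover have "norm x \<le> norm (x - y i) + norm (y i)" using norm_triangle_ineq[of "x - y i" "y i"] by simp
 ultimately have "\<epsilon> \<le> norm (x - y i)" using x by (simp add: core_def)
 then show ?thesis using True \<mu>[of i] by (simp add: coef_def Q_def)
qed (use lam_neg[of i j] in \<open>simp add: coef_def\<close>)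

text \<open>Outside the ball the integrand is nonpositive and is dropped, so that the local
  estimates apply to what remains.\<close>

lemma \<beta>_diag_le_core: "\<beta> i i v \<le> coef_bound * (LBINT x. indicator (cball 0 core) x * \<bar>h1_fun (v $ i) x\<bar> powr (2 * p))"
proof -
 note s = sob(2)[of "v $ i", unfolded power_bounded_def]
 have i: "integrable lborel (\<lambda>x. indicator (cball 0 core) x * \<bar>h1_fun (v $ i) x\<bar> powr (2 * p))"
  using s integrable_mult_indicator[of "cball 0 core" lborel "\<lambda>x. \<bar>h1_fun (v $ i) x\<bar> powr (2 * p)"] by simp
 have "\<beta> i i v \<le> (LBINT x. coef_bound * (indicator (cball 0 core) x * \<bar>h1_fun (v $ i) x\<bar> powr (2 * p)))"
  unfolding \<beta>_def
 proof (rule integral_mono[OF \<beta>_integrable])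
  fix x
  have "coef i i x * \<bar>h1_fun (v $ i) x\<bar> powr p * \<bar>h1_fun (v $ i) x\<bar> powr p = coef i i x * \<bar>h1_fun (v $ i) x\<bar> powr (2 * p)"
   by (simp add: mult.assoc flip: powr_add)
  also have "\<dots> \<le> (coef_bound * indicator (cball 0 core) x) * \<bar>h1_fun (v $ i) x\<bar> powr (2 * p)"
   using coef_le[of i i x] coef_nonpos_outside[of x i i] by (intro mult_right_mono) (auto simp: indicator_def)
  finally show "coef i i x * \<bar>h1_fun (v $ i) x\<bar> powr p * \<bar>h1_fun (v $ i) x\<bar> powr p
   \<le> coef_bound * (indicator (cball 0 core) x * \<bar>h1_fun (v $ i) x\<bar> powr (2 * p))" by (simp add: mult.assoc)
 qed (use i in auto)
 then show ?thesis by simp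
qed

lemma \<beta>_detect:
 assumes c: "0 < c"
 shows "\<exists>m (\<Lambda> :: nat \<Rightarrow> 'a h1 ^ 'l \<Rightarrow> real). (\<forall>j. bounded_linear (\<Lambda> j)) \<and>
    (\<forall>v. norm v \<le> R \<longrightarrow> (\<forall>j<m. \<Lambda> j v = 0) \<longrightarrow> \<beta> i i v < c)"
proof -
 have q: "2 < 2 * p" using p by simp
 have cc: "0 < c / coef_bound" using c coef_bound_pos by simp
 obtain m and \<Lambda> :: "nat \<Rightarrow> 'a h1 \<Rightarrow> real" where \<Lambda>: "\<And>j. bounded_linear (\<Lambda> j)"
  "\<And>h. norm h \<le> R \<Longrightarrow> (\<And>j. j < m \<Longrightarrow> \<Lambda> j h = 0) \<Longrightarrow>
   (LBINT x. indicator (cball 0 core) x * \<bar>h1_fun h x\<bar> powr (2 * p)) < c / coef_bound"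
  by (rule finitely_many_functionals_detect[OF q gap cc, of R core]) blast
 have "bounded_linear (\<lambda>v. \<Lambda> j (v $ i))" for j
  by (rule bounded_linear_compose[OF \<Lambda>(1) bounded_linear_vec_nth])
 moreover have "\<beta> i i v < c" if v: "norm v \<le> R" "\<forall>j<m. \<Lambda> j (v $ i) = 0" for v
 proof -
  have "norm (v $ i) \<le> R" using Finite_Cartesian_Product.norm_nth_le[of v i] v(1) by linarith
  then have "(LBINT x. indicator (cball 0 core) x * \<bar>h1_fun (v $ i) x\<bar> powr (2 * p)) < c / coef_bound"
   using v(2) by (intro \<Lambda>(2)) auto
  then have "coef_bound * (LBINT x. indicator (cball 0 core) x * \<bar>h1_fun (v $ i) x\<bar> powr (2 * p)) < c"
   using coef_bound_pos by (simp add: pos_less_divide_eq mult.commute)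
  then show ?thesis using \<beta>_diag_le_core[of i v] by linarith
 qed
 ultimately show ?thesis by (intro exI[of _ m] exI[of _ "\<lambda>j v. \<Lambda> j (v $ i)"]) auto
qed

lemma indicator_power:
 "\<bar>indicator A x * u\<bar> powr q = indicator A x * \<bar>u\<bar> powr q" for u :: real
 by (simp add: indicator_def)

lemma power_bounded_indicator:
 assumes f: "power_bounded q f B" and A [measurable]: "A \<in> sets borel" and \<tau>: "0 \<le> \<tau>"
  and le: "(LBINT x. indicator A x * \<bar>f x\<bar> powr q) \<le> \<tau> powr q"
 shows "power_bounded q (\<lambda>x. indicator A x * f x) \<tau>"
proof -
 have [measurable]: "f \<in> borel_measurable borel" and i: "integrable lborel (\<lambda>x. \<bar>f x\<bar> powr q)"
  using f by (auto simp: power_bounded_def)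
 have "integrable lborel (\<lambda>x. indicator A x * \<bar>f x\<bar> powr q)"
  using integrable_mult_indicator[OF _ i, of A] by simp
 then show ?thesis using \<tau> le by (simp add: power_bounded_def indicator_power)
qed

lemma small_tail:
 fixes h :: "'a h1"
 assumes c: "0 < c"
 shows "eventually (\<lambda>n. (LBINT x. indicator (- cball 0 (real n)) x * \<bar>h1_fun h x\<bar> powr (2 * p)) \<le> c) sequentially"
proof -
 have i: "integrable lborel (\<lambda>x. \<bar>h1_fun h x\<bar> powr (2 * p))" using sob(2)[of h] by (simp add: power_bounded_def)
 have "(\<lambda>n. \<integral>x. indicator (- cball 0 (real n)) x * \<bar>h1_fun h x\<bar> powr (2 * p) \<partial>lborel) \<longlonglongrightarrow> (\<integral>x. 0 \<partial>(lborel :: 'a measure))"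
 proof (rule integral_dominated_convergence[where w = "\<lambda>x. \<bar>h1_fun h x\<bar> powr (2 * p)"])
  have "(\<lambda>n. indicator (- cball 0 (real n)) x * \<bar>h1_fun h x\<bar> powr (2 * p)) \<longlonglongrightarrow> 0" for x
  proof (rule tendsto_eventually)
   obtain n0 where "norm x \<le> real n0" using real_arch_simple by blast
   then have "indicator (- cball 0 (real n)) x * \<bar>h1_fun h x\<bar> powr (2 * p) = 0" if "n0 \<le> n" for n
    using that by (auto simp: indicator_def)
   then show "eventually (\<lambda>n. indicator (- cball 0 (real n)) x * \<bar>h1_fun h x\<bar> powr (2 * p) = 0) sequentially"
    by (rule eventually_sequentiallyI)
  qed
  then show "AE x in lborel. (\<lambda>n. indicator (- cball 0 (real n)) x * \<bar>h1_fun h x\<bar> powr (2 * p)) \<longlonglongrightarrow> 0" by simp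
 qed (use i in \<open>auto simp: indicator_def\<close>)
 then show ?thesis using c by (intro eventually_mono[OF order_tendstoD(2)[of _ 0]]) auto
qed

text \<open>Outside the ball all coefficients are nonpositive, so that the term with \<open>x $ i\<close> can be dropped
 there and only the tail of the fixed \<open>v $ i\<close> remains.\<close>

lemma kern_weak_le:
 assumes x: "norm x \<le> C" and R: "core \<le> R" and \<tau>: "0 \<le> \<tau>"
  and inside: "(LBINT z. indicator (cball 0 R) z * \<bar>h1_fun ((x - v) $ i) z\<bar> powr (2 * p)) \<le> \<tau> powr (2 * p)"
  and outside: "(LBINT z. indicator (- cball 0 R) z * \<bar>h1_fun (v $ i) z\<bar> powr (2 * p)) \<le> \<tau> powr (2 * p)"
 shows "kern i j x ((x - v) $ i) \<le> coef_bound * (4 * (8 * sob * C) powr (2 * p - 1) * \<tau>)"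
proof -
 let ?r = "2 * p - 1"
 let ?g = "\<lambda>z. indicator (cball 0 R) z * h1_fun ((x - v) $ i) z"
 let ?g' = "\<lambda>z. indicator (- cball 0 R) z * h1_fun (v $ i) z"
 let ?m = "pair_sum i j x"
 have p1: "1 < 2 * p" using p by simp
 note m = power_bounded_pair_sum[OF x, of i j]
 have g: "power_bounded (2 * p) ?g \<tau>" by (rule power_bounded_indicator[OF sob(2) _ \<tau> inside]) simp
 have g': "power_bounded (2 * p) ?g' \<tau>" by (rule power_bounded_indicator[OF sob(2) _ \<tau> outside]) simp
 note H = power_bounded_Hoelder[OF m g p1] and H' = power_bounded_Hoelder[OF m g' p1]
 have "kern i j x ((x - v) $ i) \<le> (LBINT z. coef_bound * (\<bar>?m z\<bar> powr ?r * \<bar>?g z\<bar> + \<bar>?m z\<bar> powr ?r * \<bar>?g' z\<bar>))"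
  unfolding kern_def
 proof (rule integral_mono_AE[OF kern_integrable])
  show "AE z in lborel. coef i j z * (odd_powr p (h1_fun (x $ i) z) * \<bar>h1_fun (x $ j) z\<bar> powr p) * h1_fun ((x - v) $ i) z
    \<le> coef_bound * (\<bar>?m z\<bar> powr ?r * \<bar>?g z\<bar> + \<bar>?m z\<bar> powr ?r * \<bar>?g' z\<bar>)"
   using h1_fun_arith_AE(2)[of "x $ i" "v $ i"]
  proof eventually_elim
   case (elim z)
   let ?K = "odd_powr p (h1_fun (x $ i) z) * \<bar>h1_fun (x $ j) z\<bar> powr p"
   have K: "\<bar>?K\<bar> \<le> \<bar>?m z\<bar> powr ?r"
    using kernel_le[OF p, of "h1_fun (x $ i) z" "h1_fun (x $ j) z"] by (simp add: pair_sum_def)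
   have le: "coef i j z * ?K * w \<le> coef_bound * (\<bar>?m z\<bar> powr ?r * \<bar>w\<bar>)" for w
   proof -
    have "coef i j z * ?K * w \<le> \<bar>coef i j z\<bar> * (\<bar>?K\<bar> * \<bar>w\<bar>)"
     using abs_ge_self[of "coef i j z * ?K * w"] by (simp add: abs_mult mult.assoc)
    also have "\<dots> \<le> coef_bound * (\<bar>?m z\<bar> powr ?r * \<bar>w\<bar>)"
     using coef_bound_pos by (intro mult_mono coef_le K) auto
    finally show ?thesis .
   qed
   show ?case
   proof (cases "z \<in> cball 0 R")
    case True
    then show ?thesis using le[of "h1_fun ((x - v) $ i) z"] by simp
   next
    case False
    then have "z \<notin> cball 0 core" using R by auto
    then have c: "coef i j z \<le> 0" by (rule coef_nonpos_outside)
    have "?K * h1_fun (x $ i) z = (odd_powr p (h1_fun (x $ i) z) * h1_fun (x $ i) z) * \<bar>h1_fun (x $ j) z\<bar> powr p"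
     by (simp add: mult_ac)
    then have "0 \<le> ?K * h1_fun (x $ i) z" by (simp only: odd_powr_mult) simp
    then have "coef i j z * (?K * h1_fun (x $ i) z) \<le> 0" using c by (rule mult_nonpos_nonneg[rotated])
    moreover have "h1_fun ((x - v) $ i) z = h1_fun (x $ i) z - h1_fun (v $ i) z" using elim by simp
    then have "coef i j z * ?K * h1_fun ((x - v) $ i) z = coef i j z * (?K * h1_fun (x $ i) z) + coef i j z * ?K * (- h1_fun (v $ i) z)"
     by (simp add: right_diff_distrib mult.assoc)
    ultimately have "coef i j z * ?K * h1_fun ((x - v) $ i) z \<le> coef_bound * (\<bar>?m z\<bar> powr ?r * \<bar>- h1_fun (v $ i) z\<bar>)"
     using le[of "- h1_fun (v $ i) z"] by linarith
    then show ?thesis using False by simp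
   qed
  qed
 qed (use H(1) H'(1) in auto)
 also have "\<dots> = coef_bound * ((LBINT z. \<bar>?m z\<bar> powr ?r * \<bar>?g z\<bar>) + (LBINT z. \<bar>?m z\<bar> powr ?r * \<bar>?g' z\<bar>))"
  using H(1) H'(1) by (simp del: integral_mult_right_zero add: integral_mult_right)
 also have "\<dots> \<le> coef_bound * (2 * (8 * sob * C) powr ?r * \<tau> + 2 * (8 * sob * C) powr ?r * \<tau>)"
  using H(2) H'(2) coef_bound_pos by (intro mult_left_mono add_mono) auto
 finally show ?thesis by (simp add: mult_ac)
qed

text \<open>The radius \<open>N\<close> is fixed first, large enough for the tails of the single
  limit \<open>v\<close>. Local convergence on this ball then takes care of all large
  \<open>n\<close>, and \<open>kern_weak_le\<close> combines both.\<close>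

lemma G_weak:
 fixes x :: "nat \<Rightarrow> 'a h1 ^ 'l"
 assumes C: "\<And>n. norm (x n) \<le> C" and w: "\<And>w. (\<lambda>n. x n \<bullet> w) \<longlonglongrightarrow> v \<bullet> w" and e: "0 < e"
 shows "eventually (\<lambda>n. G (x n) \<bullet> (x n - v) \<le> e) sequentially"
proof -
 let ?L = "real CARD('l)" and ?A = "(8 * sob * C) powr (2 * p - 1)"
 have L: "0 < ?L" by simp
 \<comment> \<open>The denominator is the number of pairs times the constant of
   \<open>kern_weak_le\<close>, with \<open>?A + 1\<close> in place of \<open>?A\<close> so that it
   cannot be 0.\<close>
 define \<tau> where "\<tau> = e / (?L * (?L * (coef_bound * (4 * (?A + 1)))))"
 have A: "0 \<le> ?A" by simp
 have \<tau>: "0 < \<tau>" using e L coef_bound_pos by (simp add: \<tau>_def add_nonneg_pos)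
 then have \<tau>q: "0 < \<tau> powr (2 * p)" by simp
 have "eventually (\<lambda>n. \<forall>i. (LBINT z. indicator (- cball 0 (real n)) z * \<bar>h1_fun (v $ i) z\<bar> powr (2 * p)) \<le> \<tau> powr (2 * p)) sequentially"
  by (intro eventually_all_finite small_tail \<tau>q)
 moreover have "eventually (\<lambda>n. core \<le> real n) sequentially"
  using real_arch_simple[of core] by (meson eventually_sequentiallyI of_nat_le_iff order_trans)
 ultimately have "eventually (\<lambda>n. (\<forall>i. (LBINT z. indicator (- cball 0 (real n)) z * \<bar>h1_fun (v $ i) z\<bar> powr (2 * p)) \<le> \<tau> powr (2 * p)) \<and> core \<le> real n) sequentially"
  by (rule eventually_conj)
 then obtain N where N: "\<And>i. (LBINT z. indicator (- cball 0 (real N)) z * \<bar>h1_fun (v $ i) z\<bar> powr (2 * p)) \<le> \<tau> powr (2 * p)"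
  "core \<le> real N" by (auto simp: eventually_sequentially)
 have "eventually (\<lambda>n. (LBINT z. indicator (cball 0 (real N)) z * \<bar>h1_fun ((x n - v) $ i) z\<bar> powr (2 * p)) \<le> \<tau> powr (2 * p)) sequentially" for i
 proof -
  have q: "2 < 2 * p" using p by simp
  have "norm ((x n - v) $ i) \<le> C + norm v" for n
   using Finite_Cartesian_Product.norm_nth_le[of "x n - v" i] norm_triangle_ineq4[of "x n" v] C[of n] by linarith
  moreover have "(\<lambda>n. (x n - v) $ i \<bullet> z) \<longlonglongrightarrow> 0" for z
  proof -
   have "(\<lambda>n. x n \<bullet> axis i z - v \<bullet> axis i z) \<longlonglongrightarrow> v \<bullet> axis i z - v \<bullet> axis i z"
    by (intro tendsto_diff w tendsto_const)
   then show ?thesis by (simp add: inner_axis_vec inner_diff_left)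
  qed
  ultimately have "(\<lambda>n. \<integral>z. indicator (cball 0 (real N)) z * \<bar>h1_fun ((x n - v) $ i) z\<bar> powr (2 * p) \<partial>lborel) \<longlonglongrightarrow> 0"
   by (rule weak_null_local_convergence[OF q gap])
  from order_tendstoD(2)[OF this \<tau>q] show ?thesis by (rule eventually_mono) simp
 qed
 then have "eventually (\<lambda>n. \<forall>i. (LBINT z. indicator (cball 0 (real N)) z * \<bar>h1_fun ((x n - v) $ i) z\<bar> powr (2 * p)) \<le> \<tau> powr (2 * p)) sequentially"
  by (rule eventually_all_finite)
 then show ?thesis
 proof eventually_elim
  case (elim n)
  have "G (x n) \<bullet> (x n - v) = (\<Sum>i\<in>UNIV. \<Sum>j\<in>UNIV. kern i j (x n) ((x n - v) $ i))" by (rule G_inner)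
  also have "\<dots> \<le> (\<Sum>i\<in>(UNIV :: 'l set). \<Sum>j\<in>(UNIV :: 'l set). coef_bound * (4 * ?A * \<tau>))"
   using elim \<tau> by (intro sum_mono kern_weak_le[OF C N(2) _ _ N(1)]) auto
  also have "\<dots> = ?L * (?L * (coef_bound * (4 * ?A))) * \<tau>" by simp
  also have "\<dots> \<le> ?L * (?L * (coef_bound * (4 * (?A + 1)))) * \<tau>"
   using \<tau> coef_bound_pos by (intro mult_right_mono mult_left_mono) auto
  also have "\<dots> = e" using L coef_bound_pos A by (simp add: \<tau>_def add_nonneg_eq_0_iff)
  finally show ?case .
 qed
qed

end

lemma h1_fun_sum_AE:
 fixes \<phi> :: "'k \<Rightarrow> 'a::euclidean_space h1"
 shows "finite K \<Longrightarrow> AE x in lborel. h1_fun (\<Sum>k\<in>K. c k *\<^sub>R \<phi> k) x = (\<Sum>k\<in>K. c k * h1_fun (\<phi> k) x)"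
proof (induction K rule: finite_induct)
 case empty
 then show ?case using h1_fun_0_AE[where 'a = 'a] by simp
next
 case (insert k K)
 from insert(3) h1_fun_arith_AE(1)[of "c k *\<^sub>R \<phi> k" "\<Sum>k\<in>K. c k *\<^sub>R \<phi> k"] h1_fun_arith_AE(3)[of "c k" "\<phi> k"]
 show ?case by eventually_elim (use insert(1,2) in simp)
qed

context schroedinger_system
begin

lemma \<beta>_diag_pos:
 assumes nz: "v $ i \<noteq> 0" and supp: "AE x in lborel. x \<notin> ball (y i) \<epsilon> \<longrightarrow> h1_fun (v $ i) x = 0"
 shows "0 < \<beta> i i v"
proof -
 have int: "integrable lborel (\<lambda>x. \<bar>h1_fun (v $ i) x\<bar> powr (2 * p))"
  using sob(2)[of "v $ i"] by (simp add: power_bounded_def)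
 have "\<beta> i i v = (LBINT x. \<mu> i * \<bar>h1_fun (v $ i) x\<bar> powr (2 * p))"
  unfolding \<beta>_def
 proof (rule integral_cong_AE)
  show "AE x in lborel. coef i i x * \<bar>h1_fun (v $ i) x\<bar> powr p * \<bar>h1_fun (v $ i) x\<bar> powr p = \<mu> i * \<bar>h1_fun (v $ i) x\<bar> powr (2 * p)"
   using supp by eventually_elim (auto simp: coef_def Q_def dist_norm norm_minus_commute mult.assoc simp flip: powr_add)
 qed measurable
 moreover have "0 \<le> (LBINT x. \<bar>h1_fun (v $ i) x\<bar> powr (2 * p))" by (rule integral_nonneg_AE) simp
 moreover have "(LBINT x. \<bar>h1_fun (v $ i) x\<bar> powr (2 * p)) \<noteq> 0"
  using nz integral_nonneg_eq_0_iff_AE[OF int] by (simp add: h1_eq_0_iff)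
 ultimately show ?thesis using \<mu>[of i] by (simp add: less_le)
qed

text \<open>Every component uses the same coordinates \<open>s k\<close> as coefficients of its own
  bumps. Disjointness makes all couplings vanish, and it also shows that a zero component would
  force every coordinate to be 0, which is impossible on the sphere.\<close>

lemma decoupled_spheres:
 "\<exists>f. continuous_on (topspace (nsphere n)) f \<and> (\<forall>x\<in>topspace (nsphere n). f (\<lambda>i. - x i) = - f x \<and>
  (\<forall>i. f x $ i \<noteq> 0 \<and> 0 < \<beta> i i (f x) \<and> (\<forall>j. j \<noteq> i \<longrightarrow> \<beta> i j (f x) = 0)))"
proof -
 have q: "0 < 2 * p" using p by simp
 obtain \<phi> :: "'l \<Rightarrow> nat \<Rightarrow> 'a h1" where
  supp: "\<And>i k. k \<le> n \<Longrightarrow> AE x in lborel. x \<notin> ball (y i) \<epsilon> \<longrightarrow> h1_fun (\<phi> i k) x = 0"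
  and disj: "\<And>i k i' k'. k \<le> n \<Longrightarrow> k' \<le> n \<Longrightarrow> (i, k) \<noteq> (i', k') \<Longrightarrow>
    AE x in lborel. h1_fun (\<phi> i k) x = 0 \<or> h1_fun (\<phi> i' k') x = 0"
  and nz: "\<And>i k. k \<le> n \<Longrightarrow> \<not> (AE x in lborel. h1_fun (\<phi> i k) x = 0)"
  by (rule disjoint_bumps[OF \<epsilon> q, of n y]) blast
 define f where "f s = (\<chi> i. \<Sum>k\<le>n. s k *\<^sub>R \<phi> i k)" for s :: "nat \<Rightarrow> real"
 have ffun: "AE x in lborel. h1_fun (f s $ i) x = (\<Sum>k\<le>n. s k * h1_fun (\<phi> i k) x)" for i s
  unfolding f_def vec_lambda_beta by (rule h1_fun_sum_AE) simp
 have main: "f s $ i \<noteq> 0 \<and> 0 < \<beta> i i (f s) \<and> (\<forall>j. j \<noteq> i \<longrightarrow> \<beta> i j (f s) = 0)"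
  if s: "s \<in> topspace (nsphere n)" for s i
 proof (intro conjI allI impI)
  show f0: "f s $ i \<noteq> 0"
  proof
   assume "f s $ i = 0"
   then have "AE x in lborel. h1_fun (f s $ i) x = 0" by (simp add: h1_eq_0_iff)
   moreover have "AE x in lborel. \<forall>k\<in>{..n}. \<forall>k'\<in>{..n}. k \<noteq> k' \<longrightarrow> h1_fun (\<phi> i k) x = 0 \<or> h1_fun (\<phi> i k') x = 0"
   proof (intro eventually_ball_finite ballI)
    show "AE x in lborel. k \<noteq> k' \<longrightarrow> h1_fun (\<phi> i k) x = 0 \<or> h1_fun (\<phi> i k') x = 0"
     if "k \<in> {..n}" "k' \<in> {..n}" for k k'
     using disj[of k k' i i] that by (cases "k = k'") auto
   qed auto
   ultimately have ae: "AE x in lborel. \<forall>k\<in>{..n}. s k * h1_fun (\<phi> i k) x = 0"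
    using ffun[of s i]
   proof eventually_elim
    case (elim x)
    show ?case
    proof (rule ballI, rule ccontr)
     fix k assume k: "k \<in> {..n}" "s k * h1_fun (\<phi> i k) x \<noteq> 0"
     then have "h1_fun (\<phi> i k') x = 0" if "k' \<in> {..n} - {k}" for k' using elim(2) that by auto
     then show False
      using sum.remove[of "{..n}" k "\<lambda>k. s k * h1_fun (\<phi> i k) x"] k elim(1,3) by simp
    qed
   qed
   have "s k = 0" if k: "k \<le> n" for k
   proof (rule ccontr)
    assume "s k \<noteq> 0"
    with ae k have "AE x in lborel. h1_fun (\<phi> i k) x = 0" by (auto elim!: eventually_mono)
    then show False using nz[OF k] by blast
   qed
   then show False using s by (simp add: nsphere)
  qed
  have "AE x in lborel. \<forall>k\<in>{..n}. x \<notin> ball (y i) \<epsilon> \<longrightarrow> h1_fun (\<phi> i k) x = 0"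
   by (intro eventually_ball_finite ballI supp) auto
  with ffun[of s i] have "AE x in lborel. x \<notin> ball (y i) \<epsilon> \<longrightarrow> h1_fun (f s $ i) x = 0"
   by eventually_elim auto
  then show "0 < \<beta> i i (f s)" by (rule \<beta>_diag_pos[OF f0])
  fix j assume "j \<noteq> i"
  then have "AE x in lborel. \<forall>k\<in>{..n}. \<forall>k'\<in>{..n}. h1_fun (\<phi> i k) x = 0 \<or> h1_fun (\<phi> j k') x = 0"
   by (intro eventually_ball_finite ballI disj) auto
  with ffun[of s i] ffun[of s j]
  have "AE x in lborel. coef i j x * \<bar>h1_fun (f s $ i) x\<bar> powr p * \<bar>h1_fun (f s $ j) x\<bar> powr p = 0"
  proof eventually_elim
   case (elim x)
   then have "(\<forall>k\<in>{..n}. h1_fun (\<phi> i k) x = 0) \<or> (\<forall>k\<in>{..n}. h1_fun (\<phi> j k) x = 0)" by blast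
   then show ?case using elim(1,2) by auto
  qed
  then show "\<beta> i j (f s) = 0" unfolding \<beta>_def by (rule integral_eq_zero_AE)
 qed
 have odd: "f (\<lambda>i. - s i) = - f s" for s by (simp add: vec_eq_iff f_def sum_negf)
 have "continuous_on UNIV f"
  unfolding f_def by (intro continuous_on_vec_lambda continuous_on_sum continuous_on_scaleR
   continuous_on_product_coordinates continuous_on_const)
 then have "continuous_on (topspace (nsphere n)) f" by (rule continuous_on_subset) simp
 then show ?thesis using main odd by (intro exI[of _ f]) simp
qed

end

sublocale schroedinger_system \<subseteq> nehari_functional p \<beta> G
 by (unfold_locales; (fact p \<beta>_sym \<beta>_nonpos \<beta>_rescale G_odd \<beta>_even G_euler G_deriv G_uniform G_bounded \<beta>_bound
   G_weak \<beta>_detect decoupled_spheres)?)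

section \<open>From classes in H^1 back to functions and the system\<close>

definition h1_tuple :: "('l::finite \<Rightarrow> 'a::euclidean_space \<Rightarrow> real) \<Rightarrow> 'a h1 ^ 'l" where
 "h1_tuple v = (\<chi> i. h1_of (v i))"

lemma h1_tuple_nth [simp]: "h1_tuple v $ i = h1_of (v i)"
 by (simp add: h1_tuple_def)

lemma h1_tuple_fun [simp]: "h1_tuple (\<lambda>i. h1_fun (u $ i)) = u"
 by (simp add: vec_eq_iff)

lemma h1_tuple_fun_in: "(\<lambda>i. h1_fun (u $ i)) \<in> H1_tuples"
 by (simp add: H1_tuples_def h1_fun_H1)

lemma h1_tuple_add:
 "v \<in> H1_tuples \<Longrightarrow> w \<in> H1_tuples \<Longrightarrow> (\<lambda>i x. v i x + w i x) \<in> H1_tuples \<and>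
  h1_tuple (\<lambda>i x. v i x + w i x) = h1_tuple v + h1_tuple w"
 by (simp add: H1_tuples_def H1_add h1_of_add vec_eq_iff)

lemma H1_norm_eq: "v \<in> H1_tuples \<Longrightarrow> H1_norm v = norm (h1_tuple v)"
 by (simp add: H1_norm_def H1_inner_def H1_tuples_def H1_inner_eq norm_vec_def L2_set_def power2_norm_eq_inner)

lemma H1_energy_eq:
 assumes "u \<in> H1"
 shows "(LBINT x. (norm (weak_gradient u x))\<^sup>2 + (u x)\<^sup>2) = (norm (h1_of u))\<^sup>2"
 using H1_inner_eq[OF assms assms] unfolding power2_norm_eq_inner by (simp add: power2_eq_square)

lemma nontrivial_iff:
 assumes "v \<in> H1_tuples"
 shows "nontrivial v \<longleftrightarrow> (\<forall>i. h1_tuple v $ i \<noteq> 0)"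
proof -
 have "(AE x in lborel. v i x = 0) \<longleftrightarrow> h1_of (v i) = 0" for i
 proof -
  have e: "AE x in lborel. h1_fun (h1_of (v i)) x = v i x" using assms by (simp add: H1_tuples_def h1_fun_of_AE)
  show ?thesis unfolding h1_eq_0_iff
  proof
   show "AE x in lborel. h1_fun (h1_of (v i)) x = 0" if "AE x in lborel. v i x = 0"
    using that e by eventually_elim simp
   show "AE x in lborel. v i x = 0" if "AE x in lborel. h1_fun (h1_of (v i)) x = 0"
    using that e by eventually_elim simp
  qed
 qed
 then show ?thesis by (simp add: nontrivial_def)
qed

context schroedinger_system
begin

lemma tuple_measurable:
 assumes "v \<in> H1_tuples"
 shows "v i \<in> borel_measurable borel"
 using sq_intD(2)[OF H1_sq_int, of "v i"] assms by (simp add: H1_tuples_def)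

lemma \<beta>_tuple:
 assumes v: "v \<in> H1_tuples"
 shows "\<beta> i j (h1_tuple v) = (LBINT x. coef i j x * \<bar>v i x\<bar> powr p * \<bar>v j x\<bar> powr p)"
 unfolding \<beta>_def
proof (rule integral_cong_AE)
 note [measurable] = tuple_measurable[OF v]
 show "(\<lambda>x. coef i j x * \<bar>v i x\<bar> powr p * \<bar>v j x\<bar> powr p) \<in> borel_measurable lborel" by measurable
 have "AE x in lborel. h1_fun (h1_of (v k)) x = v k x" for k using v by (simp add: H1_tuples_def h1_fun_of_AE)
 from this[of i] this[of j]
 show "AE x in lborel. coef i j x * \<bar>h1_fun (h1_tuple v $ i) x\<bar> powr p * \<bar>h1_fun (h1_tuple v $ j) x\<bar> powr p =
   coef i j x * \<bar>v i x\<bar> powr p * \<bar>v j x\<bar> powr p"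
  by eventually_elim simp
qed measurable

lemma \<beta>_tuple_diag:
 "v \<in> H1_tuples \<Longrightarrow> (LBINT x. \<mu> i * Q \<epsilon> (x - y i) * \<bar>v i x\<bar> powr (2 * p)) = \<beta> i i (h1_tuple v)"
 by (simp add: \<beta>_tuple coef_def mult.assoc flip: powr_add)

lemma \<beta>_tuple_off:
 "v \<in> H1_tuples \<Longrightarrow> i \<noteq> j \<Longrightarrow> (LBINT x. lam i j * \<bar>v j x\<bar> powr p * \<bar>v i x\<bar> powr p) = \<beta> i j (h1_tuple v)"
 by (simp add: \<beta>_tuple coef_def mult_ac)

lemma energy_eq:
 assumes v: "v \<in> H1_tuples"
 shows "energy p \<epsilon> y \<mu> lam v = I (h1_tuple v)"
proof -
 let ?u = "h1_tuple v"
 have H: "v i \<in> H1" for i using v by (simp add: H1_tuples_def)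
 have "(\<Sum>(i, j)\<in>{(i, j). i \<noteq> j}. \<integral>x. lam i j * \<bar>v j x\<bar> powr p * \<bar>v i x\<bar> powr p \<partial>lborel)
   = (\<Sum>(i, j)\<in>{(i, j). i \<noteq> j}. \<beta> i j ?u)"
  by (rule sum.cong) (auto simp: \<beta>_tuple_off[OF v])
 also have "\<dots> = (\<Sum>(i, j)\<in>(SIGMA i:UNIV. UNIV - {i}). \<beta> i j ?u)" by (rule sum.cong) auto
 also have "\<dots> = (\<Sum>i\<in>UNIV. \<Sum>j\<in>UNIV - {i}. \<beta> i j ?u)" by (subst sum.Sigma) auto
 finally have off: "(\<Sum>(i, j)\<in>{(i, j). i \<noteq> j}. \<integral>x. lam i j * \<bar>v j x\<bar> powr p * \<bar>v i x\<bar> powr p \<partial>lborel)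
   = (\<Sum>i\<in>UNIV. \<Sum>j\<in>UNIV - {i}. \<beta> i j ?u)" .
 have "total \<beta> ?u = (\<Sum>i\<in>UNIV. \<beta> i i ?u + (\<Sum>j\<in>UNIV - {i}. \<beta> i j ?u))"
  by (intro sum.cong refl sum.remove) auto
 also have "\<dots> = (\<Sum>i\<in>UNIV. \<beta> i i ?u) + (\<Sum>i\<in>UNIV. \<Sum>j\<in>UNIV - {i}. \<beta> i j ?u)" by (rule sum.distrib)
 finally show ?thesis
  unfolding energy_def I_def off \<beta>_tuple_diag[OF v] H1_energy_eq[OF H]
  by (simp add: norm_vec_squared add_divide_distrib)
qed

lemma nehari_set_iff:
 assumes v: "v \<in> H1_tuples"
 shows "v \<in> nehari_set p \<epsilon> y \<mu> lam \<longleftrightarrow> h1_tuple v \<in> N"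
proof -
 let ?u = "h1_tuple v"
 have H: "v i \<in> H1" for i using v by (simp add: H1_tuples_def)
 have "(LBINT x. \<mu> i * Q \<epsilon> (x - y i) * \<bar>v i x\<bar> powr (2 * p))
    + (\<Sum>j\<in>UNIV - {i}. \<integral>x. lam i j * \<bar>v j x\<bar> powr p * \<bar>v i x\<bar> powr p \<partial>lborel) = (\<Sum>j\<in>UNIV. \<beta> i j ?u)" for i
 proof -
  have "(\<Sum>j\<in>UNIV - {i}. \<integral>x. lam i j * \<bar>v j x\<bar> powr p * \<bar>v i x\<bar> powr p \<partial>lborel) = (\<Sum>j\<in>UNIV - {i}. \<beta> i j ?u)"
   by (rule sum.cong) (auto simp: \<beta>_tuple_off[OF v])
  then show ?thesis unfolding \<beta>_tuple_diag[OF v] by (simp add: sum.remove[of UNIV i])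
 qed
 then show ?thesis
  unfolding nehari_set_def N_def using v by (auto simp: nontrivial_iff H1_energy_eq[OF H])
qed

lemma critical_pointI:
 assumes v: "v \<in> H1_tuples" and g: "grad (h1_tuple v) = 0"
 shows "critical_point (energy p \<epsilon> y \<mu> lam) v"
 unfolding critical_point_def
proof (intro conjI v allI impI)
 fix e :: real assume "0 < e"
 from I_deriv[OF this, of "norm (h1_tuple v)"] obtain d where d: "0 < d"
  "\<And>h. norm h \<le> d \<Longrightarrow> \<bar>I (h1_tuple v + h) - I (h1_tuple v) - grad (h1_tuple v) \<bullet> h\<bar> \<le> e * norm h" by blast
 have "\<bar>energy p \<epsilon> y \<mu> lam (\<lambda>i x. v i x + h i x) - energy p \<epsilon> y \<mu> lam v\<bar> \<le> e * H1_norm h"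
  if h: "h \<in> H1_tuples" "H1_norm h < d" for h
  using d(2)[of "h1_tuple h"] h h1_tuple_add[OF v h(1)] by (simp add: energy_eq v H1_norm_eq g)
 then show "\<exists>d>0. \<forall>h\<in>H1_tuples. H1_norm h < d \<longrightarrow>
   \<bar>energy p \<epsilon> y \<mu> lam (\<lambda>i x. v i x + h i x) - energy p \<epsilon> y \<mu> lam v\<bar> \<le> e * H1_norm h"
  using d(1) by blast
qed

lemma kern_tuple_sum:
 assumes v: "v \<in> H1_tuples" and \<phi>: "\<phi> \<in> H1"
 shows "(LBINT x. (\<mu> i * Q \<epsilon> (x - y i) * (\<bar>v i x\<bar> powr (2 * p - 2) * v i x)
       + (\<Sum>j\<in>UNIV - {i}. lam i j * \<bar>v j x\<bar> powr p * (\<bar>v i x\<bar> powr (p - 2) * v i x))) * \<phi> x)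
   = (\<Sum>j\<in>UNIV. kern i j (h1_tuple v) (h1_of \<phi>))"
proof -
 let ?u = "h1_tuple v" and ?\<psi> = "h1_of \<phi>"
 let ?F = "\<lambda>j x. coef i j x * (odd_powr p (h1_fun (?u $ i) x) * \<bar>h1_fun (?u $ j) x\<bar> powr p) * h1_fun ?\<psi> x"
 note [measurable] = tuple_measurable[OF v]
 have [measurable]: "\<phi> \<in> borel_measurable borel" using sq_intD(2)[OF H1_sq_int[OF \<phi>]] .
 have Qm [measurable]: "(\<lambda>x. Q \<epsilon> (x - y i)) \<in> borel_measurable borel" unfolding Q_def by measurable
 have "(\<Sum>j\<in>UNIV. kern i j ?u ?\<psi>) = (LBINT x. (\<Sum>j\<in>UNIV. ?F j x))"
  unfolding kern_def by (rule Bochner_Integration.integral_sum[symmetric]) (rule kern_integrable)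
 also have "\<dots> = (LBINT x. (\<mu> i * Q \<epsilon> (x - y i) * (\<bar>v i x\<bar> powr (2 * p - 2) * v i x)
       + (\<Sum>j\<in>UNIV - {i}. lam i j * \<bar>v j x\<bar> powr p * (\<bar>v i x\<bar> powr (p - 2) * v i x))) * \<phi> x)"
 proof (rule integral_cong_AE)
  have "AE x in lborel. \<forall>k\<in>UNIV. h1_fun (h1_of (v k)) x = v k x"
   using v by (intro eventually_ball_finite) (auto simp: H1_tuples_def h1_fun_of_AE)
  then show "AE x in lborel. (\<Sum>j\<in>UNIV. ?F j x) = (\<mu> i * Q \<epsilon> (x - y i) * (\<bar>v i x\<bar> powr (2 * p - 2) * v i x)
       + (\<Sum>j\<in>UNIV - {i}. lam i j * \<bar>v j x\<bar> powr p * (\<bar>v i x\<bar> powr (p - 2) * v i x))) * \<phi> x"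
   using h1_fun_of_AE[OF \<phi>]
  proof eventually_elim
   case (elim x)
   have F: "?F j x = coef i j x * (odd_powr p (v i x) * \<bar>v j x\<bar> powr p) * \<phi> x" for j using elim by simp
   have "(\<Sum>j\<in>UNIV. ?F j x) = ?F i x + (\<Sum>j\<in>UNIV - {i}. ?F j x)" by (simp add: sum.remove[of UNIV i])
   also have "?F i x = \<mu> i * Q \<epsilon> (x - y i) * (\<bar>v i x\<bar> powr (2 * p - 2) * v i x) * \<phi> x"
    unfolding F unfolding odd_powr_diagonal by (simp add: coef_def)
   also have "(\<Sum>j\<in>UNIV - {i}. ?F j x) = (\<Sum>j\<in>UNIV - {i}. lam i j * \<bar>v j x\<bar> powr p * (\<bar>v i x\<bar> powr (p - 2) * v i x)) * \<phi> x"
    unfolding F sum_distrib_right by (rule sum.cong) (auto simp: coef_def odd_powr_def)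
   finally show ?case by (simp add: distrib_right)
  qed
 qed measurable
 finally show ?thesis by simp
qed

lemma satisfies_systemI:
 assumes v: "v \<in> H1_tuples" and g: "grad (h1_tuple v) = 0"
 shows "satisfies_system p \<epsilon> y \<mu> lam v"
 unfolding satisfies_system_def
proof (intro conjI v allI ballI)
 fix i and \<phi> :: "'a \<Rightarrow> real" assume \<phi>: "\<phi> \<in> H1"
 have H: "v i \<in> H1" using v by (simp add: H1_tuples_def)
 have "h1_tuple v = G (h1_tuple v)" using g by (simp add: grad_def)
 then have "h1_of (v i) = G (h1_tuple v) $ i" by (metis h1_tuple_nth)
 then have "h1_of (v i) \<bullet> h1_of \<phi> = (\<Sum>j\<in>UNIV. kern i j (h1_tuple v) (h1_of \<phi>))"
  by (simp add: G_inner_nth)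
 then show "(LBINT x. weak_gradient (v i) x \<bullet> weak_gradient \<phi> x + v i x * \<phi> x) =
    (LBINT x. (\<mu> i * Q \<epsilon> (x - y i) * (\<bar>v i x\<bar> powr (2 * p - 2) * v i x)
       + (\<Sum>j\<in>UNIV - {i}. lam i j * \<bar>v j x\<bar> powr p * (\<bar>v i x\<bar> powr (p - 2) * v i x)))
       * \<phi> x)"
  unfolding kern_tuple_sum[OF v \<phi>] H1_inner_eq[OF H \<phi>] .
qed

lemma is_solutionI:
 assumes u: "u \<in> N" "grad u = 0"
 shows "is_solution p \<epsilon> y \<mu> lam (\<lambda>i. h1_fun (u $ i))"
proof -
 let ?v = "\<lambda>i. h1_fun (u $ i)"
 have v: "?v \<in> H1_tuples" "h1_tuple ?v = u" by (simp_all add: h1_tuple_fun_in)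
 have "nontrivial ?v" unfolding nontrivial_iff[OF v(1)] v(2) using u(1) by (simp add: N_def)
 then show ?thesis
  unfolding is_solution_def using critical_pointI[OF v(1)] satisfies_systemI[OF v(1)] v(2) u(2) by simp
qed

text \<open>Taking absolute values of a minimiser preserves all \<beta> and does not increase the
  component norms, which is the situation of \<open>minimizer_rearrangement\<close>. The new tuple
  is again a minimiser and hence critical.\<close>

lemma nonnegative_least_energy_solution:
 "\<exists>u\<in>N. grad u = 0 \<and> nonnegative (\<lambda>i. h1_fun (u $ i)) \<and>
   is_least_energy_solution p \<epsilon> y \<mu> lam (\<lambda>i. h1_fun (u $ i))"
proof -
 obtain v where v: "v \<in> N" "\<And>w. w \<in> N \<Longrightarrow> I v \<le> I w" using exists_minimizer by blast
 have "\<exists>k. (AE x in lborel. h1_fun k x = \<bar>h1_fun (v $ i) x\<bar>) \<and> norm k \<le> norm (v $ i)" for i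
  by (rule h1_abs[of "v $ i"]) blast
 then obtain k where k: "\<And>i. AE x in lborel. h1_fun (k i) x = \<bar>h1_fun (v $ i) x\<bar>" "\<And>i. norm (k i) \<le> norm (v $ i)"
  by metis
 define u where "u = (\<chi> i. k i)"
 have u: "u $ i = k i" for i by (simp add: u_def)
 have abs: "AE x in lborel. \<bar>h1_fun (u $ i) x\<bar> = \<bar>h1_fun (v $ i) x\<bar>" for i
  using k(1)[of i] unfolding u by eventually_elim simp
 have "u $ i \<noteq> 0" for i
 proof
  assume "u $ i = 0"
  then have "AE x in lborel. h1_fun (u $ i) x = 0" by (simp add: h1_eq_0_iff)
  with abs[of i] have "AE x in lborel. h1_fun (v $ i) x = 0" by eventually_elim simp
  then have "v $ i = 0" by (simp add: h1_eq_0_iff)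
  then show False using v(1) by (simp add: N_def)
 qed
 moreover have "norm (u $ i) \<le> norm (v $ i)" for i unfolding u by (rule k)
 moreover have "\<beta> i j u = \<beta> i j v" for i j by (rule \<beta>_cong) (rule abs)
 ultimately have uN: "u \<in> N" "I u = I v" using minimizer_rearrangement[OF v] by blast+
 then have min: "I u \<le> I w" if "w \<in> N" for w using v(2)[OF that] by simp
 have g: "grad u = 0" by (rule minimizer_grad_0[OF uN(1) min])
 let ?v = "\<lambda>i. h1_fun (u $ i)"
 have "nonnegative ?v" unfolding nonnegative_def
 proof
  show "AE x in lborel. 0 \<le> h1_fun (u $ i) x" for i using k(1)[of i] unfolding u by eventually_elim simp
 qed
 moreover have "is_least_energy_solution p \<epsilon> y \<mu> lam ?v"
  unfolding is_least_energy_solution_def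
 proof (intro conjI ballI is_solutionI uN(1) g)
  show "?v \<in> nehari_set p \<epsilon> y \<mu> lam" using uN(1) by (simp add: nehari_set_iff h1_tuple_fun_in)
  fix w assume w: "w \<in> nehari_set p \<epsilon> y \<mu> lam"
  then have wH: "w \<in> H1_tuples" by (simp add: nehari_set_def)
  then have "h1_tuple w \<in> N" using w nehari_set_iff by blast
  from min[OF this] show "energy p \<epsilon> y \<mu> lam ?v \<le> energy p \<epsilon> y \<mu> lam w"
   by (simp add: energy_eq[OF wH] energy_eq[OF h1_tuple_fun_in])
 qed
 ultimately show ?thesis using uN(1) g by blast
qed

lemma unbounded_solutions:
 "\<exists>v :: nat \<Rightarrow> 'l \<Rightarrow> 'a \<Rightarrow> real.
   (\<forall>k. is_solution p \<epsilon> y \<mu> lam (v k)) \<and> \<not> bdd_above (range (\<lambda>k. H1_norm (v k))) \<and>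
   (\<exists>k. nonnegative (v k) \<and> is_least_energy_solution p \<epsilon> y \<mu> lam (v k))"
proof -
 obtain u0 where u0: "u0 \<in> N" "grad u0 = 0" "nonnegative (\<lambda>i. h1_fun (u0 $ i))"
  "is_least_energy_solution p \<epsilon> y \<mu> lam (\<lambda>i. h1_fun (u0 $ i))"
  using nonnegative_least_energy_solution by blast
 have "\<forall>k::nat. \<exists>u. u \<in> N \<and> grad u = 0 \<and> real k < I u" using critical_points_unbounded by blast
 then obtain u where u: "\<And>k. u k \<in> N" "\<And>k. grad (u k) = 0" "\<And>k. real k < I (u k)" by metis
 \<comment> \<open>The least energy solution is put in front of critical points of growing energy,
   so that one sequence has both properties.\<close>
 define s where "s k = (case k of 0 \<Rightarrow> u0 | Suc k \<Rightarrow> u k)" for k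
 define v where "v k = (\<lambda>i. h1_fun (s k $ i))" for k
 have "is_solution p \<epsilon> y \<mu> lam (v k)" for k
  unfolding v_def using u u0 by (intro is_solutionI) (auto simp: s_def split: nat.split)
 moreover have "\<not> bdd_above (range (\<lambda>k. H1_norm (v k)))"
 proof
  assume "bdd_above (range (\<lambda>k. H1_norm (v k)))"
  then obtain B where B: "\<And>k. H1_norm (v k) \<le> B" by (auto simp: bdd_above_def)
  have "real k < (1 / 2 - 1 / (2 * p)) * B\<^sup>2" for k
  proof -
   have "H1_norm (v (Suc k)) = norm (u k)"
    unfolding v_def by (simp add: H1_norm_eq h1_tuple_fun_in s_def)
   then have "norm (u k) \<le> B" using B[of "Suc k"] by simp
   then have "(1 / 2 - 1 / (2 * p)) * (norm (u k))\<^sup>2 \<le> (1 / 2 - 1 / (2 * p)) * B\<^sup>2"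
    using I_coeff_pos by (intro mult_left_mono power_mono) auto
   then show ?thesis using u(3)[of k] I_on_N[OF u(1), of k] by linarith
  qed
  moreover obtain k where "(1 / 2 - 1 / (2 * p)) * B\<^sup>2 \<le> real k" using real_arch_simple by blast
  ultimately show False by (meson less_le_not_le)
 qed
 moreover have "v 0 = (\<lambda>i. h1_fun (u0 $ i))" by (simp add: v_def s_def)
 ultimately show ?thesis using u0(3,4) by (intro exI[of _ v] conjI exI[of _ 0]) auto
qed

end

theorem theorem1p1:
  fixes p \<epsilon> :: real
    and y :: "'l::finite \<Rightarrow> real ^ 'n"
    and \<mu> :: "'l \<Rightarrow> real"
    and lam :: "'l \<Rightarrow> 'l \<Rightarrow> real"
  assumes "CARD('n) \<ge> 3"
    and "1 < p" and "p < real CARD('n) / (real CARD('n) - 2)"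
    and "\<epsilon> > 0"
    and "\<And>i. \<mu> i > 0"
    and "\<And>i j. i \<noteq> j \<Longrightarrow> lam i j = lam j i"
    and "\<And>i j. i \<noteq> j \<Longrightarrow> lam i j < 0"
  shows "\<exists>v :: nat \<Rightarrow> 'l \<Rightarrow> real ^ 'n \<Rightarrow> real.
           (\<forall>k. is_solution p \<epsilon> y \<mu> lam (v k)) \<and>
           \<not> bdd_above (range (\<lambda>k. H1_norm (v k))) \<and>
           (\<exists>k. nonnegative (v k) \<and> is_least_energy_solution p \<epsilon> y \<mu> lam (v k))"
proof -
 have "0 < real CARD('n) - 2" using assms(1) by linarith
 then have "p * (real CARD('n) - 2) < real CARD('n)" using assms(3) by (simp add: pos_less_divide_eq)
 \<comment> \<open>For q = 2p the gap equals N - p (N - 2), so its positivity is exactly the upper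
   bound on \<open>p\<close>.\<close>
 then have "0 < sobolev_gap TYPE(real ^ 'n) (2 * p)"
  by (simp add: sobolev_gap_def algebra_simps)
 then interpret schroedinger_system p \<epsilon> y \<mu> lam
  using assms by unfold_locales auto
 show ?thesis by (rule unbounded_solutions)
qed

end
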